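(* In the setting of the context, let $m\in[0,r+1]$ if $\mathcal P\Lambda^k(\mathcal T)=\mathcal P_r\Lambda^k(\mathcal T)$, and let $m\in[0,r]$ otherwise. Then for all $T\in\Delta_n(\mathcal T)$ $$\|\omega-\mathcal I_{\mathcal T}\omega\|_{L^p\Lambda^k(T)}\le C_{\mathcal I,0}\,h_T^m\,|\omega|_{W^{m,p}\Lambda^k(U^\ast_{T,\mathcal T})},\qquad\omega\in W^{m,p}\Lambda^k(\Omega).$$ Here $C_{\mathcal I,0}>0$ depends only on $n$, $p$, the polynomial degree $r$, and the shape measure of the triangulation.
   Context: Triangulation. $\mathcal T$ is a finite $n$-dimensional simplicial complex in $\mathbb R^n$ (every simplex is contained in an $n$-dimensional simplex of $\mathcal T$) that triangulates a domain $\Omega$: $\overline\Omega$ is the union of the simplices and $\Omega$ is the interior of that union. $\Delta_n(\mathcal T)$ is the set of $n$-dimensional simplices. $\mathcal T$ is face-connected: for all $T_0,T\in\Delta_n(\mathcal T)$ with $T_0\cap T\neq\emptyset$ there is a sequence $T_1,\dots,T_N=T$ in $\Delta_n(\mathcal T)$ such that each $F_i=T_i\cap T_{i-1}$ is a common facet of $T_i$ and $T_{i-1}$ with $T_0\cap T\subseteq F_i$. For a simplex $T$ of dimension $d\ge1$, $h_T$ is its diameter and $\mu(T)=h_T^d/\mathrm{vol}^d(T)$; for a vertex $V$, $h_V$ is the minimum length of an edge adjacent to $V$. The shape measure $\mu(\mathcal T)$ is $\sup\mu(T)$ over non-vertex simplices. For $S\in\mathcal T$: $U_{S,\mathcal T}=\bigcup\{T'\in\Delta_n(\mathcal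 T):S\subseteq T'\}$ and $U^\ast_{S,\mathcal T}=\bigcup\{T'\in\Delta_n(\mathcal T):T'\cap S\ne\emptyset\}$. Function spaces. $L^p\Lambda^k$, $W^{s,p}\Lambda^k$ are the spaces of $k$-forms with coefficients in $L^p$, resp. in the Sobolev–Slobodeckij space $W^{s,p}$ ($s\ge0$ real), with seminorm $|\omega|_{W^{m,p}}=\sum_{|\alpha|=m}\|\partial^\alpha\omega\|_{L^p}$ for integer $m$, and for $\theta\in(0,1)$ $|\omega|_{W^{m+\theta,p}(U)}=\sum_{|\alpha|=m}\big(\iint_{U\times U}\frac{|\partial^\alpha\omega(x)-\partial^\alpha\omega(y)|^p}{|x-y|^{n+p\theta}}dxdy\big)^{1/p}$ (essential supremum of $|\partial^\alpha\omega(x)-\partial^\alpha\omega(y)|/|x-y|^\theta$ if $p=\infty$). $\mathcal W^{p,q}\Lambda^k(U)=\{\omega\in L^p\Lambda^k(U):d\omega\in L^q\Lambda^{k+1}(U)\}$. Finite element spaces. Fix $p\in[1,\infty]$, $k\in\mathbb N_0$, $r\in\mathbb N$. $\mathcal P_r\Lambda^k$: $k$-forms with polynomial coefficients of degree at most $r$ (zero for $r<0$ or $k<0$). For $r\ge1$, $\mathcal P^-_r\Lambda^k=\mathcal P_{r-1}\Lambda^k+\kappa\mathcal P_{r-1}\Lambda^{k+1}$ with $\kappa$ the contraction with the position vector field; zero for $r\le0$. $\mathcal P_r\Lambda^k(S),\mathcal P^-_r\Lambda^k(S)$ are the pullbacks to a simplex $S$; $\mathring{\mathcal P}_r\Lambda^k(S),\mathring{\mathcal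 P}^-_r\Lambda^k(S)$ are the subspaces with vanishing trace $\operatorname{tr}_F$ (pullback) on all proper subsimplices $F$ of $S$. $\mathcal P_r\Lambda^k(\mathcal T)$ (resp. $\mathcal P^-_r\Lambda^k(\mathcal T)$): forms $\omega\in\mathcal W^{\infty,\infty}\Lambda^k(\Omega)$ with $\omega_{|T}\in\mathcal P_r\Lambda^k(T)$ (resp. $\mathcal P_r^-\Lambda^k(T)$) for all $T\in\Delta_n(\mathcal T)$. For $F\in\mathcal T$, $m=\dim F$, $\mathcal C_r\Lambda^k(F)$ is the space of functionals $\omega\mapsto\int_F\eta\wedge\operatorname{tr}_F\omega$ with $\eta\in\mathcal P^-_{r+k-m}\Lambda^{m-k}(F)$; $\mathcal C^-_r\Lambda^k(F)$ is the same with $\eta\in\mathcal P_{r+k-m-1}\Lambda^{m-k}(F)$. $\mathcal P\Lambda^k,\mathring{\mathcal P}\Lambda^k,\mathcal C\Lambda^k$ denote either consistently $\mathcal P_r\Lambda^k,\mathring{\mathcal P}_r\Lambda^k,\mathcal C_r\Lambda^k$ or consistently $\mathcal P^-_r\Lambda^k,\mathring{\mathcal P}^-_r\Lambda^k,\mathcal C^-_r\Lambda^k$ (first option if $k=0$, second if $k=n$). $I(S)=\{1,\dots,\dim\mathring{\mathcal P}\Lambda^k(S)\}$. Biorthogonal system. One fixes bases $\{\phi^\ast_{S,i}\}_{i\in I(S)}$ of $\mathcal C\Lambda^k(S)$ for $S\in\mathcal T$ and a basis $\{\phi_{S,i}\}_{S\in\mathcal T,i\in I(S)}$ of $\mathcal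 P\Lambda^k(\mathcal T)$ with: $\phi^\ast_{S,i}(\phi_{S',j})=1$ if $(S,i)=(S',j)$ and $0$ otherwise; $\operatorname{tr}_{S'}\phi_{S,i}=0$ whenever $S\nsubseteq S'\in\mathcal T$; and for $S\subseteq T\in\Delta_n(\mathcal T)$: $\|\phi_{S,i}\|_{L^p\Lambda^k(T)}\le C_Ah_S^{n/p-k}$ and $\|\phi^\ast_{S,i}(\omega)\phi_{S,i}\|_{L^p\Lambda^k(T)}\le C_A\|\omega\|_{L^p\Lambda^k(T)}$ for all $\omega\in\mathcal P_r\Lambda^k(T)$, with $C_A$ depending only on $p,n,r,\mu(\mathcal T)$. Local projections. For each $S\in\mathcal T$, $P_S:L^p\Lambda^k(\Omega)\to\mathcal P_r\Lambda^k(U_{S,\mathcal T})\subset L^p\Lambda^k(\Omega)$ (polynomial forms on the patch, extended by zero) is a fixed idempotent bounded linear map with $\|\omega-P_S\omega\|_{L^p\Lambda^k(U_{S,\mathcal T})}\le C_{BH}h_S^m|\omega|_{W^{m,p}\Lambda^k(U_{S,\mathcal T})}$ for $\omega\in W^{m,p}\Lambda^k(\Omega)$, $m\in[0,r+1]$, and $\|d\omega-dP_S\omega\|_{L^p\Lambda^{k+1}(U_{S,\mathcal T})}\le C_{BH}h_S^l|d\omega|_{W^{l,p}\Lambda^{k+1}(U_{S,\mathcal T})}$ whenever $d\omega\in W^{l,p}\Lambda^{k+1}(\Omega)$, $l\in[0,r]$. $C_{BH}$ depends only on $n,p,r$ and the shape measure. Clément interpolant. $\mathcal I_{\mathcal T}:L^p\Lambda^k(\Omega)\to\mathcal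 P\Lambda^k(\mathcal T)$, $\mathcal I_{\mathcal T}\omega=\sum_{S\in\mathcal T}\sum_{i\in I(S)}\phi^\ast_{S,i}(P_S\omega)\,\phi_{S,i}$. *)

theory Defs
  imports
    "HOL-Analysis.Analysis"
    "HOL-Combinatorics.Permutations"
    "HOL-Library.Function_Algebras"
    "HOL-Library.Multiset"
    "HOL-Probability.Essential_Supremum"
begin

section \<open>Pointwise real vector space structure on functions\<close>

instantiation "fun" :: (type, real_vector) real_vector
begin

definition scaleR_fun :: "real \<Rightarrow> ('a \<Rightarrow> 'b) \<Rightarrow> 'a \<Rightarrow> 'b" where
  "scaleR_fun c f = (\<lambda>x. c *\<^sub>R f x)"

instance
  by standard (simp_all add: scaleR_fun_def fun_eq_iff plus_fun_def scaleR_add_left scaleR_add_right)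

end

section \<open>Alternating multilinear forms and differential forms\<close>

text \<open>
  A \<open>k\<close>-form is a function of the list of its \<open>k\<close> arguments, normalised to vanish on lists of any
  other length.  The degree is an integer, so that there are only zero forms of negative degree.
  A differential form is a field of such functions; it is only relevant on the set where it is
  considered.
\<close>

type_synonym 'a form = "'a \<Rightarrow> 'a list \<Rightarrow> real"

definition alt_forms :: "int \<Rightarrow> ('a::real_vector list \<Rightarrow> real) set" where
  "alt_forms k = {A.
     (\<forall>v. int (length v) \<noteq> k \<longrightarrow> A v = 0) \<and>
     (\<forall>v i. int (length v) = k \<and> i < length v \<longrightarrow> linear (\<lambda>x. A (v[i := x]))) \<and>
     (\<forall>v i j. int (length v) = k \<and> i < j \<and> j < length v \<and> v ! i = v ! j \<longrightarrow> A v = 0)}"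

text \<open>
  The Euclidean norm of an alternating form, that is
  \<open>\<bar>A\<bar>\<^sup>2 = \<Sum>\<^bsub>i\<^sub>1 < \<dots> < i\<^sub>k\<^esub> A(e\<^bsub>i\<^sub>1\<^esub>, \<dots>, e\<^bsub>i\<^sub>k\<^esub>)\<^sup>2\<close>; summing over all tuples counts each summand \<open>k!\<close> times.
\<close>

definition alt_norm :: "nat \<Rightarrow> ('a::euclidean_space list \<Rightarrow> real) \<Rightarrow> real" where
  "alt_norm k A = sqrt ((\<Sum>v | set v \<subseteq> Basis \<and> length v = k. (A v)\<^sup>2) / fact k)"

definition wedge :: "nat \<Rightarrow> nat \<Rightarrow> 'a form \<Rightarrow> 'a form \<Rightarrow> 'a form" where
  "wedge j k \<eta> \<omega> = (\<lambda>x v. if length v = j + k then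
     (\<Sum>\<sigma> | \<sigma> permutes {..<j + k}. of_int (sign \<sigma>) *
        \<eta> x (take j (permute_list \<sigma> v)) * \<omega> x (drop j (permute_list \<sigma> v))) / (fact j * fact k)
     else 0)"

definition koszul :: "'a form \<Rightarrow> 'a form" where
  "koszul \<omega> = (\<lambda>x v. \<omega> x (x # v))"

section \<open>Lebesgue and Sobolev--Slobodeckij spaces of differential forms\<close>

definition ennreal_powr :: "ennreal \<Rightarrow> real \<Rightarrow> ennreal" where
  "ennreal_powr a s = (if a = \<infinity> then \<infinity> else ennreal (enn2real a powr s))"

definition Lp_norm :: "ennreal \<Rightarrow> nat \<Rightarrow> 'a::euclidean_space set \<Rightarrow> 'a form \<Rightarrow> ennreal" where
  "Lp_norm p k U \<omega> =
     (if p = \<infinity> then esssup (lebesgue_on U) (\<lambda>x. ennreal (alt_norm k (\<omega> x)))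
      else ennreal_powr (\<integral>\<^sup>+x. ennreal (alt_norm k (\<omega> x) powr enn2real p) \<partial>lebesgue_on U)
             (1 / enn2real p))"

definition Lp_forms :: "ennreal \<Rightarrow> nat \<Rightarrow> 'a::euclidean_space set \<Rightarrow> 'a form set" where
  "Lp_forms p k U = {\<omega>. (\<forall>x\<in>U. \<omega> x \<in> alt_forms (int k)) \<and>
     (\<forall>v. (\<lambda>x. \<omega> x v) \<in> borel_measurable (lebesgue_on U)) \<and> Lp_norm p k U \<omega> < \<infinity>}"

definition dir_deriv :: "'a::euclidean_space \<Rightarrow> ('a \<Rightarrow> real) \<Rightarrow> 'a \<Rightarrow> real" where
  "dir_deriv v f = (\<lambda>x. frechet_derivative f (at x) v)"

definition smooth :: "('a::euclidean_space \<Rightarrow> real) \<Rightarrow> bool" where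
  "smooth f \<longleftrightarrow> (\<forall>vs x. foldr dir_deriv vs f differentiable (at x))"

definition test_fun :: "'a::euclidean_space set \<Rightarrow> ('a \<Rightarrow> real) \<Rightarrow> bool" where
  "test_fun U \<psi> \<longleftrightarrow> smooth \<psi> \<and> compact (closure {x. \<psi> x \<noteq> 0}) \<and> closure {x. \<psi> x \<noteq> 0} \<subseteq> U"

definition locally_integrable :: "'a::euclidean_space set \<Rightarrow> ('a \<Rightarrow> real) \<Rightarrow> bool" where
  "locally_integrable U f \<longleftrightarrow> (\<forall>K. compact K \<and> K \<subseteq> U \<longrightarrow> set_integrable lebesgue K f)"

text \<open>
  Multi-indices are multisets of basis vectors, the order \<open>\<bar>\<alpha>\<bar>\<close> being the size.  Weak derivatives are
  taken on open sets \<open>U\<close>.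
\<close>

definition multi_indices :: "nat \<Rightarrow> 'a::euclidean_space multiset set" where
  "multi_indices m = {\<alpha>. set_mset \<alpha> \<subseteq> Basis \<and> size \<alpha> = m}"

definition weak_deriv ::
    "'a::euclidean_space set \<Rightarrow> 'a multiset \<Rightarrow> ('a \<Rightarrow> real) \<Rightarrow> ('a \<Rightarrow> real) \<Rightarrow> bool" where
  "weak_deriv U \<alpha> f g \<longleftrightarrow> locally_integrable U f \<and> locally_integrable U g \<and>
     (\<forall>\<psi> vs. test_fun U \<psi> \<and> mset vs = \<alpha> \<longrightarrow>
        (LINT x:U|lebesgue. f x * foldr dir_deriv vs \<psi> x) =
        (- 1) ^ size \<alpha> * (LINT x:U|lebesgue. g x * \<psi> x))"

definition weak_deriv_form ::
    "nat \<Rightarrow> 'a::euclidean_space set \<Rightarrow> 'a multiset \<Rightarrow> 'a form \<Rightarrow> 'a form \<Rightarrow> bool" where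
  "weak_deriv_form k U \<alpha> \<omega> \<eta> \<longleftrightarrow> (\<forall>x\<in>U. \<eta> x \<in> alt_forms (int k)) \<and>
     (\<forall>v. weak_deriv U \<alpha> (\<lambda>x. \<omega> x v) (\<lambda>x. \<eta> x v))"

text \<open>A representative of \<open>\<partial>\<^sup>\<alpha>\<omega>\<close>, which is determined only up to null sets.\<close>

definition pderiv_form :: "nat \<Rightarrow> 'a::euclidean_space set \<Rightarrow> 'a multiset \<Rightarrow> 'a form \<Rightarrow> 'a form" where
  "pderiv_form k U \<alpha> \<omega> = (SOME \<eta>. weak_deriv_form k U \<alpha> \<omega> \<eta>)"

definition slobodeckij ::
    "real \<Rightarrow> ennreal \<Rightarrow> nat \<Rightarrow> 'a::euclidean_space set \<Rightarrow> 'a form \<Rightarrow> ennreal" where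
  "slobodeckij \<theta> p k U \<omega> =
     (if p = \<infinity> then
        esssup (lebesgue_on (U \<times> U))
          (\<lambda>(x, y). ennreal (alt_norm k (\<omega> x - \<omega> y) / norm (x - y) powr \<theta>))
      else
        ennreal_powr
          (\<integral>\<^sup>+(x, y). ennreal (alt_norm k (\<omega> x - \<omega> y) powr enn2real p /
              norm (x - y) powr (real DIM('a) + enn2real p * \<theta>)) \<partial>lebesgue_on (U \<times> U))
          (1 / enn2real p))"

definition sobolev_seminorm ::
    "real \<Rightarrow> ennreal \<Rightarrow> nat \<Rightarrow> 'a::euclidean_space set \<Rightarrow> 'a form \<Rightarrow> ennreal" where
  "sobolev_seminorm s p k U \<omega> =
     (\<Sum>\<alpha>\<in>multi_indices (nat \<lfloor>s\<rfloor>).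
        if frac s = 0 then Lp_norm p k U (pderiv_form k U \<alpha> \<omega>)
        else slobodeckij (frac s) p k U (pderiv_form k U \<alpha> \<omega>))"

definition sobolev_forms ::
    "real \<Rightarrow> ennreal \<Rightarrow> nat \<Rightarrow> 'a::euclidean_space set \<Rightarrow> 'a form set" where
  "sobolev_forms s p k U = {\<omega> \<in> Lp_forms p k U.
     (\<forall>j \<le> nat \<lfloor>s\<rfloor>. \<forall>\<alpha>\<in>multi_indices j. \<exists>\<eta>\<in>Lp_forms p k U. weak_deriv_form k U \<alpha> \<omega> \<eta>) \<and>
     sobolev_seminorm s p k U \<omega> < \<infinity>}"

text \<open>
  The distributional form of
  \<open>d\<omega>(v\<^sub>0, \<dots>, v\<^sub>k) = \<Sum>\<^sub>i (-1)\<^sup>i \<partial>\<^bsub>v\<^sub>i\<^esub> \<omega>(v\<^sub>0, \<dots>, v\<^bsub>i-1\<^esub>, v\<^bsub>i+1\<^esub>, \<dots>, v\<^sub>k)\<close> for constant vectors \<open>v\<^sub>i\<close>.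
\<close>

definition weak_ext_deriv ::
    "nat \<Rightarrow> 'a::euclidean_space set \<Rightarrow> 'a form \<Rightarrow> 'a form \<Rightarrow> bool" where
  "weak_ext_deriv k U \<omega> \<eta> \<longleftrightarrow>
     (\<forall>x\<in>U. \<eta> x \<in> alt_forms (int (k + 1))) \<and>
     (\<forall>v. locally_integrable U (\<lambda>x. \<omega> x v)) \<and> (\<forall>v. locally_integrable U (\<lambda>x. \<eta> x v)) \<and>
     (\<forall>\<psi> vs. test_fun U \<psi> \<and> length vs = k + 1 \<longrightarrow>
        (LINT x:U|lebesgue. \<eta> x vs * \<psi> x) =
        - (\<Sum>i\<le>k. (- 1) ^ i *
             (LINT x:U|lebesgue. \<omega> x (take i vs @ drop (Suc i) vs) * dir_deriv (vs ! i) \<psi> x)))"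

definition W_forms :: "ennreal \<Rightarrow> ennreal \<Rightarrow> nat \<Rightarrow> 'a::euclidean_space set \<Rightarrow> 'a form set" where
  "W_forms p q k U = {\<omega> \<in> Lp_forms p k U. \<exists>\<eta>\<in>Lp_forms q (k + 1) U. weak_ext_deriv k U \<omega> \<eta>}"

section \<open>Triangulations\<close>

text \<open>
  The simplices of a triangulation are nonempty, whereas the library's
  \<^const>\<open>simplicial_complex\<close> is closed under all faces including the empty one.
\<close>

definition top_simplices :: "'a::euclidean_space set set \<Rightarrow> 'a set set" where
  "top_simplices \<T> = {T \<in> \<T>. aff_dim T = int DIM('a)}"

definition triangulates :: "'a::euclidean_space set set \<Rightarrow> 'a set \<Rightarrow> bool" where
  "triangulates \<T> \<Omega> \<longleftrightarrow>
     {} \<notin> \<T> \<and> \<T> \<noteq> {} \<and> simplicial_complex (insert {} \<T>) \<and>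
     (\<forall>S\<in>\<T>. \<exists>T\<in>top_simplices \<T>. S \<subseteq> T) \<and>
     closure \<Omega> = \<Union>\<T> \<and> \<Omega> = interior (\<Union>\<T>)"

definition face_connected :: "'a::euclidean_space set set \<Rightarrow> bool" where
  "face_connected \<T> \<longleftrightarrow>
     (\<forall>T\<^sub>0\<in>top_simplices \<T>. \<forall>T\<in>top_simplices \<T>. T\<^sub>0 \<inter> T \<noteq> {} \<longrightarrow>
        (\<exists>(N::nat) R. R 0 = T\<^sub>0 \<and> R N = T \<and> (\<forall>i\<le>N. R i \<in> top_simplices \<T>) \<and>
           (\<forall>i\<in>{1..N}. (R i \<inter> R (i - 1)) facet_of R i \<and> (R i \<inter> R (i - 1)) facet_of R (i - 1) \<and>
              T\<^sub>0 \<inter> T \<subseteq> R i \<inter> R (i - 1))))"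

definition direction_space :: "'a::euclidean_space set \<Rightarrow> 'a set" where
  "direction_space S = span {x - y | x y. x \<in> S \<and> y \<in> S}"

text \<open>
  An orthonormal basis of the tangent space of \<open>S\<close> and a base point give isometric coordinates
  \<open>\<real>\<^sup>d \<rightarrow> aff S\<close>, through which \<open>d\<close>-dimensional volume and integrals over \<open>S\<close> are defined.  The
  volume does not depend on the choices; integrals of \<open>d\<close>-forms depend on the frame
  only through the orientation of \<open>S\<close>.
\<close>

definition frame :: "'a::euclidean_space set \<Rightarrow> 'a list" where
  "frame S = (SOME es. int (length es) = aff_dim S \<and> distinct es \<and> pairwise orthogonal (set es) \<and>
     (\<forall>e\<in>set es. norm e = 1) \<and> span (set es) = direction_space S)"

definition chart :: "'a::euclidean_space set \<Rightarrow> (nat \<Rightarrow> real) \<Rightarrow> 'a" where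
  "chart S t = (SOME x. x \<in> S) + (\<Sum>i<length (frame S). t i *\<^sub>R frame S ! i)"

definition chart_measure :: "'a::euclidean_space set \<Rightarrow> (nat \<Rightarrow> real) measure" where
  "chart_measure S = (\<Pi>\<^sub>M i\<in>{..<length (frame S)}. lborel)"

definition chart_domain :: "'a::euclidean_space set \<Rightarrow> (nat \<Rightarrow> real) set" where
  "chart_domain S = {t \<in> space (chart_measure S). chart S t \<in> S}"

definition simplex_volume :: "'a::euclidean_space set \<Rightarrow> real" where
  "simplex_volume S = measure (chart_measure S) (chart_domain S)"

definition simplex_integral :: "'a::euclidean_space set \<Rightarrow> 'a form \<Rightarrow> real" where
  "simplex_integral S \<nu> =
     (LINT t:chart_domain S|chart_measure S. \<nu> (chart S t) (frame S))"

definition mesh_size :: "'a::euclidean_space set set \<Rightarrow> 'a set \<Rightarrow> real" where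
  "mesh_size \<T> S =
     (if aff_dim S = 0 then Min {diameter E | E. E \<in> \<T> \<and> aff_dim E = 1 \<and> S \<subseteq> E}
      else diameter S)"

definition shape_measure :: "'a::euclidean_space set set \<Rightarrow> real" where
  "shape_measure \<T> =
     (SUP S\<in>{S \<in> \<T>. 1 \<le> aff_dim S}. diameter S ^ nat (aff_dim S) / simplex_volume S)"

definition patch :: "'a::euclidean_space set set \<Rightarrow> 'a set \<Rightarrow> 'a set" where
  "patch \<T> S = \<Union> {T \<in> top_simplices \<T>. S \<subseteq> T}"

definition star_patch :: "'a::euclidean_space set set \<Rightarrow> 'a set \<Rightarrow> 'a set" where
  "star_patch \<T> S = \<Union> {T \<in> top_simplices \<T>. T \<inter> S \<noteq> {}}"

section \<open>Polynomial differential forms and finite element spaces\<close>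

definition polys :: "int \<Rightarrow> ('a::euclidean_space \<Rightarrow> real) set" where
  "polys r = span {(\<lambda>x. \<Prod>b\<in>#\<alpha>. x \<bullet> b) | \<alpha>. set_mset \<alpha> \<subseteq> Basis \<and> int (size \<alpha>) \<le> r}"

definition poly_forms :: "int \<Rightarrow> int \<Rightarrow> 'a::euclidean_space form set" where
  "poly_forms r k = {\<omega>. (\<forall>x. \<omega> x \<in> alt_forms k) \<and> (\<forall>v. (\<lambda>x. \<omega> x v) \<in> polys r)}"

definition trimmed_forms :: "int \<Rightarrow> int \<Rightarrow> 'a::euclidean_space form set" where
  "trimmed_forms r k =
     {\<omega> + koszul \<eta> | \<omega> \<eta>. \<omega> \<in> poly_forms (r - 1) k \<and> \<eta> \<in> poly_forms (r - 1) (k + 1)}"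

text \<open>Pullback along the inclusion of \<open>S\<close>; the result is zero off \<open>S\<close> and on nontangential vectors.\<close>

definition tr :: "'a::euclidean_space set \<Rightarrow> 'a form \<Rightarrow> 'a form" where
  "tr S \<omega> = (\<lambda>x v. if x \<in> S \<and> set v \<subseteq> direction_space S then \<omega> x v else 0)"

text \<open>\<open>Full\<close> stands for the family \<open>P\<^sub>r\<Lambda>\<^sup>k\<close>, \<open>Trimmed\<close> for the family \<open>P\<^sub>r\<^sup>-\<Lambda>\<^sup>k\<close>.\<close>

datatype family = Full | Trimmed

fun family_forms :: "family \<Rightarrow> int \<Rightarrow> int \<Rightarrow> 'a::euclidean_space form set" where
  "family_forms Full r k = poly_forms r k"
| "family_forms Trimmed r k = trimmed_forms r k"

definition bubble_forms :: "family \<Rightarrow> nat \<Rightarrow> nat \<Rightarrow> 'a::euclidean_space set \<Rightarrow> 'a form set" where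
  "bubble_forms fam r k S = {\<omega> \<in> tr S ` family_forms fam (int r) (int k).
     \<forall>F. F face_of S \<and> F \<noteq> {} \<and> F \<noteq> S \<longrightarrow> tr F \<omega> = 0}"

definition indices :: "family \<Rightarrow> nat \<Rightarrow> nat \<Rightarrow> 'a::euclidean_space set \<Rightarrow> nat set" where
  "indices fam r k S = {1..dim (bubble_forms fam r k S)}"

definition fe_space ::
    "family \<Rightarrow> nat \<Rightarrow> nat \<Rightarrow> 'a::euclidean_space set set \<Rightarrow> 'a set \<Rightarrow> 'a form set" where
  "fe_space fam r k \<T> \<Omega> = {\<omega> \<in> W_forms \<infinity> \<infinity> k \<Omega>.
     \<forall>T\<in>top_simplices \<T>. \<exists>q\<in>family_forms fam (int r) (int k). AE x in lebesgue_on T. \<omega> x = q x}"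

text \<open>
  A form that is piecewise polynomial up to null sets has a unique polynomial representative on each
  full-dimensional simplex \<open>T\<close>, and its trace on \<open>F \<subseteq> T\<close> is the pullback of that representative.  For
  members of \<^const>\<open>fe_space\<close> and for polynomial forms on \<^term>\<open>patch \<T> F\<close> (extended by zero) the trace
  does not depend on the choice of \<open>T\<close>.
\<close>

definition poly_rep :: "nat \<Rightarrow> 'a::euclidean_space set \<Rightarrow> 'a form \<Rightarrow> 'a form" where
  "poly_rep k T \<omega> =
     (let Q = {q. (\<exists>d. q \<in> poly_forms d (int k)) \<and> (AE x in lebesgue_on T. \<omega> x = q x)}
      in if Q = {} then 0 else (SOME q. q \<in> Q))"

definition fe_trace ::
    "nat \<Rightarrow> 'a::euclidean_space set set \<Rightarrow> 'a set \<Rightarrow> 'a form \<Rightarrow> 'a form" where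
  "fe_trace k \<T> F \<omega> = tr F (poly_rep k (SOME T. T \<in> top_simplices \<T> \<and> F \<subseteq> T) \<omega>)"

fun moment_forms :: "family \<Rightarrow> nat \<Rightarrow> nat \<Rightarrow> 'a::euclidean_space set \<Rightarrow> 'a form set" where
  "moment_forms Full r k F =
     tr F ` trimmed_forms (int r + int k - aff_dim F) (aff_dim F - int k)"
| "moment_forms Trimmed r k F =
     tr F ` poly_forms (int r + int k - aff_dim F - 1) (aff_dim F - int k)"

definition functionals ::
    "family \<Rightarrow> nat \<Rightarrow> nat \<Rightarrow> 'a::euclidean_space set set \<Rightarrow> 'a set \<Rightarrow> ('a form \<Rightarrow> real) set" where
  "functionals fam r k \<T> F =
     {(\<lambda>\<omega>. simplex_integral F (wedge (nat (aff_dim F - int k)) k \<eta> (fe_trace k \<T> F \<omega>))) | \<eta>.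
        \<eta> \<in> moment_forms fam r k F}"

section \<open>Biorthogonal systems, local projections, and the Clement interpolant\<close>

definition dim_over_p :: "'a::euclidean_space itself \<Rightarrow> ennreal \<Rightarrow> real" where
  "dim_over_p _ p = (if p = \<infinity> then 0 else real DIM('a) / enn2real p)"

text \<open>
  The family \<open>\<phi>\<close> is a basis of a space of equivalence classes modulo equality almost everywhere, so
  existence and uniqueness of coefficients refer to equality almost everywhere.  In the last
  condition, forms in \<open>P\<^sub>r\<Lambda>\<^sup>k(T)\<close> are identified with the polynomial forms on the whole space.
\<close>

definition biorthogonal_system ::
    "ennreal \<Rightarrow> family \<Rightarrow> nat \<Rightarrow> nat \<Rightarrow> 'a::euclidean_space set set \<Rightarrow> 'a set \<Rightarrow>
     ('a set \<Rightarrow> nat \<Rightarrow> 'a form \<Rightarrow> real) \<Rightarrow> ('a set \<Rightarrow> nat \<Rightarrow> 'a form) \<Rightarrow> real \<Rightarrow> bool" where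
  "biorthogonal_system p fam r k \<T> \<Omega> \<phi>' \<phi> C\<^sub>A \<longleftrightarrow>
     (\<forall>S\<in>\<T>. inj_on (\<phi>' S) (indices fam r k S) \<and> independent (\<phi>' S ` indices fam r k S) \<and>
        span (\<phi>' S ` indices fam r k S) = functionals fam r k \<T> S) \<and>
     (\<forall>S\<in>\<T>. \<forall>i\<in>indices fam r k S. \<phi> S i \<in> fe_space fam r k \<T> \<Omega>) \<and>
     (\<forall>\<omega>\<in>fe_space fam r k \<T> \<Omega>. \<exists>!c. c \<in> (SIGMA S:\<T>. indices fam r k S) \<rightarrow>\<^sub>E UNIV \<and>
        (AE x in lebesgue_on \<Omega>. \<omega> x = (\<Sum>(S, i)\<in>(SIGMA S:\<T>. indices fam r k S). c (S, i) *\<^sub>R \<phi> S i x))) \<and>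
     (\<forall>S\<in>\<T>. \<forall>i\<in>indices fam r k S. \<forall>S'\<in>\<T>. \<forall>j\<in>indices fam r k S'.
        \<phi>' S i (\<phi> S' j) = (if (S, i) = (S', j) then 1 else 0)) \<and>
     (\<forall>S\<in>\<T>. \<forall>i\<in>indices fam r k S. \<forall>S'\<in>\<T>. \<not> S \<subseteq> S' \<longrightarrow> fe_trace k \<T> S' (\<phi> S i) = 0) \<and>
     (\<forall>S\<in>\<T>. \<forall>i\<in>indices fam r k S. \<forall>T\<in>top_simplices \<T>. S \<subseteq> T \<longrightarrow>
        Lp_norm p k T (\<phi> S i) \<le> ennreal (C\<^sub>A * mesh_size \<T> S powr (dim_over_p TYPE('a) p - real k)) \<and>
        (\<forall>\<omega>\<in>poly_forms (int r) (int k).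
           Lp_norm p k T (\<phi>' S i \<omega> *\<^sub>R \<phi> S i) \<le> ennreal C\<^sub>A * Lp_norm p k T \<omega>))"

definition zero_extension :: "'a set \<Rightarrow> 'a form \<Rightarrow> 'a form" where
  "zero_extension U \<omega> = (\<lambda>x. if x \<in> U then \<omega> x else 0)"

text \<open>
  Weak derivatives on a closed patch \<open>U\<close> are taken on its interior, whose complement in \<open>U\<close> is a null
  set.
\<close>

definition local_projection ::
    "ennreal \<Rightarrow> nat \<Rightarrow> nat \<Rightarrow> 'a::euclidean_space set set \<Rightarrow> 'a set \<Rightarrow> real \<Rightarrow> 'a set \<Rightarrow>
     ('a form \<Rightarrow> 'a form) \<Rightarrow> bool" where
  "local_projection p r k \<T> \<Omega> C\<^sub>B\<^sub>H S P \<longleftrightarrow>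
     (\<forall>\<omega>\<in>Lp_forms p k \<Omega>. P \<omega> \<in> zero_extension (patch \<T> S) ` poly_forms (int r) (int k)) \<and>
     (\<forall>\<omega>\<in>Lp_forms p k \<Omega>. \<forall>\<eta>\<in>Lp_forms p k \<Omega>. P (\<omega> + \<eta>) = P \<omega> + P \<eta>) \<and>
     (\<forall>\<omega>\<in>Lp_forms p k \<Omega>. \<forall>c. P (c *\<^sub>R \<omega>) = c *\<^sub>R P \<omega>) \<and>
     (\<exists>B. \<forall>\<omega>\<in>Lp_forms p k \<Omega>. Lp_norm p k \<Omega> (P \<omega>) \<le> ennreal B * Lp_norm p k \<Omega> \<omega>) \<and>
     (\<forall>\<omega>\<in>Lp_forms p k \<Omega>. P (P \<omega>) = P \<omega>) \<and>
     (\<forall>m. 0 \<le> m \<and> m \<le> real (r + 1) \<longrightarrow> (\<forall>\<omega>\<in>sobolev_forms m p k \<Omega>.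
        Lp_norm p k (patch \<T> S) (\<omega> - P \<omega>) \<le>
        ennreal (C\<^sub>B\<^sub>H * mesh_size \<T> S powr m) * sobolev_seminorm m p k (interior (patch \<T> S)) \<omega>)) \<and>
     (\<forall>l. 0 \<le> l \<and> l \<le> real r \<longrightarrow> (\<forall>\<omega>\<in>Lp_forms p k \<Omega>. \<forall>\<eta> \<zeta>.
        weak_ext_deriv k \<Omega> \<omega> \<eta> \<and> \<eta> \<in> sobolev_forms l p (k + 1) \<Omega> \<and>
        weak_ext_deriv k (interior (patch \<T> S)) (P \<omega>) \<zeta> \<longrightarrow>
        Lp_norm p (k + 1) (patch \<T> S) (\<eta> - \<zeta>) \<le>
        ennreal (C\<^sub>B\<^sub>H * mesh_size \<T> S powr l) *
          sobolev_seminorm l p (k + 1) (interior (patch \<T> S)) \<eta>))"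

definition clement ::
    "family \<Rightarrow> nat \<Rightarrow> nat \<Rightarrow> 'a::euclidean_space set set \<Rightarrow> ('a set \<Rightarrow> nat \<Rightarrow> 'a form \<Rightarrow> real) \<Rightarrow>
     ('a set \<Rightarrow> nat \<Rightarrow> 'a form) \<Rightarrow> ('a set \<Rightarrow> 'a form \<Rightarrow> 'a form) \<Rightarrow> 'a form \<Rightarrow> 'a form" where
  "clement fam r k \<T> \<phi>' \<phi> P \<omega> = (\<Sum>S\<in>\<T>. \<Sum>i\<in>indices fam r k S. \<phi>' S i (P S \<omega>) *\<^sub>R \<phi> S i)"

end

theory Submission
  imports Defs
begin

text \<open>
  On a full-dimensional simplex \<open>T\<close> the interpolation error is
  \<open>\<omega> - Q + \<Sum> \<phi>\<^sup>*\<^bsub>S,i\<^esub>(Q - P\<^sub>S \<omega>) \<phi>\<^bsub>S,i\<^esub>\<close>, summed over the faces \<open>S\<close> of \<open>T\<close>, for every polynomial form \<open>Q\<close> in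
  the finite element family.  This follows from biorthogonality alone: a global polynomial form
  belongs to the finite element space, and the shape functions of simplices not contained in \<open>T\<close>
  vanish on \<open>T\<close>.  All terms are controlled by \<open>\<omega> - Q\<close> and \<open>\<omega> - P\<^sub>S \<omega>\<close> on patches.

  For the full family \<open>Q = P\<^sub>T \<omega>\<close> is a suitable choice.  For the trimmed family \<open>Q\<close> is \<open>P\<^sub>T \<omega>\<close> without
  its part of degree \<open>r\<close> in barycentric coordinates.  The coefficients of that part are \<open>r\<close>-fold
  derivatives along edges of \<open>T\<close>; testing with a bump function and integrating by parts bounds them
  by \<open>\<omega> - P\<^sub>T \<omega>\<close> and by weak derivatives of \<open>\<omega>\<close>.  Only the fractional seminorm requires the shape
  measure here.
\<close>

section \<open>Lebesgue norms\<close>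

text \<open>Biorthogonality reproduces only members of the chosen family, whereas
  \<open>P T \<omega>\<close> is a full polynomial form of degree \<open>r\<close>; hence the
  truncation in the trimmed case. The bound m \<le> r comes from there: the top-degree coefficients
  are tested with exactly \<open>r\<close> derivatives, and only these can be traded for weak
  derivatives of \<omega>. The edges of \<open>T\<close> have length at most h and its barycentric
  coordinates are bounded by 1, so no angle of \<open>T\<close> enters the integer case. Averaging a
  Slobodeckij quotient over two points costs a power of h^n / V, with V the volume of
  \<open>T\<close>, and this ratio is what the shape measure controls. Weak derivatives and traces
  are selected by Hilbert choice. Uniqueness almost everywhere of weak derivatives and of polynomial
  representatives makes the choices harmless. Linearity of the functionals is established on
  polynomial forms, so shape functions and projections are replaced by polynomials before a
  functional is applied. Constants are not optimised: triangle and Hoelder inequalities carry extra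
  factors, and the dependence on the form degree is removed at the end by adding the constants of
  all degrees up to n.\<close>

lemma ex_maximal_image:
  fixes f :: "'b \<Rightarrow> 'c::linorder"
  assumes "finite I" "I \<noteq> {}"
  shows "\<exists>i\<in>I. \<forall>j\<in>I. f j \<le> f i"
proof -
  have "Max (f ` I) \<in> f ` I" using assms by (intro Max_in) auto
  then obtain i where "i \<in> I" "f i = Max (f ` I)" by auto
  then show ?thesis using assms by (intro bexI[of _ i]) auto
qed

lemma ennreal_powr_mono:
  assumes "a \<le> b" "0 < s"
  shows "ennreal_powr a s \<le> ennreal_powr b s"
proof (cases "b = \<infinity>")
  case False
  then have "a \<noteq> \<infinity>" using assms(1) by (auto simp: top_unique)
  moreover have "enn2real a \<le> enn2real b"
    using assms(1) False by (simp add: enn2real_mono top.not_eq_extremum)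
  ultimately show ?thesis
    using False assms(2) by (auto simp: ennreal_powr_def intro!: ennreal_leI powr_mono2)
qed (simp add: ennreal_powr_def)

lemma ennreal_powr_cmult:
  assumes "0 < s" "0 \<le> c"
  shows "ennreal_powr (ennreal c * X) s = ennreal (c powr s) * ennreal_powr X s"
proof (cases "X = \<infinity>")
  case True
  show ?thesis
  proof (cases "c = 0")
    case False
    then have "0 < c" using assms(2) by simp
    then show ?thesis using True by (simp add: ennreal_powr_def ennreal_mult_top)
  qed (simp add: ennreal_powr_def)
next
  case False
  then obtain x where "X = ennreal x" "0 \<le> x" by (cases X) auto
  then show ?thesis using assms
    by (simp add: ennreal_powr_def ennreal_mult'[symmetric] powr_mult ennreal_mult_eq_top_iff)
qed

text \<open>Bounding the sum by \<open>card I\<close> times its largest term takes the place of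
  subadditivity of t \<mapsto> t^s. The factor is crude, but infinite terms need no separate
  treatment, and \<open>card I powr s\<close> is at most \<open>card I\<close> because s \<le>
  1.\<close>

lemma ennreal_powr_sum_le:
  assumes "finite I" "0 < s" "s \<le> 1"
  shows "ennreal_powr (\<Sum>i\<in>I. X i) s \<le> ennreal (real (card I)) * (\<Sum>i\<in>I. ennreal_powr (X i) s)"
proof (cases "I = {}")
  case True
  then show ?thesis by (simp add: ennreal_powr_def)
next
  case False
  obtain i where i: "i \<in> I" "\<And>j. j \<in> I \<Longrightarrow> X j \<le> X i"
    using ex_maximal_image[OF assms(1) False, of X] by blast
  have N: "1 \<le> real (card I)" using assms(1) False by (simp add: Suc_le_eq card_gt_0_iff)
  have "(\<Sum>i\<in>I. X i) \<le> of_nat (card I) * X i"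
    using i(2) by (rule sum_bounded_above)
  then have "ennreal_powr (\<Sum>i\<in>I. X i) s \<le> ennreal_powr (ennreal (real (card I)) * X i) s"
    using assms(2) by (intro ennreal_powr_mono) (simp add: ennreal_of_nat_eq_real_of_nat)
  also have "\<dots> = ennreal (real (card I) powr s) * ennreal_powr (X i) s"
    using assms by (simp add: ennreal_powr_cmult)
  also have "\<dots> \<le> ennreal (real (card I)) * (\<Sum>i\<in>I. ennreal_powr (X i) s)"
  proof (rule mult_mono)
    have "real (card I) powr s \<le> real (card I) powr 1" using N assms by (intro powr_mono) auto
    then show "ennreal (real (card I) powr s) \<le> ennreal (real (card I))"
      using N by (intro ennreal_leI) auto
    show "ennreal_powr (X i) s \<le> (\<Sum>i\<in>I. ennreal_powr (X i) s)"
      using i(1) assms(1) by (intro member_le_sum) auto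
  qed auto
  finally show ?thesis .
qed

text \<open>Working with a scalar integrand over an arbitrary measure covers both
  \<open>Lp_norm\<close> on a set \<open>U\<close> and \<open>slobodeckij\<close>, which is the norm
  of a difference quotient on \<open>U \<times> U\<close>.\<close>

definition lpnorm :: "ennreal \<Rightarrow> 'b measure \<Rightarrow> ('b \<Rightarrow> real) \<Rightarrow> ennreal" where
  "lpnorm p M F = (if p = \<infinity> then esssup M (\<lambda>x. ennreal (F x))
     else ennreal_powr (\<integral>\<^sup>+x. ennreal (F x powr enn2real p) \<partial>M) (1 / enn2real p))"

text \<open>The convention 1/\<infinity> = 0 lets powers such as \<open>V powr (1 - recip p)\<close>
  cover p = \<infinity> without a separate formula.\<close>

definition recip :: "ennreal \<Rightarrow> real" where
  "recip p = (if p = \<infinity> then 0 else 1 / enn2real p)"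

lemma enn2real_ge_1: "1 \<le> p \<Longrightarrow> p \<noteq> \<infinity> \<Longrightarrow> 1 \<le> enn2real p"
  by (cases p) auto

lemma recip_bounds:
  assumes "1 \<le> p"
  shows "0 \<le> recip p" "recip p \<le> 1"
  using enn2real_ge_1[OF assms] by (auto simp: recip_def)

lemma Lp_norm_eq_lpnorm: "Lp_norm p k U \<omega> = lpnorm p (lebesgue_on U) (\<lambda>x. alt_norm k (\<omega> x))"
  by (simp add: Lp_norm_def lpnorm_def)

lemma alt_norm_nonneg: "0 \<le> alt_norm k A"
  by (auto simp: alt_norm_def intro!: divide_nonneg_nonneg sum_nonneg)

text \<open>With the exponent n/p + \<theta> in the denominator, the p-th power of the quotient
  acquires the exponent n + p \<theta>; for p = \<infinity> only \<theta> is left.\<close>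

lemma slobodeckij_eq_lpnorm:
  fixes U :: "'a::euclidean_space set"
  assumes "1 \<le> p"
  shows "slobodeckij \<theta> p k U \<omega> = lpnorm p (lebesgue_on (U \<times> U))
    (\<lambda>(x, y). alt_norm k (\<omega> x - \<omega> y) / norm (x - y) powr (real DIM('a) * recip p + \<theta>))"
proof (cases "p = \<infinity>")
  case True
  then show ?thesis by (simp add: slobodeckij_def lpnorm_def recip_def case_prod_unfold)
next
  case False
  have p: "1 \<le> enn2real p" using enn2real_ge_1[OF assms False] .
  then have "(norm (x - y) powr (real DIM('a) * recip p + \<theta>)) powr enn2real p =
      norm (x - y) powr (real DIM('a) + enn2real p * \<theta>)" for x y :: 'a
    using False by (auto simp: powr_powr recip_def algebra_simps)
  then show ?thesis
    using False by (simp add: slobodeckij_def lpnorm_def case_prod_unfold powr_divide alt_norm_nonneg)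
qed

text \<open>Measurability is required of the smaller function only, because the larger one may be a
  Slobodeckij quotient. For \<open>F\<close> it matters: the essential supremum of a nonmeasurable
  function is infinite.\<close>

lemma lpnorm_mono_AE:
  assumes "1 \<le> p" "F \<in> borel_measurable M" "AE x in M. F x \<le> c * G x" "0 < c"
    "\<And>x. 0 \<le> F x" "\<And>x. 0 \<le> G x"
  shows "lpnorm p M F \<le> ennreal c * lpnorm p M G"
proof (cases "p = \<infinity>")
  case True
  have "AE x in M. ennreal (F x) \<le> ennreal c * esssup M (\<lambda>x. ennreal (G x))"
    using assms(3) esssup_AE[of "\<lambda>x. ennreal (G x)" M]
  proof eventually_elim
    case (elim x)
    have "ennreal (F x) \<le> ennreal (c * G x)" using elim(1) by (rule ennreal_leI)
    also have "\<dots> = ennreal c * ennreal (G x)" using assms(4,6) by (simp add: ennreal_mult')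
    also have "\<dots> \<le> ennreal c * esssup M (\<lambda>x. ennreal (G x))"
      using elim(2) by (intro mult_left_mono) auto
    finally show ?case .
  qed
  then have "esssup M (\<lambda>x. ennreal (F x)) \<le> ennreal c * esssup M (\<lambda>x. ennreal (G x))"
    using assms(2) by (intro esssup_I) auto
  then show ?thesis using True by (simp add: lpnorm_def)
next
  case False
  define q where "q = enn2real p"
  have q: "1 \<le> q" using enn2real_ge_1[OF assms(1) False] by (simp add: q_def)
  have "(\<integral>\<^sup>+x. ennreal (F x powr q) \<partial>M) \<le> (\<integral>\<^sup>+x. ennreal (c powr q) * ennreal (G x powr q) \<partial>M)"
  proof (rule nn_integral_mono_AE)
    show "AE x in M. ennreal (F x powr q) \<le> ennreal (c powr q) * ennreal (G x powr q)"
      using assms(3)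
    proof eventually_elim
      case (elim x)
      have "F x powr q \<le> (c * G x) powr q" using elim q assms by (intro powr_mono2) auto
      then show ?case using assms by (simp add: powr_mult ennreal_mult'[symmetric])
    qed
  qed
  also have "\<dots> \<le> ennreal (c powr q) * (\<integral>\<^sup>+x. ennreal (G x powr q) \<partial>M)"
  proof (cases "(\<lambda>x. ennreal (G x powr q)) \<in> borel_measurable M")
    case True
    then show ?thesis by (simp add: nn_integral_cmult)
  next
    \<comment> \<open>For nonmeasurable \<open>G\<close> the constant cannot be pulled out by
      linearity. The integral is by definition a supremum over simple functions, and multiplying
      such a minorant by \<open>c'\<close> yields a minorant of \<open>G x powr q\<close>.\<close>
    case False
    define c' where "c' = 1 / c powr q"
    have c': "0 < c'" "c' * c powr q = 1" using assms(4) by (auto simp: c'_def)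
    have "(\<integral>\<^sup>+x. ennreal (c powr q) * ennreal (G x powr q) \<partial>M) =
        (SUP g\<in>{g. simple_function M g \<and> g \<le> (\<lambda>x. ennreal (c powr q) * ennreal (G x powr q))}. integral\<^sup>S M g)"
      by (simp add: nn_integral_def)
    also have "\<dots> \<le> ennreal (c powr q) * (\<integral>\<^sup>+x. ennreal (G x powr q) \<partial>M)"
    proof (rule SUP_least)
      fix g assume "g \<in> {g. simple_function M g \<and> g \<le> (\<lambda>x. ennreal (c powr q) * ennreal (G x powr q))}"
      then have g: "simple_function M g" "\<And>x. g x \<le> ennreal (c powr q) * ennreal (G x powr q)"
        by (auto simp: le_fun_def)
      have "ennreal c' * g x \<le> ennreal (G x powr q)" for x
      proof -
        have "ennreal c' * g x \<le> ennreal c' * (ennreal (c powr q) * ennreal (G x powr q))"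
          using g(2) by (intro mult_left_mono) auto
        also have "\<dots> = ennreal (c' * c powr q) * ennreal (G x powr q)"
          using c'(1) by (subst ennreal_mult') (simp_all add: mult.assoc)
        finally show ?thesis using c'(2) by simp
      qed
      then have "(\<integral>\<^sup>+x. ennreal c' * g x \<partial>M) \<le> (\<integral>\<^sup>+x. ennreal (G x powr q) \<partial>M)"
        by (intro nn_integral_mono) auto
      then have "ennreal c' * integral\<^sup>S M g \<le> (\<integral>\<^sup>+x. ennreal (G x powr q) \<partial>M)"
        using g(1) by (simp add: nn_integral_cmult nn_integral_eq_simple_integral borel_measurable_simple_function)
      then have "ennreal (c powr q) * (ennreal c' * integral\<^sup>S M g) \<le> ennreal (c powr q) * (\<integral>\<^sup>+x. ennreal (G x powr q) \<partial>M)"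
        by (intro mult_left_mono) auto
      moreover have "ennreal (c powr q) * (ennreal c' * integral\<^sup>S M g) = integral\<^sup>S M g"
        using c' by (simp add: mult.assoc[symmetric] ennreal_mult'[symmetric] mult.commute)
      ultimately show "integral\<^sup>S M g \<le> ennreal (c powr q) * (\<integral>\<^sup>+x. ennreal (G x powr q) \<partial>M)" by simp
    qed
    finally show ?thesis .
  qed
  finally have "ennreal_powr (\<integral>\<^sup>+x. ennreal (F x powr q) \<partial>M) (1 / q) \<le>
      ennreal_powr (ennreal (c powr q) * (\<integral>\<^sup>+x. ennreal (G x powr q) \<partial>M)) (1 / q)"
    using q by (intro ennreal_powr_mono) auto
  also have "\<dots> = ennreal ((c powr q) powr (1 / q)) * ennreal_powr (\<integral>\<^sup>+x. ennreal (G x powr q) \<partial>M) (1 / q)"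
    using q by (simp add: ennreal_powr_cmult)
  also have "(c powr q) powr (1 / q) = c" using q assms(4) by (simp add: powr_powr)
  finally show ?thesis using False by (simp add: lpnorm_def q_def)
qed

lemma lpnorm_0: "lpnorm p M (\<lambda>_. 0) = 0"
proof (cases "p = \<infinity>")
  case True
  have "esssup M (\<lambda>_. 0::ennreal) \<le> 0" by (rule esssup_I) auto
  then show ?thesis using True by (simp add: lpnorm_def)
qed (simp add: lpnorm_def ennreal_powr_def)

text \<open>A weak form of Minkowski's inequality. One factor \<open>card I\<close> comes from
  estimating the sum pointwise by its largest term, the other from
  \<open>ennreal_powr_sum_le\<close>, which splits the root of a sum of integrals.\<close>

lemma lpnorm_sum_le:
  assumes p: "1 \<le> p" and I: "finite I" and F: "F \<in> borel_measurable M"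
    and f: "\<And>i. i \<in> I \<Longrightarrow> f i \<in> borel_measurable M"
    and le: "AE x in M. F x \<le> (\<Sum>i\<in>I. f i x)"
    and nn: "\<And>x. 0 \<le> F x" "\<And>i x. i \<in> I \<Longrightarrow> 0 \<le> f i x"
  shows "lpnorm p M F \<le> ennreal ((real (card I))\<^sup>2) * (\<Sum>i\<in>I. lpnorm p M (f i))"
proof (cases "I = {}")
  case True
  then have "AE x in M. F x \<le> c * 0" for c using le by auto
  then have "lpnorm p M F \<le> ennreal 1 * lpnorm p M (\<lambda>_. 0)"
    using p F nn by (intro lpnorm_mono_AE) auto
  then show ?thesis using True by (simp add: lpnorm_0)
next
  case I0: False
  have N: "1 \<le> real (card I)" using I I0 by (simp add: Suc_le_eq card_gt_0_iff)
  then have N2: "1 \<le> (real (card I))\<^sup>2" by simp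
  show ?thesis
  proof (cases "p = \<infinity>")
    case True
    have "AE x in M. \<forall>i\<in>I. ennreal (f i x) \<le> esssup M (\<lambda>x. ennreal (f i x))"
      using I by (intro AE_finite_allI esssup_AE)
    with le have "AE x in M. ennreal (F x) \<le> (\<Sum>i\<in>I. esssup M (\<lambda>x. ennreal (f i x)))"
    proof eventually_elim
      case (elim x)
      have "ennreal (F x) \<le> ennreal (\<Sum>i\<in>I. f i x)" using elim by (intro ennreal_leI)
      also have "\<dots> = (\<Sum>i\<in>I. ennreal (f i x))" using nn by (simp add: sum_ennreal)
      also have "\<dots> \<le> (\<Sum>i\<in>I. esssup M (\<lambda>x. ennreal (f i x)))" using elim by (intro sum_mono) auto
      finally show ?case .
    qed
    then have "lpnorm p M F \<le> 1 * (\<Sum>i\<in>I. lpnorm p M (f i))"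
      using F True by (auto simp: lpnorm_def intro!: esssup_I)
    also have "\<dots> \<le> ennreal ((real (card I))\<^sup>2) * (\<Sum>i\<in>I. lpnorm p M (f i))"
      using N2 by (intro mult_right_mono) (simp_all add: ennreal_ge_1)
    finally show ?thesis .
  next
    case False
    define q where "q = enn2real p"
    have q: "1 \<le> q" using enn2real_ge_1[OF p False] by (simp add: q_def)
    let ?N = "real (card I)"
    have "(\<integral>\<^sup>+x. ennreal (F x powr q) \<partial>M) \<le> (\<integral>\<^sup>+x. ennreal (?N powr q) * (\<Sum>i\<in>I. ennreal (f i x powr q)) \<partial>M)"
    proof (rule nn_integral_mono_AE)
      show "AE x in M. ennreal (F x powr q) \<le> ennreal (?N powr q) * (\<Sum>i\<in>I. ennreal (f i x powr q))"
        using le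
      proof eventually_elim
        case (elim x)
        obtain i where i: "i \<in> I" "\<And>j. j \<in> I \<Longrightarrow> f j x \<le> f i x"
          using ex_maximal_image[OF I I0, of "\<lambda>j. f j x"] by blast
        have "F x \<le> ?N * f i x"
          using elim sum_bounded_above[of I "\<lambda>j. f j x" "f i x"] i(2) by simp
        then have "F x powr q \<le> (?N * f i x) powr q" using nn q by (intro powr_mono2) auto
        also have "\<dots> = ?N powr q * f i x powr q" using nn i by (simp add: powr_mult)
        also have "\<dots> \<le> ?N powr q * (\<Sum>i\<in>I. f i x powr q)"
          using i I by (intro mult_left_mono member_le_sum) auto
        finally have "ennreal (F x powr q) \<le> ennreal (?N powr q * (\<Sum>i\<in>I. f i x powr q))"
          by (rule ennreal_leI)
        then show ?case by (simp add: ennreal_mult' sum_ennreal)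
      qed
    qed
    also have "\<dots> = ennreal (?N powr q) * (\<Sum>i\<in>I. \<integral>\<^sup>+x. ennreal (f i x powr q) \<partial>M)"
    proof -
      have "(\<integral>\<^sup>+x. (\<Sum>i\<in>I. ennreal (f i x powr q)) \<partial>M) = (\<Sum>i\<in>I. \<integral>\<^sup>+x. ennreal (f i x powr q) \<partial>M)"
        using f by (intro nn_integral_sum) auto
      moreover have "(\<lambda>x. \<Sum>i\<in>I. ennreal (f i x powr q)) \<in> borel_measurable M"
        using f by (intro borel_measurable_sum) auto
      ultimately show ?thesis by (simp only: nn_integral_cmult)
    qed
    finally have "ennreal_powr (\<integral>\<^sup>+x. ennreal (F x powr q) \<partial>M) (1 / q) \<le>
        ennreal_powr (ennreal (?N powr q) * (\<Sum>i\<in>I. \<integral>\<^sup>+x. ennreal (f i x powr q) \<partial>M)) (1 / q)"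
      using q by (intro ennreal_powr_mono) auto
    also have "\<dots> = ennreal ?N * ennreal_powr (\<Sum>i\<in>I. \<integral>\<^sup>+x. ennreal (f i x powr q) \<partial>M) (1 / q)"
      using q N by (simp add: ennreal_powr_cmult powr_powr)
    also have "\<dots> \<le> ennreal ?N * (ennreal ?N * (\<Sum>i\<in>I. ennreal_powr (\<integral>\<^sup>+x. ennreal (f i x powr q) \<partial>M) (1 / q)))"
      using q I by (intro mult_left_mono ennreal_powr_sum_le) auto
    also have "\<dots> = ennreal (?N\<^sup>2) * (\<Sum>i\<in>I. ennreal_powr (\<integral>\<^sup>+x. ennreal (f i x powr q) \<partial>M) (1 / q))"
      by (simp add: power2_eq_square ennreal_mult' mult.assoc)
    finally show ?thesis using False by (simp add: lpnorm_def q_def)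
  qed
qed

lemma lpnorm_const_le:
  assumes "1 \<le> p" "0 \<le> c" "emeasure M (space M) = ennreal V" "0 \<le> V"
  shows "lpnorm p M (\<lambda>_. c) \<le> ennreal (c * V powr recip p)"
proof (cases "p = \<infinity>")
  case True
  show ?thesis
  proof (cases "V = 0")
    \<comment> \<open>In HOL \<open>0 powr 0\<close> is 0, so for p = \<infinity> and
      \<open>V = 0\<close> the claim is that the norm vanishes. It does, the whole space being a
      null set.\<close>
    case True
    have "AE x in M. ennreal c \<le> 0"
      using True assms by (intro AE_I'[of "space M"]) auto
    then have "esssup M (\<lambda>_. ennreal c) \<le> 0" by (intro esssup_I) auto
    then show ?thesis using \<open>p = \<infinity>\<close> by (simp add: lpnorm_def True)
  qed (use True assms in \<open>auto simp: lpnorm_def recip_def intro!: esssup_I\<close>)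
next
  case False
  then have "1 \<le> enn2real p" using enn2real_ge_1 assms by auto
  then show ?thesis using False assms
    by (simp add: lpnorm_def recip_def ennreal_powr_def ennreal_mult'[symmetric]
        powr_mult powr_powr ennreal_mult_eq_top_iff)
qed

text \<open>Hoelder's inequality against the constant 1, with an extra factor 2. The pointwise bound
  t \<le> a + a^(1-q) t^q, valid for all a > 0 and t \<ge> 0, is integrated, and a is chosen so that
  both resulting terms are at most a V.\<close>

lemma nn_integral_le_lpnorm:
  assumes p: "1 \<le> p" and F: "F \<in> borel_measurable M" and nn: "\<And>x. 0 \<le> F x"
    and V: "emeasure M (space M) = ennreal V" "0 < V"
  shows "(\<integral>\<^sup>+x. ennreal (F x) \<partial>M) \<le> ennreal (2 * V powr (1 - recip p)) * lpnorm p M F"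
proof (cases "p = \<infinity>")
  case True
  have "(\<integral>\<^sup>+x. ennreal (F x) \<partial>M) \<le> (\<integral>\<^sup>+x. lpnorm p M F \<partial>M)"
    using esssup_AE[of "\<lambda>x. ennreal (F x)" M] True
    by (intro nn_integral_mono_AE) (simp add: lpnorm_def)
  also have "\<dots> = ennreal V * lpnorm p M F" using V by (simp add: mult.commute)
  also have "\<dots> \<le> ennreal (2 * V powr (1 - recip p)) * lpnorm p M F"
    using True V by (intro mult_right_mono ennreal_leI) (auto simp: recip_def)
  finally show ?thesis .
next
  case False
  define q where "q = enn2real p"
  have q: "1 \<le> q" using enn2real_ge_1[OF p False] by (simp add: q_def)
  have r: "recip p = 1 / q" using False by (simp add: recip_def q_def)
  define X where "X = (\<integral>\<^sup>+x. ennreal (F x powr q) \<partial>M)"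
  have n: "lpnorm p M F = ennreal_powr X (1 / q)"
    using False by (simp add: lpnorm_def X_def q_def)
  show ?thesis
  proof (cases "X = \<infinity>")
    case True
    then show ?thesis using V n by (simp add: ennreal_powr_def ennreal_mult_top)
  next
    case False
    define N where "N = enn2real X powr (1 / q)"
    have nN: "lpnorm p M F = ennreal N" using n False by (simp add: ennreal_powr_def N_def)
    have N0: "0 \<le> N" by (simp add: N_def)
    have XN: "X = ennreal (N powr q)"
      using False q by (cases X) (auto simp: N_def powr_powr)
    have "(\<integral>\<^sup>+x. ennreal (F x) \<partial>M) \<le> ennreal (2 * V powr (1 - recip p) * (N + e))" if e: "0 < e" for e
    proof -
      \<comment> \<open>This value balances the two terms. Adding \<open>e\<close> to the norm
        \<open>N\<close> keeps it positive when \<open>N\<close> is 0; \<open>e\<close> tends to 0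
        afterwards.\<close>
      define a where "a = (N + e) * V powr (- (1 / q))"
      have a: "0 < a" using e N0 V by (simp add: a_def)
      have le: "t \<le> a + (a / a powr q) * t powr q" if "0 \<le> t" for t
      proof (cases "t \<le> a")
        case True
        then show ?thesis using a by (simp add: add_increasing2)
      next
        case False
        then have "(t / a) powr 1 \<le> (t / a) powr q" using a q by (intro powr_mono) auto
        then have "t \<le> a * (t / a) powr q" using a False by (simp add: field_simps)
        then show ?thesis using a that by (simp add: powr_divide)
      qed
      have "(\<integral>\<^sup>+x. ennreal (F x) \<partial>M) \<le> (\<integral>\<^sup>+x. ennreal a + ennreal (a / a powr q) * ennreal (F x powr q) \<partial>M)"
        using le nn a by (intro nn_integral_mono) (simp add: ennreal_mult'[symmetric] ennreal_plus[symmetric] del: ennreal_plus)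
      also have "\<dots> = ennreal a * ennreal V + ennreal (a / a powr q) * X"
        using F V by (simp add: nn_integral_add nn_integral_cmult X_def)
      also have "\<dots> = ennreal (a * V + a / a powr q * N powr q)"
        using a V by (simp add: XN ennreal_mult'[symmetric] ennreal_plus[symmetric] del: ennreal_plus)
      also have "\<dots> \<le> ennreal (2 * V powr (1 - recip p) * (N + e))"
      proof (rule ennreal_leI)
        have aV: "a * V = V powr (1 - recip p) * (N + e)"
          using V by (simp add: a_def r powr_diff powr_minus field_simps)
        have "a powr q = (N + e) powr q / V"
        proof -
          have "(V powr (- (1 / q))) powr q = V powr (- 1)" using q by (simp only: powr_powr) simp
          also have "\<dots> = inverse V" using V by (simp add: powr_minus)
          finally show ?thesis using e N0 V unfolding a_def by (simp add: powr_mult divide_inverse)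
        qed
        moreover have "N powr q \<le> (N + e) powr q" using e N0 q by (intro powr_mono2) auto
        ultimately have "N powr q \<le> a powr q * V" using V by simp
        then have "N powr q / a powr q \<le> V" using a by (simp add: divide_le_eq mult.commute)
        then have "a * (N powr q / a powr q) \<le> a * V" using a by (intro mult_left_mono) auto
        then have "a * V + a / a powr q * N powr q \<le> 2 * (a * V)" by (simp add: mult.commute)
        then show "a * V + a / a powr q * N powr q \<le> 2 * V powr (1 - recip p) * (N + e)"
          by (simp only: aV mult.assoc)
      qed
      finally show ?thesis .
    qed
    note * = this
    have "(\<integral>\<^sup>+x. ennreal (F x) \<partial>M) \<le> ennreal (2 * V powr (1 - recip p) * N) + ennreal d" if "0 < d" for d
    proof -
      define c where "c = 2 * V powr (1 - recip p)"
      have c: "0 < c" using V by (simp add: c_def)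
      then have "0 < d / c" using that by simp
      from *[OF this] have "(\<integral>\<^sup>+x. ennreal (F x) \<partial>M) \<le> ennreal (c * (N + d / c))"
        by (simp only: c_def)
      also have "c * (N + d / c) = c * N + d" using c by (simp add: distrib_left)
      also have "ennreal (c * N + d) = ennreal (c * N) + ennreal d" using c N0 that by (intro ennreal_plus) auto
      finally show ?thesis by (simp only: c_def)
    qed
    then have "(\<integral>\<^sup>+x. ennreal (F x) \<partial>M) \<le> ennreal (2 * V powr (1 - recip p) * N)"
      by (rule ennreal_le_epsilon)
    then show ?thesis using nN N0 by (simp add: ennreal_mult')
  qed
qed

lemma complete_lebesgue_on:
  assumes "U \<in> sets lebesgue"
  shows "complete_measure (lebesgue_on U)"
proof
  fix A B :: "'a set"
  assume B: "B \<subseteq> A" and "A \<in> null_sets (lebesgue_on U)"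
  then have "A \<in> null_sets lebesgue" "A \<subseteq> U" using assms by (auto simp: null_sets_restrict_space)
  then have "B \<in> null_sets lebesgue" "B \<subseteq> U" using B completion.complete2 by auto
  then show "B \<in> sets (lebesgue_on U)" using assms by (auto simp: sets_restrict_space_iff)
qed

text \<open>The preimages of a Borel set under the two functions differ by a null set, and Lebesgue
  measure on \<open>U\<close> is complete.\<close>

lemma borel_measurable_lebesgue_on_AE_eq:
  assumes f: "f \<in> borel_measurable (lebesgue_on U)" and U: "U \<in> sets lebesgue"
    and eq: "AE x in lebesgue_on U. f x = g x"
  shows "g \<in> borel_measurable (lebesgue_on U)"
proof (rule measurableI)
  fix A :: "'b set" assume A: "A \<in> sets borel"
  show "g -` A \<inter> space (lebesgue_on U) \<in> sets (lebesgue_on U)"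
  proof (rule complete_measure.in_sets_AE[OF complete_lebesgue_on[OF U]])
    show "AE x in lebesgue_on U. (x \<in> f -` A \<inter> space (lebesgue_on U)) =
        (x \<in> g -` A \<inter> space (lebesgue_on U))"
      using eq by eventually_elim simp
    show "f -` A \<inter> space (lebesgue_on U) \<in> sets (lebesgue_on U)"
      using f A by (rule measurable_sets)
  qed simp
qed simp

text \<open>The statement avoids measurability so that it applies to Slobodeckij quotients. For p <
  \<infinity> the nonnegative integral is monotone for arbitrary functions; for p = \<infinity> a
  nonmeasurable \<open>G\<close> has infinite essential supremum, and otherwise \<open>F\<close> is
  measurable by completeness.\<close>

lemma lpnorm_le_AE_eq:
  fixes F G :: "'a::euclidean_space \<Rightarrow> real"
  assumes "U \<subseteq> V" "U \<in> sets lebesgue" "V \<in> sets lebesgue" "AE x in lebesgue_on U. F x = G x" "1 \<le> p"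
  shows "lpnorm p (lebesgue_on U) F \<le> lpnorm p (lebesgue_on V) G"
proof (cases "p = \<infinity>")
  case True
  show ?thesis
  proof (cases "(\<lambda>x. ennreal (G x)) \<in> borel_measurable (lebesgue_on V)")
    case m: True
    have mU: "(\<lambda>x. ennreal (G x)) \<in> borel_measurable (lebesgue_on U)"
      using m assms(1) measurable_restrict_mono by blast
    have eq: "AE x in lebesgue_on U. ennreal (G x) = ennreal (F x)"
      using assms(4) by eventually_elim simp
    have mF: "(\<lambda>x. ennreal (F x)) \<in> borel_measurable (lebesgue_on U)"
      using borel_measurable_lebesgue_on_AE_eq[OF mU assms(2) eq] .
    have "AE x in lebesgue_on V. ennreal (G x) \<le> esssup (lebesgue_on V) (\<lambda>x. ennreal (G x))"
      by (rule esssup_AE)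
    then have "AE x in lebesgue_on U. ennreal (G x) \<le> esssup (lebesgue_on V) (\<lambda>x. ennreal (G x))"
      using assms(1-3) by (auto simp: AE_restrict_space_iff)
    with eq have "AE x in lebesgue_on U. ennreal (F x) \<le> esssup (lebesgue_on V) (\<lambda>x. ennreal (G x))"
      by eventually_elim simp
    then show ?thesis using True mF by (auto simp: lpnorm_def intro!: esssup_I)
  qed (simp add: lpnorm_def True esssup_non_measurable)
next
  case False
  have "(\<integral>\<^sup>+x. ennreal (F x powr enn2real p) \<partial>lebesgue_on U) \<le> (\<integral>\<^sup>+x. ennreal (G x powr enn2real p) \<partial>lebesgue_on V)"
  proof -
    have "(\<integral>\<^sup>+x. ennreal (F x powr enn2real p) \<partial>lebesgue_on U) = (\<integral>\<^sup>+x. ennreal (G x powr enn2real p) \<partial>lebesgue_on U)"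
      using assms(4) by (intro nn_integral_cong_AE) (auto elim: eventually_mono)
    also have "\<dots> = (\<integral>\<^sup>+x. ennreal (G x powr enn2real p) * indicator U x \<partial>lebesgue)"
      using assms by (simp add: nn_integral_restrict_space)
    also have "\<dots> \<le> (\<integral>\<^sup>+x. ennreal (G x powr enn2real p) * indicator V x \<partial>lebesgue)"
      using assms(1) by (intro nn_integral_mono) (auto simp: indicator_def)
    also have "\<dots> = (\<integral>\<^sup>+x. ennreal (G x powr enn2real p) \<partial>lebesgue_on V)"
      using assms by (simp add: nn_integral_restrict_space)
    finally show ?thesis .
  qed
  moreover have "0 < 1 / enn2real p" using enn2real_ge_1[OF assms(5) False] by simp
  ultimately show ?thesis using False by (simp add: lpnorm_def ennreal_powr_mono)
qed

section \<open>Smooth functions and integration by parts\<close>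

text \<open>The classical functions t \<mapsto> q(1/t) e^(-1/t), extended by 0 to t \<le> 0. The
  polynomial factor makes the class closed under differentiation.\<close>

definition flat :: "real poly \<Rightarrow> real \<Rightarrow> real" where
  "flat q t = (if 0 < t then poly q (1 / t) * exp (- (1 / t)) else 0)"

lemma tendsto_poly_mult_exp_uminus: "((\<lambda>s. s ^ k * poly q s * exp (- s)) \<longlongrightarrow> (0::real)) at_top"
proof (induction q arbitrary: k)
  case (pCons a q)
  have "((\<lambda>s. a * (s ^ k / exp s) + s ^ Suc k * poly q s * exp (- s)) \<longlongrightarrow> a * 0 + 0) at_top"
    by (intro tendsto_intros tendsto_power_div_exp_0 pCons.IH)
  then show ?case by (simp add: algebra_simps exp_minus divide_inverse)
qed simp

text \<open>In the variable s = 1/t the derivative of q(s) e^(-s) with respect to t is s^2 (q -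
  q')(s) e^(-s), whence the factor \<open>[:0, 0, 1:]\<close>. At t = 0 the exponential decay beats
  every polynomial from the right.\<close>

lemma flat_has_derivative:
  "(flat q has_real_derivative flat ([:0, 0, 1:] * (q - pderiv q)) t) (at t)"
proof -
  consider "t < 0" | "t = 0" | "0 < t" by linarith
  then show ?thesis
  proof cases
    case 1
    have "((\<lambda>_. 0) has_real_derivative 0) (at t)" by simp
    then have "(flat q has_real_derivative 0) (at t)"
      by (rule has_field_derivative_transform_within_open[where S = "{..<0}"]) (use 1 in \<open>auto simp: flat_def\<close>)
    then show ?thesis using 1 by (simp add: flat_def)
  next
    case 2
    have "((\<lambda>y. flat q y / y) \<longlongrightarrow> 0) (at (0::real))"
    proof (rule filterlim_split_at)
      have "eventually (\<lambda>y. flat q y / y = 0) (at_left (0::real))"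
        by (auto simp: eventually_at flat_def intro: exI[of _ 1])
      then show "((\<lambda>y. flat q y / y) \<longlongrightarrow> 0) (at_left (0::real))"
        by (simp add: tendsto_eventually)
      have "((\<lambda>y. inverse y ^ 1 * poly q (inverse y) * exp (- inverse y)) \<longlongrightarrow> 0) (at_right (0::real))"
        by (rule filterlim_compose[OF tendsto_poly_mult_exp_uminus filterlim_inverse_at_top_right])
      moreover have "eventually (\<lambda>y. inverse y ^ 1 * poly q (inverse y) * exp (- inverse y) = flat q y / y) (at_right (0::real))"
        by (auto simp: eventually_at flat_def field_simps intro: exI[of _ 1])
      ultimately show "((\<lambda>y. flat q y / y) \<longlongrightarrow> 0) (at_right (0::real))"
        by (rule Lim_transform_eventually)
    qed
    then show ?thesis using 2 by (simp add: has_field_derivative_iff flat_def)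
  next
    case 3
    have "((\<lambda>t. poly q (1 / t) * exp (- (1 / t))) has_real_derivative
        flat ([:0, 0, 1:] * (q - pderiv q)) t) (at t)"
      using 3 by (auto intro!: derivative_eq_intros simp: flat_def field_simps power2_eq_square)
    then show ?thesis
      by (rule has_field_derivative_transform_within_open[where S = "{0<..}"]) (use 3 in \<open>auto simp: flat_def\<close>)
  qed
qed

text \<open>The algebra generated by constants and by flat functions of affine functions. It is
  stable under directional derivatives, so its members are smooth without computing any higher
  derivative.\<close>

inductive_set flat_alg :: "('a::euclidean_space \<Rightarrow> real) set" where
  const: "(\<lambda>_. c) \<in> flat_alg"
| flat: "(\<lambda>x. flat q (a + x \<bullet> w)) \<in> flat_alg"
| add: "f \<in> flat_alg \<Longrightarrow> g \<in> flat_alg \<Longrightarrow> (\<lambda>x. f x + g x) \<in> flat_alg"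
| mult: "f \<in> flat_alg \<Longrightarrow> g \<in> flat_alg \<Longrightarrow> (\<lambda>x. f x * g x) \<in> flat_alg"

lemma dir_deriv_eq: "(f has_derivative D) (at x) \<Longrightarrow> dir_deriv v f x = D v"
  by (metis dir_deriv_def frechet_derivative_at)

lemma has_derivative_dir_deriv:
  "f differentiable (at x) \<Longrightarrow> (f has_derivative (\<lambda>v. dir_deriv v f x)) (at x)"
  unfolding dir_deriv_def by (metis frechet_derivative_works)

lemma flat_alg_has_derivative:
  assumes "f \<in> flat_alg"
  shows "\<exists>D. (\<forall>x. (f has_derivative D x) (at x)) \<and> (\<forall>v. (\<lambda>x. D x v) \<in> flat_alg)"
  using assms
proof induction
  case (const c)
  then show ?case by (intro exI[of _ "\<lambda>_ _. 0"]) (auto intro: flat_alg.const)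
next
  case (flat q a w)
  let ?q = "[:0, 0, 1:] * (q - pderiv q)"
  have "((\<lambda>x. flat q (a + x \<bullet> w)) has_derivative (\<lambda>v. (v \<bullet> w) * flat ?q (a + x \<bullet> w))) (at x)" for x
  proof -
    have w: "((\<lambda>x. a + x \<bullet> w) has_derivative (\<lambda>v. v \<bullet> w)) (at x)"
      by (auto intro!: derivative_eq_intros)
    show ?thesis
      using has_derivative_compose[OF w, where g = "flat q" and g' = "(*) (flat ?q (a + x \<bullet> w))"]
        flat_has_derivative[of q "a + x \<bullet> w"]
      by (simp add: has_field_derivative_def mult.commute)
  qed
  then show ?case
    by (intro exI[of _ "\<lambda>x v. (v \<bullet> w) * flat ?q (a + x \<bullet> w)"])
      (auto intro!: flat_alg.mult flat_alg.const flat_alg.flat)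
next
  case (add f g)
  then obtain D E where "\<And>x. (f has_derivative D x) (at x)" "\<And>v. (\<lambda>x. D x v) \<in> flat_alg"
    "\<And>x. (g has_derivative E x) (at x)" "\<And>v. (\<lambda>x. E x v) \<in> flat_alg" by blast
  then show ?case
    by (intro exI[of _ "\<lambda>x v. D x v + E x v"]) (auto intro: has_derivative_add flat_alg.add)
next
  case (mult f g)
  then obtain D E where "\<And>x. (f has_derivative D x) (at x)" "\<And>v. (\<lambda>x. D x v) \<in> flat_alg"
    "\<And>x. (g has_derivative E x) (at x)" "\<And>v. (\<lambda>x. E x v) \<in> flat_alg" by blast
  then show ?case
    using flat_alg.add[OF flat_alg.mult[OF mult.hyps(1)] flat_alg.mult[OF _ mult.hyps(2)]]
    by (intro exI[of _ "\<lambda>x v. f x * E x v + D x v * g x"]) (blast intro: has_derivative_mult)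
qed

lemma smooth_flat_alg:
  assumes "f \<in> flat_alg"
  shows "smooth f"
proof -
  have "foldr dir_deriv vs f \<in> flat_alg" for vs
  proof (induction vs)
    case (Cons v vs)
    obtain D where D: "\<And>x. (foldr dir_deriv vs f has_derivative D x) (at x)" "\<And>v. (\<lambda>x. D x v) \<in> flat_alg"
      using flat_alg_has_derivative[OF Cons] by blast
    have "dir_deriv v (foldr dir_deriv vs f) = (\<lambda>x. D x v)"
      using dir_deriv_eq[OF D(1)] by auto
    then show ?case using D(2) by simp
  qed (use assms in simp)
  then show ?thesis
    unfolding smooth_def using flat_alg_has_derivative differentiableI by blast
qed

section \<open>Test functions and iterated directional derivatives\<close>

lemma smooth_differentiable: "smooth f \<Longrightarrow> f differentiable (at x)"
  unfolding smooth_def by (metis foldr_Nil id_apply)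

lemma smooth_foldr_dir_deriv: "smooth f \<Longrightarrow> smooth (foldr dir_deriv vs f)"
  unfolding smooth_def by (metis foldr_append comp_apply)

lemma smooth_dir_deriv: "smooth f \<Longrightarrow> smooth (dir_deriv v f)"
  using smooth_foldr_dir_deriv[of f "[v]"] by simp

lemma smooth_continuous: "smooth f \<Longrightarrow> continuous_on S f"
  by (meson continuous_at_imp_continuous_on differentiable_imp_continuous_within smooth_differentiable)

lemma dir_deriv_locally_zero:
  assumes "x \<notin> closure {x. f x \<noteq> 0}"
  shows "dir_deriv v f x = 0"
proof -
  have "(f has_derivative (\<lambda>_. 0)) (at x)"
  proof (rule has_derivative_transform_within_open[where f = "\<lambda>_. 0" and s = "- closure {x. f x \<noteq> 0}"])
    show "\<And>y. y \<in> - closure {x. f x \<noteq> 0} \<Longrightarrow> 0 = f y"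
      using closure_subset[of "{x. f x \<noteq> 0}"] by auto
  qed (use assms in auto)
  then show ?thesis by (simp add: dir_deriv_eq)
qed

lemma closure_support_dir_deriv:
  "closure {x. dir_deriv v f x \<noteq> 0} \<subseteq> closure {x. f x \<noteq> 0}"
  using dir_deriv_locally_zero by (intro closure_minimal) auto

lemma compact_closure_subset:
  fixes A B :: "'a::t2_space set"
  shows "compact (closure B) \<Longrightarrow> closure A \<subseteq> closure B \<Longrightarrow> compact (closure A)"
  by (metis closed_closure compact_Int_closed inf.absorb2)

lemma test_fun_dir_deriv:
  assumes "test_fun U \<psi>"
  shows "test_fun U (dir_deriv v \<psi>)"
  using assms closure_support_dir_deriv[of v \<psi>] unfolding test_fun_def
  by (meson compact_closure_subset smooth_dir_deriv subset_trans)

lemma test_fun_foldr_dir_deriv: "test_fun U \<psi> \<Longrightarrow> test_fun U (foldr dir_deriv vs \<psi>)"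
  by (induction vs) (auto intro: test_fun_dir_deriv)

lemma test_fun_mono: "test_fun U \<psi> \<Longrightarrow> U \<subseteq> V \<Longrightarrow> test_fun V \<psi>"
  by (auto simp: test_fun_def)

lemma test_fun_eq_0: "test_fun U \<psi> \<Longrightarrow> x \<notin> U \<Longrightarrow> \<psi> x = 0"
  unfolding test_fun_def using closure_subset[of "{x. \<psi> x \<noteq> 0}"] by blast

lemma has_derivative_linear_diff:
  fixes L :: "'a::euclidean_space \<Rightarrow> 'b::real_normed_vector"
  assumes "linear L"
  shows "((\<lambda>x. L (x - x0)) has_derivative L) (at x)"
proof -
  have "((\<lambda>x. x - x0) has_derivative (\<lambda>v. v - 0)) (at x)"
    by (intro has_derivative_diff has_derivative_ident has_derivative_const)
  then show ?thesis
    using bounded_linear.has_derivative[of L "\<lambda>x. x - x0" "\<lambda>x. x"] assms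
    by (simp add: linear_conv_bounded_linear)
qed

lemma dir_deriv_affine_comp:
  fixes f :: "'a::euclidean_space \<Rightarrow> real" and L :: "'a \<Rightarrow> 'a"
  assumes L: "linear L" and f: "\<And>x. f differentiable (at x)"
  shows "dir_deriv v (\<lambda>x. f (L (x - x0))) = (\<lambda>x. dir_deriv (L v) f (L (x - x0)))"
proof
  fix x
  from has_derivative_compose[OF has_derivative_linear_diff[OF L] has_derivative_dir_deriv[OF f]]
  show "dir_deriv v (\<lambda>x. f (L (x - x0))) x = dir_deriv (L v) f (L (x - x0))"
    by (rule dir_deriv_eq)
qed

lemma foldr_dir_deriv_affine_comp:
  fixes f :: "'a::euclidean_space \<Rightarrow> real" and L :: "'a \<Rightarrow> 'a"
  assumes L: "linear L" and f: "smooth f"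
  shows "foldr dir_deriv vs (\<lambda>x. f (L (x - x0))) = (\<lambda>x. foldr dir_deriv (map L vs) f (L (x - x0)))"
proof (induction vs)
  case (Cons v vs)
  then show ?case
    using dir_deriv_affine_comp[OF L smooth_differentiable[OF smooth_foldr_dir_deriv[OF f]], where v = v] by simp
qed simp

lemma smooth_affine_comp:
  fixes f :: "'a::euclidean_space \<Rightarrow> real" and L :: "'a \<Rightarrow> 'a"
  assumes L: "linear L" and f: "smooth f"
  shows "smooth (\<lambda>x. f (L (x - x0)))"
  unfolding smooth_def
proof (intro allI)
  fix vs x
  have "(\<lambda>x. foldr dir_deriv (map L vs) f (L (x - x0))) differentiable (at x)"
    using has_derivative_compose[OF has_derivative_linear_diff[OF L, of x0 x]
        has_derivative_dir_deriv[OF smooth_differentiable[OF smooth_foldr_dir_deriv[OF f, of "map L vs"]]]]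
    by (rule differentiableI)
  then show "foldr dir_deriv vs (\<lambda>x. f (L (x - x0))) differentiable (at x)"
    by (simp only: foldr_dir_deriv_affine_comp[OF L f])
qed

lemma dir_deriv_linear: "f differentiable (at x) \<Longrightarrow> linear (\<lambda>v. dir_deriv v f x)"
  using has_derivative_dir_deriv has_derivative_linear by blast

lemma dir_deriv_Basis:
  assumes "f differentiable (at x)"
  shows "dir_deriv v f x = (\<Sum>b\<in>Basis. (v \<bullet> b) * dir_deriv b f x)"
proof -
  interpret linear "\<lambda>v. dir_deriv v f x" by (rule dir_deriv_linear[OF assms])
  have "dir_deriv v f x = dir_deriv (\<Sum>b\<in>Basis. (v \<bullet> b) *\<^sub>R b) f x" by (simp add: euclidean_representation)
  then show ?thesis by (simp add: sum scale)
qed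

lemma dir_deriv_sum:
  assumes "\<And>i. i \<in> I \<Longrightarrow> f i differentiable (at x)"
  shows "dir_deriv v (\<lambda>x. \<Sum>i\<in>I. c i * f i x) x = (\<Sum>i\<in>I. c i * dir_deriv v (f i) x)"
proof -
  have "((\<lambda>x. \<Sum>i\<in>I. c i * f i x) has_derivative (\<lambda>v. \<Sum>i\<in>I. c i * dir_deriv v (f i) x)) (at x)"
    by (intro has_derivative_sum has_derivative_mult_right has_derivative_dir_deriv assms)
  then show ?thesis by (rule dir_deriv_eq)
qed

section \<open>Integration by parts for compactly supported functions\<close>

lemma continuous_compact_support_integrable:
  fixes f :: "'a::euclidean_space \<Rightarrow> real"
  assumes "continuous_on UNIV f" "compact (closure {x. f x \<noteq> 0})"
  shows "integrable lborel f"
proof -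
  have "integrable lborel (\<lambda>x. indicator (closure {x. f x \<noteq> 0}) x *\<^sub>R f x)"
    using borel_integrable_compact[OF assms(2)] assms(1) continuous_on_subset by blast
  moreover have "(\<lambda>x. indicator (closure {x. f x \<noteq> 0}) x *\<^sub>R f x) = f"
    using closure_subset[of "{x. f x \<noteq> 0}"] by (auto simp: indicator_def fun_eq_iff)
  ultimately show ?thesis by simp
qed

lemma has_real_derivative_line:
  assumes "h differentiable (at (x + s *\<^sub>R v))"
  shows "((\<lambda>s. h (x + s *\<^sub>R v)) has_real_derivative dir_deriv v h (x + s *\<^sub>R v)) (at s)"
proof -
  have "((\<lambda>s. x + s *\<^sub>R v) has_derivative (\<lambda>s. s *\<^sub>R v)) (at s)"
    by (auto intro!: derivative_eq_intros)
  from has_derivative_compose[OF this has_derivative_dir_deriv[OF assms]]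
  have "((\<lambda>s. h (x + s *\<^sub>R v)) has_derivative (\<lambda>r. dir_deriv (r *\<^sub>R v) h (x + s *\<^sub>R v))) (at s)" .
  moreover have "dir_deriv (r *\<^sub>R v) h (x + s *\<^sub>R v) = r * dir_deriv v h (x + s *\<^sub>R v)" for r
    using linear_scale[OF dir_deriv_linear[OF assms]] by simp
  ultimately show ?thesis by (simp add: has_field_derivative_def mult_commute_abs)
qed

text \<open>The difference quotients of h along v have integral 0 by translation invariance and
  converge to the derivative. The mean value theorem dominates them by a constant on a compact
  set.\<close>

lemma integral_dir_deriv_eq_0:
  fixes h :: "'a::euclidean_space \<Rightarrow> real"
  assumes h: "\<And>x. h differentiable (at x)" and D: "continuous_on UNIV (dir_deriv v h)"
    and K: "compact (closure {x. h x \<noteq> 0})"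
  shows "(\<integral>x. dir_deriv v h x \<partial>lborel) = 0"
proof -
  define K where "K = closure {x. h x \<noteq> 0}"
  define t where "t n = 1 / (real n + 1)" for n
  define u where "u n x = (h (x + t n *\<^sub>R v) - h x) / t n" for n x
  have t: "0 < t n" "t n \<le> 1" for n by (auto simp: t_def)
  have hc: "continuous_on UNIV h"
    using h by (simp add: continuous_at_imp_continuous_on differentiable_imp_continuous_within)
  have cK: "compact K" using K by (simp add: K_def)
  have suppD: "dir_deriv v h x = 0" if "x \<notin> K" for x
    using dir_deriv_locally_zero that by (auto simp: K_def)
  obtain M where M: "0 < M" "\<And>x. \<bar>dir_deriv v h x\<bar> \<le> M"
  proof -
    have "bounded (dir_deriv v h ` K)"
      using cK D by (intro compact_imp_bounded compact_continuous_image) (auto intro: continuous_on_subset)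
    then obtain M where "0 < M" "\<And>x. x \<in> K \<Longrightarrow> \<bar>dir_deriv v h x\<bar> \<le> M"
      by (auto simp: bounded_pos)
    then show ?thesis using that[of M] suppD by (metis abs_zero less_eq_real_def)
  qed
  \<comment> \<open>The points from which some shift by s v with 0 \<le> s \<le> 1 reaches the
    support. All difference quotients with step at most 1 vanish outside this set.\<close>
  define K' where "K' = (\<lambda>(s, x). x - s *\<^sub>R v) ` ({0..1::real} \<times> K)"
  have cK': "compact K'" unfolding K'_def
    using cK by (intro compact_continuous_image compact_Times) (auto intro!: continuous_intros simp: case_prod_unfold)
  have u_bound: "\<bar>u n x\<bar> \<le> M * indicator K' x" for n x
  proof -
    define g where "g = (\<lambda>s. h (x + s *\<^sub>R v))"
    have g: "(g has_real_derivative dir_deriv v h (x + s *\<^sub>R v)) (at s)" for s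
      unfolding g_def by (rule has_real_derivative_line) (rule h)
    obtain s where s: "0 < s" "s < t n" "g (t n) - g 0 = (t n - 0) * dir_deriv v h (x + s *\<^sub>R v)"
      using MVT2[of 0 "t n" g "\<lambda>s. dir_deriv v h (x + s *\<^sub>R v)"] t[of n] g by blast
    have u: "u n x = dir_deriv v h (x + s *\<^sub>R v)" using s t[of n] by (simp add: u_def g_def)
    show ?thesis
    proof (cases "x + s *\<^sub>R v \<in> K")
      case True
      then have "x \<in> K'" unfolding K'_def using s t[of n]
        by (intro image_eqI[where x = "(s, x + s *\<^sub>R v)"]) auto
      then show ?thesis using M u by simp
    next
      case False
      then show ?thesis using suppD u M(1) by (simp add: indicator_def)
    qed
  qed
  have u_lim: "(\<lambda>n. u n x) \<longlonglongrightarrow> dir_deriv v h x" for x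
  proof -
    define g where "g = (\<lambda>s. h (x + s *\<^sub>R v))"
    have "(g has_real_derivative dir_deriv v h x) (at 0)"
      using has_real_derivative_line[of h x 0 v] h unfolding g_def by simp
    then have lim: "((\<lambda>s. (g s - g 0) / s) \<longlongrightarrow> dir_deriv v h x) (at 0)"
      by (simp add: has_field_derivative_iff)
    have "t \<longlonglongrightarrow> 0" unfolding t_def using LIMSEQ_inverse_real_of_nat by (simp add: inverse_eq_divide add.commute)
    moreover have "t n \<noteq> 0" for n using t(1)[of n] by simp
    ultimately have "filterlim t (at 0) sequentially" by (simp add: filterlim_at)
    from filterlim_compose[OF lim this] show ?thesis by (simp add: u_def g_def)
  qed
  have int_h: "integrable lborel h" using continuous_compact_support_integrable hc K by blast
  have u0: "(\<integral>x. u n x \<partial>lborel) = 0" for n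
  proof -
    have i: "integrable lborel (\<lambda>x. h (x + t n *\<^sub>R v))" "(\<integral>x. h (x + t n *\<^sub>R v) \<partial>lborel) = (\<integral>x. h x \<partial>lborel)"
    proof -
      have m: "h \<in> borel_measurable borel" using hc by (rule borel_measurable_continuous_onI)
      have "integrable (distr lborel borel ((+) (t n *\<^sub>R v))) h" using int_h by (simp add: lborel_distr_plus)
      then show "integrable lborel (\<lambda>x. h (x + t n *\<^sub>R v))"
        using m by (subst (asm) integrable_distr_eq) (auto simp: add.commute)
      have "(\<integral>x. h x \<partial>lborel) = (\<integral>x. h x \<partial>distr lborel borel ((+) (t n *\<^sub>R v)))"
        by (simp add: lborel_distr_plus)
      also have "\<dots> = (\<integral>x. h (x + t n *\<^sub>R v) \<partial>lborel)"
        using m by (subst integral_distr) (auto simp: add.commute)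
      finally show "(\<integral>x. h (x + t n *\<^sub>R v) \<partial>lborel) = (\<integral>x. h x \<partial>lborel)" by simp
    qed
    show ?thesis using i int_h by (simp add: u_def)
  qed
  have "(\<lambda>n. \<integral>x. u n x \<partial>lborel) \<longlonglongrightarrow> (\<integral>x. dir_deriv v h x \<partial>lborel)"
  proof (rule integral_dominated_convergence[where w = "\<lambda>x. M * indicator K' x"])
    show "dir_deriv v h \<in> borel_measurable lborel" using D borel_measurable_continuous_onI by auto
    show "u n \<in> borel_measurable lborel" for n
      using hc t(1)[of n] unfolding u_def
      by (auto intro!: borel_measurable_continuous_onI continuous_intros continuous_on_compose2[OF hc])
    show "integrable lborel (\<lambda>x. M * indicator K' x)"
      using cK' by (intro integrable_mult_right integrable_real_indicator)
        (use emeasure_bounded_finite[OF compact_imp_bounded[OF cK']] in \<open>auto simp: compact_imp_closed\<close>)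
  qed (use u_lim u_bound in auto)
  then show ?thesis using u0 by (simp add: LIMSEQ_const_iff)
qed

lemma integral_by_parts_dir_deriv:
  fixes f g :: "'a::euclidean_space \<Rightarrow> real"
  assumes f: "smooth f" and g: "smooth g" and K: "compact (closure {x. g x \<noteq> 0})"
  shows "(\<integral>x. f x * dir_deriv v g x \<partial>lborel) = - (\<integral>x. dir_deriv v f x * g x \<partial>lborel)"
proof -
  have d: "((\<lambda>x. f x * g x) has_derivative (\<lambda>v. f x * dir_deriv v g x + dir_deriv v f x * g x)) (at x)" for x
    by (intro has_derivative_mult has_derivative_dir_deriv smooth_differentiable f g)
  then have eq: "dir_deriv v (\<lambda>x. f x * g x) = (\<lambda>x. f x * dir_deriv v g x + dir_deriv v f x * g x)"
    using dir_deriv_eq by blast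
  have sub: "compact (closure {x. p x * q x \<noteq> 0})" if "closure {x. q x \<noteq> 0} \<subseteq> closure {x. g x \<noteq> 0}" for p q :: "'a \<Rightarrow> real"
  proof -
    have "closure {x. p x * q x \<noteq> 0} \<subseteq> closure {x. q x \<noteq> 0}" by (intro closure_mono) auto
    then show ?thesis using that K by (meson compact_closure_subset subset_trans)
  qed
  have c: "continuous_on UNIV f" "continuous_on UNIV g" "continuous_on UNIV (dir_deriv v f)" "continuous_on UNIV (dir_deriv v g)"
    using f g by (auto intro: smooth_continuous smooth_dir_deriv)
  have i: "integrable lborel (\<lambda>x. f x * dir_deriv v g x)" "integrable lborel (\<lambda>x. dir_deriv v f x * g x)"
    using c closure_support_dir_deriv[of v g]
    by (auto intro!: continuous_compact_support_integrable sub continuous_intros)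
  have "(\<integral>x. dir_deriv v (\<lambda>x. f x * g x) x \<partial>lborel) = 0"
  proof (rule integral_dir_deriv_eq_0)
    show "(\<lambda>x. f x * g x) differentiable (at x)" for x using d differentiableI by blast
    show "continuous_on UNIV (dir_deriv v (\<lambda>x. f x * g x))" unfolding eq using c by (intro continuous_intros)
    show "compact (closure {x. f x * g x \<noteq> 0})" by (rule sub) simp
  qed
  then show ?thesis using i by (simp add: eq)
qed

section \<open>Uniqueness of weak derivatives\<close>

text \<open>A product of one-dimensional bumps, positive exactly on the open box when c > 0. As c
  grows it tends to the indicator of the box.\<close>

definition box_bump :: "real \<Rightarrow> 'a::euclidean_space \<Rightarrow> 'a \<Rightarrow> 'a \<Rightarrow> real" where
  "box_bump c a b x = (\<Prod>i\<in>Basis. flat 1 (c * (x \<bullet> i - a \<bullet> i)) * flat 1 (c * (b \<bullet> i - x \<bullet> i)))"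

lemma flat_1_bounds: "0 \<le> flat 1 t" "flat 1 t \<le> 1"
  by (auto simp: flat_def)

lemma flat_alg_prod: "finite I \<Longrightarrow> (\<And>i. i \<in> I \<Longrightarrow> f i \<in> flat_alg) \<Longrightarrow> (\<lambda>x. \<Prod>i\<in>I. f i x) \<in> flat_alg"
  by (induction I rule: finite_induct) (auto intro: flat_alg.const flat_alg.mult)

lemma smooth_box_bump: "smooth (box_bump c a b)"
proof -
  have "(\<lambda>x. flat 1 (c * (x \<bullet> i - a \<bullet> i))) \<in> flat_alg" "(\<lambda>x. flat 1 (c * (b \<bullet> i - x \<bullet> i))) \<in> flat_alg" for i :: 'a
    using flat_alg.flat[of 1 "- c * (a \<bullet> i)" "c *\<^sub>R i"] flat_alg.flat[of 1 "c * (b \<bullet> i)" "- c *\<^sub>R i"]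
    by (simp_all add: algebra_simps)
  then have "(\<lambda>x. \<Prod>i\<in>Basis. flat 1 (c * (x \<bullet> i - a \<bullet> i)) * flat 1 (c * (b \<bullet> i - x \<bullet> i))) \<in> flat_alg"
    by (intro flat_alg_prod flat_alg.mult) auto
  then show ?thesis unfolding box_bump_def by (intro smooth_flat_alg)
qed

lemma box_bump_bounds: "0 \<le> box_bump c a b x" "box_bump c a b x \<le> 1"
  unfolding box_bump_def
  by (auto intro!: prod_nonneg prod_le_1 mult_nonneg_nonneg mult_le_one simp: flat_1_bounds)

lemma box_bump_eq_0:
  assumes "0 < c" "x \<notin> box a b"
  shows "box_bump c a b x = 0"
proof -
  obtain i where "i \<in> Basis" "x \<bullet> i \<le> a \<bullet> i \<or> b \<bullet> i \<le> x \<bullet> i"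
    using assms(2) by (auto simp: mem_box not_less)
  then show ?thesis unfolding box_bump_def using assms(1)
    by (intro prod_zero) (auto simp: flat_def zero_less_mult_iff intro!: bexI[of _ i])
qed

lemma box_bump_pos:
  assumes "0 < c" "x \<in> box a b"
  shows "0 < box_bump c a b x"
  unfolding box_bump_def using assms by (intro prod_pos) (auto simp: flat_def mem_box)

lemma closure_support_box_bump: "0 < c \<Longrightarrow> closure {x. box_bump c a b x \<noteq> 0} \<subseteq> cbox a b"
  using box_bump_eq_0[of c _ a b] box_subset_cbox[of a b] by (intro closure_minimal) auto

lemma test_fun_box_bump:
  assumes "0 < c" "cbox a b \<subseteq> U"
  shows "test_fun U (box_bump c a b)"
proof -
  have "compact (closure {x. box_bump c a b x \<noteq> 0})"
    using closure_support_box_bump[OF assms(1), of a b] compact_closure_subset[of "cbox a b"] by auto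
  then show ?thesis
    using assms closure_support_box_bump[OF assms(1), of a b] smooth_box_bump by (auto simp: test_fun_def)
qed

lemma box_bump_tendsto:
  "(\<lambda>n. box_bump (real (Suc n)) a b x) \<longlonglongrightarrow> indicator (box a b) x"
proof (cases "x \<in> box a b")
  case True
  have "(\<lambda>n. flat 1 (real (Suc n) * s)) \<longlonglongrightarrow> 1" if "0 < s" for s
  proof -
    have "(\<lambda>n. exp (- (1 / s * inverse (real (Suc n))))) \<longlonglongrightarrow> exp (- (1 / s * 0))"
      by (intro tendsto_intros LIMSEQ_inverse_real_of_nat)
    then show ?thesis using that by (simp add: flat_def divide_inverse mult.commute)
  qed
  then have "(\<lambda>n. box_bump (real (Suc n)) a b x) \<longlonglongrightarrow> (\<Prod>i\<in>(Basis :: 'a set). 1 * 1)"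
    unfolding box_bump_def using True by (intro tendsto_prod tendsto_mult) (auto simp: mem_box)
  then show ?thesis using True by simp
next
  case False
  then show ?thesis using box_bump_eq_0[of "real (Suc _)" x a b] by simp
qed

text \<open>The positive and negative parts of a Borel representative are densities of measures that
  agree on open boxes. Boxes form an intersection-stable generator of the Borel sets, so the
  measures coincide, and with them their densities.\<close>

lemma AE_eq_0_of_cbox_integrals:
  fixes f :: "'a::euclidean_space \<Rightarrow> real"
  assumes f: "integrable lebesgue f" and 0: "\<And>a b. (LINT x:cbox a b|lebesgue. f x) = 0"
  shows "AE x in lebesgue. f x = 0"
proof -
  have "f \<in> borel_measurable (completion lborel)" using f by auto
  then obtain g where g[measurable]: "g \<in> borel_measurable lborel" and fg: "AE x in lborel. f x = g x"
    using completion_ex_borel_measurable_real[of f lborel] by blast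
  have fg': "AE x in lebesgue. f x = g x" using fg by (rule AE_completion)
  have ig: "integrable lborel g"
  proof -
    have "integrable lebesgue g"
      using g by (intro integrable_cong_AE_imp[OF f _ fg'] measurable_completion)
    then show ?thesis using g by (simp add: integrable_completion)
  qed
  have box0: "(LINT x:cbox a b|lborel. g x) = 0" for a b
  proof -
    have "(LINT x:cbox a b|lebesgue. g x) = (LINT x:cbox a b|lebesgue. f x)"
      unfolding set_lebesgue_integral_def
    proof (rule integral_cong_AE)
      show "(\<lambda>x. indicat_real (cbox a b) x *\<^sub>R g x) \<in> borel_measurable lebesgue"
        using g by (intro borel_measurable_scaleR borel_measurable_indicator measurable_completion) auto
      show "(\<lambda>x. indicat_real (cbox a b) x *\<^sub>R f x) \<in> borel_measurable lebesgue"
        using f by (intro borel_measurable_scaleR borel_measurable_indicator borel_measurable_integrable) auto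
    qed (use fg' in auto)
    then show ?thesis using 0 unfolding set_lebesgue_integral_def
      by (simp add: integral_completion)
  qed
  \<comment> \<open>\<open>ennreal\<close> sends negative numbers to 0, so these are the densities
    given by the positive and the negative part of \<open>g\<close>.\<close>
  have "density lborel (\<lambda>x. ennreal (g x)) = density lborel (\<lambda>x. ennreal (- g x))"
  proof (rule measure_eqI_generator_eq[where E = "range (\<lambda>(a, b). box a b)" and \<Omega> = UNIV
        and A = "\<lambda>n::nat. box (- (real n *\<^sub>R One)) (real n *\<^sub>R One)"])
    show "Int_stable (range (\<lambda>(a, b). box a b :: 'a set))"
      by (auto simp: Int_stable_def box_Int_box)
    have fin: "(\<integral>\<^sup>+x. ennreal (s * g x) * indicator (box a b) x \<partial>lborel) < \<infinity>" if "s = 1 \<or> s = - 1" for a b s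
    proof -
      have "(\<integral>\<^sup>+x. ennreal (s * g x) * indicator (box a b) x \<partial>lborel) \<le> (\<integral>\<^sup>+x. ennreal (norm (g x)) \<partial>lborel)"
        using that by (intro nn_integral_mono) (auto simp: indicator_def intro!: ennreal_leI)
      then show ?thesis using ig by (auto simp: integrable_iff_bounded less_top[symmetric] top_unique)
    qed
    show "emeasure (density lborel (\<lambda>x. ennreal (g x))) X = emeasure (density lborel (\<lambda>x. ennreal (- g x))) X"
      if Xr: "X \<in> range (\<lambda>(a, b). box a b)" for X
    proof -
      obtain a b where X: "X = box a b" using Xr by auto
      \<comment> \<open>The hypothesis concerns closed boxes, the generator open ones; their
        difference is a null set.\<close>
      have bd: "AE x in lborel. x \<notin> cbox a b - box a b"
        using AE_not_in[of "cbox a b - box a b" lborel] negligible_frontier_interval[of a b]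
        by (simp add: negligible_iff_null_sets null_sets_completion_iff)
      define h where "h x = indicator (cbox a b) x * g x" for x
      have ih: "integrable lborel h" unfolding h_def using ig integrable_mult_indicator[of "cbox a b" lborel g] by simp
      have h0: "(\<integral>x. h x \<partial>lborel) = 0" using box0[of a b] by (simp add: h_def set_lebesgue_integral_def)
      have p: "(\<integral>\<^sup>+x. ennreal (g x) * indicator (box a b) x \<partial>lborel) = (\<integral>\<^sup>+x. ennreal (h x) \<partial>lborel)"
        by (intro nn_integral_cong_AE, use bd in eventually_elim) (use box_subset_cbox[of a b] in \<open>auto simp: h_def indicator_def\<close>)
      have m: "(\<integral>\<^sup>+x. ennreal (- g x) * indicator (box a b) x \<partial>lborel) = (\<integral>\<^sup>+x. ennreal (- h x) \<partial>lborel)"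
        by (intro nn_integral_cong_AE, use bd in eventually_elim) (use box_subset_cbox[of a b] in \<open>auto simp: h_def indicator_def\<close>)
      have "enn2real (\<integral>\<^sup>+x. ennreal (h x) \<partial>lborel) = enn2real (\<integral>\<^sup>+x. ennreal (- h x) \<partial>lborel)"
        using real_lebesgue_integral_def[OF ih] h0 by simp
      moreover have "(\<integral>\<^sup>+x. ennreal (h x) \<partial>lborel) < \<infinity>" "(\<integral>\<^sup>+x. ennreal (- h x) \<partial>lborel) < \<infinity>"
        using fin[of 1 a b] fin[of "-1" a b] p m by simp_all
      ultimately have "(\<integral>\<^sup>+x. ennreal (h x) \<partial>lborel) = (\<integral>\<^sup>+x. ennreal (- h x) \<partial>lborel)"
        by (metis ennreal_enn2real infinity_ennreal_def)
      then show ?thesis using p m by (simp add: X emeasure_density)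
    qed
    show "emeasure (density lborel (\<lambda>x. ennreal (g x))) (box (- (real n *\<^sub>R One)) (real n *\<^sub>R One)) \<noteq> \<infinity>" for n
      using fin[of 1 "- (real n *\<^sub>R One)" "real n *\<^sub>R One"] by (simp add: emeasure_density less_top)
    show "(\<Union>n::nat. box (- (real n *\<^sub>R One)) (real n *\<^sub>R One)) = (UNIV :: 'a set)"
      by (rule UN_box_eq_UNIV)
    have s: "sets borel = sigma_sets UNIV (range (\<lambda>(a, b). box a b :: 'a set))"
      by (subst borel_eq_box) simp
    show "sets (density lborel (\<lambda>x. ennreal (g x))) = sigma_sets UNIV (range (\<lambda>(a, b). box a b :: 'a set))"
      "sets (density lborel (\<lambda>x. ennreal (- g x))) = sigma_sets UNIV (range (\<lambda>(a, b). box a b :: 'a set))"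
      using s by simp_all
  qed auto
  then have "AE x in lborel. ennreal (g x) = ennreal (- g x)"
    by (subst (asm) sigma_finite_measure.density_unique_iff[OF lborel.sigma_finite_measure_axioms]) auto
  then have "AE x in lborel. f x = 0"
    using fg
  proof eventually_elim
    case (elim x)
    then have "g x = 0" by (cases "0 \<le> g x") (auto simp: ennreal_neg)
    then show ?case using elim by simp
  qed
  then show ?thesis by (rule AE_completion)
qed

text \<open>Bumps on a box inside \<open>U\<close> tend boundedly to its indicator, so dominated
  convergence gives integral 0 over every such box. Hence g vanishes almost everywhere on each of
  countably many boxes with union \<open>U\<close>.\<close>

lemma du_Bois_Reymond:
  fixes g :: "'a::euclidean_space \<Rightarrow> real"
  assumes U: "open U" and g: "locally_integrable U g"
    and 0: "\<And>\<psi>. test_fun U \<psi> \<Longrightarrow> (LINT x:U|lebesgue. g x * \<psi> x) = 0"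
  shows "AE x in lebesgue_on U. g x = 0"
proof -
  have cb: "(LINT x:cbox a b|lebesgue. g x) = 0" if sub: "cbox a b \<subseteq> U" for a b
  proof -
    have ig: "integrable lebesgue (\<lambda>x. indicator (cbox a b) x * g x)"
      using g sub by (auto simp: locally_integrable_def set_integrable_def)
    have "(\<lambda>n. \<integral>x. indicator (cbox a b) x * g x * box_bump (real (Suc n)) a b x \<partial>lebesgue)
        \<longlonglongrightarrow> (\<integral>x. indicator (cbox a b) x * g x * indicator (box a b) x \<partial>lebesgue)"
    proof (rule integral_dominated_convergence[where w = "\<lambda>x. norm (indicator (cbox a b) x * g x)"])
      have bm: "box_bump c a b \<in> borel_measurable lebesgue" for c
        using borel_measurable_continuous_onI[OF smooth_continuous[OF smooth_box_bump[of c a b]]]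
        by (intro measurable_completion) simp
      have im: "(\<lambda>x. indicator (cbox a b) x * g x) \<in> borel_measurable lebesgue" using ig by auto
      show "(\<lambda>x. indicator (cbox a b) x * g x * box_bump (real (Suc n)) a b x) \<in> borel_measurable lebesgue" for n
        by (rule borel_measurable_times[OF im bm])
      show "(\<lambda>x. indicator (cbox a b) x * g x * indicator (box a b) x) \<in> borel_measurable lebesgue"
        by (intro borel_measurable_times[OF im] borel_measurable_indicator) auto
      show "integrable lebesgue (\<lambda>x. norm (indicator (cbox a b) x * g x))" using ig by (rule integrable_norm)
      show "AE x in lebesgue. (\<lambda>n. indicator (cbox a b) x * g x * box_bump (real (Suc n)) a b x)
          \<longlonglongrightarrow> indicator (cbox a b) x * g x * indicator (box a b) x"
        by (intro AE_I2 tendsto_mult box_bump_tendsto tendsto_const)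
      show "AE x in lebesgue. norm (indicator (cbox a b) x * g x * box_bump (real (Suc n)) a b x)
          \<le> norm (indicator (cbox a b) x * g x)" for n
        using box_bump_bounds[of "real (Suc n)" a b]
        by (intro AE_I2) (simp add: abs_mult mult_left_le)
    qed
    moreover have "(\<integral>x. indicator (cbox a b) x * g x * box_bump (real (Suc n)) a b x \<partial>lebesgue) = 0" for n
    proof -
      have "(\<integral>x. indicator (cbox a b) x * g x * box_bump (real (Suc n)) a b x \<partial>lebesgue) =
          (LINT x:U|lebesgue. g x * box_bump (real (Suc n)) a b x)"
        unfolding set_lebesgue_integral_def
      proof (rule Bochner_Integration.integral_cong)
        fix x
        show "indicator (cbox a b) x * g x * box_bump (real (Suc n)) a b x =
            indicat_real U x *\<^sub>R (g x * box_bump (real (Suc n)) a b x)"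
          using sub box_bump_eq_0[of "real (Suc n)" x a b] box_subset_cbox[of a b]
          by (cases "x \<in> cbox a b") (auto simp: indicator_def)
      qed simp
      then show ?thesis using 0[OF test_fun_box_bump[OF _ sub, of "real (Suc n)"]] by simp
    qed
    ultimately have "(\<integral>x. indicator (cbox a b) x * g x * indicator (box a b) x \<partial>lebesgue) = 0"
      by (simp add: LIMSEQ_const_iff)
    moreover have "AE x in lebesgue. indicator (cbox a b) x * g x * indicator (box a b) x = indicator (cbox a b) x *\<^sub>R g x"
    proof -
      have "cbox a b - box a b \<in> null_sets lebesgue"
        using negligible_frontier_interval[of a b] by (simp add: negligible_iff_null_sets)
      from AE_not_in[OF this] show ?thesis by eventually_elim (auto simp: indicator_def)
    qed
    then have "(\<integral>x. indicator (cbox a b) x * g x * indicator (box a b) x \<partial>lebesgue) = (LINT x:cbox a b|lebesgue. g x)"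
      unfolding set_lebesgue_integral_def
      using integrable_mult_indicator[of "box a b" lebesgue, OF _ ig] ig
      by (intro integral_cong_AE) (auto simp: mult.commute)
    ultimately show ?thesis by simp
  qed
  have AE_cb: "AE x in lebesgue. x \<in> cbox a b \<longrightarrow> g x = 0" if sub: "cbox a b \<subseteq> U" for a b
  proof -
    have "AE x in lebesgue. indicator (cbox a b) x * g x = 0"
    proof (rule AE_eq_0_of_cbox_integrals)
      show "integrable lebesgue (\<lambda>x. indicator (cbox a b) x * g x)"
        using g sub by (auto simp: locally_integrable_def set_integrable_def)
      fix c d
      obtain e f where ef: "cbox a b \<inter> cbox c d = cbox e f" by (rule that[OF Int_interval])
      then have "cbox e f \<subseteq> U" using sub by blast
      then have "(LINT x:cbox e f|lebesgue. g x) = 0" by (rule cb)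
      moreover have "(LINT x:cbox c d|lebesgue. indicator (cbox a b) x * g x) = (LINT x:cbox e f|lebesgue. g x)"
        unfolding set_lebesgue_integral_def ef[symmetric]
        by (intro Bochner_Integration.integral_cong) (auto simp: indicator_def)
      ultimately show "(LINT x:cbox c d|lebesgue. indicator (cbox a b) x * g x) = 0" by simp
    qed
    then show ?thesis by eventually_elim auto
  qed
  obtain D where D: "countable D" "\<And>X. X \<in> D \<Longrightarrow> \<exists>a b. X = cbox a b" "\<Union>D = U"
    using open_countable_Union_open_cbox[OF U] by metis
  have "AE x in lebesgue. \<forall>X\<in>D. x \<in> X \<longrightarrow> g x = 0"
    using D AE_cb by (intro AE_ball_countable') (metis Union_upper, blast)
  then have "AE x in lebesgue. x \<in> U \<longrightarrow> g x = 0" using D(3) by (auto elim: eventually_mono)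
  then show ?thesis using U by (simp add: AE_restrict_space_iff)
qed

section \<open>Restriction and uniqueness of weak derivatives\<close>

lemma LINT_test_fun:
  assumes "test_fun U \<psi>" "U \<subseteq> V"
  shows "(LINT x:V|lebesgue. f x * \<psi> x) = (LINT x:U|lebesgue. f x * \<psi> x)"
  unfolding set_lebesgue_integral_def
  using assms test_fun_eq_0[OF assms(1)] by (intro Bochner_Integration.integral_cong) (auto simp: indicator_def)

lemma locally_integrable_mono: "locally_integrable V f \<Longrightarrow> U \<subseteq> V \<Longrightarrow> locally_integrable U f"
  by (auto simp: locally_integrable_def)

lemma weak_deriv_mono:
  assumes "weak_deriv V \<alpha> f g" "U \<subseteq> V"
  shows "weak_deriv U \<alpha> f g"
  unfolding weak_deriv_def
proof (intro conjI allI impI)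
  show "locally_integrable U f" "locally_integrable U g"
    using assms by (auto simp: weak_deriv_def intro: locally_integrable_mono)
  fix \<psi> vs assume *: "test_fun U \<psi> \<and> mset vs = \<alpha>"
  then have t: "test_fun U \<psi>" by simp
  have "(LINT x:V|lebesgue. f x * foldr dir_deriv vs \<psi> x) = (- 1) ^ size \<alpha> * (LINT x:V|lebesgue. g x * \<psi> x)"
    using assms * test_fun_mono[OF t assms(2)] by (auto simp: weak_deriv_def)
  then show "(LINT x:U|lebesgue. f x * foldr dir_deriv vs \<psi> x) = (- 1) ^ size \<alpha> * (LINT x:U|lebesgue. g x * \<psi> x)"
    by (simp add: LINT_test_fun[OF t assms(2)] LINT_test_fun[OF test_fun_foldr_dir_deriv[OF t] assms(2)])
qed

lemma weak_deriv_form_mono: "weak_deriv_form k V \<alpha> \<omega> \<eta> \<Longrightarrow> U \<subseteq> V \<Longrightarrow> weak_deriv_form k U \<alpha> \<omega> \<eta>"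
  unfolding weak_deriv_form_def using weak_deriv_mono by blast

lemma locally_integrable_test_fun:
  assumes g: "locally_integrable U g" and t: "test_fun U \<psi>"
  shows "set_integrable lebesgue U (\<lambda>x. g x * \<psi> x)"
proof -
  define K where "K = closure {x. \<psi> x \<noteq> 0}"
  have K: "compact K" "K \<subseteq> U" using t by (auto simp: test_fun_def K_def)
  have ig: "integrable lebesgue (\<lambda>x. indicator K x * g x)"
    using g K by (auto simp: locally_integrable_def set_integrable_def)
  have c: "continuous_on UNIV \<psi>" using t by (auto simp: test_fun_def intro: smooth_continuous)
  have "bounded (\<psi> ` K)"
    using K(1) c by (intro compact_imp_bounded compact_continuous_image) (auto intro: continuous_on_subset)
  then obtain M where M: "\<And>x. x \<in> K \<Longrightarrow> \<bar>\<psi> x\<bar> \<le> M" by (auto simp: bounded_iff)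
  have psi0: "\<psi> x = 0" if "x \<notin> K" for x
    using that closure_subset[of "{x. \<psi> x \<noteq> 0}"] by (auto simp: K_def)
  have "integrable lebesgue (\<lambda>x. (indicator K x * g x) * \<psi> x)"
  proof (rule Bochner_Integration.integrable_bound[OF integrable_mult_right[OF ig, of M]])
    have "\<psi> \<in> borel_measurable lebesgue"
      using borel_measurable_continuous_onI[OF c] by (intro measurable_completion) simp
    then show "(\<lambda>x. (indicator K x * g x) * \<psi> x) \<in> borel_measurable lebesgue"
      by (rule borel_measurable_times[OF borel_measurable_integrable[OF ig]])
    show "AE x in lebesgue. norm (indicator K x * g x * \<psi> x) \<le> norm (M * (indicator K x * g x))"
    proof (rule AE_I2)
      fix x
      show "norm (indicator K x * g x * \<psi> x) \<le> norm (M * (indicator K x * g x))"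
      proof (cases "x \<in> K")
        case True
        then have "\<bar>\<psi> x\<bar> \<le> \<bar>M\<bar>" using M[OF True] by linarith
        then show ?thesis using True by (simp add: abs_mult mult.commute mult_right_mono)
      qed simp
    qed
  qed
  moreover have "(\<lambda>x. (indicator K x * g x) * \<psi> x) = (\<lambda>x. indicat_real U x *\<^sub>R (g x * \<psi> x))"
    using psi0 K(2) by (auto simp: indicator_def fun_eq_iff)
  ultimately show ?thesis by (simp add: set_integrable_def)
qed

lemma weak_deriv_unique:
  assumes U: "open U" and g: "weak_deriv U \<alpha> f g" "weak_deriv U \<alpha> f h"
  shows "AE x in lebesgue_on U. g x = h x"
proof -
  have l: "locally_integrable U g" "locally_integrable U h" using g by (auto simp: weak_deriv_def)
  have "AE x in lebesgue_on U. g x - h x = 0"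
  proof (rule du_Bois_Reymond[OF U])
    show "locally_integrable U (\<lambda>x. g x - h x)"
      using l unfolding locally_integrable_def by (auto intro: set_integral_diff)
    fix \<psi> assume t: "test_fun U \<psi>"
    obtain vs where vs: "mset vs = \<alpha>" using ex_mset by blast
    have "(- 1) ^ size \<alpha> * (LINT x:U|lebesgue. g x * \<psi> x) = (- 1) ^ size \<alpha> * (LINT x:U|lebesgue. h x * \<psi> x)"
    proof -
      have "(LINT x:U|lebesgue. f x * foldr dir_deriv vs \<psi> x) = (- 1) ^ size \<alpha> * (LINT x:U|lebesgue. g x * \<psi> x)"
        using g(1) t vs by (simp add: weak_deriv_def)
      moreover have "(LINT x:U|lebesgue. f x * foldr dir_deriv vs \<psi> x) = (- 1) ^ size \<alpha> * (LINT x:U|lebesgue. h x * \<psi> x)"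
        using g(2) t vs by (simp add: weak_deriv_def)
      ultimately show ?thesis by simp
    qed
    then have "(LINT x:U|lebesgue. g x * \<psi> x) = (LINT x:U|lebesgue. h x * \<psi> x)" by simp
    then show "(LINT x:U|lebesgue. (g x - h x) * \<psi> x) = 0"
      using l t by (simp add: left_diff_distrib set_integral_diff locally_integrable_test_fun)
  qed
  then show ?thesis by (rule eventually_mono) simp
qed

lemma weak_deriv_form_pderiv_form:
  "weak_deriv_form k U \<alpha> \<omega> \<eta> \<Longrightarrow> weak_deriv_form k U \<alpha> \<omega> (pderiv_form k U \<alpha> \<omega>)"
  unfolding pderiv_form_def by (metis someI_ex)

lemma finite_Basis_lists: "finite {v. set v \<subseteq> (Basis :: 'a::euclidean_space set) \<and> length v = k}"
  using finite_lists_length_eq[of "Basis :: 'a set"] by simp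

lemma alt_norm_cong: "(\<And>v. set v \<subseteq> Basis \<Longrightarrow> length v = k \<Longrightarrow> A v = B v) \<Longrightarrow> alt_norm k A = alt_norm k B"
  unfolding alt_norm_def by (intro arg_cong[where f = sqrt] arg_cong2[where f = "(/)"] sum.cong) auto

lemma AE_Basis_lists:
  fixes P :: "'b \<Rightarrow> 'a::euclidean_space list \<Rightarrow> bool"
  assumes "\<And>v. AE x in M. P x v"
  shows "AE x in M. \<forall>v. set v \<subseteq> Basis \<and> length v = k \<longrightarrow> P x v"
proof -
  have "AE x in M. \<forall>v\<in>{v. set v \<subseteq> Basis \<and> length v = k}. P x v"
    using assms by (intro AE_finite_allI finite_Basis_lists)
  then show ?thesis by simp
qed

lemma negligible_Times_UNIV:
  fixes N :: "'a::euclidean_space set"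
  assumes "negligible N"
  shows "negligible (N \<times> (UNIV :: 'b::euclidean_space set))" "negligible ((UNIV :: 'b set) \<times> N)"
proof -
  obtain N' where N': "N' \<in> null_sets lborel" "N \<subseteq> N'"
    using assms by (metis negligible_iff_null_sets null_sets_completion_iff2)
  have b: "N' \<in> sets borel" "emeasure lborel N' = 0" using N'(1) by auto
  have "emeasure lborel (N' \<times> (UNIV :: 'b set)) = 0"
    using b by (subst lborel_prod[symmetric]) (simp add: lborel.emeasure_pair_measure_Times)
  moreover have "N' \<times> (UNIV :: 'b set) \<in> sets borel" using b by (simp add: borel_prod[symmetric])
  ultimately have "negligible (N' \<times> (UNIV :: 'b set))"
    by (simp add: negligible_iff_null_sets null_sets_completionI null_setsI)
  then show "negligible (N \<times> (UNIV :: 'b set))" by (rule negligible_subset) (use N' in auto)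
  have "emeasure lborel ((UNIV :: 'b set) \<times> N') = 0"
    using b by (subst lborel_prod[symmetric]) (simp add: lborel.emeasure_pair_measure_Times)
  moreover have "(UNIV :: 'b set) \<times> N' \<in> sets borel" using b by (simp add: borel_prod[symmetric])
  ultimately have "negligible ((UNIV :: 'b set) \<times> N')"
    by (simp add: negligible_iff_null_sets null_sets_completionI null_setsI)
  then show "negligible ((UNIV :: 'b set) \<times> N)" by (rule negligible_subset) (use N' in auto)
qed

text \<open>In a Slobodeckij quotient an equality almost everywhere has to hold in both variables at
  once; the exceptional points lie in two cylinders over a null set.\<close>

lemma AE_lebesgue_on_Times:
  fixes U :: "'a::euclidean_space set"
  assumes U: "open U" and P: "AE x in lebesgue_on U. P x"
  shows "AE z in lebesgue_on (U \<times> U). P (fst z) \<and> P (snd z)"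
proof -
  define N where "N = {x\<in>U. \<not> P x}"
  have "AE x in lebesgue. x \<notin> N" using P U by (simp add: AE_restrict_space_iff N_def)
  then have "negligible N"
    by (simp add: negligible_iff_null_sets completion.AE_iff_null_sets)
  note null = negligible_Times_UNIV[OF this, where ?'b = 'a, unfolded negligible_iff_null_sets]
  from AE_not_in[OF null(1)] AE_not_in[OF null(2)]
  have "AE z in lebesgue. z \<in> U \<times> U \<longrightarrow> P (fst z) \<and> P (snd z)"
    by eventually_elim (auto simp: N_def)
  moreover have "U \<times> U \<inter> space lebesgue \<in> sets lebesgue" using U by (simp add: open_Times)
  ultimately show ?thesis by (simp only: AE_restrict_space_iff)
qed

text \<open>The representatives that \<open>pderiv_form\<close> selects on \<open>U\<close> and on
  \<open>V\<close> are unrelated choices. A weak derivative on \<open>V\<close> restricts to one on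
  \<open>U\<close>, and by uniqueness the two agree almost everywhere on \<open>U\<close>. Existence
  on \<open>V\<close> is assumed because otherwise the selected form carries no information.\<close>

lemma sobolev_seminorm_mono:
  fixes U V :: "'a::euclidean_space set"
  assumes p: "1 \<le> p" and UV: "open U" "open V" "U \<subseteq> V"
    and ex: "\<And>\<alpha>. \<alpha> \<in> multi_indices (nat \<lfloor>s\<rfloor>) \<Longrightarrow> \<exists>\<eta>. weak_deriv_form k V \<alpha> \<omega> \<eta>"
  shows "sobolev_seminorm s p k U \<omega> \<le> sobolev_seminorm s p k V \<omega>"
  unfolding sobolev_seminorm_def
proof (rule sum_mono)
  fix \<alpha> :: "'a multiset" assume "\<alpha> \<in> multi_indices (nat \<lfloor>s\<rfloor>)"
  then obtain \<eta> where \<eta>: "weak_deriv_form k V \<alpha> \<omega> \<eta>" using ex by blast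
  define \<eta>U \<eta>V where "\<eta>U = pderiv_form k U \<alpha> \<omega>" "\<eta>V = pderiv_form k V \<alpha> \<omega>"
  have "weak_deriv_form k V \<alpha> \<omega> \<eta>V" "weak_deriv_form k U \<alpha> \<omega> \<eta>U"
    unfolding \<eta>U_\<eta>V_def using \<eta> weak_deriv_form_mono[OF \<eta> UV(3)] by (auto intro: weak_deriv_form_pderiv_form)
  then have "AE x in lebesgue_on U. \<eta>U x v = \<eta>V x v" for v
    using weak_deriv_unique[OF UV(1)] weak_deriv_form_mono[OF _ UV(3)] unfolding weak_deriv_form_def
    by (metis weak_deriv_mono UV(3))
  then have AE: "AE x in lebesgue_on U. \<forall>v. set v \<subseteq> Basis \<and> length v = k \<longrightarrow> \<eta>U x v = \<eta>V x v"
    by (rule AE_Basis_lists)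
  have "AE x in lebesgue_on U. alt_norm k (\<eta>U x) = alt_norm k (\<eta>V x)"
    using AE by eventually_elim (auto intro: alt_norm_cong)
  then have 1: "Lp_norm p k U \<eta>U \<le> Lp_norm p k V \<eta>V"
    unfolding Lp_norm_eq_lpnorm using UV p by (intro lpnorm_le_AE_eq) auto
  have "AE z in lebesgue_on (U \<times> U).
      alt_norm k (\<eta>U (fst z) - \<eta>U (snd z)) = alt_norm k (\<eta>V (fst z) - \<eta>V (snd z))"
    using AE_lebesgue_on_Times[OF UV(1) AE] by eventually_elim (auto intro: alt_norm_cong)
  then have 2: "slobodeckij (frac s) p k U \<eta>U \<le> slobodeckij (frac s) p k V \<eta>V"
    unfolding slobodeckij_eq_lpnorm[OF p] case_prod_unfold
    using UV p by (intro lpnorm_le_AE_eq) (auto simp: open_Times elim: eventually_mono)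
  show "(if frac s = 0 then Lp_norm p k U (pderiv_form k U \<alpha> \<omega>) else slobodeckij (frac s) p k U (pderiv_form k U \<alpha> \<omega>))
      \<le> (if frac s = 0 then Lp_norm p k V (pderiv_form k V \<alpha> \<omega>) else slobodeckij (frac s) p k V (pderiv_form k V \<alpha> \<omega>))"
    using 1 2 by (simp add: \<eta>U_\<eta>V_def)
qed

section \<open>Polynomial forms\<close>

definition monom_fun :: "'a::euclidean_space multiset \<Rightarrow> 'a \<Rightarrow> real" where
  "monom_fun \<alpha> x = (\<Prod>b\<in>#\<alpha>. x \<bullet> b)"

lemma polys_eq: "polys r = span {monom_fun \<alpha> | \<alpha>. set_mset \<alpha> \<subseteq> Basis \<and> int (size \<alpha>) \<le> r}"
  by (simp add: polys_def monom_fun_def[abs_def])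

lemma polys_monom: "set_mset \<alpha> \<subseteq> Basis \<Longrightarrow> int (size \<alpha>) \<le> r \<Longrightarrow> monom_fun \<alpha> \<in> polys r"
  unfolding polys_eq by (intro span_base) auto

lemma polys_0: "(\<lambda>_. 0) \<in> polys r"
  using span_zero[of "{monom_fun \<alpha> | \<alpha>. set_mset \<alpha> \<subseteq> Basis \<and> int (size \<alpha>) \<le> r}"]
  unfolding polys_eq zero_fun_def .

lemma polys_add: "f \<in> polys r \<Longrightarrow> g \<in> polys r \<Longrightarrow> (\<lambda>x. f x + g x) \<in> polys r"
  using span_add[of f _ g] unfolding polys_eq plus_fun_def .

lemma polys_cmult: "f \<in> polys r \<Longrightarrow> (\<lambda>x. c * f x) \<in> polys r"
  using span_scale[of f _ c] unfolding polys_eq scaleR_fun_def by simp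

lemma polys_diff: "f \<in> polys r \<Longrightarrow> g \<in> polys r \<Longrightarrow> (\<lambda>x. f x - g x) \<in> polys r"
  using polys_add[of f r "\<lambda>x. - 1 * g x"] polys_cmult[of g r "- 1"] by simp

lemma polys_sum: "(\<And>i. i \<in> I \<Longrightarrow> f i \<in> polys r) \<Longrightarrow> (\<lambda>x. \<Sum>i\<in>I. f i x) \<in> polys r"
  by (induction I rule: infinite_finite_induct) (auto intro: polys_0 polys_add)

lemma polys_mono: "r \<le> s \<Longrightarrow> f \<in> polys r \<Longrightarrow> f \<in> polys s"
  unfolding polys_eq by (rule subsetD[OF span_mono]) auto

lemma polys_const: "0 \<le> r \<Longrightarrow> (\<lambda>_. c) \<in> polys r"
  using polys_cmult[OF polys_monom[of "{#}" r], of c] by (simp add: monom_fun_def)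

lemma polys_induct [consumes 1, case_names zero step]:
  assumes "f \<in> polys r" "P (\<lambda>_. 0)"
    and "\<And>c \<alpha> g. set_mset \<alpha> \<subseteq> Basis \<Longrightarrow> int (size \<alpha>) \<le> r \<Longrightarrow> g \<in> polys r \<Longrightarrow> P g \<Longrightarrow>
      P (\<lambda>x. c * monom_fun \<alpha> x + g x)"
  shows "P f"
proof -
  have "f \<in> polys r \<and> P f"
    using assms(1) unfolding polys_eq
  proof (induction rule: span_induct_alt)
    case base
    show ?case using polys_0[of r] assms(2) by (simp add: zero_fun_def polys_eq)
  next
    case (step c h g)
    then obtain \<alpha> where \<alpha>: "set_mset \<alpha> \<subseteq> Basis" "int (size \<alpha>) \<le> r" "h = monom_fun \<alpha>" by blast
    have e: "c *\<^sub>R h + g = (\<lambda>x. c * monom_fun \<alpha> x + g x)"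
      by (simp add: \<alpha>(3) fun_eq_iff plus_fun_def scaleR_fun_def)
    show ?case
      using assms(3)[OF \<alpha>(1,2)] step \<alpha> unfolding e
      using polys_add[OF polys_cmult[OF polys_monom[OF \<alpha>(1,2)]]] by (auto simp: polys_eq)
  qed
  then show ?thesis by simp
qed

lemma polys_zero_const:
  assumes "f \<in> polys 0"
  shows "f x = f y"
  using assms by (induction rule: polys_induct) (auto simp: monom_fun_def)

lemma monom_fun_add: "monom_fun (add_mset b \<alpha>) x = (x \<bullet> b) * monom_fun \<alpha> x"
  by (simp add: monom_fun_def)

lemma polys_mult:
  assumes "f \<in> polys r" "g \<in> polys s"
  shows "(\<lambda>x. f x * g x) \<in> polys (r + s)"
proof -
  have m: "(\<lambda>x. monom_fun \<alpha> x * g x) \<in> polys (r + s)" if a: "set_mset \<alpha> \<subseteq> Basis" "int (size \<alpha>) \<le> r" for \<alpha>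
    using assms(2)
  proof (induction rule: polys_induct)
    case (step c \<beta> h)
    have "monom_fun (\<alpha> + \<beta>) \<in> polys (r + s)" using a step by (intro polys_monom) auto
    then have "(\<lambda>x. c * monom_fun (\<alpha> + \<beta>) x + monom_fun \<alpha> x * h x) \<in> polys (r + s)"
      by (intro polys_add polys_cmult step)
    then show ?case by (simp add: monom_fun_def algebra_simps)
  qed (simp add: polys_0)
  show ?thesis using assms(1)
  proof (induction rule: polys_induct)
    case (step c \<alpha> h)
    have "(\<lambda>x. c * (monom_fun \<alpha> x * g x) + h x * g x) \<in> polys (r + s)"
      by (intro polys_add polys_cmult m step)
    then show ?case by (simp add: algebra_simps)
  qed (simp add: polys_0)
qed

lemma polys_inner: "(\<lambda>x. x \<bullet> w) \<in> polys 1"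
proof -
  have "monom_fun {#b#} \<in> polys 1" if "b \<in> Basis" for b using that by (intro polys_monom) auto
  then have "(\<lambda>x. \<Sum>b\<in>Basis. (w \<bullet> b) * monom_fun {#b#} x) \<in> polys 1"
    by (intro polys_sum polys_cmult) auto
  moreover have "(\<lambda>x. \<Sum>b\<in>Basis. (w \<bullet> b) * monom_fun {#b#} x) = (\<lambda>x. x \<bullet> w)"
    by (simp add: monom_fun_def fun_eq_iff euclidean_inner[of _ w] mult.commute)
  ultimately show ?thesis by simp
qed

lemma polys_affine:
  fixes L :: "'a::euclidean_space \<Rightarrow> 'a"
  assumes "linear L"
  shows "(\<lambda>x. L (x - x0) \<bullet> b) \<in> polys 1"
proof -
  have "L (x - x0) \<bullet> b = x \<bullet> adjoint L b - L x0 \<bullet> b" for x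
    using adjoint_works[OF assms] assms by (simp add: linear_diff inner_diff_left)
  then show ?thesis using polys_diff[OF polys_inner[of "adjoint L b"] polys_const[of 1 "L x0 \<bullet> b"]] by simp
qed

lemma polys_prod_list:
  assumes "\<And>f. f \<in> set fs \<Longrightarrow> f \<in> polys 1"
  shows "(\<lambda>x. \<Prod>f\<leftarrow>fs. f x) \<in> polys (int (length fs))"
  using assms
proof (induction fs)
  case (Cons f fs)
  then show ?case using polys_mult[of f 1 "\<lambda>x. \<Prod>f\<leftarrow>fs. f x" "int (length fs)"] by simp
qed (simp add: polys_const)

lemma monom_fun_has_derivative:
  assumes "set_mset \<alpha> \<subseteq> Basis"
  shows "\<exists>D. (\<forall>x. (monom_fun \<alpha> has_derivative D x) (at x)) \<and>
    (\<forall>v. (\<lambda>x. D x v) \<in> polys (int (size \<alpha>) - 1)) \<and> (\<forall>x. D x x = size \<alpha> * monom_fun \<alpha> x)"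
  using assms
proof (induction \<alpha>)
  case empty
  show ?case by (intro exI[of _ "\<lambda>_ _. 0"]) (auto simp: monom_fun_def polys_0)
next
  case (add b \<alpha>)
  then obtain D where D: "\<And>x. (monom_fun \<alpha> has_derivative D x) (at x)"
    "\<And>v. (\<lambda>x. D x v) \<in> polys (int (size \<alpha>) - 1)" "\<And>x. D x x = size \<alpha> * monom_fun \<alpha> x" by auto
  have "monom_fun (add_mset b \<alpha>) = (\<lambda>x. (x \<bullet> b) * monom_fun \<alpha> x)" by (simp add: monom_fun_add fun_eq_iff)
  moreover have "((\<lambda>x. (x \<bullet> b) * monom_fun \<alpha> x) has_derivative
      (\<lambda>v. (x \<bullet> b) * D x v + (v \<bullet> b) * monom_fun \<alpha> x)) (at x)" for x
    by (intro has_derivative_mult D has_derivative_inner_left has_derivative_ident)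
  moreover have "(\<lambda>x. (x \<bullet> b) * D x v + (v \<bullet> b) * monom_fun \<alpha> x) \<in> polys (int (size \<alpha>))" for v
    using polys_mult[OF polys_inner D(2), of b v] add.prems
    by (intro polys_add polys_cmult polys_monom) auto
  ultimately show ?case
    by (intro exI[of _ "\<lambda>x v. (x \<bullet> b) * D x v + (v \<bullet> b) * monom_fun \<alpha> x"])
      (simp add: D(3) monom_fun_add algebra_simps)
qed

text \<open>The last conjunct is Euler's identity up to lower order: r f minus the derivative of f
  at x in direction x has no part of degree r, because a monomial of degree d is multiplied by r -
  d.\<close>

lemma polys_has_derivative:
  assumes "f \<in> polys r"
  shows "\<exists>D. (\<forall>x. (f has_derivative D x) (at x)) \<and> (\<forall>v. (\<lambda>x. D x v) \<in> polys (r - 1)) \<and>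
    (\<lambda>x. r * f x - D x x) \<in> polys (r - 1)"
  using assms
proof (induction rule: polys_induct)
  case zero
  show ?case by (intro exI[of _ "\<lambda>_ _. 0"]) (auto simp: polys_0)
next
  case (step c \<alpha> g)
  obtain D where D: "\<And>x. (monom_fun \<alpha> has_derivative D x) (at x)"
    "\<And>v. (\<lambda>x. D x v) \<in> polys (int (size \<alpha>) - 1)" "\<And>x. D x x = size \<alpha> * monom_fun \<alpha> x"
    using monom_fun_has_derivative[OF step(1)] by blast
  obtain E where E: "\<And>x. (g has_derivative E x) (at x)" "\<And>v. (\<lambda>x. E x v) \<in> polys (r - 1)"
    "(\<lambda>x. r * g x - E x x) \<in> polys (r - 1)" using step by blast
  have "((\<lambda>x. c * monom_fun \<alpha> x + g x) has_derivative (\<lambda>v. c * D x v + E x v)) (at x)" for x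
    by (intro has_derivative_add has_derivative_mult_right D E)
  moreover have "(\<lambda>x. c * D x v + E x v) \<in> polys (r - 1)" for v
    using step(2) by (intro polys_add polys_cmult E polys_mono[OF _ D(2)]) auto
  moreover have "(\<lambda>x. (c * (r - size \<alpha>)) * monom_fun \<alpha> x) \<in> polys (r - 1)"
  proof (cases "r = int (size \<alpha>)")
    case False
    then show ?thesis using step by (intro polys_cmult polys_monom) auto
  qed (simp add: polys_0)
  then have "(\<lambda>x. (c * (r - size \<alpha>)) * monom_fun \<alpha> x + (r * g x - E x x)) \<in> polys (r - 1)"
    by (intro polys_add E)
  then have "(\<lambda>x. r * (c * monom_fun \<alpha> x + g x) - (c * D x x + E x x)) \<in> polys (r - 1)"
    by (simp add: D(3) algebra_simps)
  ultimately show ?case by (intro exI[of _ "\<lambda>x v. c * D x v + E x v"]) simp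
qed

lemma
  assumes "f \<in> polys r"
  shows polys_differentiable: "f differentiable (at x)"
    and polys_dir_deriv: "dir_deriv v f \<in> polys (r - 1)"
    and polys_Euler: "(\<lambda>x. r * f x - dir_deriv x f x) \<in> polys (r - 1)"
proof -
  obtain D where D: "\<And>x. (f has_derivative D x) (at x)" "\<And>v. (\<lambda>x. D x v) \<in> polys (r - 1)"
    "(\<lambda>x. r * f x - D x x) \<in> polys (r - 1)" using polys_has_derivative[OF assms] by blast
  have eq: "dir_deriv v f = (\<lambda>x. D x v)" for v using dir_deriv_eq[OF D(1)] by blast
  show "dir_deriv v f \<in> polys (r - 1)" "(\<lambda>x. r * f x - dir_deriv x f x) \<in> polys (r - 1)"
    using D(2,3) by (simp_all add: eq)
  show "f differentiable (at x)" using D(1) by (rule differentiableI)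
qed

lemma polys_foldr_dir_deriv:
  "f \<in> polys r \<Longrightarrow> foldr dir_deriv vs f \<in> polys (r - int (length vs))"
proof (induction vs)
  case (Cons v vs)
  then show ?case using polys_dir_deriv[of "foldr dir_deriv vs f" "r - int (length vs)" v]
    by (simp add: algebra_simps)
qed simp

lemma polys_smooth: "f \<in> polys r \<Longrightarrow> smooth f"
  unfolding smooth_def using polys_foldr_dir_deriv polys_differentiable by blast

lemma polys_continuous: "f \<in> polys r \<Longrightarrow> continuous_on S f"
  by (meson polys_smooth smooth_continuous)

lemma polys_on_line:
  assumes "f \<in> polys r"
  shows "\<exists>p. \<forall>t. f (x + t *\<^sub>R w) = poly p t"
  using assms
proof (induction rule: polys_induct)
  case (step c \<alpha> g)
  have "\<exists>p. \<forall>t. monom_fun \<alpha> (x + t *\<^sub>R w) = poly p t"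
  proof (induction \<alpha>)
    case empty
    show ?case by (intro exI[of _ 1]) (simp add: monom_fun_def)
  next
    case (add b \<alpha>)
    then obtain p where "\<And>t. monom_fun \<alpha> (x + t *\<^sub>R w) = poly p t" by blast
    then show ?case
      by (intro exI[of _ "[:x \<bullet> b, w \<bullet> b:] * p"]) (simp add: monom_fun_add algebra_simps)
  qed
  then obtain p q where "\<And>t. monom_fun \<alpha> (x + t *\<^sub>R w) = poly p t" "\<And>t. g (x + t *\<^sub>R w) = poly q t"
    using step by blast
  then show ?case by (intro exI[of _ "smult c p + q"]) simp
qed (auto intro: exI[of _ 0])

text \<open>On the line from a point y of \<open>S\<close> to x the polynomial depends on one
  variable and vanishes for all small positive parameters, hence identically.\<close>

lemma polys_eq_0_open:
  assumes f: "f \<in> polys r" and S: "open S" "S \<noteq> {}" "\<And>x. x \<in> S \<Longrightarrow> f x = 0"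
  shows "f x = 0"
proof -
  obtain y where y: "y \<in> S" using S by blast
  obtain e where e: "0 < e" "ball y e \<subseteq> S" using S(1) y openE by blast
  obtain p where p: "\<And>t. f (y + t *\<^sub>R (x - y)) = poly p t" using polys_on_line[OF f] by blast
  \<comment> \<open>The summand 1 keeps the denominator positive when x = y.\<close>
  define d where "d = e / (norm (x - y) + 1)"
  have d: "0 < d" using e(1) by (simp add: d_def add_nonneg_pos)
  have "poly p t = 0" if "t \<in> {0<..<d}" for t
  proof -
    have "norm (t *\<^sub>R (x - y)) \<le> t * (norm (x - y) + 1)" using that by simp
    also have "\<dots> < d * (norm (x - y) + 1)" using that by (intro mult_strict_right_mono) (auto simp: add_nonneg_pos)
    also have "\<dots> = e" by (simp add: d_def add_nonneg_eq_0_iff)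
    finally have "y + t *\<^sub>R (x - y) \<in> ball y e" by (simp add: dist_norm)
    then show ?thesis using e(2) S(3) p by fastforce
  qed
  then have "{0<..<d} \<subseteq> {t. poly p t = 0}" by blast
  moreover have "infinite {0<..<d}" using d infinite_Ioo by blast
  ultimately have "p = 0" using poly_roots_finite[of p] finite_subset by blast
  then show ?thesis using p[of 1] by simp
qed

lemma AE_eq_0_imp_open:
  fixes f :: "'a::euclidean_space \<Rightarrow> real"
  assumes "continuous_on UNIV f" "open S" "AE x in lebesgue_on S. f x = 0" "x \<in> S"
  shows "f x = 0"
proof (rule ccontr)
  assume "f x \<noteq> 0"
  define W where "W = S \<inter> {x. f x \<noteq> 0}"
  have W: "open W" "x \<in> W"
    using assms \<open>f x \<noteq> 0\<close> open_Collect_neq[of f "\<lambda>_. 0"] by (auto simp: W_def)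
  have "AE x in lebesgue. x \<notin> W" using assms by (auto simp: AE_restrict_space_iff W_def elim: eventually_mono)
  then have "negligible W" by (simp add: negligible_iff_null_sets completion.AE_iff_null_sets)
  then show False using W open_not_negligible by blast
qed

lemma polys_eq_AE:
  assumes f: "f \<in> polys r" and g: "g \<in> polys s" and T: "interior T \<noteq> {}" "T \<in> sets lebesgue"
    and eq: "AE x in lebesgue_on T. f x = g x"
  shows "f = g"
proof
  fix x
  let ?h = "\<lambda>x. f x - g x"
  have h: "?h \<in> polys (max r s)" by (intro polys_diff polys_mono[OF _ f] polys_mono[OF _ g]) auto
  have "AE x in lebesgue_on (interior T). ?h x = 0"
    using eq T(2) interior_subset[of T] by (auto simp: AE_restrict_space_iff elim: eventually_mono)
  then have "?h x = 0" if "x \<in> interior T" for x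
    using AE_eq_0_imp_open[OF polys_continuous[OF h]] that by blast
  then have "?h x = 0" using T polys_eq_0_open[OF h open_interior] by blast
  then show "f x = g x" by simp
qed

section \<open>Alternating forms and polynomial forms\<close>

lemma alt_forms_0: "(\<lambda>_. 0) \<in> alt_forms k"
  by (simp add: alt_forms_def linear_zero)

lemma alt_forms_add: "A \<in> alt_forms k \<Longrightarrow> B \<in> alt_forms k \<Longrightarrow> (\<lambda>v. A v + B v) \<in> alt_forms k"
  by (simp add: alt_forms_def linear_compose_add)

lemma linear_cmult_real: "linear f \<Longrightarrow> linear (\<lambda>x. c * f x :: real)"
  by (simp add: linear_iff algebra_simps)

lemma alt_forms_cmult: "A \<in> alt_forms k \<Longrightarrow> (\<lambda>v. c * A v) \<in> alt_forms k"
  by (simp add: alt_forms_def linear_cmult_real)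

lemma alt_forms_diff: "A \<in> alt_forms k \<Longrightarrow> B \<in> alt_forms k \<Longrightarrow> (\<lambda>v. A v - B v) \<in> alt_forms k"
  using alt_forms_add[of A k "\<lambda>v. - 1 * B v"] alt_forms_cmult[of B k "- 1"] by simp

lemma alt_forms_sum: "(\<And>i. i \<in> I \<Longrightarrow> A i \<in> alt_forms k) \<Longrightarrow> (\<lambda>v. \<Sum>i\<in>I. A i v) \<in> alt_forms k"
  by (induction I rule: infinite_finite_induct) (auto intro: alt_forms_0 alt_forms_add)

lemma alt_forms_length: "A \<in> alt_forms k \<Longrightarrow> int (length v) \<noteq> k \<Longrightarrow> A v = 0"
  by (simp add: alt_forms_def)

lemma poly_forms_alt: "\<omega> \<in> poly_forms r k \<Longrightarrow> \<omega> x \<in> alt_forms k"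
  and poly_forms_polys: "\<omega> \<in> poly_forms r k \<Longrightarrow> (\<lambda>x. \<omega> x v) \<in> polys r"
  by (auto simp: poly_forms_def)

lemma poly_forms_0: "0 \<in> poly_forms r k"
  by (auto simp: poly_forms_def zero_fun_def polys_0 alt_forms_0)

lemma poly_forms_add: "\<omega> \<in> poly_forms r k \<Longrightarrow> \<eta> \<in> poly_forms r k \<Longrightarrow> \<omega> + \<eta> \<in> poly_forms r k"
  by (auto simp: poly_forms_def plus_fun_def polys_add alt_forms_add)

lemma poly_forms_scaleR: "\<omega> \<in> poly_forms r k \<Longrightarrow> c *\<^sub>R \<omega> \<in> poly_forms r k"
  by (auto simp: poly_forms_def scaleR_fun_def polys_cmult alt_forms_cmult)

lemma poly_forms_diff: "\<omega> \<in> poly_forms r k \<Longrightarrow> \<eta> \<in> poly_forms r k \<Longrightarrow> \<omega> - \<eta> \<in> poly_forms r k"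
  by (auto simp: poly_forms_def fun_diff_def polys_diff alt_forms_diff)

lemma poly_forms_mono: "r \<le> s \<Longrightarrow> \<omega> \<in> poly_forms r k \<Longrightarrow> \<omega> \<in> poly_forms s k"
  by (auto simp: poly_forms_def intro: polys_mono)

lemma poly_forms_eq_AE:
  assumes "\<omega> \<in> poly_forms r k" "\<eta> \<in> poly_forms s k" "interior T \<noteq> {}" "T \<in> sets lebesgue"
    "AE x in lebesgue_on T. \<omega> x = \<eta> x"
  shows "\<omega> = \<eta>"
proof (intro ext)
  fix x v
  have "AE x in lebesgue_on T. \<omega> x v = \<eta> x v" using assms(5) by (auto elim: eventually_mono)
  then have "(\<lambda>x. \<omega> x v) = (\<lambda>x. \<eta> x v)"
    using assms by (intro polys_eq_AE[where T = T]) (auto intro: poly_forms_polys)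
  then show "\<omega> x v = \<eta> x v" by meson
qed

lemma alt_forms_linear_Cons:
  assumes "A \<in> alt_forms k" "int (length v) + 1 = k"
  shows "linear (\<lambda>x. A (x # v))"
proof -
  have "linear (\<lambda>x. A ((0 # v)[0 := x]))"
    using assms unfolding alt_forms_def by (simp add: add.commute del: list_update_code list_update.simps)
  then show ?thesis by simp
qed

lemma linear_Basis_expansion:
  fixes f :: "'a::euclidean_space \<Rightarrow> real"
  assumes "linear f"
  shows "f x = (\<Sum>b\<in>Basis. (x \<bullet> b) * f b)"
proof -
  have "f x = f (\<Sum>b\<in>Basis. (x \<bullet> b) *\<^sub>R b)" by (simp add: euclidean_representation)
  then show ?thesis using assms by (simp add: linear_sum linear_scale)
qed

text \<open>Contraction with x lowers the form degree by one and raises the polynomial degree by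
  one: expanding x in the standard basis exhibits the additional linear factor.\<close>

lemma trimmed_forms_subset: "trimmed_forms r k \<subseteq> poly_forms r k"
proof -
  have "koszul \<eta> \<in> poly_forms r k" if \<eta>: "\<eta> \<in> poly_forms (r - 1) (k + 1)" for \<eta> :: "'a form"
  proof -
    have A: "koszul \<eta> x \<in> alt_forms k" for x
    proof -
      have a: "\<eta> x \<in> alt_forms (k + 1)" using \<eta> by (rule poly_forms_alt)
      have "linear (\<lambda>y. \<eta> x (x # v[i := y]))" if "int (length v) = k" "i < length v" for v i
      proof -
        have "linear (\<lambda>y. \<eta> x ((x # v)[Suc i := y]))"
          using a that unfolding alt_forms_def by (simp del: list_update.simps)
        then show ?thesis by simp
      qed
      moreover have "\<eta> x (x # v) = 0" if "int (length v) = k" "i < j" "j < length v" "v ! i = v ! j" for v i j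
      proof -
        have "int (length (x # v)) = k + 1 \<and> Suc i < Suc j \<and> Suc j < length (x # v) \<and> (x # v) ! Suc i = (x # v) ! Suc j"
          using that by simp
        then show ?thesis using a unfolding alt_forms_def by blast
      qed
      moreover have "\<eta> x (x # v) = 0" if "int (length v) \<noteq> k" for v
        using alt_forms_length[OF a] that by simp
      ultimately show ?thesis unfolding alt_forms_def koszul_def by blast
    qed
    have "(\<lambda>x. koszul \<eta> x v) \<in> polys r" for v
    proof (cases "int (length v) = k")
      case True
      have "(\<lambda>x. \<Sum>b\<in>Basis. (x \<bullet> b) * \<eta> x (b # v)) \<in> polys r"
        using polys_mult[OF polys_inner poly_forms_polys[OF \<eta>]] by (intro polys_sum) simp
      moreover have "koszul \<eta> x v = (\<Sum>b\<in>Basis. (x \<bullet> b) * \<eta> x (b # v))" for x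
        unfolding koszul_def using alt_forms_linear_Cons[OF poly_forms_alt[OF \<eta>]] True
        by (intro linear_Basis_expansion) simp
      ultimately show ?thesis by simp
    next
      case False
      then show ?thesis using alt_forms_length[OF A] by (simp add: polys_0)
    qed
    with A show ?thesis by (simp add: poly_forms_def)
  qed
  moreover have "\<omega> \<in> poly_forms r k" if "\<omega> \<in> poly_forms (r - 1) k" for \<omega> :: "'a form"
    using that poly_forms_mono[of "r - 1" r] by simp
  ultimately show ?thesis unfolding trimmed_forms_def using poly_forms_add by fastforce
qed

text \<open>This inclusion is what makes the truncation of \<open>P T \<omega>\<close> to degree
  \<open>r - 1\<close> a member of the trimmed family.\<close>

lemma poly_forms_subset_trimmed: "poly_forms (r - 1) k \<subseteq> trimmed_forms r k"
proof
  fix \<omega> :: "'a form" assume "\<omega> \<in> poly_forms (r - 1) k"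
  moreover have "\<omega> = \<omega> + koszul 0" by (simp add: koszul_def fun_eq_iff)
  ultimately show "\<omega> \<in> trimmed_forms r k"
    unfolding trimmed_forms_def using poly_forms_0 by blast
qed

lemma family_forms_subset: "family_forms fam r k \<subseteq> poly_forms r k"
  by (cases fam) (auto dest: subsetD[OF trimmed_forms_subset])

lemma Basis_lists_Suc:
  "{v. set v \<subseteq> B \<and> length v = Suc k} = (\<lambda>(b, v). b # v) ` (B \<times> {v. set v \<subseteq> B \<and> length v = k})"
  by (auto simp: length_Suc_conv image_iff)

lemma sum_lists_Suc:
  "(\<Sum>v | set v \<subseteq> B \<and> length v = Suc k. f v) = (\<Sum>b\<in>B. \<Sum>v | set v \<subseteq> B \<and> length v = k. f (b # v))"
  unfolding Basis_lists_Suc by (subst sum.reindex) (auto simp: inj_on_def sum.cartesian_product case_prod_unfold)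

lemma sum_fun_apply:
  fixes f :: "'i \<Rightarrow> 'b \<Rightarrow> 'c::comm_monoid_add"
  shows "(\<Sum>i\<in>I. f i) x = (\<Sum>i\<in>I. f i x)"
  by (induction I rule: infinite_finite_induct) auto

lemma multilinear_expansion:
  fixes A :: "'a::euclidean_space list \<Rightarrow> real"
  assumes "\<And>v i. length v = k \<Longrightarrow> i < k \<Longrightarrow> linear (\<lambda>x. A (v[i := x]))" "length v = k"
  shows "A v = (\<Sum>bs | set bs \<subseteq> Basis \<and> length bs = k. (\<Prod>i<k. v ! i \<bullet> bs ! i) * A bs)"
  using assms
proof (induction k arbitrary: A v)
  case 0
  have "{bs. set bs \<subseteq> (Basis :: 'a set) \<and> length bs = 0} = {[]}" by auto
  then show ?case using 0 by simp
next
  case (Suc k)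
  obtain x w where v: "v = x # w" "length w = k" using Suc.prems(2) by (cases v) auto
  have l: "linear (\<lambda>x. A (x # w))"
    using Suc.prems(1)[of "0 # w" 0] v by simp
  have IH: "A (b # w) = (\<Sum>bs | set bs \<subseteq> Basis \<and> length bs = k. (\<Prod>i<k. w ! i \<bullet> bs ! i) * A (b # bs))" for b
    using v(2)
  proof (intro Suc.IH)
    fix u :: "'a list" and i assume "length u = k" "i < k"
    then show "linear (\<lambda>x. A (b # u[i := x]))" using Suc.prems(1)[of "b # u" "Suc i"] by simp
  qed
  have "A v = (\<Sum>b\<in>Basis. (x \<bullet> b) * A (b # w))" unfolding v(1) by (rule linear_Basis_expansion[OF l])
  also have "\<dots> = (\<Sum>b\<in>Basis. \<Sum>bs | set bs \<subseteq> Basis \<and> length bs = k. (x \<bullet> b) * (\<Prod>i<k. w ! i \<bullet> bs ! i) * A (b # bs))"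
    by (subst IH) (simp add: sum_distrib_left mult.assoc)
  also have "\<dots> = (\<Sum>bs | set bs \<subseteq> Basis \<and> length bs = Suc k. (\<Prod>i<Suc k. v ! i \<bullet> bs ! i) * A bs)"
    unfolding sum_lists_Suc v(1) by (simp only: prod.lessThan_Suc_shift) simp
  finally show ?case .
qed

lemma poly_forms_finite_span:
  "\<exists>G :: 'a::euclidean_space form set. finite G \<and> poly_forms (int r) (int k) \<subseteq> span G"
proof -
  define M where "M = {\<alpha> :: 'a multiset. set_mset \<alpha> \<subseteq> Basis \<and> int (size \<alpha>) \<le> int r}"
  define L where "L = {bs. set bs \<subseteq> (Basis :: 'a set) \<and> length bs = k}"
  \<comment> \<open>\<open>E bs f\<close> need not be alternating; the finite set \<open>G\<close>
    only has to generate a space that contains the polynomial forms.\<close>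
  define E where "E bs f = (\<lambda>x v. if length v = k then (\<Prod>i<k. v ! i \<bullet> bs ! i) * f x else 0)"
    for bs :: "'a list" and f :: "'a \<Rightarrow> real"
  define G where "G = (\<lambda>(\<alpha>, bs). E bs (monom_fun \<alpha>)) ` (M \<times> L)"
  have "M \<subseteq> mset ` {bs. set bs \<subseteq> Basis \<and> length bs \<le> r}"
  proof
    fix \<alpha> assume "\<alpha> \<in> M"
    moreover obtain bs where "mset bs = \<alpha>" using ex_mset by blast
    ultimately show "\<alpha> \<in> mset ` {bs. set bs \<subseteq> Basis \<and> length bs \<le> r}" by (auto simp: M_def)
  qed
  then have M: "finite M" by (rule finite_subset[OF _ finite_imageI[OF finite_lists_length_le[OF finite_Basis]]])
  have L: "finite L" unfolding L_def by (rule finite_Basis_lists)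
  have E: "E bs f \<in> span G" if "f \<in> polys (int r)" "bs \<in> L" for bs f
    using that(1)
  proof (induction rule: polys_induct)
    case zero
    have "E bs (\<lambda>_. 0) = 0" by (simp add: E_def fun_eq_iff)
    then show ?case by (simp only: span_zero)
  next
    case (step c \<alpha> g)
    have "E bs (monom_fun \<alpha>) \<in> span G" using step that by (intro span_base) (auto simp: G_def M_def)
    then have "c *\<^sub>R E bs (monom_fun \<alpha>) + E bs g \<in> span G" by (intro span_add span_scale step)
    also have "c *\<^sub>R E bs (monom_fun \<alpha>) + E bs g = E bs (\<lambda>x. c * monom_fun \<alpha> x + g x)"
      by (auto simp: E_def fun_eq_iff scaleR_fun_def plus_fun_def algebra_simps)
    finally show ?case .
  qed
  have "\<omega> \<in> span G" if \<omega>: "\<omega> \<in> poly_forms (int r) (int k)" for \<omega>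
  proof -
    have "(\<Sum>bs\<in>L. E bs (\<lambda>x. \<omega> x bs)) \<in> span G"
      using E poly_forms_polys[OF \<omega>] by (intro span_sum) auto
    moreover have "\<omega> = (\<Sum>bs\<in>L. E bs (\<lambda>x. \<omega> x bs))"
    proof (intro ext)
      fix x v
      have s: "(\<Sum>bs\<in>L. E bs (\<lambda>x. \<omega> x bs)) x v = (\<Sum>bs\<in>L. E bs (\<lambda>x. \<omega> x bs) x v)"
        by (simp add: sum_fun_apply)
      show "\<omega> x v = (\<Sum>bs\<in>L. E bs (\<lambda>x. \<omega> x bs)) x v"
      proof (cases "length v = k")
        case True
        have "\<omega> x v = (\<Sum>bs\<in>L. (\<Prod>i<k. v ! i \<bullet> bs ! i) * \<omega> x bs)"
          unfolding L_def using poly_forms_alt[OF \<omega>, of x] True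
          by (intro multilinear_expansion) (auto simp: alt_forms_def)
        then show ?thesis using True unfolding s by (simp add: E_def)
      next
        case False
        then show ?thesis using alt_forms_length[OF poly_forms_alt[OF \<omega>]] unfolding s by (simp add: E_def)
      qed
    qed
    ultimately show ?thesis by simp
  qed
  moreover have "finite G" using M L by (simp add: G_def)
  ultimately show ?thesis by blast
qed

text \<open>The number of shape functions per simplex enters the final constant, so it has to be
  bounded independently of the triangulation. The trace is linear, and every bubble space lies in
  the trace of one fixed finitely generated space.\<close>

lemma card_indices_bounded:
  "\<exists>N. \<forall>fam (S :: 'a::euclidean_space set). card (indices fam r k S) \<le> N"
proof -
  obtain G :: "'a form set" where G: "finite G" "poly_forms (int r) (int k) \<subseteq> span G"
    using poly_forms_finite_span by blast
  have "card (indices fam r k S) \<le> card G" for fam and S :: "'a set"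
  proof -
    have lin: "linear (tr S)"
      by (rule linearI) (auto simp: tr_def fun_eq_iff scaleR_fun_def plus_fun_def)
    have "bubble_forms fam r k S \<subseteq> tr S ` span G"
      using G(2) family_forms_subset unfolding bubble_forms_def by fast
    also have "\<dots> = span (tr S ` G)" using lin by (simp add: linear_span_image)
    finally have "dim (bubble_forms fam r k S) \<le> card (tr S ` G)"
      using G(1) by (intro dim_le_card) auto
    also have "\<dots> \<le> card G" using G(1) by (rule card_image_le)
    finally show ?thesis by (simp add: indices_def)
  qed
  then show ?thesis by blast
qed

section \<open>Polynomial forms as finite element functions\<close>

definition del_nth :: "nat \<Rightarrow> 'b list \<Rightarrow> 'b list" where
  "del_nth i v = take i v @ drop (Suc i) v"

lemma length_del_nth: "i < length v \<Longrightarrow> length (del_nth i v) = length v - 1"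
  by (simp add: del_nth_def)

lemma nth_del_nth: "i < length v \<Longrightarrow> Suc m < length v \<Longrightarrow> del_nth i v ! m = (if m < i then v ! m else v ! Suc m)"
  by (auto simp: del_nth_def nth_append min_def)

lemma del_nth_update_same: "del_nth i (v[i := y]) = del_nth i v"
  by (simp add: del_nth_def)

lemma del_nth_update:
  assumes "i < length v" "l < length v" "l \<noteq> i"
  shows "del_nth l (v[i := y]) = (del_nth l v)[if i < l then i else i - 1 := y]"
proof (rule nth_equalityI)
  fix m assume "m < length (del_nth l (v[i := y]))"
  then have "Suc m < length v" using assms by (simp add: length_del_nth)
  then show "del_nth l (v[i := y]) ! m = (del_nth l v)[if i < l then i else i - 1 := y] ! m"
    using assms by (auto simp: nth_del_nth nth_list_update length_del_nth)
qed (use assms in \<open>simp add: length_del_nth\<close>)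

lemma alt_forms_linear: "A \<in> alt_forms k \<Longrightarrow> int (length v) = k \<Longrightarrow> i < length v \<Longrightarrow> linear (\<lambda>x. A (v[i := x]))"
  by (simp add: alt_forms_def)

lemma alt_forms_eq_0: "A \<in> alt_forms k \<Longrightarrow> i < j \<Longrightarrow> j < length v \<Longrightarrow> v ! i = v ! j \<Longrightarrow> A v = 0"
  using alt_forms_length[of A k v] unfolding alt_forms_def by blast

text \<open>Vanishing on repeated neighbouring arguments suffices, since it implies antisymmetry under the
  exchange of neighbours.\<close>

lemma alt_formsI_adjacent:
  fixes A :: "'a::real_vector list \<Rightarrow> real"
  assumes len: "\<And>v. int (length v) \<noteq> k \<Longrightarrow> A v = 0"
    and lin: "\<And>v i. int (length v) = k \<Longrightarrow> i < length v \<Longrightarrow> linear (\<lambda>x. A (v[i := x]))"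
    and adj: "\<And>v i. int (length v) = k \<Longrightarrow> Suc i < length v \<Longrightarrow> v ! i = v ! Suc i \<Longrightarrow> A v = 0"
  shows "A \<in> alt_forms k"
proof -
  have "A v = 0" if "int (length v) = k" "i + Suc d < length v" "v ! i = v ! (i + Suc d)" for v i d
    using that
  proof (induction d arbitrary: v)
    case 0
    then show ?case using adj by simp
  next
    case (Suc d)
    \<comment> \<open>The second of the two equal arguments, at position j + 1, is exchanged with
      its left neighbour. Expanding A at the sum of the two neighbours shows that this changes only
      the sign, and in the exchanged list the equal arguments are one step closer.\<close>
    define j where "j = i + Suc d"
    have j: "i < j" "Suc j < length v" using Suc.prems by (auto simp: j_def)
    define a b where "a = v ! j" "b = v ! Suc j"
    define F where "F x y = A (v[j := x, Suc j := y])" for x y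
    have l1: "linear (\<lambda>x. F x y)" for y
      using lin[of "v[Suc j := y]" j] Suc.prems j by (simp add: F_def list_update_swap)
    have l2: "linear (\<lambda>y. F x y)" for x
      using lin[of "v[j := x]" "Suc j"] Suc.prems j by (simp add: F_def)
    have d0: "F x x = 0" for x
      unfolding F_def using Suc.prems j by (intro adj[where i = j]) auto
    have "F (a + b) (a + b) = F a a + F a b + F b a + F b b"
      using linear_add[OF l1] linear_add[OF l2] by simp
    then have "F a b + F b a = 0" using d0 by simp
    moreover have "F b a = 0"
      unfolding F_def using Suc.prems j by (intro Suc.IH) (auto simp: a_b_def j_def nth_list_update)
    moreover have "F a b = A v" by (simp add: F_def a_b_def)
    ultimately show ?case by simp
  qed
  then have "A v = 0" if "int (length v) = k" "i < j" "j < length v" "v ! i = v ! j" for v i j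
    using that less_imp_Suc_add[OF that(2)] by auto
  then show ?thesis unfolding alt_forms_def using len lin by blast
qed

text \<open>The classical exterior derivative, by the formula that \<open>weak_ext_deriv\<close>
  expresses in distributional form.\<close>

definition poly_ext_deriv :: "nat \<Rightarrow> 'a::euclidean_space form \<Rightarrow> 'a form" where
  "poly_ext_deriv k \<omega> = (\<lambda>x v. if length v = Suc k then
     \<Sum>l\<le>k. (- 1) ^ l * dir_deriv (v ! l) (\<lambda>z. \<omega> z (del_nth l v)) x else 0)"

lemma dir_deriv_form_alt:
  assumes \<omega>: "\<omega> \<in> poly_forms r k"
  shows "(\<lambda>v. dir_deriv w (\<lambda>z. \<omega> z v) x) \<in> alt_forms k"
proof -
  have diff: "(\<lambda>z. \<omega> z v) differentiable (at x)" for v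
    using poly_forms_polys[OF \<omega>] by (rule polys_differentiable)
  have 0: "dir_deriv w (\<lambda>z. \<omega> z v) x = 0" if "\<And>z. \<omega> z v = 0" for v
    using that dir_deriv_eq[of "\<lambda>_. 0" "\<lambda>_. 0"] by simp
  have "linear (\<lambda>y. dir_deriv w (\<lambda>z. \<omega> z (v[i := y])) x)" if v: "int (length v) = k" "i < length v" for v i
  proof (rule linearI)
    have l: "linear (\<lambda>y. \<omega> z (v[i := y]))" for z
      using alt_forms_linear[OF poly_forms_alt[OF \<omega>] v] .
    fix y y' c
    have "((\<lambda>z. \<omega> z (v[i := y]) + \<omega> z (v[i := y'])) has_derivative
        (\<lambda>w. dir_deriv w (\<lambda>z. \<omega> z (v[i := y])) x + dir_deriv w (\<lambda>z. \<omega> z (v[i := y'])) x)) (at x)"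
      by (intro has_derivative_add has_derivative_dir_deriv diff)
    then show "dir_deriv w (\<lambda>z. \<omega> z (v[i := y + y'])) x =
        dir_deriv w (\<lambda>z. \<omega> z (v[i := y])) x + dir_deriv w (\<lambda>z. \<omega> z (v[i := y'])) x"
      by (simp add: linear_add[OF l] dir_deriv_eq)
    have "((\<lambda>z. c * \<omega> z (v[i := y])) has_derivative (\<lambda>w. c * dir_deriv w (\<lambda>z. \<omega> z (v[i := y])) x)) (at x)"
      by (intro has_derivative_mult_right has_derivative_dir_deriv diff)
    then show "dir_deriv w (\<lambda>z. \<omega> z (v[i := c *\<^sub>R y])) x = c *\<^sub>R dir_deriv w (\<lambda>z. \<omega> z (v[i := y])) x"
      by (simp add: linear_scale[OF l] dir_deriv_eq)
  qed
  then show ?thesis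
    using 0 alt_forms_length[OF poly_forms_alt[OF \<omega>]] alt_forms_eq_0[OF poly_forms_alt[OF \<omega>]]
    unfolding alt_forms_def by blast
qed

text \<open>The derivative is only used to be a bounded form on \<Omega>, so the degree bound
  \<open>r\<close> is simply kept.\<close>

lemma poly_ext_deriv_poly_forms:
  assumes \<omega>: "\<omega> \<in> poly_forms r (int k)"
  shows "poly_ext_deriv k \<omega> \<in> poly_forms r (int (k + 1))"
proof -
  let ?D = "\<lambda>w x v. dir_deriv w (\<lambda>z. \<omega> z v) x"
  have "poly_ext_deriv k \<omega> x \<in> alt_forms (int (k + 1))" for x
  proof (rule alt_formsI_adjacent)
    fix v :: "'a list" and i
    assume v: "int (length v) = int (k + 1)" "i < length v"
    have "linear (\<lambda>y. ?D (v[i := y] ! l) x (del_nth l (v[i := y])))" if "l \<le> k" for l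
    proof (cases "l = i")
      case True
      then show ?thesis
        using v that dir_deriv_linear[OF polys_differentiable[OF poly_forms_polys[OF \<omega>]]]
        by (simp add: del_nth_update_same)
    next
      case False
      then show ?thesis
        using v that alt_forms_linear[OF dir_deriv_form_alt[OF \<omega>], of "del_nth l v"]
        by (auto simp: del_nth_update length_del_nth)
    qed
    then have "linear (\<lambda>y. \<Sum>l\<le>k. (- 1) ^ l * ?D (v[i := y] ! l) x (del_nth l (v[i := y])))"
      by (intro linear_compose_sum ballI linear_cmult_real) auto
    then show "linear (\<lambda>y. poly_ext_deriv k \<omega> x (v[i := y]))" using v by (simp add: poly_ext_deriv_def)
  next
    fix v :: "'a list" and i
    assume v: "int (length v) = int (k + 1)" "Suc i < length v" "v ! i = v ! Suc i"
    let ?t = "\<lambda>l. (- 1) ^ l * ?D (v ! l) x (del_nth l v)"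
    \<comment> \<open>If the arguments i and i + 1 agree, a term that deletes another argument still
      contains the equal pair. The two remaining terms delete one argument of the pair each; they
      have equal values and opposite signs.\<close>
    have "?t l = 0" if "l \<le> k" "l \<noteq> i" "l \<noteq> Suc i" for l
    proof -
      have "?D (v ! l) x (del_nth l v) = 0"
        using v that
        by (intro alt_forms_eq_0[OF dir_deriv_form_alt[OF \<omega>], where i = "if i < l then i else i - 1"
              and j = "if i < l then Suc i else i"]) (auto simp: nth_del_nth length_del_nth)
      then show ?thesis by simp
    qed
    then have "(\<Sum>l\<le>k. ?t l) = (\<Sum>l\<in>{i, Suc i}. ?t l)"
      using v by (intro sum.mono_neutral_right) auto
    also have "del_nth i v = del_nth (Suc i) v"
      using v by (intro nth_equalityI) (auto simp: length_del_nth nth_del_nth less_Suc_eq)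
    then have "(\<Sum>l\<in>{i, Suc i}. ?t l) = 0" using v(3) by simp
    finally show "poly_ext_deriv k \<omega> x v = 0" by (simp add: poly_ext_deriv_def)
  qed (simp add: poly_ext_deriv_def)
  moreover have "(\<lambda>x. poly_ext_deriv k \<omega> x v) \<in> polys r" for v
  proof -
    have "(\<lambda>x. \<Sum>l\<le>k. (- 1) ^ l * ?D (v ! l) x (del_nth l v)) \<in> polys r"
      using polys_mono[OF _ polys_dir_deriv[OF poly_forms_polys[OF \<omega>]]]
      by (intro polys_sum polys_cmult) simp
    then show ?thesis by (cases "length v = Suc k") (simp_all add: poly_ext_deriv_def polys_0)
  qed
  ultimately show ?thesis by (simp add: poly_forms_def)
qed

section \<open>Weak exterior derivatives of polynomial forms\<close>

lemma continuous_borel_measurable_lebesgue_on: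
  "continuous_on UNIV f \<Longrightarrow> f \<in> borel_measurable (lebesgue_on U)"
  by (intro measurable_restrict_space1 measurable_completion) (simp add: borel_measurable_continuous_onI)

lemma continuous_locally_integrable:
  fixes f :: "'a::euclidean_space \<Rightarrow> real"
  assumes "continuous_on UNIV f"
  shows "locally_integrable U f"
proof -
  have "integrable lebesgue (\<lambda>x. indicat_real K x *\<^sub>R f x)" if "compact K" for K
  proof -
    have "integrable lborel (\<lambda>x. indicat_real K x *\<^sub>R f x)"
      using that assms by (intro borel_integrable_compact) (auto intro: continuous_on_subset)
    then show ?thesis by (subst integrable_completion) auto
  qed
  then show ?thesis by (simp add: locally_integrable_def set_integrable_def)
qed

lemma LINT_test_fun_lborel:
  assumes f: "continuous_on UNIV f" and \<psi>: "test_fun U \<psi>"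
  shows "(LINT x:U|lebesgue. f x * \<psi> x) = (\<integral>x. f x * \<psi> x \<partial>lborel)"
proof -
  have c: "continuous_on UNIV \<psi>" using \<psi> by (auto simp: test_fun_def intro: smooth_continuous)
  have "(LINT x:U|lebesgue. f x * \<psi> x) = (\<integral>x. f x * \<psi> x \<partial>lebesgue)"
    unfolding set_lebesgue_integral_def using test_fun_eq_0[OF \<psi>]
    by (intro Bochner_Integration.integral_cong) (auto simp: indicator_def)
  also have "\<dots> = (\<integral>x. f x * \<psi> x \<partial>lborel)"
    using f c by (intro integral_completion) (auto intro!: borel_measurable_continuous_onI continuous_intros)
  finally show ?thesis .
qed

lemma LINT_by_parts:
  assumes f: "smooth f" and \<psi>: "test_fun U \<psi>"
  shows "(LINT x:U|lebesgue. f x * dir_deriv v \<psi> x) = - (LINT x:U|lebesgue. dir_deriv v f x * \<psi> x)"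
  using integral_by_parts_dir_deriv[OF f] \<psi>
  by (simp add: LINT_test_fun_lborel smooth_continuous f smooth_dir_deriv test_fun_dir_deriv) (simp add: test_fun_def)

lemma weak_ext_deriv_poly:
  assumes \<omega>: "\<omega> \<in> poly_forms r (int k)"
  shows "weak_ext_deriv k U \<omega> (poly_ext_deriv k \<omega>)"
  unfolding weak_ext_deriv_def
proof (intro conjI allI impI ballI)
  have d: "poly_ext_deriv k \<omega> \<in> poly_forms r (int (k + 1))" by (rule poly_ext_deriv_poly_forms[OF \<omega>])
  show "poly_ext_deriv k \<omega> x \<in> alt_forms (int (k + 1))" for x using d by (rule poly_forms_alt)
  show "locally_integrable U (\<lambda>x. \<omega> x v)" "locally_integrable U (\<lambda>x. poly_ext_deriv k \<omega> x v)" for v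
    using poly_forms_polys[OF \<omega>] poly_forms_polys[OF d]
    by (auto intro!: continuous_locally_integrable polys_continuous)
  fix \<psi> :: "'a \<Rightarrow> real" and vs :: "'a list"
  assume *: "test_fun U \<psi> \<and> length vs = k + 1"
  then have \<psi>: "test_fun U \<psi>" by simp
  let ?f = "\<lambda>l x. \<omega> x (del_nth l vs)"
  have sm: "smooth (?f l)" for l using poly_forms_polys[OF \<omega>] by (rule polys_smooth)
  have i: "set_integrable lebesgue U (\<lambda>x. dir_deriv (vs ! l) (?f l) x * \<psi> x)" for l
    using \<psi> sm by (intro locally_integrable_test_fun continuous_locally_integrable) (auto intro: smooth_continuous smooth_dir_deriv)
  have "(LINT x:U|lebesgue. poly_ext_deriv k \<omega> x vs * \<psi> x) =
      (LINT x:U|lebesgue. (\<Sum>l\<le>k. (- 1) ^ l * (dir_deriv (vs ! l) (?f l) x * \<psi> x)))"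
    using * by (simp add: poly_ext_deriv_def sum_distrib_right mult.assoc)
  also have "\<dots> = (\<Sum>l\<le>k. (- 1) ^ l * (LINT x:U|lebesgue. dir_deriv (vs ! l) (?f l) x * \<psi> x))"
  proof -
    have "(LINT x:U|lebesgue. (\<Sum>l\<le>k. (- 1) ^ l * (dir_deriv (vs ! l) (?f l) x * \<psi> x))) =
        (\<integral>x. (\<Sum>l\<le>k. (- 1) ^ l * (indicat_real U x *\<^sub>R (dir_deriv (vs ! l) (?f l) x * \<psi> x))) \<partial>lebesgue)"
      unfolding set_lebesgue_integral_def
      by (intro Bochner_Integration.integral_cong) (simp_all add: sum_distrib_left mult.left_commute)
    also have "\<dots> = (\<Sum>l\<le>k. \<integral>x. (- 1) ^ l * (indicat_real U x *\<^sub>R (dir_deriv (vs ! l) (?f l) x * \<psi> x)) \<partial>lebesgue)"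
      using i unfolding set_integrable_def by (intro Bochner_Integration.integral_sum integrable_mult_right)
    finally show ?thesis by (simp add: set_lebesgue_integral_def)
  qed
  also have "\<dots> = (\<Sum>l\<le>k. (- 1) ^ l * - (LINT x:U|lebesgue. ?f l x * dir_deriv (vs ! l) \<psi> x))"
    by (simp add: LINT_by_parts[OF sm \<psi>])
  finally show "(LINT x:U|lebesgue. poly_ext_deriv k \<omega> x vs * \<psi> x) = - (\<Sum>i\<le>k. (- 1) ^ i *
      (LINT x:U|lebesgue. \<omega> x (take i vs @ drop (Suc i) vs) * dir_deriv (vs ! i) \<psi> x))"
    by (simp add: sum_negf del_nth_def)
qed

lemma continuous_on_alt_norm:
  assumes "\<And>v. continuous_on S (\<lambda>x. \<omega> x v)"
  shows "continuous_on S (\<lambda>x. alt_norm k (\<omega> x))"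
  unfolding alt_norm_def using assms by (intro continuous_intros) auto

lemma poly_forms_Lp_infty:
  assumes \<omega>: "\<omega> \<in> poly_forms r (int k)" and U: "bounded U" "U \<in> sets lebesgue"
  shows "\<omega> \<in> Lp_forms \<infinity> k U"
proof -
  have c: "continuous_on UNIV (\<lambda>x. \<omega> x v)" for v using poly_forms_polys[OF \<omega>] by (rule polys_continuous)
  have "compact (closure U)" using U by simp
  then have "bounded ((\<lambda>x. alt_norm k (\<omega> x)) ` closure U)"
    by (intro compact_imp_bounded compact_continuous_image continuous_on_alt_norm continuous_on_subset[OF c]) auto
  then obtain B where B: "\<And>x. x \<in> closure U \<Longrightarrow> alt_norm k (\<omega> x) \<le> B"
    by (auto simp: bounded_iff abs_le_iff)
  have "esssup (lebesgue_on U) (\<lambda>x. ennreal (alt_norm k (\<omega> x))) \<le> ennreal B"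
  proof (rule esssup_I)
    show "(\<lambda>x. ennreal (alt_norm k (\<omega> x))) \<in> borel_measurable (lebesgue_on U)"
      using continuous_borel_measurable_lebesgue_on[OF continuous_on_alt_norm[OF c]] by measurable
    show "AE x in lebesgue_on U. ennreal (alt_norm k (\<omega> x)) \<le> ennreal B"
      using B closure_subset[of U] by (intro AE_I2 ennreal_leI) auto
  qed
  then have "Lp_norm \<infinity> k U \<omega> < \<infinity>" by (simp add: Lp_norm_def le_less_trans)
  then show ?thesis
    using poly_forms_alt[OF \<omega>] continuous_borel_measurable_lebesgue_on[OF c] by (simp add: Lp_forms_def)
qed

section \<open>Simplices and the domain they triangulate\<close>

lemma triangulates_simplex:
  assumes "triangulates \<T> \<Omega>" "S \<in> \<T>"
  obtains C where "finite C" "\<not> affine_dependent C" "S = convex hull C" "C \<noteq> {}" "int (card C) = aff_dim S + 1"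
proof -
  have S: "S \<noteq> {}" "\<exists>n. n simplex S" using assms by (auto simp: triangulates_def simplicial_complex_def)
  then obtain C n where C: "\<not> affine_dependent C" "int (card C) = n + 1" "S = convex hull C"
    by (auto simp: simplex_def)
  have "aff_dim S = n" using C aff_dim_affine_independent[of C] by (simp add: aff_dim_convex_hull)
  then show ?thesis using that[of C] C S aff_independent_finite[of C] by auto
qed

lemma
  assumes "triangulates \<T> \<Omega>"
  shows triangulates_finite: "finite \<T>"
    and triangulates_open: "open \<Omega>"
    and triangulates_compact: "S \<in> \<T> \<Longrightarrow> compact S"
    and triangulates_convex: "S \<in> \<T> \<Longrightarrow> convex S"
    and triangulates_nonempty: "S \<in> \<T> \<Longrightarrow> S \<noteq> {}"
    and triangulates_bounded: "bounded \<Omega>"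
proof -
  show f: "finite \<T>" using assms by (auto simp: triangulates_def simplicial_complex_def)
  show "open \<Omega>" using assms by (simp add: triangulates_def)
  show c: "compact S" "convex S" if S: "S \<in> \<T>" for S
  proof -
    obtain C where "finite C" "S = convex hull C" using triangulates_simplex[OF assms S] by blast
    then show "compact S" "convex S" by (simp_all add: finite_imp_compact_convex_hull)
  qed
  show "S \<in> \<T> \<Longrightarrow> S \<noteq> {}" using assms by (auto simp: triangulates_def)
  have "bounded (\<Union>\<T>)" using f c by (intro bounded_Union) (auto intro: compact_imp_bounded)
  moreover have "\<Omega> \<subseteq> \<Union>\<T>" using assms interior_subset by (auto simp: triangulates_def)
  ultimately show "bounded \<Omega>" by (rule bounded_subset)
qed

lemma top_simplicesD: "T \<in> top_simplices \<T> \<Longrightarrow> T \<in> \<T>" "T \<in> top_simplices \<T> \<Longrightarrow> aff_dim T = int DIM('a)"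
  for T :: "'a::euclidean_space set"
  by (auto simp: top_simplices_def)

lemma
  fixes T :: "'a::euclidean_space set"
  assumes tri: "triangulates \<T> \<Omega>" and T: "T \<in> top_simplices \<T>"
  shows top_simplex_interior: "interior T \<noteq> {}"
    and top_simplex_negligible: "negligible (T - \<Omega>)"
    and top_simplex_lebesgue: "T \<in> sets lebesgue"
proof -
  note T' = top_simplicesD[OF T]
  have c: "convex T" "T \<noteq> {}" "compact T"
    using triangulates_convex[OF tri T'(1)] triangulates_nonempty[OF tri T'(1)] triangulates_compact[OF tri T'(1)] by auto
  have "interior T = rel_interior T" using T'(2) by (simp add: interior_rel_interior_gen)
  then show "interior T \<noteq> {}" using c rel_interior_eq_empty by auto
  have "T \<subseteq> \<Union>\<T>" using T' by auto
  then have sub: "interior T \<subseteq> \<Omega>" using tri interior_mono by (auto simp: triangulates_def)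
  have "T - \<Omega> \<subseteq> frontier T" using sub closure_subset[of T] by (auto simp: frontier_def)
  then show "negligible (T - \<Omega>)" using negligible_convex_frontier[OF c(1)] negligible_subset by blast
  show "T \<in> sets lebesgue" using c(3) by (simp add: compact_imp_closed)
qed

text \<open>Forms live on the open set \<Omega>, norms are taken on closed simplices. The frontier
  of a convex set is a null set, so \<open>T\<close> lies in \<Omega> up to a null set.\<close>

lemma AE_top_simplex:
  fixes T :: "'a::euclidean_space set"
  assumes tri: "triangulates \<T> \<Omega>" and T: "T \<in> top_simplices \<T>" and P: "AE x in lebesgue_on \<Omega>. P x"
  shows "AE x in lebesgue_on T. P x"
proof -
  have "AE x in lebesgue. x \<in> \<Omega> \<longrightarrow> P x"
    using P triangulates_open[OF tri] by (simp add: AE_restrict_space_iff)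
  moreover have "AE x in lebesgue. x \<notin> T - \<Omega>"
    using top_simplex_negligible[OF tri T] by (intro AE_not_in) (simp add: negligible_iff_null_sets)
  ultimately have "AE x in lebesgue. x \<in> T \<longrightarrow> P x" by eventually_elim auto
  then show ?thesis using top_simplex_lebesgue[OF tri T] by (simp add: AE_restrict_space_iff)
qed

lemma top_simplex_measurable:
  fixes f :: "'a::euclidean_space \<Rightarrow> real"
  assumes tri: "triangulates \<T> \<Omega>" and T: "T \<in> top_simplices \<T>"
    and f: "f \<in> borel_measurable (lebesgue_on \<Omega>)"
  shows "f \<in> borel_measurable (lebesgue_on T)"
proof -
  have "(\<lambda>x. if x \<in> \<Omega> then f x else 0) \<in> borel_measurable lebesgue"
    using f triangulates_open[OF tri] by (intro borel_measurable_if_I) auto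
  then have m: "(\<lambda>x. if x \<in> \<Omega> then f x else 0) \<in> borel_measurable (lebesgue_on T)"
    by (rule measurable_restrict_space1)
  have "AE x in lebesgue_on T. (if x \<in> \<Omega> then f x else 0) = f x"
    using triangulates_open[OF tri] by (intro AE_top_simplex[OF tri T]) (auto simp: AE_restrict_space_iff)
  then show ?thesis by (rule borel_measurable_lebesgue_on_AE_eq[OF m top_simplex_lebesgue[OF tri T]])
qed

text \<open>The smaller simplex is a face of the larger one, and a proper face has smaller
  dimension. Consequently the trace on a full-dimensional simplex is read off from that simplex
  itself.\<close>

lemma top_simplices_subset_eq:
  fixes T :: "'a::euclidean_space set"
  assumes tri: "triangulates \<T> \<Omega>" and T: "T \<in> top_simplices \<T>" "T' \<in> top_simplices \<T>" "T \<subseteq> T'"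
  shows "T = T'"
proof (rule ccontr)
  note m = top_simplicesD[OF T(1)] top_simplicesD[OF T(2)]
  assume "T \<noteq> T'"
  have "(T \<inter> T') face_of T'"
  proof -
    have "simplicial_complex (insert {} \<T>)" using tri by (simp add: triangulates_def)
    then have "(T' \<inter> T) face_of T'" using m unfolding simplicial_complex_def by blast
    then show ?thesis by (simp add: Int_commute)
  qed
  then have "T face_of T'" using T(3) by (simp add: Int_absorb2)
  then have "aff_dim T < aff_dim T'"
    using \<open>T \<noteq> T'\<close> m by (intro face_of_aff_dim_lt triangulates_convex[OF tri]) auto
  then show False using m by simp
qed

lemma family_forms_fe_space:
  fixes \<omega> :: "'a::euclidean_space form"
  assumes tri: "triangulates \<T> \<Omega>" and \<omega>: "\<omega> \<in> family_forms fam (int r) (int k)"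
  shows "\<omega> \<in> fe_space fam r k \<T> \<Omega>"
proof -
  have p: "\<omega> \<in> poly_forms (int r) (int k)" using \<omega> family_forms_subset by blast
  have O: "bounded \<Omega>" "\<Omega> \<in> sets lebesgue"
    using triangulates_bounded[OF tri] triangulates_open[OF tri] by auto
  have "\<omega> \<in> W_forms \<infinity> \<infinity> k \<Omega>"
    using poly_forms_Lp_infty[OF p O] poly_forms_Lp_infty[OF poly_ext_deriv_poly_forms[OF p] O]
      weak_ext_deriv_poly[OF p, of \<Omega>] by (auto simp: W_forms_def)
  then show ?thesis using \<omega> by (auto simp: fe_space_def)
qed

section \<open>Unisolvence on a simplex\<close>

lemma poly_rep_cong: "AE x in lebesgue_on T. \<omega> x = \<eta> x \<Longrightarrow> poly_rep k T \<omega> = poly_rep k T \<eta>"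
proof -
  assume *: "AE x in lebesgue_on T. \<omega> x = \<eta> x"
  have "(AE x in lebesgue_on T. \<omega> x = q x) \<longleftrightarrow> (AE x in lebesgue_on T. \<eta> x = q x)" for q
  proof
    show "AE x in lebesgue_on T. \<eta> x = q x" if "AE x in lebesgue_on T. \<omega> x = q x"
      using * that by eventually_elim simp
    show "AE x in lebesgue_on T. \<omega> x = q x" if "AE x in lebesgue_on T. \<eta> x = q x"
      using * that by eventually_elim simp
  qed
  then show ?thesis by (simp add: poly_rep_def)
qed

lemma poly_rep_eq:
  assumes q: "q \<in> poly_forms d (int k)" and T: "interior T \<noteq> {}" "T \<in> sets lebesgue"
    and eq: "AE x in lebesgue_on T. \<omega> x = q x"
  shows "poly_rep k T \<omega> = q"
proof -
  have "p = q" if "p \<in> poly_forms e (int k)" "AE x in lebesgue_on T. \<omega> x = p x" for p e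
  proof -
    have "AE x in lebesgue_on T. p x = q x" using eq that(2) by eventually_elim simp
    then show ?thesis using poly_forms_eq_AE[OF that(1) q T] by simp
  qed
  then have "{q. (\<exists>d. q \<in> poly_forms d (int k)) \<and> (AE x in lebesgue_on T. \<omega> x = q x)} = {q}"
    using q eq by blast
  then show ?thesis by (simp add: poly_rep_def)
qed

text \<open>The full-dimensional simplex that \<open>fe_trace\<close> selects for \<open>S\<close>.
  A functional attached to \<open>S\<close> sees a form only through its values almost everywhere on
  this simplex.\<close>

definition carrier_simplex :: "'a::euclidean_space set set \<Rightarrow> 'a set \<Rightarrow> 'a set" where
  "carrier_simplex \<T> S = (SOME T. T \<in> top_simplices \<T> \<and> S \<subseteq> T)"

lemma carrier_simplex:
  assumes "triangulates \<T> \<Omega>" "S \<in> \<T>"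
  shows "carrier_simplex \<T> S \<in> top_simplices \<T>" "S \<subseteq> carrier_simplex \<T> S"
proof -
  have "\<exists>T. T \<in> top_simplices \<T> \<and> S \<subseteq> T" using assms by (auto simp: triangulates_def)
  from someI_ex[OF this] show "carrier_simplex \<T> S \<in> top_simplices \<T>" "S \<subseteq> carrier_simplex \<T> S"
    by (auto simp: carrier_simplex_def)
qed

lemma fe_trace_carrier: "fe_trace k \<T> F \<omega> = tr F (poly_rep k (carrier_simplex \<T> F) \<omega>)"
  by (simp add: fe_trace_def carrier_simplex_def)

lemma fe_trace_poly:
  assumes tri: "triangulates \<T> \<Omega>" "S \<in> \<T>" and q: "q \<in> poly_forms d (int k)"
    and eq: "AE x in lebesgue_on (carrier_simplex \<T> S). \<omega> x = q x"
  shows "fe_trace k \<T> S \<omega> = tr S q"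
  unfolding fe_trace_carrier
  using poly_rep_eq[OF q _ _ eq] carrier_simplex[OF tri] top_simplex_interior[OF tri(1)] top_simplex_lebesgue[OF tri(1)]
  by simp

lemma carrier_simplex_top:
  assumes tri: "triangulates \<T> \<Omega>" and T: "T \<in> top_simplices \<T>"
  shows "carrier_simplex \<T> T = T"
  using top_simplices_subset_eq[OF tri T carrier_simplex[OF tri top_simplicesD(1)[OF T]]] by (rule sym)

section \<open>Charts of simplices and linearity of the functionals\<close>

lemma frame_properties:
  fixes S :: "'a::euclidean_space set"
  assumes "S \<noteq> {}"
  shows "int (length (frame S)) = aff_dim S" "distinct (frame S)" "pairwise orthogonal (set (frame S))"
    "\<And>e. e \<in> set (frame S) \<Longrightarrow> norm e = 1" "span (set (frame S)) = direction_space S"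
proof -
  obtain a where a: "a \<in> S" using assms by blast
  have "direction_space S = span ((\<lambda>x. x - a) ` S)"
    unfolding direction_space_def
  proof (rule antisym)
    show "span {x - y | x y. x \<in> S \<and> y \<in> S} \<subseteq> span ((\<lambda>x. x - a) ` S)"
    proof (rule span_minimal)
      show "{x - y | x y. x \<in> S \<and> y \<in> S} \<subseteq> span ((\<lambda>x. x - a) ` S)"
      proof clarify
        fix x y assume "x \<in> S" "y \<in> S"
        then have "(x - a) - (y - a) \<in> span ((\<lambda>x. x - a) ` S)" by (intro span_diff span_base) auto
        then show "x - y \<in> span ((\<lambda>x. x - a) ` S)" by simp
      qed
    qed simp
    show "span ((\<lambda>x. x - a) ` S) \<subseteq> span {x - y | x y. x \<in> S \<and> y \<in> S}"
      using a by (intro span_mono) auto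
  qed
  moreover have "aff_dim S = int (dim ((\<lambda>x. x - a) ` S))"
    using aff_dim_eq_dim_subtract[of a S] a by (simp add: hull_inc)
  ultimately have d: "aff_dim S = int (dim (direction_space S))" by simp
  have "subspace (direction_space S)" by (simp add: direction_space_def)
  then have "\<exists>B. pairwise orthogonal B \<and> (\<forall>x\<in>B. norm x = 1) \<and> independent B \<and>
      card B = dim (direction_space S) \<and> span B = direction_space S"
    by (rule orthonormal_basis_subspace) (rule exI, intro conjI ballI; simp)
  then obtain B where B: "pairwise orthogonal B" "\<forall>x\<in>B. norm x = 1" "independent B"
    "card B = dim (direction_space S)" "span B = direction_space S" by blast
  have "finite B" using B(3) by (rule finiteI_independent)
  then obtain es where "set es = B" "distinct es" using finite_distinct_list by blast
  then have "\<exists>es. int (length es) = aff_dim S \<and> distinct es \<and> pairwise orthogonal (set es) \<and>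
     (\<forall>e\<in>set es. norm e = 1) \<and> span (set es) = direction_space S"
    using B d by (intro exI[of _ es]) (auto simp: distinct_card[symmetric])
  from someI_ex[OF this] show "int (length (frame S)) = aff_dim S" "distinct (frame S)"
    "pairwise orthogonal (set (frame S))" "\<And>e. e \<in> set (frame S) \<Longrightarrow> norm e = 1"
    "span (set (frame S)) = direction_space S"
    unfolding frame_def by blast+
qed

lemma frame_inner:
  assumes "S \<noteq> {}" "i < length (frame S)" "j < length (frame S)"
  shows "frame S ! i \<bullet> frame S ! j = (if i = j then 1 else 0)"
proof -
  note f = frame_properties[OF assms(1)]
  show ?thesis
  proof (cases "i = j")
    case True
    then show ?thesis using f(4)[of "frame S ! i"] assms by (simp add: dot_square_norm)
  next
    case False
    then have "frame S ! i \<noteq> frame S ! j" using f(2) assms by (simp add: nth_eq_iff_index_eq)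
    then show ?thesis using f(3) assms False by (simp add: pairwise_def orthogonal_def)
  qed
qed

lemma chart_coordinate:
  assumes "S \<noteq> {}" "i < length (frame S)"
  shows "(chart S t - (SOME x. x \<in> S)) \<bullet> frame S ! i = t i"
proof -
  have "(chart S t - (SOME x. x \<in> S)) \<bullet> frame S ! i = (\<Sum>j<length (frame S). t j * (frame S ! j \<bullet> frame S ! i))"
    by (simp add: chart_def inner_sum_left)
  also have "\<dots> = (\<Sum>j<length (frame S). if j = i then t j else 0)"
    using assms by (intro sum.cong) (auto simp: frame_inner)
  finally show ?thesis using assms by simp
qed

lemma chart_measurable [measurable]: "chart S \<in> chart_measure S \<rightarrow>\<^sub>M borel"
  unfolding chart_def[abs_def] chart_measure_def
  by (intro borel_measurable_add borel_measurable_sum borel_measurable_scaleR measurable_const) auto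

lemma chart_domain_sets: "S \<in> sets borel \<Longrightarrow> chart_domain S \<in> sets (chart_measure S)"
  using measurable_sets[OF chart_measurable[of S], of S]
  by (simp add: chart_domain_def vimage_def Int_def conj_commute)

lemma emeasure_chart_box:
  "emeasure (chart_measure S) (PiE {..<length (frame S)} (\<lambda>_. {a..b})) = ennreal (b - a) ^ length (frame S)"
  if "a \<le> b"
proof -
  interpret product_sigma_finite "\<lambda>_::nat. lborel :: real measure" by standard
  show ?thesis using that by (simp add: chart_measure_def emeasure_PiM)
qed

text \<open>The frame is orthonormal, so coordinates are recovered as inner products and are bounded
  on a bounded simplex. Finiteness makes the integrals over simplices genuine ones, as additivity of
  the functionals requires.\<close>

lemma emeasure_chart_domain:
  fixes S :: "'a::euclidean_space set"
  assumes "S \<noteq> {}" "bounded S"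
  shows "emeasure (chart_measure S) (chart_domain S) < \<infinity>"
proof -
  let ?a = "SOME x. x \<in> S"
  obtain R where R: "\<And>x. x \<in> S \<Longrightarrow> norm (x - ?a) \<le> R" "0 \<le> R"
  proof -
    obtain B where B: "0 < B" "\<And>x. x \<in> S \<Longrightarrow> norm x \<le> B" using assms(2) by (auto simp: bounded_pos)
    have "norm (x - ?a) \<le> B + norm ?a" if "x \<in> S" for x
      using norm_triangle_ineq4[of x ?a] B(2)[OF that] by simp
    then show ?thesis by (rule that) (use B(1) in \<open>auto intro: add_nonneg_nonneg\<close>)
  qed
  have "chart_domain S \<subseteq> PiE {..<length (frame S)} (\<lambda>_. {- R..R})"
  proof
    fix t assume t: "t \<in> chart_domain S"
    have "\<bar>t i\<bar> \<le> R" if i: "i < length (frame S)" for i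
    proof -
      have "\<bar>t i\<bar> \<le> norm (chart S t - ?a) * norm (frame S ! i)"
        using chart_coordinate[OF assms(1) i, of t] Cauchy_Schwarz_ineq2 by metis
      also have "norm (frame S ! i) = 1" using frame_properties(4)[OF assms(1)] i by simp
      finally show ?thesis using R(1)[of "chart S t"] t by (simp add: chart_domain_def)
    qed
    then have "- R \<le> t i \<and> t i \<le> R" if "i < length (frame S)" for i
      using that by (simp add: abs_le_iff minus_le_iff)
    then show "t \<in> PiE {..<length (frame S)} (\<lambda>_. {- R..R})"
      using t by (auto simp: chart_domain_def chart_measure_def space_PiM PiE_def)
  qed
  moreover have "PiE {..<length (frame S)} (\<lambda>_. {- R..R}) \<in> sets (chart_measure S)"
    unfolding chart_measure_def by (intro sets_PiM_I_finite) auto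
  ultimately have "emeasure (chart_measure S) (chart_domain S) \<le> ennreal (R - - R) ^ length (frame S)"
    using emeasure_mono[of "chart_domain S" "PiE {..<length (frame S)} (\<lambda>_. {- R..R})" "chart_measure S"]
      emeasure_chart_box[of "- R" R S] R(2) by simp
  then show ?thesis by (rule le_less_trans) (use R(2) in \<open>simp add: ennreal_power\<close>)
qed

lemma chart_domain_integrable:
  fixes S :: "'a::euclidean_space set"
  assumes S: "S \<noteq> {}" "compact S" and G: "continuous_on UNIV G"
  shows "set_integrable (chart_measure S) (chart_domain S) (\<lambda>t. G (chart S t) :: real)"
  unfolding set_integrable_def
proof -
  have "bounded (G ` S)"
    using S(2) G by (intro compact_imp_bounded compact_continuous_image) (auto intro: continuous_on_subset)
  then obtain B where B: "\<And>x. x \<in> S \<Longrightarrow> norm (G x) \<le> B" by (auto simp: bounded_iff)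
  show "integrable (chart_measure S) (\<lambda>t. indicat_real (chart_domain S) t *\<^sub>R G (chart S t))"
  proof (rule integrableI_bounded_set_indicator[where B = B])
    show "chart_domain S \<in> sets (chart_measure S)"
      using S(2) by (intro chart_domain_sets) (simp add: compact_imp_closed)
    show "(\<lambda>t. G (chart S t)) \<in> borel_measurable (chart_measure S)"
      using borel_measurable_continuous_onI[OF G] by measurable
    show "emeasure (chart_measure S) (chart_domain S) < \<infinity>"
      by (rule emeasure_chart_domain[OF S(1) compact_imp_bounded[OF S(2)]])
    show "AE t in chart_measure S. t \<in> chart_domain S \<longrightarrow> norm (G (chart S t)) \<le> B"
      using B by (auto simp: chart_domain_def)
  qed
qed

lemma chart_domain_wedge_integrable:
  fixes S :: "'a::euclidean_space set"
  assumes S: "S \<noteq> {}" "compact S"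
    and c: "\<And>v. continuous_on UNIV (\<lambda>x. \<eta> x v)" "\<And>v. continuous_on UNIV (\<lambda>x. \<omega> x v)"
  shows "set_integrable (chart_measure S) (chart_domain S)
    (\<lambda>t. wedge j k (tr S \<eta>) (tr S \<omega>) (chart S t) (frame S))"
proof -
  \<comment> \<open>\<open>tr S\<close> sets a form to 0 off \<open>S\<close> and so destroys
    continuity in x. \<open>res\<close> restricts only the argument vectors, preserves continuity,
    and agrees with \<open>tr S\<close> on the chart domain.\<close>
  define res where "res \<omega> = (\<lambda>x v. if set v \<subseteq> direction_space S then \<omega> x v else 0)" for \<omega> :: "'a form"
  have "continuous_on UNIV (\<lambda>x. res \<eta> x v)" "continuous_on UNIV (\<lambda>x. res \<omega> x v)" for v
    by (cases "set v \<subseteq> direction_space S"; simp add: res_def c)+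
  then have "continuous_on UNIV (\<lambda>x. wedge j k (res \<eta>) (res \<omega>) x (frame S))"
    by (cases "length (frame S) = j + k") (auto simp: wedge_def intro!: continuous_intros)
  from chart_domain_integrable[OF S this]
  have "set_integrable (chart_measure S) (chart_domain S) (\<lambda>t. wedge j k (res \<eta>) (res \<omega>) (chart S t) (frame S))" .
  moreover have "wedge j k (tr S \<eta>) (tr S \<omega>) (chart S t) (frame S) = wedge j k (res \<eta>) (res \<omega>) (chart S t) (frame S)"
    if "t \<in> chart_domain S" for t
    using that by (simp add: wedge_def tr_def res_def chart_domain_def)
  ultimately show ?thesis by (simp cong: set_integrable_cong)
qed

lemma wedge_tr_add: "wedge j k \<eta> (tr S (\<omega> + \<omega>')) x v = wedge j k \<eta> (tr S \<omega>) x v + wedge j k \<eta> (tr S \<omega>') x v"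
  by (auto simp: wedge_def tr_def plus_fun_def sum.distrib[symmetric] add_divide_distrib[symmetric] algebra_simps
      intro!: arg_cong2[where f = "(/)"] sum.cong)

lemma wedge_tr_scaleR: "wedge j k \<eta> (tr S (c *\<^sub>R \<omega>)) x v = c * wedge j k \<eta> (tr S \<omega>) x v"
  by (auto simp: wedge_def tr_def scaleR_fun_def sum_distrib_left intro!: arg_cong2[where f = "(/)"] sum.cong)

lemma moment_forms_continuous:
  assumes "\<eta> \<in> moment_forms fam r k S"
  shows "\<exists>\<eta>0. \<eta> = tr S \<eta>0 \<and> (\<forall>v. continuous_on UNIV (\<lambda>x. \<eta>0 x v))"
proof -
  obtain d e \<eta>0 where *: "\<eta> = tr S \<eta>0" "\<eta>0 \<in> poly_forms d e"
    using assms by (cases fam) (auto dest: subsetD[OF trimmed_forms_subset])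
  have "continuous_on UNIV (\<lambda>x. \<eta>0 x v)" for v
    using poly_forms_polys[OF *(2)] by (rule polys_continuous)
  with *(1) show ?thesis by blast
qed

lemma functionals_cong:
  assumes "f \<in> functionals fam r k \<T> S" "AE x in lebesgue_on (carrier_simplex \<T> S). \<omega> x = \<eta> x"
  shows "f \<omega> = f \<eta>"
  using assms(1) poly_rep_cong[OF assms(2)] by (auto simp: functionals_def fe_trace_carrier)

text \<open>Linearity is claimed for polynomial forms because \<open>poly_rep\<close> sends every
  form without polynomial representative to 0: two such forms may well have a polynomial sum. On
  polynomial forms the trace is the plain pullback and the integrals exist.\<close>

lemma functionals_linear:
  fixes f :: "'a::euclidean_space form \<Rightarrow> real"
  assumes tri: "triangulates \<T> \<Omega>" "S \<in> \<T>" and f: "f \<in> functionals fam r k \<T> S"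
    and p: "p \<in> poly_forms d (int k)" "q \<in> poly_forms d (int k)"
  shows "f (p + q) = f p + f q" "f (c *\<^sub>R p) = c * f p"
proof -
  have S: "S \<noteq> {}" "compact S" using triangulates_nonempty[OF tri] triangulates_compact[OF tri] by auto
  obtain \<eta> where f_eq: "f = (\<lambda>\<omega>. simplex_integral S (wedge (nat (aff_dim S - int k)) k \<eta> (fe_trace k \<T> S \<omega>)))"
    and eta: "\<eta> \<in> moment_forms fam r k S"
    using f by (auto simp: functionals_def)
  obtain \<eta>0 where \<eta>0: "\<eta> = tr S \<eta>0" "\<And>v. continuous_on UNIV (\<lambda>x. \<eta>0 x v)"
    using moment_forms_continuous[OF eta] by blast
  have f: "f \<omega> = (LINT t:chart_domain S|chart_measure S. wedge (nat (aff_dim S - int k)) k \<eta> (tr S \<omega>) (chart S t) (frame S))"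
    if "\<omega> \<in> poly_forms d (int k)" for \<omega>
    using fe_trace_poly[OF tri that, of \<omega>] by (simp add: f_eq simplex_integral_def)
  have i: "set_integrable (chart_measure S) (chart_domain S)
      (\<lambda>t. wedge (nat (aff_dim S - int k)) k \<eta> (tr S \<omega>) (chart S t) (frame S))" if "\<omega> \<in> poly_forms d (int k)" for \<omega>
    unfolding \<eta>0(1) using poly_forms_polys[OF that]
    by (intro chart_domain_wedge_integrable S \<eta>0(2)) (rule polys_continuous)
  show "f (p + q) = f p + f q"
    using p i by (simp add: f poly_forms_add wedge_tr_add set_integral_add)
  show "f (c *\<^sub>R p) = c * f p"
    using p i by (simp add: f poly_forms_scaleR wedge_tr_scaleR)
qed

lemma poly_forms_sum: "(\<And>j. j \<in> J \<Longrightarrow> q j \<in> poly_forms d k) \<Longrightarrow> (\<Sum>j\<in>J. q j) \<in> poly_forms d k"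
  by (induction J rule: infinite_finite_induct) (auto intro: poly_forms_0 poly_forms_add simp del: zero_fun_apply)

lemma functionals_sum:
  fixes f :: "'a::euclidean_space form \<Rightarrow> real"
  assumes tri: "triangulates \<T> \<Omega>" "S \<in> \<T>" and f: "f \<in> functionals fam r k \<T> S" and J: "finite J"
    and q: "\<And>j. j \<in> J \<Longrightarrow> q j \<in> poly_forms d (int k)"
  shows "f (\<Sum>j\<in>J. c j *\<^sub>R q j) = (\<Sum>j\<in>J. c j * f (q j))"
  using J q
proof (induction J rule: finite_induct)
  case empty
  \<comment> \<open>The zero form is a multiple of itself by 0, so homogeneity yields the value
    0.\<close>
  have "f (0 *\<^sub>R 0) = 0 * f 0" by (rule functionals_linear(2)[OF tri f poly_forms_0 poly_forms_0])
  then show ?case by (simp only: sum.empty scaleR_zero_left mult_zero_left)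
next
  case (insert j J)
  have "f (c j *\<^sub>R q j + (\<Sum>j\<in>J. c j *\<^sub>R q j)) = f (c j *\<^sub>R q j) + f (\<Sum>j\<in>J. c j *\<^sub>R q j)"
    using insert.prems by (intro functionals_linear(1)[OF tri f] poly_forms_scaleR poly_forms_sum) auto
  also have "f (c j *\<^sub>R q j) = c j * f (q j)"
    using insert.prems by (intro functionals_linear(2)[OF tri f, of _ d]) auto
  finally show ?case using insert by simp
qed

section \<open>Expansion of polynomial forms in shape functions\<close>

lemma biorthogonal_systemD:
  fixes \<T> :: "'a::euclidean_space set set"
  assumes "biorthogonal_system p fam r k \<T> \<Omega> \<phi>' \<phi> C"
  shows "S \<in> \<T> \<Longrightarrow> span (\<phi>' S ` indices fam r k S) = functionals fam r k \<T> S"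
    and "S \<in> \<T> \<Longrightarrow> i \<in> indices fam r k S \<Longrightarrow> \<phi> S i \<in> fe_space fam r k \<T> \<Omega>"
    and "\<omega> \<in> fe_space fam r k \<T> \<Omega> \<Longrightarrow> \<exists>c. AE x in lebesgue_on \<Omega>.
        \<omega> x = (\<Sum>(S, i)\<in>(SIGMA S:\<T>. indices fam r k S). c (S, i) *\<^sub>R \<phi> S i x)"
    and "S \<in> \<T> \<Longrightarrow> i \<in> indices fam r k S \<Longrightarrow> S' \<in> \<T> \<Longrightarrow> j \<in> indices fam r k S' \<Longrightarrow>
      \<phi>' S i (\<phi> S' j) = (if (S, i) = (S', j) then 1 else 0)"
    and "S \<in> \<T> \<Longrightarrow> i \<in> indices fam r k S \<Longrightarrow> S' \<in> \<T> \<Longrightarrow> \<not> S \<subseteq> S' \<Longrightarrow> fe_trace k \<T> S' (\<phi> S i) = 0"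
    and "S \<in> \<T> \<Longrightarrow> i \<in> indices fam r k S \<Longrightarrow> T \<in> top_simplices \<T> \<Longrightarrow> S \<subseteq> T \<Longrightarrow>
      \<omega> \<in> poly_forms (int r) (int k) \<Longrightarrow> Lp_norm p k T (\<phi>' S i \<omega> *\<^sub>R \<phi> S i) \<le> ennreal C * Lp_norm p k T \<omega>"
proof -
  note b = assms[unfolded biorthogonal_system_def]
  note b1 = b[THEN conjunct1] and r1 = b[THEN conjunct2]
  note b2 = r1[THEN conjunct1] and r2 = r1[THEN conjunct2]
  note b3 = r2[THEN conjunct1] and r3 = r2[THEN conjunct2]
  note b4 = r3[THEN conjunct1] and r4 = r3[THEN conjunct2]
  note b5 = r4[THEN conjunct1] and b6 = r4[THEN conjunct2]
  show "S \<in> \<T> \<Longrightarrow> span (\<phi>' S ` indices fam r k S) = functionals fam r k \<T> S"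
    using b1 by simp
  show "S \<in> \<T> \<Longrightarrow> i \<in> indices fam r k S \<Longrightarrow> \<phi> S i \<in> fe_space fam r k \<T> \<Omega>"
    using b2 by simp
  show "\<exists>c. AE x in lebesgue_on \<Omega>. \<omega> x = (\<Sum>(S, i)\<in>(SIGMA S:\<T>. indices fam r k S). c (S, i) *\<^sub>R \<phi> S i x)"
    if "\<omega> \<in> fe_space fam r k \<T> \<Omega>"
    using ex1_implies_ex[OF bspec[OF b3 that]] by (elim exE conjE) (rule exI)
  show "S \<in> \<T> \<Longrightarrow> i \<in> indices fam r k S \<Longrightarrow> S' \<in> \<T> \<Longrightarrow> j \<in> indices fam r k S' \<Longrightarrow>
      \<phi>' S i (\<phi> S' j) = (if (S, i) = (S', j) then 1 else 0)"
    using b4 by simp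
  show "S \<in> \<T> \<Longrightarrow> i \<in> indices fam r k S \<Longrightarrow> S' \<in> \<T> \<Longrightarrow> \<not> S \<subseteq> S' \<Longrightarrow> fe_trace k \<T> S' (\<phi> S i) = 0"
    using b5 by simp
  show "S \<in> \<T> \<Longrightarrow> i \<in> indices fam r k S \<Longrightarrow> T \<in> top_simplices \<T> \<Longrightarrow> S \<subseteq> T \<Longrightarrow>
      \<omega> \<in> poly_forms (int r) (int k) \<Longrightarrow> Lp_norm p k T (\<phi>' S i \<omega> *\<^sub>R \<phi> S i) \<le> ennreal C * Lp_norm p k T \<omega>"
    using b6 by simp
qed

lemma biorthogonal_functionals:
  assumes "biorthogonal_system p fam r k \<T> \<Omega> \<phi>' \<phi> C" "S \<in> \<T>" "i \<in> indices fam r k S"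
  shows "\<phi>' S i \<in> functionals fam r k \<T> S"
  unfolding biorthogonal_systemD(1)[OF assms(1,2), symmetric] using assms(3) by (intro span_base) simp

lemma direction_space_UNIV:
  fixes T :: "'a::euclidean_space set"
  assumes "T \<noteq> {}" "aff_dim T = int DIM('a)"
  shows "direction_space T = UNIV"
proof -
  note f = frame_properties[OF assms(1)]
  have "independent (set (frame T))"
    using f(3,4) by (intro pairwise_orthogonal_independent) fastforce+
  then have "dim (set (frame T)) = DIM('a)"
    using f(1,2) assms(2) by (simp add: dim_eq_card_independent distinct_card)
  then show ?thesis using f(5) by (simp add: dim_eq_full)
qed

text \<open>All vectors are tangential to a full-dimensional simplex, so a vanishing trace on
  \<open>T\<close> forces the polynomial representative of the shape function to vanish at every
  point of \<open>T\<close>.\<close>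

lemma shape_function_zero:
  fixes T :: "'a::euclidean_space set"
  assumes tri: "triangulates \<T> \<Omega>" and bio: "biorthogonal_system p fam r k \<T> \<Omega> \<phi>' \<phi> C"
    and T: "T \<in> top_simplices \<T>" and S: "S \<in> \<T>" "i \<in> indices fam r k S" "\<not> S \<subseteq> T"
  shows "AE x in lebesgue_on T. \<phi> S i x = 0"
proof -
  have "\<exists>q\<in>family_forms fam (int r) (int k). AE x in lebesgue_on T. \<phi> S i x = q x"
    using biorthogonal_systemD(2)[OF bio S(1,2)] T unfolding fe_space_def by simp
  then have ex: "\<exists>q\<in>poly_forms (int r) (int k). AE x in lebesgue_on T. \<phi> S i x = q x"
    using family_forms_subset by blast
  note T' = top_simplicesD[OF T]
  obtain q where q: "q \<in> poly_forms (int r) (int k)" "AE x in lebesgue_on T. \<phi> S i x = q x"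
    using ex by blast
  have "fe_trace k \<T> T (\<phi> S i) = 0" using biorthogonal_systemD(5)[OF bio S(1,2) T'(1) S(3)] .
  moreover have "fe_trace k \<T> T (\<phi> S i) = tr T q"
    by (rule fe_trace_poly[OF tri T'(1) q(1), unfolded carrier_simplex_top[OF tri T], OF q(2)])
  ultimately have trq: "tr T q = 0" by simp
  have "direction_space T = UNIV"
    by (rule direction_space_UNIV[OF triangulates_nonempty[OF tri T'(1)] T'(2)])
  then have "q x = 0" if "x \<in> T" for x
    using that fun_cong[OF fun_cong[OF trq], of x] by (auto simp: tr_def fun_eq_iff)
  then have "AE x in lebesgue_on T. q x = 0" by (intro AE_I2) simp
  with q(2) show ?thesis by eventually_elim simp
qed

text \<open>The basis property only provides some coefficients \<open>c\<close>. They are identified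
  by applying the dual functionals to the expansion, after which it is restricted to
  \<open>T\<close>.\<close>

lemma unisolvence:
  fixes T :: "'a::euclidean_space set"
  assumes tri: "triangulates \<T> \<Omega>" and bio: "biorthogonal_system p fam r k \<T> \<Omega> \<phi>' \<phi> C"
    and T: "T \<in> top_simplices \<T>" and Q: "Q \<in> family_forms fam (int r) (int k)"
  shows "AE x in lebesgue_on T. Q x = (\<Sum>(S, i)\<in>(SIGMA S:{S\<in>\<T>. S \<subseteq> T}. indices fam r k S). \<phi>' S i Q *\<^sub>R \<phi> S i x)"
proof -
  let ?I = "indices fam r k"
  let ?D = "SIGMA S:\<T>. ?I S"
  have finI: "finite (?I S)" for S by (simp add: indices_def)
  have finD: "finite ?D" using triangulates_finite[OF tri] finI by auto
  note func = biorthogonal_functionals[OF bio] and phi = biorthogonal_systemD(2)[OF bio]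
    and dual = biorthogonal_systemD(4)[OF bio]
  have Qfe: "Q \<in> fe_space fam r k \<T> \<Omega>" by (rule family_forms_fe_space[OF tri Q])
  have Qp: "Q \<in> poly_forms (int r) (int k)" using Q family_forms_subset by blast
  obtain c where c: "AE x in lebesgue_on \<Omega>. Q x = (\<Sum>(S, i)\<in>?D. c (S, i) *\<^sub>R \<phi> S i x)"
    using biorthogonal_systemD(3)[OF bio Qfe] by blast
  have ex: "\<exists>q\<in>poly_forms (int r) (int k). AE x in lebesgue_on T. \<phi> S i x = q x"
    if "S \<in> \<T>" "i \<in> ?I S" "T \<in> top_simplices \<T>" for S i T
  proof -
    have "\<exists>q\<in>family_forms fam (int r) (int k). AE x in lebesgue_on T. \<phi> S i x = q x"
      using phi[OF that(1,2)] that(3) unfolding fe_space_def by simp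
    then show ?thesis using family_forms_subset by blast
  qed
  have coeff: "c (S0, i0) = \<phi>' S0 i0 Q" if S0: "S0 \<in> \<T>" "i0 \<in> ?I S0" for S0 i0
  proof -
    \<comment> \<open>The functional belonging to (S0, i0) is evaluated on this one simplex, where
      each shape function has a polynomial representative \<open>q j\<close>. Linearity on
      polynomial forms and duality then isolate a single coefficient.\<close>
    define T0 where "T0 = carrier_simplex \<T> S0"
    have T0: "T0 \<in> top_simplices \<T>" using carrier_simplex[OF tri S0(1)] by (simp add: T0_def)
    obtain q where q: "\<And>j. j \<in> ?D \<Longrightarrow> q j \<in> poly_forms (int r) (int k)"
      "\<And>j. j \<in> ?D \<Longrightarrow> AE x in lebesgue_on T0. \<phi> (fst j) (snd j) x = q j x"
    proof -
      have "\<forall>j\<in>?D. \<exists>q. q \<in> poly_forms (int r) (int k) \<and> (AE x in lebesgue_on T0. \<phi> (fst j) (snd j) x = q x)"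
        using ex[OF _ _ T0] by (auto simp: Bex_def)
      from bchoice[OF this] obtain q where "\<forall>j\<in>?D. q j \<in> poly_forms (int r) (int k) \<and>
          (AE x in lebesgue_on T0. \<phi> (fst j) (snd j) x = q j x)" ..
      note * = bspec[OF this]
      show ?thesis by (rule that[of q]) (use * in \<open>blast+\<close>)
    qed
    have "AE x in lebesgue_on T0. \<forall>j\<in>?D. \<phi> (fst j) (snd j) x = q j x"
      using finD q(2) by (intro AE_finite_allI)
    moreover have "AE x in lebesgue_on T0. Q x = (\<Sum>(S, i)\<in>?D. c (S, i) *\<^sub>R \<phi> S i x)"
      by (rule AE_top_simplex[OF tri T0 c])
    ultimately have "AE x in lebesgue_on T0. Q x = (\<Sum>j\<in>?D. c j *\<^sub>R q j) x"
    proof eventually_elim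
      case (elim x)
      have "(\<Sum>(S, i)\<in>?D. c (S, i) *\<^sub>R \<phi> S i x) = (\<Sum>j\<in>?D. c j *\<^sub>R q j x)"
        using elim(1) by (intro sum.cong) (auto simp: case_prod_unfold)
      then show ?case using elim(2) by (simp add: sum_fun_apply scaleR_fun_def)
    qed
    then have "\<phi>' S0 i0 Q = \<phi>' S0 i0 (\<Sum>j\<in>?D. c j *\<^sub>R q j)"
      unfolding T0_def by (rule functionals_cong[OF func[OF S0]])
    also have "\<dots> = (\<Sum>j\<in>?D. c j * \<phi>' S0 i0 (q j))"
      by (rule functionals_sum[OF tri S0(1) func[OF S0] finD q(1)])
    also have "\<dots> = (\<Sum>j\<in>?D. if j = (S0, i0) then c j else 0)"
    proof (rule sum.cong)
      fix j assume j: "j \<in> ?D"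
      have "\<phi>' S0 i0 (\<phi> (fst j) (snd j)) = \<phi>' S0 i0 (q j)"
        using q(2)[OF j] unfolding T0_def by (rule functionals_cong[OF func[OF S0]])
      moreover have "\<phi>' S0 i0 (\<phi> (fst j) (snd j)) = (if j = (S0, i0) then 1 else 0)"
      proof -
        have "fst j \<in> \<T>" "snd j \<in> ?I (fst j)" using j by auto
        from dual[OF S0 this] show ?thesis by (simp only: prod.collapse eq_commute[of "(S0, i0)"])
      qed
      ultimately have "\<phi>' S0 i0 (q j) = (if j = (S0, i0) then 1 else 0)" by simp
      then show "c j * \<phi>' S0 i0 (q j) = (if j = (S0, i0) then c j else 0)" by (cases "j = (S0, i0)") auto
    qed simp
    also have "\<dots> = c (S0, i0)" using finD S0 by simp
    finally show ?thesis by simp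
  qed
  note zero = shape_function_zero[OF tri bio T]
  have "AE x in lebesgue_on T. \<forall>j\<in>?D. \<not> fst j \<subseteq> T \<longrightarrow> \<phi> (fst j) (snd j) x = 0"
  proof (rule AE_finite_allI[OF finD])
    fix j assume j: "j \<in> ?D"
    show "AE x in lebesgue_on T. \<not> fst j \<subseteq> T \<longrightarrow> \<phi> (fst j) (snd j) x = 0"
    proof (cases "fst j \<subseteq> T")
      case False
      have "AE x in lebesgue_on T. \<phi> (fst j) (snd j) x = 0" using j False by (intro zero) auto
      then show ?thesis by (rule eventually_mono) simp
    qed simp
  qed
  moreover have "AE x in lebesgue_on T. Q x = (\<Sum>(S, i)\<in>?D. c (S, i) *\<^sub>R \<phi> S i x)"
    by (rule AE_top_simplex[OF tri T c])
  ultimately show ?thesis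
  proof eventually_elim
    case (elim x)
    have "(\<Sum>(S, i)\<in>?D. c (S, i) *\<^sub>R \<phi> S i x) =
        (\<Sum>(S, i)\<in>(SIGMA S:{S\<in>\<T>. S \<subseteq> T}. ?I S). c (S, i) *\<^sub>R \<phi> S i x)"
    proof (intro sum.mono_neutral_right finD ballI)
      fix j assume "j \<in> ?D - (SIGMA S:{S\<in>\<T>. S \<subseteq> T}. ?I S)"
      then have "j \<in> ?D" "\<not> fst j \<subseteq> T" by auto
      then have "\<phi> (fst j) (snd j) x = 0" using elim(1) by blast
      then show "(case j of (S, i) \<Rightarrow> c (S, i) *\<^sub>R \<phi> S i x) = 0" by (simp add: case_prod_unfold)
    qed auto
    also have "\<dots> = (\<Sum>(S, i)\<in>(SIGMA S:{S\<in>\<T>. S \<subseteq> T}. ?I S). \<phi>' S i Q *\<^sub>R \<phi> S i x)"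
      by (intro sum.cong) (auto simp: coeff)
    finally show ?case using elim(2) by simp
  qed
qed

section \<open>Geometry of the triangulation\<close>

lemma triangulates_Int_face:
  assumes "triangulates \<T> \<Omega>" "S \<in> \<T>" "T \<in> \<T>" "S \<subseteq> T"
  shows "S face_of T"
proof -
  have "simplicial_complex (insert {} \<T>)" using assms(1) by (simp add: triangulates_def)
  then have "(T \<inter> S) face_of T" using assms unfolding simplicial_complex_def by blast
  then show ?thesis using assms(4) by (simp add: Int_absorb1)
qed

lemma triangulates_face:
  assumes "triangulates \<T> \<Omega>" "T \<in> \<T>" "F face_of T" "F \<noteq> {}"
  shows "F \<in> \<T>"
proof -
  have "simplicial_complex (insert {} \<T>)" using assms(1) by (simp add: triangulates_def)
  then have "F \<in> insert {} \<T>" using assms unfolding simplicial_complex_def by blast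
  then show ?thesis using assms(4) by simp
qed

text \<open>Every simplex contained in \<open>T\<close> is a face of it, hence the convex hull of a
  subset of its n + 1 vertices.\<close>

lemma card_faces_le:
  fixes T :: "'a::euclidean_space set"
  assumes tri: "triangulates \<T> \<Omega>" and T: "T \<in> top_simplices \<T>"
  shows "card {S \<in> \<T>. S \<subseteq> T} \<le> 2 ^ (DIM('a) + 1)"
proof -
  note T' = top_simplicesD[OF T]
  obtain C where C: "finite C" "\<not> affine_dependent C" "T = convex hull C" "int (card C) = aff_dim T + 1"
    using triangulates_simplex[OF tri T'(1)] by metis
  have "{S \<in> \<T>. S \<subseteq> T} \<subseteq> (\<lambda>c. convex hull c) ` Pow C"
  proof
    fix S assume "S \<in> {S \<in> \<T>. S \<subseteq> T}"
    then have "S face_of convex hull C" using triangulates_Int_face[OF tri _ T'(1)] C(3) by auto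
    then obtain c where "c \<subseteq> C" "S = convex hull c"
      using face_of_convex_hull_affine_independent[OF C(2)] by auto
    then show "S \<in> (\<lambda>c. convex hull c) ` Pow C" by blast
  qed
  then have "card {S \<in> \<T>. S \<subseteq> T} \<le> card ((\<lambda>c. convex hull c) ` Pow C)"
    using C(1) by (intro card_mono) auto
  also have "\<dots> \<le> card (Pow C)" using C(1) by (intro card_image_le) auto
  also have "\<dots> = 2 ^ card C" using C(1) by (rule card_Pow)
  also have "card C = DIM('a) + 1" using C(4) T'(2) by simp
  finally show ?thesis .
qed

lemma mesh_size_top:
  fixes T :: "'a::euclidean_space set"
  assumes tri: "triangulates \<T> \<Omega>" and T: "T \<in> top_simplices \<T>"
  shows "mesh_size \<T> T = diameter T" "0 < diameter T"
proof -
  note T' = top_simplicesD[OF T]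
  have "aff_dim T \<noteq> 0" using T'(2) by simp
  then show "mesh_size \<T> T = diameter T" by (simp add: mesh_size_def)
  obtain y where "y \<in> interior T" using top_simplex_interior[OF tri T] by blast
  then obtain e where e: "0 < e" "ball y e \<subseteq> T" by (auto simp: mem_interior)
  obtain b :: 'a where b: "b \<in> Basis" using nonempty_Basis by blast
  have "y \<in> T" "y + (e / 2) *\<^sub>R b \<in> T" using e b by (auto intro!: subsetD[OF e(2)] simp: dist_norm)
  moreover have "bounded T" using triangulates_compact[OF tri T'(1)] by (rule compact_imp_bounded)
  ultimately have "dist y (y + (e / 2) *\<^sub>R b) \<le> diameter T" by (intro diameter_bounded_bound)
  then show "0 < diameter T" using e b by (simp add: dist_norm)
qed

text \<open>The projection estimates come with powers of the size of \<open>S\<close>; for m \<ge> 0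
  these may now be replaced by powers of the size of \<open>T\<close>. Only a vertex requires an
  argument: its size is a minimum over adjacent edges, one of which joins it to another vertex of
  \<open>T\<close>.\<close>

lemma mesh_size_mono:
  fixes T :: "'a::euclidean_space set"
  assumes tri: "triangulates \<T> \<Omega>" and T: "T \<in> top_simplices \<T>" and S: "S \<in> \<T>" "S \<subseteq> T"
  shows "0 \<le> mesh_size \<T> S" "mesh_size \<T> S \<le> mesh_size \<T> T"
proof -
  note T' = top_simplicesD[OF T]
  have bd: "bounded E" if "E \<in> \<T>" for E using triangulates_compact[OF tri that] by (rule compact_imp_bounded)
  have "0 \<le> mesh_size \<T> S \<and> mesh_size \<T> S \<le> diameter T"
  proof (cases "aff_dim S = 0")
    case False
    then show ?thesis using S bd[OF T'(1)] bd[OF S(1)]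
      by (auto simp: mesh_size_def intro: diameter_subset diameter_ge_0)
  next
    case True
    then obtain a where a: "S = {a}" by (auto simp: aff_dim_eq_0)
    obtain C where C: "finite C" "\<not> affine_dependent C" "T = convex hull C" "int (card C) = aff_dim T + 1"
      using triangulates_simplex[OF tri T'(1)] by metis
    have "{a} face_of convex hull C" using triangulates_Int_face[OF tri S(1) T'(1) S(2)] a C(3) by simp
    then have aC: "a \<in> C" using extreme_point_of_convex_hull by (auto simp: face_of_singleton)
    have "card C = Suc DIM('a)" using C(4) T'(2) by simp
    then have "C \<noteq> {a}" using DIM_positive[where 'a = 'a] by auto
    then obtain w where w: "w \<in> C" "w \<noteq> a" using aC by blast
    define E where "E = convex hull {a, w}"
    have "{a, w} \<subseteq> C" using aC w by simp
    then have "E face_of T" unfolding C(3) E_def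
      by (subst face_of_convex_hull_affine_independent[OF C(2)]) blast
    moreover have aE: "a \<in> E" unfolding E_def by (rule hull_inc) simp
    ultimately have E: "E \<in> \<T>" "E \<subseteq> T"
      using triangulates_face[OF tri T'(1)] face_of_imp_subset by blast+
    have "aff_dim E = 1" using w by (simp add: E_def aff_dim_convex_hull aff_dim_2)
    then have mem: "diameter E \<in> {diameter E | E. E \<in> \<T> \<and> aff_dim E = 1 \<and> S \<subseteq> E}" using E aE a by blast
    have fin: "finite {diameter E | E. E \<in> \<T> \<and> aff_dim E = 1 \<and> S \<subseteq> E}"
      using triangulates_finite[OF tri] by (rule_tac finite_subset[of _ "diameter ` \<T>"]) auto
    have "mesh_size \<T> S \<le> diameter E" using True fin mem by (simp add: mesh_size_def Min_le)
    also have "\<dots> \<le> diameter T" using E bd[OF T'(1)] by (intro diameter_subset)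
    finally have "mesh_size \<T> S \<le> diameter T" .
    moreover have "Min {diameter E | E. E \<in> \<T> \<and> aff_dim E = 1 \<and> S \<subseteq> E} \<in> {diameter E | E. E \<in> \<T> \<and> aff_dim E = 1 \<and> S \<subseteq> E}"
      using fin mem by (intro Min_in) auto
    then obtain E' where "E' \<in> \<T>" "mesh_size \<T> S = diameter E'" using True by (auto simp: mesh_size_def)
    then have "0 \<le> mesh_size \<T> S" using diameter_ge_0[OF bd] by simp
    ultimately show ?thesis by simp
  qed
  then show "0 \<le> mesh_size \<T> S" "mesh_size \<T> S \<le> mesh_size \<T> T"
    by (simp_all add: mesh_size_top[OF tri T])
qed

lemma
  fixes T :: "'a::euclidean_space set"
  assumes tri: "triangulates \<T> \<Omega>" and T: "T \<in> top_simplices \<T>" and S: "S \<in> \<T>" "S \<subseteq> T"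
  shows patch_superset: "T \<subseteq> patch \<T> S"
    and patch_subset_star_patch: "patch \<T> S \<subseteq> star_patch \<T> T"
    and patch_lebesgue: "patch \<T> S \<in> sets lebesgue"
    and star_patch_interior: "interior (star_patch \<T> T) \<subseteq> \<Omega>"
    and interior_subset_star_patch: "interior T \<subseteq> interior (star_patch \<T> T)"
proof -
  show p: "T \<subseteq> patch \<T> S" using T S by (auto simp: patch_def)
  show s: "patch \<T> S \<subseteq> star_patch \<T> T"
    using triangulates_nonempty[OF tri S(1)] S(2) by (fastforce simp: patch_def star_patch_def)
  have "finite {T \<in> top_simplices \<T>. S \<subseteq> T}"
    using triangulates_finite[OF tri] by (auto simp: top_simplices_def)
  moreover have "closed T'" if "T' \<in> top_simplices \<T>" for T'
    using triangulates_compact[OF tri top_simplicesD(1)[OF that]] by (rule compact_imp_closed)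
  ultimately have "closed (patch \<T> S)" unfolding patch_def by (intro closed_Union) auto
  then show "patch \<T> S \<in> sets lebesgue" by simp
  have "star_patch \<T> T \<subseteq> \<Union>\<T>" by (auto simp: star_patch_def top_simplices_def)
  then show "interior (star_patch \<T> T) \<subseteq> \<Omega>" using tri interior_mono by (auto simp: triangulates_def)
  show "interior T \<subseteq> interior (star_patch \<T> T)" using p s by (intro interior_mono) auto
qed

section \<open>Comparison of chart volume with Lebesgue measure\<close>

lemma nn_integral_lborel_shift:
  fixes f :: "'a::euclidean_space \<Rightarrow> ennreal"
  assumes "f \<in> borel_measurable borel"
  shows "(\<integral>\<^sup>+x. f (c + x) \<partial>lborel) = (\<integral>\<^sup>+x. f x \<partial>lborel)"
proof -
  have "(\<integral>\<^sup>+x. f x \<partial>lborel) = (\<integral>\<^sup>+x. f x \<partial>distr lborel borel ((+) c))" by (simp add: lborel_distr_plus)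
  also have "\<dots> = (\<integral>\<^sup>+x. f (c + x) \<partial>lborel)" using assms by (subst nn_integral_distr) auto
  finally show ?thesis by simp
qed

lemma nn_integral_lborel_reflect:
  fixes f :: "'a::euclidean_space \<Rightarrow> ennreal"
  assumes "f \<in> borel_measurable borel"
  shows "(\<integral>\<^sup>+x. f (c - x) \<partial>lborel) = (\<integral>\<^sup>+x. f x \<partial>lborel)"
proof -
  have "distr lborel borel uminus = (lborel :: 'a measure)"
    using lborel_affine[of "- 1" "0 :: 'a"] by (simp add: density_1)
  then have "(\<integral>\<^sup>+x. f (c + x) \<partial>lborel) = (\<integral>\<^sup>+x. f (c + x) \<partial>distr lborel borel uminus)" by simp
  also have "\<dots> = (\<integral>\<^sup>+x. f (c - x) \<partial>lborel)" using assms by (subst nn_integral_distr) auto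
  finally show ?thesis using nn_integral_lborel_shift[OF assms, of c] by simp
qed

lemma PiM_lborel_shift:
  fixes s :: "nat \<Rightarrow> real" and n :: nat
  defines "M \<equiv> \<Pi>\<^sub>M i\<in>{..<n}. lborel :: (nat \<Rightarrow> real) measure"
  shows "distr M M (\<lambda>t. \<lambda>i\<in>{..<n}. t i + s i) = M"
proof -
  interpret product_sigma_finite "\<lambda>_::nat. lborel :: real measure" by standard
  have m: "(\<lambda>t. \<lambda>i\<in>{..<n}. t i + s i) \<in> M \<rightarrow>\<^sub>M M"
    unfolding M_def by (intro measurable_restrict borel_measurable_add) auto
  show ?thesis
    unfolding M_def
  proof (rule PiM_eqI)
    fix A :: "nat \<Rightarrow> real set" assume A: "\<And>i. i \<in> {..<n} \<Longrightarrow> A i \<in> sets lborel"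
    have "emeasure (distr M M (\<lambda>t. \<lambda>i\<in>{..<n}. t i + s i)) (PiE {..<n} A) =
        emeasure M ((\<lambda>t. \<lambda>i\<in>{..<n}. t i + s i) -` PiE {..<n} A \<inter> space M)"
      using A m by (intro emeasure_distr) (auto simp: M_def intro!: sets_PiM_I_finite)
    also have "(\<lambda>t. \<lambda>i\<in>{..<n}. t i + s i) -` PiE {..<n} A \<inter> space M = PiE {..<n} (\<lambda>i. (\<lambda>x. x + s i) -` A i)"
      by (auto simp: M_def space_PiM PiE_def Pi_def)
    also have "emeasure M \<dots> = (\<Prod>i<n. emeasure lborel ((\<lambda>x. x + s i) -` A i))"
      unfolding M_def
    proof (rule emeasure_PiM)
      fix i assume "i \<in> {..<n}"
      then show "(\<lambda>x. x + s i) -` A i \<in> sets lborel"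
        using measurable_sets_borel[of "\<lambda>x. x + s i" borel "A i"] A by simp
    qed simp
    also have "\<dots> = (\<Prod>i<n. emeasure lborel (A i))"
    proof (rule prod.cong)
      fix i assume i: "i \<in> {..<n}"
      have "emeasure lborel (A i) = emeasure (distr lborel borel ((+) (s i))) (A i)" by (simp add: lborel_distr_plus)
      also have "\<dots> = emeasure lborel ((\<lambda>x. x + s i) -` A i)"
        using A[OF i] by (subst emeasure_distr) (auto simp: add.commute vimage_def)
      finally show "emeasure lborel ((\<lambda>x. x + s i) -` A i) = emeasure lborel (A i)" by simp
    qed simp
    finally show "emeasure (distr (Pi\<^sub>M {..<n} (\<lambda>_. lborel)) (Pi\<^sub>M {..<n} (\<lambda>_. lborel)) (\<lambda>t. \<lambda>i\<in>{..<n}. t i + s i))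
        (PiE {..<n} A) = (\<Prod>i\<in>{..<n}. emeasure lborel (A i))" unfolding M_def .
  qed auto
qed

text \<open>Uniqueness of translation invariant measures: the integral of
  \<open>1\<^sub>A(chart t) 1\<^sub>B(chart t - x)\<close> over both variables is symmetric in \<open>A\<close> and \<open>B\<close>.\<close>

lemma chart_measure_lborel_symmetry:
  fixes T :: "'a::euclidean_space set"
  assumes T: "T \<noteq> {}" "aff_dim T = int DIM('a)" and A: "A \<in> sets borel" and B: "B \<in> sets borel"
  shows "emeasure (chart_measure T) {t \<in> space (chart_measure T). chart T t \<in> A} * emeasure lborel B =
    emeasure (chart_measure T) {t \<in> space (chart_measure T). chart T t \<in> B} * emeasure lborel A"
proof -
  let ?M = "chart_measure T" and ?n = "length (frame T)" and ?c = "chart T"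
  let ?iA = "indicator A :: 'a \<Rightarrow> ennreal" and ?iB = "indicator B :: 'a \<Rightarrow> ennreal"
  interpret M: finite_product_sigma_finite "\<lambda>_::nat. lborel :: real measure" "{..<?n}" by standard auto
  interpret pair_sigma_finite ?M "lborel :: 'a measure"
    unfolding chart_measure_def using M.sigma_finite_measure_axioms lborel.sigma_finite_measure_axioms
    by (intro pair_sigma_finite.intro) auto
  have iA[measurable]: "?iA \<in> borel_measurable borel" and iB[measurable]: "?iB \<in> borel_measurable borel"
    using A B by auto
  note f = frame_properties[OF T(1)]
  have "span (set (frame T)) = UNIV" using f(5) direction_space_UNIV[OF T] by simp
  then have ex: "\<exists>s. x = (\<Sum>i<?n. s i *\<^sub>R frame T ! i)" for x
  proof -
    have "x \<in> span (set (frame T))" using \<open>span (set (frame T)) = UNIV\<close> by simp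
    then obtain u where "x = (\<Sum>e\<in>set (frame T). u e *\<^sub>R e)" by (auto simp: span_finite)
    also have "set (frame T) = (\<lambda>i. frame T ! i) ` {..<?n}" by (auto simp: set_conv_nth)
    also have "(\<Sum>e\<in>\<dots>. u e *\<^sub>R e) = (\<Sum>i<?n. u (frame T ! i) *\<^sub>R frame T ! i)"
      using f(2) by (subst sum.reindex) (auto simp: inj_on_def nth_eq_iff_index_eq)
    finally show ?thesis by (intro exI[of _ "\<lambda>i. u (frame T ! i)"])
  qed
  \<comment> \<open>The frame spans the whole space, so translating by x amounts to shifting the
    chart coordinates by the coefficients of x, which leaves the product measure invariant.\<close>
  have shift: "(\<integral>\<^sup>+t. ?iA (?c t) * ?iB (?c t - x) \<partial>?M) = (\<integral>\<^sup>+t. ?iA (?c t + x) * ?iB (?c t) \<partial>?M)" for x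
  proof -
    obtain s where s: "x = (\<Sum>i<?n. s i *\<^sub>R frame T ! i)" using ex by blast
    let ?h = "\<lambda>t. \<lambda>i\<in>{..<?n}. t i + s i"
    have c: "?c (?h t) = ?c t + x" for t
      by (simp add: chart_def s scaleR_add_left sum.distrib)
    have m: "?h \<in> ?M \<rightarrow>\<^sub>M ?M"
      unfolding chart_measure_def by (intro measurable_restrict borel_measurable_add) auto
    have "(\<integral>\<^sup>+t. ?iA (?c t) * ?iB (?c t - x) \<partial>?M) = (\<integral>\<^sup>+t. ?iA (?c t) * ?iB (?c t - x) \<partial>distr ?M ?M ?h)"
      unfolding chart_measure_def by (simp only: PiM_lborel_shift)
    also have "\<dots> = (\<integral>\<^sup>+t. ?iA (?c (?h t)) * ?iB (?c (?h t) - x) \<partial>?M)"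
      by (rule nn_integral_distr[OF m]) measurable
    finally show ?thesis by (simp add: c)
  qed
  have em: "emeasure ?M {t \<in> space ?M. ?c t \<in> X} = (\<integral>\<^sup>+t. indicator X (?c t) \<partial>?M)" if "X \<in> sets borel" for X
  proof -
    have "{t \<in> space ?M. ?c t \<in> X} \<in> sets ?M" using that by measurable
    then have "emeasure ?M {t \<in> space ?M. ?c t \<in> X} = (\<integral>\<^sup>+t. indicator {t \<in> space ?M. ?c t \<in> X} t \<partial>?M)" by simp
    also have "\<dots> = (\<integral>\<^sup>+t. indicator X (?c t) \<partial>?M)" by (intro nn_integral_cong) (auto simp: indicator_def)
    finally show ?thesis .
  qed
  have "emeasure ?M {t \<in> space ?M. ?c t \<in> A} * emeasure lborel B = (\<integral>\<^sup>+t. ?iA (?c t) * emeasure lborel B \<partial>?M)"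
    using em[OF A] by (simp add: nn_integral_multc)
  \<comment> \<open>For fixed t the substitution x \<mapsto> chart t - x turns the inner integral of
    the indicator of \<open>B\<close> into the Lebesgue measure of \<open>B\<close>.\<close>
  also have "\<dots> = (\<integral>\<^sup>+t. \<integral>\<^sup>+x. ?iA (?c t) * ?iB (?c t - x) \<partial>lborel \<partial>?M)"
    using nn_integral_lborel_reflect[OF iB] B by (simp add: nn_integral_cmult)
  also have "\<dots> = (\<integral>\<^sup>+x. \<integral>\<^sup>+t. ?iA (?c t) * ?iB (?c t - x) \<partial>?M \<partial>lborel)"
    by (rule Fubini'[symmetric]) measurable
  also have "\<dots> = (\<integral>\<^sup>+x. \<integral>\<^sup>+t. ?iA (?c t + x) * ?iB (?c t) \<partial>?M \<partial>lborel)"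
    by (simp only: shift)
  also have "\<dots> = (\<integral>\<^sup>+t. \<integral>\<^sup>+x. ?iA (?c t + x) * ?iB (?c t) \<partial>lborel \<partial>?M)"
    by (rule Fubini') measurable
  also have "\<dots> = (\<integral>\<^sup>+t. ?iB (?c t) * emeasure lborel A \<partial>?M)"
    using nn_integral_lborel_shift[OF iA] A by (simp add: nn_integral_cmult mult.commute)
  also have "\<dots> = emeasure ?M {t \<in> space ?M. ?c t \<in> B} * emeasure lborel A"
    using em[OF B] by (simp add: nn_integral_multc)
  finally show ?thesis .
qed

text \<open>The symmetry is applied to \<open>T\<close> and to the set \<open>B\<close> of points
  with chart coordinates in [0,1], which has chart measure 1. \<open>B\<close> contains a ball of
  radius 1/2, so its Lebesgue measure is at least \<open>c1\<close>; this one-sided comparison is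
  all that bounding the diameter requires.\<close>

lemma simplex_volume_lebesgue:
  fixes T :: "'a::euclidean_space set"
  defines "c1 \<equiv> measure lborel (ball (0::'a) (1 / 2))"
  assumes T: "T \<noteq> {}" "aff_dim T = int DIM('a)" "compact T" and pos: "0 < measure lebesgue T"
  shows "0 < simplex_volume T" "simplex_volume T * c1 \<le> measure lebesgue T"
proof -
  let ?M = "chart_measure T" and ?n = "length (frame T)" and ?a = "SOME x. x \<in> T"
  define B where "B = {x. \<forall>i<?n. (x - ?a) \<bullet> frame T ! i \<in> {0..1}}"
  note f = frame_properties[OF T(1)]
  have nrm: "norm (frame T ! i) = 1" if "i < ?n" for i using f(4) that by simp
  have "B = (\<Inter>i\<in>{..<?n}. {x. (x - ?a) \<bullet> frame T ! i \<in> {0..1}})" by (auto simp: B_def)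
  moreover have "closed {x. (x - ?a) \<bullet> e \<in> {0..1}}" for e
  proof -
    have "{x. (x - ?a) \<bullet> e \<in> {0..1}} = {x. 0 \<le> (x - ?a) \<bullet> e} \<inter> {x. (x - ?a) \<bullet> e \<le> 1}" by auto
    then show ?thesis by (simp only: closed_Int closed_Collect_le continuous_intros)
  qed
  ultimately have "closed B" by (simp only:) (intro closed_INT ballI)
  then have B: "B \<in> sets borel" by simp
  have nuB: "emeasure ?M {t \<in> space ?M. chart T t \<in> B} = 1"
  proof -
    have "{t \<in> space ?M. chart T t \<in> B} = PiE {..<?n} (\<lambda>_. {0..1})"
      using chart_coordinate[OF T(1)] by (auto simp: B_def chart_measure_def space_PiM PiE_def Pi_def)
    then show ?thesis using emeasure_chart_box[of 0 1 T] by simp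
  qed
  have sub: "ball (?a + (\<Sum>i<?n. (1/2) *\<^sub>R frame T ! i)) (1/2) \<subseteq> B"
  proof
    fix x assume x: "x \<in> ball (?a + (\<Sum>i<?n. (1/2) *\<^sub>R frame T ! i)) (1/2)"
    have "(x - ?a) \<bullet> frame T ! i \<in> {0..1}" if i: "i < ?n" for i
    proof -
      have "(\<Sum>j<?n. (1/2) *\<^sub>R frame T ! j) \<bullet> frame T ! i = (\<Sum>j<?n. if j = i then 1/2 else 0)"
        unfolding inner_sum_left using i by (intro sum.cong) (auto simp: frame_inner[OF T(1)])
      then have h: "(\<Sum>j<?n. (1/2) *\<^sub>R frame T ! j) \<bullet> frame T ! i = 1/2" using i by simp
      let ?y = "x - (?a + (\<Sum>i<?n. (1/2) *\<^sub>R frame T ! i))"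
      have "\<bar>?y \<bullet> frame T ! i\<bar> \<le> norm ?y * norm (frame T ! i)" by (rule Cauchy_Schwarz_ineq2)
      also have "\<dots> < 1/2" using x nrm[OF i] by (simp add: dist_norm norm_minus_commute)
      finally have "\<bar>(x - ?a) \<bullet> frame T ! i - 1/2\<bar> < 1/2" using h by (simp add: inner_diff_left inner_add_left algebra_simps)
      then show ?thesis unfolding atLeastAtMost_iff by linarith
    qed
    then show "x \<in> B" by (simp add: B_def)
  qed
  have bc: "emeasure lborel (ball z (1/2)) = ennreal c1" for z :: 'a
  proof -
    have "emeasure lborel (ball z (1/2)) = emeasure lborel (ball (0::'a) (1/2))"
      by (simp add: emeasure_ball)
    moreover have "emeasure lborel (ball (0::'a) (1/2)) \<noteq> \<infinity>"
      using emeasure_bounded_finite[of "ball (0::'a) (1/2)"] by simp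
    ultimately show ?thesis
      using emeasure_eq_ennreal_measure[of lborel "ball (0::'a) (1/2)"] unfolding c1_def by simp
  qed
  have lamB: "ennreal c1 \<le> emeasure lborel B"
    using emeasure_mono[OF sub, of lborel] B bc by simp
  have TB: "T \<in> sets borel" using T(3) by (simp add: compact_imp_closed)
  have lamT: "emeasure lborel T = ennreal (measure lebesgue T)"
    using TB emeasure_compact_finite[OF T(3)] by (simp add: emeasure_eq_ennreal_measure less_top[symmetric] measure_completion)
  have nuT: "emeasure ?M {t \<in> space ?M. chart T t \<in> T} = ennreal (simplex_volume T)"
  proof -
    have "emeasure ?M (chart_domain T) \<noteq> \<infinity>"
      using emeasure_chart_domain[OF T(1) compact_imp_bounded[OF T(3)]] by simp
    then show ?thesis by (simp add: simplex_volume_def emeasure_eq_ennreal_measure chart_domain_def)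
  qed
  have eq: "ennreal (simplex_volume T) * emeasure lborel B = ennreal (measure lebesgue T)"
    using chart_measure_lborel_symmetry[OF T(1,2) TB B] by (simp add: nuT nuB lamT)
  have v0: "0 \<le> simplex_volume T" by (simp add: simplex_volume_def)
  have "simplex_volume T \<noteq> 0" using eq pos by auto
  then show "0 < simplex_volume T" using v0 by simp
  have "ennreal (simplex_volume T) * ennreal c1 \<le> ennreal (measure lebesgue T)"
    using mult_left_mono[OF lamB, of "ennreal (simplex_volume T)"] eq by simp
  then show "simplex_volume T * c1 \<le> measure lebesgue T"
    using v0 by (simp add: ennreal_mult'[symmetric] c1_def)
qed

lemma top_simplex_measure_pos:
  fixes T :: "'a::euclidean_space set"
  assumes tri: "triangulates \<T> \<Omega>" and T: "T \<in> top_simplices \<T>"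
  shows "0 < measure lebesgue T"
proof -
  have c: "compact T" using triangulates_compact[OF tri top_simplicesD(1)[OF T]] .
  have "\<not> negligible T" using top_simplex_interior[OF tri T] negligible_subset[OF _ interior_subset] open_not_negligible[OF open_interior] by blast
  then have "measure lebesgue T \<noteq> 0" using c by (simp add: negligible_iff_measure lmeasurable_compact)
  then show ?thesis by (simp add: zero_less_measure_iff)
qed

text \<open>The shape measure refers to volume in charts. The reciprocal of the measure of a ball of
  radius 1/2 converts it to Lebesgue measure, in which the analytic estimates are phrased.\<close>

lemma shape_measure_volume:
  "\<exists>K>0. \<forall>(\<T> :: 'a::euclidean_space set set) \<Omega> T. triangulates \<T> \<Omega> \<longrightarrow> T \<in> top_simplices \<T> \<longrightarrow>
     diameter T ^ DIM('a) \<le> K * shape_measure \<T> * measure lebesgue T"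
proof -
  define c1 where "c1 = measure lborel (ball (0::'a) (1 / 2))"
  have c1: "0 < c1" unfolding c1_def using content_ball_pos[of "1/2" "0::'a"] by simp
  have "diameter T ^ DIM('a) \<le> (1 / c1) * shape_measure \<T> * measure lebesgue T"
    if tri: "triangulates \<T> \<Omega>" and T: "T \<in> top_simplices \<T>" for \<T> \<Omega> and T :: "'a set"
  proof -
    note T' = top_simplicesD[OF T]
    have v: "0 < simplex_volume T" "simplex_volume T * c1 \<le> measure lebesgue T"
      using simplex_volume_lebesgue[OF triangulates_nonempty[OF tri T'(1)] T'(2) triangulates_compact[OF tri T'(1)]
          top_simplex_measure_pos[OF tri T]] by (simp_all add: c1_def)
    let ?f = "\<lambda>S. diameter S ^ nat (aff_dim S) / simplex_volume S"
    \<comment> \<open>The supremum is taken in the reals, so boundedness has to be supplied; it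
      follows from finiteness of the triangulation.\<close>
    have "?f T \<le> shape_measure \<T>"
      unfolding shape_measure_def
      using triangulates_finite[OF tri] T' DIM_positive[where 'a = 'a]
      by (intro cSUP_upper bdd_above_finite) (auto simp: Suc_le_eq)
    then have "diameter T ^ DIM('a) \<le> shape_measure \<T> * simplex_volume T"
      using v(1) T'(2) by (simp add: divide_le_eq)
    moreover have "0 \<le> shape_measure \<T>"
      using \<open>?f T \<le> shape_measure \<T>\<close> v(1) mesh_size_top(2)[OF tri T]
      by (intro order_trans[OF _ \<open>?f T \<le> shape_measure \<T>\<close>] divide_nonneg_nonneg zero_le_power) auto
    then have "shape_measure \<T> * simplex_volume T \<le> shape_measure \<T> * (measure lebesgue T / c1)"
      using v c1 by (intro mult_left_mono) (auto simp: le_divide_eq)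
    ultimately show ?thesis by simp
  qed
  then show ?thesis using c1 by (intro exI[of _ "1 / c1"]) auto
qed

section \<open>Testing forms against smooth functions\<close>

text \<open>Local integrability speaks of compact subsets only; a countable cover of
  \<open>U\<close> by closed boxes assembles the pieces.\<close>

lemma locally_integrable_measurable:
  fixes f :: "'a::euclidean_space \<Rightarrow> real"
  assumes U: "open U" and f: "locally_integrable U f"
  shows "f \<in> borel_measurable (lebesgue_on U)"
proof -
  obtain D where D: "countable D" "\<And>X. X \<in> D \<Longrightarrow> \<exists>a b. X = cbox a b" "\<Union>D = U"
    using open_countable_Union_open_cbox[OF U] by metis
  show ?thesis
  proof (rule measurable_piecewise_restrict[OF D(1)])
    fix X assume X: "X \<in> D"
    then obtain a b where ab: "X = cbox a b" using D(2) by blast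
    have sub: "X \<subseteq> U" using X D(3) by blast
    show "X \<inter> space (lebesgue_on U) \<in> sets (lebesgue_on U)"
      using U sub ab by (auto simp: sets_restrict_space_iff)
    have "integrable lebesgue (\<lambda>x. indicat_real X x *\<^sub>R f x)"
      using f sub unfolding ab by (auto simp: locally_integrable_def set_integrable_def)
    then have "(\<lambda>x. indicat_real X x *\<^sub>R f x) \<in> borel_measurable lebesgue" by simp
    moreover have "(\<lambda>x. indicat_real X x *\<^sub>R f x) = (\<lambda>x. if x \<in> X then f x else 0)"
      by (auto simp: indicator_def)
    ultimately have "f \<in> borel_measurable (lebesgue_on X)" by (intro borel_measurable_if_D) simp
    moreover have "restrict_space (lebesgue_on U) X = lebesgue_on X"
      using sub U ab by (subst restrict_restrict_space) (auto simp: Int_absorb1)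
    ultimately show "f \<in> borel_measurable (restrict_space (lebesgue_on U) X)" by simp
  qed (use D(3) in auto)
qed

lemma abs_le_alt_norm:
  fixes A :: "'a::euclidean_space list \<Rightarrow> real"
  assumes "set v \<subseteq> Basis" "length v = k"
  shows "\<bar>A v\<bar> \<le> sqrt (fact k) * alt_norm k A"
proof -
  have "(A v)\<^sup>2 \<le> (\<Sum>v | set v \<subseteq> Basis \<and> length v = k. (A v)\<^sup>2)"
    using assms by (intro member_le_sum finite_Basis_lists) auto
  also have "\<dots> = fact k * ((\<Sum>v | set v \<subseteq> Basis \<and> length v = k. (A v)\<^sup>2) / fact k)" by simp
  finally have "sqrt ((A v)\<^sup>2) \<le> sqrt (fact k * ((\<Sum>v | set v \<subseteq> Basis \<and> length v = k. (A v)\<^sup>2) / fact k))"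
    by (rule real_sqrt_le_mono)
  then show ?thesis unfolding alt_norm_def by (simp only: real_sqrt_abs real_sqrt_mult)
qed

lemma alt_norm_le_sum:
  fixes A :: "'a::euclidean_space list \<Rightarrow> real"
  shows "alt_norm k A \<le> (\<Sum>v | set v \<subseteq> Basis \<and> length v = k. \<bar>A v\<bar>)"
proof -
  let ?L = "{v. set v \<subseteq> (Basis :: 'a set) \<and> length v = k}"
  have "alt_norm k A \<le> sqrt (\<Sum>v\<in>?L. (A v)\<^sup>2)"
  proof -
    have "(\<Sum>v\<in>?L. (A v)\<^sup>2) / fact k \<le> (\<Sum>v\<in>?L. (A v)\<^sup>2) / 1"
      by (intro divide_left_mono) (auto simp: sum_nonneg fact_ge_1)
    then show ?thesis unfolding alt_norm_def by simp
  qed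
  also have "\<dots> = L2_set A ?L" by (simp add: L2_set_def)
  also have "\<dots> \<le> (\<Sum>v\<in>?L. \<bar>A v\<bar>)" by (rule L2_set_le_sum_abs)
  finally show ?thesis .
qed

lemma alt_norm_measurable:
  fixes \<omega> :: "'a::euclidean_space form"
  assumes "\<And>v. (\<lambda>x. \<omega> x v) \<in> borel_measurable M"
  shows "(\<lambda>x. alt_norm k (\<omega> x)) \<in> borel_measurable M"
  unfolding alt_norm_def using assms by measurable

lemma abs_LINT_test_fun_le:
  fixes f :: "'a::euclidean_space \<Rightarrow> real"
  assumes D: "open D" "D \<subseteq> U" "U \<in> sets lebesgue" and \<psi>: "test_fun D \<psi>" "\<And>x. \<bar>\<psi> x\<bar> \<le> M" and M: "0 \<le> M"
    and f: "f \<in> borel_measurable (lebesgue_on D)"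
  shows "ennreal \<bar>LINT x:U|lebesgue. f x * \<psi> x\<bar> \<le> ennreal M * (\<integral>\<^sup>+x. ennreal \<bar>f x\<bar> \<partial>lebesgue_on D)"
proof -
  have "ennreal \<bar>LINT x:U|lebesgue. f x * \<psi> x\<bar> \<le> (\<integral>\<^sup>+x. ennreal (norm (indicat_real U x *\<^sub>R (f x * \<psi> x))) \<partial>lebesgue)"
  proof (cases "integrable lebesgue (\<lambda>x. indicat_real U x *\<^sub>R (f x * \<psi> x))")
    case True
    have "\<bar>LINT x:U|lebesgue. f x * \<psi> x\<bar> \<le> (\<integral>x. norm (indicat_real U x *\<^sub>R (f x * \<psi> x)) \<partial>lebesgue)"
      unfolding set_lebesgue_integral_def using integral_norm_bound[of lebesgue "\<lambda>x. indicat_real U x *\<^sub>R (f x * \<psi> x)"] by simp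
    then have "ennreal \<bar>LINT x:U|lebesgue. f x * \<psi> x\<bar> \<le> ennreal (\<integral>x. norm (indicat_real U x *\<^sub>R (f x * \<psi> x)) \<partial>lebesgue)"
      by (rule ennreal_leI)
    also have "\<dots> = (\<integral>\<^sup>+x. ennreal (norm (indicat_real U x *\<^sub>R (f x * \<psi> x))) \<partial>lebesgue)"
      using True by (intro nn_integral_eq_integral[symmetric] integrable_norm) auto
    finally show ?thesis .
  next
    case False
    then show ?thesis unfolding set_lebesgue_integral_def by (simp add: not_integrable_integral_eq)
  qed
  also have "\<dots> \<le> (\<integral>\<^sup>+x. ennreal (M * \<bar>f x\<bar>) * indicator D x \<partial>lebesgue)"
  proof (rule nn_integral_mono)
    fix x
    show "ennreal (norm (indicat_real U x *\<^sub>R (f x * \<psi> x))) \<le> ennreal (M * \<bar>f x\<bar>) * indicator D x"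
    proof (cases "x \<in> D")
      case True
      have "\<bar>f x\<bar> * \<bar>\<psi> x\<bar> \<le> \<bar>f x\<bar> * M" using \<psi>(2) by (intro mult_left_mono) auto
      then show ?thesis using True M D(2) by (auto simp: indicator_def abs_mult mult.commute intro!: ennreal_leI)
    next
      case False
      then show ?thesis using test_fun_eq_0[OF \<psi>(1)] by simp
    qed
  qed
  also have "\<dots> = (\<integral>\<^sup>+x. ennreal (M * \<bar>f x\<bar>) \<partial>lebesgue_on D)"
    using D by (subst nn_integral_restrict_space) auto
  also have "\<dots> \<le> ennreal M * (\<integral>\<^sup>+x. ennreal \<bar>f x\<bar> \<partial>lebesgue_on D)"
    using f M by (simp add: ennreal_mult' nn_integral_cmult)
  finally show ?thesis .
qed

text \<open>Hoelder's inequality on \<open>D\<close>, which contains the support of \<psi>. The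
  factor \<open>sqrt (fact k)\<close> compensates the division by k! inside
  \<open>alt_norm\<close>.\<close>

lemma LINT_test_fun_le_Lp_norm:
  fixes \<eta> :: "'a::euclidean_space form"
  assumes p: "1 \<le> p" and D: "open D" "D \<subseteq> U" "U \<in> sets lebesgue"
    and V: "emeasure lebesgue D = ennreal V" "0 < V"
    and \<eta>: "\<And>v. (\<lambda>x. \<eta> x v) \<in> borel_measurable (lebesgue_on D)"
    and \<psi>: "test_fun D \<psi>" "\<And>x. \<bar>\<psi> x\<bar> \<le> M" and M: "0 \<le> M" and v: "set v \<subseteq> Basis" "length v = k"
  shows "ennreal \<bar>LINT x:U|lebesgue. \<eta> x v * \<psi> x\<bar> \<le>
    ennreal (2 * M * sqrt (fact k) * V powr (1 - recip p)) * Lp_norm p k D \<eta>"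
proof -
  have sp: "emeasure (lebesgue_on D) (space (lebesgue_on D)) = ennreal V"
    using V(1) D(1) by (simp add: emeasure_restrict_space)
  have m: "(\<lambda>x. \<bar>\<eta> x v\<bar>) \<in> borel_measurable (lebesgue_on D)" using \<eta>[of v] by measurable
  have "ennreal \<bar>LINT x:U|lebesgue. \<eta> x v * \<psi> x\<bar> \<le> ennreal M * (\<integral>\<^sup>+x. ennreal \<bar>\<eta> x v\<bar> \<partial>lebesgue_on D)"
    by (rule abs_LINT_test_fun_le[OF D \<psi> M \<eta>])
  also have "(\<integral>\<^sup>+x. ennreal \<bar>\<eta> x v\<bar> \<partial>lebesgue_on D) \<le>
      ennreal (2 * V powr (1 - recip p)) * lpnorm p (lebesgue_on D) (\<lambda>x. \<bar>\<eta> x v\<bar>)"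
    by (rule nn_integral_le_lpnorm[OF p m _ sp V(2)]) simp
  also have "lpnorm p (lebesgue_on D) (\<lambda>x. \<bar>\<eta> x v\<bar>) \<le> ennreal (sqrt (fact k)) * lpnorm p (lebesgue_on D) (\<lambda>x. alt_norm k (\<eta> x))"
    using abs_le_alt_norm[OF v] by (intro lpnorm_mono_AE[OF p m]) (auto simp: alt_norm_nonneg)
  finally have "ennreal \<bar>LINT x:U|lebesgue. \<eta> x v * \<psi> x\<bar> \<le> ennreal M * (ennreal (2 * V powr (1 - recip p)) *
      (ennreal (sqrt (fact k)) * Lp_norm p k D \<eta>))"
    by (simp add: mult_left_mono Lp_norm_eq_lpnorm)
  also have "\<dots> = ennreal (M * (2 * V powr (1 - recip p)) * sqrt (fact k)) * Lp_norm p k D \<eta>"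
    using M by (simp add: ennreal_mult' mult.assoc)
  also have "M * (2 * V powr (1 - recip p)) * sqrt (fact k) = 2 * M * sqrt (fact k) * V powr (1 - recip p)" by simp
  finally show ?thesis .
qed

text \<open>Here the vanishing mean of \<open>\<psi>\<close> allows subtracting \<open>\<eta> y\<close> from \<open>\<eta> x\<close> and averaging over \<open>y\<close>.\<close>

lemma LINT_test_fun_le_slobodeckij:
  fixes \<eta> :: "'a::euclidean_space form"
  assumes p: "1 \<le> p" and D: "open D" "D \<subseteq> U" "U \<in> sets lebesgue"
    and V: "emeasure lebesgue D = ennreal V" "0 < V"
    and \<eta>: "\<And>v. locally_integrable U (\<lambda>x. \<eta> x v)"
    and \<psi>: "test_fun D \<psi>" "\<And>x. \<bar>\<psi> x\<bar> \<le> M" and M: "0 \<le> M" and v: "set v \<subseteq> Basis" "length v = k"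
    and mean: "(\<integral>x. \<psi> x \<partial>lborel) = 0"
    and h: "0 < h" "\<And>x y. x \<in> D \<Longrightarrow> y \<in> D \<Longrightarrow> norm (x - y) \<le> h" and \<theta>: "0 \<le> \<theta>"
  shows "ennreal \<bar>LINT x:U|lebesgue. \<eta> x v * \<psi> x\<bar> \<le>
    ennreal (2 * M * sqrt (fact k) * h powr (real DIM('a) * recip p + \<theta>) * V powr (1 - 2 * recip p)) *
      slobodeckij \<theta> p k D \<eta>"
proof -
  let ?f = "\<lambda>x. \<eta> x v" and ?e = "real DIM('a) * recip p + \<theta>"
  let ?I = "LINT x:U|lebesgue. ?f x * \<psi> x"
  let ?G = "\<lambda>z. alt_norm k (\<eta> (fst z) - \<eta> (snd z)) / norm (fst z - snd z) powr ?e"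
  have e0: "0 \<le> ?e" using recip_bounds[OF p] \<theta> by simp
  have \<psi>U: "test_fun U \<psi>" using \<psi>(1) D(2) by (rule test_fun_mono)
  have fD: "?f \<in> borel_measurable (lebesgue_on D)"
    using D(1) locally_integrable_mono[OF \<eta> D(2)] by (rule locally_integrable_measurable)
  have "(\<lambda>x. if x \<in> D then ?f x else 0) \<in> borel_measurable (completion lborel)"
    using fD D(1) by (intro borel_measurable_if_I) auto
  \<comment> \<open>A Borel representative on \<open>D\<close>, so that the iterated integral over
    two points can be rewritten over the product by Tonelli's theorem.\<close>
  then obtain g where g[measurable]: "g \<in> borel_measurable lborel"
    and fg: "AE x in lborel. (if x \<in> D then ?f x else 0) = g x"
    using completion_ex_borel_measurable_real[of "\<lambda>x. if x \<in> D then ?f x else 0" lborel] by blast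
  have Ds[measurable]: "D \<in> sets borel" using D(1) by simp
  have fgD: "AE x in lebesgue_on D. ?f x = g x"
    using AE_completion[OF fg] D(1) by (auto simp: AE_restrict_space_iff elim: eventually_mono)
  have point: "ennreal \<bar>?I\<bar> \<le> ennreal M * (\<integral>\<^sup>+x. ennreal \<bar>g x - g y\<bar> * indicator D x \<partial>lborel)" if "?f y = g y" for y
  proof -
    have "(LINT x:U|lebesgue. \<psi> x) = 0"
      using LINT_test_fun_lborel[OF continuous_on_const[of UNIV 1] \<psi>U] mean by simp
    moreover have c: "locally_integrable U (\<lambda>_. ?f y)" by (intro continuous_locally_integrable continuous_on_const)
    moreover have "(LINT x:U|lebesgue. ?f y * \<psi> x) = ?f y * (LINT x:U|lebesgue. \<psi> x)" by simp
    ultimately have "?I = (LINT x:U|lebesgue. (?f x - ?f y) * \<psi> x)"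
      using \<eta> \<psi>U by (simp add: left_diff_distrib set_integral_diff locally_integrable_test_fun)
    then have "ennreal \<bar>?I\<bar> \<le> ennreal M * (\<integral>\<^sup>+x. ennreal \<bar>?f x - ?f y\<bar> \<partial>lebesgue_on D)"
      using abs_LINT_test_fun_le[OF D \<psi> M, of "\<lambda>x. ?f x - ?f y"] fD by simp
    also have "(\<integral>\<^sup>+x. ennreal \<bar>?f x - ?f y\<bar> \<partial>lebesgue_on D) = (\<integral>\<^sup>+x. ennreal \<bar>g x - g y\<bar> \<partial>lebesgue_on D)"
      using fgD that by (intro nn_integral_cong_AE) (auto elim: eventually_mono)
    also have "\<dots> = (\<integral>\<^sup>+x. ennreal \<bar>g x - g y\<bar> * indicator D x \<partial>lebesgue)"
      using D(1) by (subst nn_integral_restrict_space) auto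
    also have "\<dots> = (\<integral>\<^sup>+x. ennreal \<bar>g x - g y\<bar> * indicator D x \<partial>lborel)"
      by (intro nn_integral_completion) measurable
    finally show ?thesis .
  qed
  have ae: "AE y in lborel. ennreal \<bar>?I\<bar> * indicator D y \<le>
      (ennreal M * (\<integral>\<^sup>+x. ennreal \<bar>g x - g y\<bar> * indicator D x \<partial>lborel)) * indicator D y"
    using fg
  proof eventually_elim
    case (elim y)
    show ?case
    proof (cases "y \<in> D")
      case True
      then show ?thesis using point elim by simp
    qed simp
  qed
  have emD: "emeasure lborel D = ennreal V" using V(1) by simp
  have "ennreal \<bar>?I\<bar> * ennreal V = (\<integral>\<^sup>+y. ennreal \<bar>?I\<bar> * indicator D y \<partial>lborel)"
    using emD by (simp add: nn_integral_cmult)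
  also have "\<dots> \<le> (\<integral>\<^sup>+y. (ennreal M * (\<integral>\<^sup>+x. ennreal \<bar>g x - g y\<bar> * indicator D x \<partial>lborel)) * indicator D y \<partial>lborel)"
    by (rule nn_integral_mono_AE[OF ae])
  also have "\<dots> = ennreal M * (\<integral>\<^sup>+y. \<integral>\<^sup>+x. ennreal \<bar>g x - g y\<bar> * indicator D x * indicator D y \<partial>lborel \<partial>lborel)"
  proof -
    let ?F = "\<lambda>y. \<integral>\<^sup>+x. ennreal \<bar>g x - g y\<bar> * indicator D x \<partial>lborel"
    have "(\<integral>\<^sup>+y. (ennreal M * ?F y) * indicator D y \<partial>lborel) = (\<integral>\<^sup>+y. ennreal M * (?F y * indicator D y) \<partial>lborel)"
      by (simp only: mult.assoc)
    also have "\<dots> = ennreal M * (\<integral>\<^sup>+y. ?F y * indicator D y \<partial>lborel)"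
      by (rule nn_integral_cmult) measurable
    finally show ?thesis by (simp add: nn_integral_multc)
  qed
  also have "(\<integral>\<^sup>+y. \<integral>\<^sup>+x. ennreal \<bar>g x - g y\<bar> * indicator D x * indicator D y \<partial>lborel \<partial>lborel) =
      (\<integral>\<^sup>+z. ennreal \<bar>g (fst z) - g (snd z)\<bar> * indicator (D \<times> D) z \<partial>(lborel \<Otimes>\<^sub>M lborel))"
  proof -
    have "(\<integral>\<^sup>+z. ennreal \<bar>g (fst z) - g (snd z)\<bar> * indicator (D \<times> D) z \<partial>(lborel \<Otimes>\<^sub>M lborel)) =
      (\<integral>\<^sup>+y. \<integral>\<^sup>+x. ennreal \<bar>g (fst (x, y)) - g (snd (x, y))\<bar> * indicator (D \<times> D) (x, y) \<partial>lborel \<partial>lborel)"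
      by (intro lborel_pair.nn_integral_snd[symmetric]) measurable
    then show ?thesis by (simp add: indicator_times mult.assoc)
  qed
  also have "\<dots> = (\<integral>\<^sup>+z. ennreal \<bar>g (fst z) - g (snd z)\<bar> * indicator (D \<times> D) z \<partial>lborel)"
    by (simp add: lborel_prod)
  also have "\<dots> = (\<integral>\<^sup>+z. ennreal \<bar>g (fst z) - g (snd z)\<bar> * indicator (D \<times> D) z \<partial>lebesgue)"
    by (rule nn_integral_completion[symmetric])
  also have "\<dots> = (\<integral>\<^sup>+z. ennreal \<bar>g (fst z) - g (snd z)\<bar> \<partial>lebesgue_on (D \<times> D))"
    using D(1) by (subst nn_integral_restrict_space) (auto simp: open_Times)
  also have "\<dots> \<le> ennreal (2 * (V * V) powr (1 - recip p)) *
      lpnorm p (lebesgue_on (D \<times> D)) (\<lambda>z. \<bar>g (fst z) - g (snd z)\<bar>)"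
  proof (rule nn_integral_le_lpnorm[OF p])
    have "(\<lambda>z. \<bar>g (fst z) - g (snd z)\<bar>) \<in> borel_measurable (lborel :: ('a \<times> 'a) measure)"
      unfolding lborel_prod[symmetric] by measurable
    then show gm: "(\<lambda>z. \<bar>g (fst z) - g (snd z)\<bar>) \<in> borel_measurable (lebesgue_on (D \<times> D))"
      by (intro measurable_restrict_space1 measurable_completion)
    have "emeasure lborel (D \<times> D) = ennreal (V * V)"
      using V(2) emD by (simp add: lborel_prod[symmetric] lborel.emeasure_pair_measure_Times ennreal_mult')
    then show "emeasure (lebesgue_on (D \<times> D)) (space (lebesgue_on (D \<times> D))) = ennreal (V * V)"
      using D(1) by (simp add: emeasure_restrict_space open_Times)
  qed (use V(2) in auto)
  also have "lpnorm p (lebesgue_on (D \<times> D)) (\<lambda>z. \<bar>g (fst z) - g (snd z)\<bar>) \<le>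
      ennreal (sqrt (fact k) * h powr ?e) * lpnorm p (lebesgue_on (D \<times> D)) ?G"
  proof (rule lpnorm_mono_AE[OF p])
    have "(\<lambda>z. \<bar>g (fst z) - g (snd z)\<bar>) \<in> borel_measurable (lborel :: ('a \<times> 'a) measure)"
      unfolding lborel_prod[symmetric] by measurable
    then show "(\<lambda>z. \<bar>g (fst z) - g (snd z)\<bar>) \<in> borel_measurable (lebesgue_on (D \<times> D))"
      by (intro measurable_restrict_space1 measurable_completion)
    have "AE z in lebesgue_on (D \<times> D). z \<in> D \<times> D"
      using D(1) by (simp add: AE_restrict_space_iff open_Times)
    with AE_lebesgue_on_Times[OF D(1) fgD]
    show "AE z in lebesgue_on (D \<times> D). \<bar>g (fst z) - g (snd z)\<bar> \<le> sqrt (fact k) * h powr ?e * ?G z"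
    proof eventually_elim
      case (elim z)
      obtain x y where z: "z = (x, y)" "x \<in> D" "y \<in> D" using elim(2) by (cases z) auto
      have "\<bar>g x - g y\<bar> = \<bar>(\<eta> x - \<eta> y) v\<bar>" using elim(1) z by simp
      also have "\<dots> \<le> sqrt (fact k) * alt_norm k (\<eta> x - \<eta> y)" by (rule abs_le_alt_norm[OF v])
      also have "alt_norm k (\<eta> x - \<eta> y) \<le> h powr ?e * (alt_norm k (\<eta> x - \<eta> y) / norm (x - y) powr ?e)"
      \<comment> \<open>On the diagonal the quotient is 0 by the convention for division by 0, and
        so is the difference on the left.\<close>
      proof (cases "x = y")
        case True
        then show ?thesis by (simp add: alt_norm_def)
      next
        case False
        then have n: "0 < norm (x - y) powr ?e" by simp
        have "norm (x - y) powr ?e \<le> h powr ?e" using h(2)[OF z(2,3)] e0 by (intro powr_mono2) auto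
        then have "alt_norm k (\<eta> x - \<eta> y) * norm (x - y) powr ?e \<le> alt_norm k (\<eta> x - \<eta> y) * h powr ?e"
          by (intro mult_left_mono alt_norm_nonneg)
        then show ?thesis using n by (simp add: le_divide_eq mult.commute)
      qed
      finally show ?case using z by (simp add: mult_left_mono mult.assoc)
    qed
  qed (use h(1) in \<open>auto simp: alt_norm_nonneg\<close>)
  also have "lpnorm p (lebesgue_on (D \<times> D)) ?G = slobodeckij \<theta> p k D \<eta>"
    by (simp add: slobodeckij_eq_lpnorm[OF p] case_prod_unfold)
  finally have "ennreal \<bar>?I\<bar> * ennreal V \<le> ennreal M * (ennreal (2 * (V * V) powr (1 - recip p)) *
      (ennreal (sqrt (fact k) * h powr ?e) * slobodeckij \<theta> p k D \<eta>))"
    by (simp add: mult_left_mono)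
  also have "\<dots> = ennreal (M * (2 * (V * V) powr (1 - recip p)) * (sqrt (fact k) * h powr ?e)) * slobodeckij \<theta> p k D \<eta>"
    using M by (simp add: ennreal_mult' mult.assoc)
  finally have "ennreal (1 / V) * (ennreal \<bar>?I\<bar> * ennreal V) \<le> ennreal (1 / V) *
      (ennreal (M * (2 * (V * V) powr (1 - recip p)) * (sqrt (fact k) * h powr ?e)) * slobodeckij \<theta> p k D \<eta>)"
    by (rule mult_left_mono) simp
  also have "ennreal (1 / V) * (ennreal \<bar>?I\<bar> * ennreal V) = ennreal \<bar>?I\<bar>"
    using V(2) by (simp add: ennreal_mult'[symmetric] mult.commute)
  also have "ennreal (1 / V) *
      (ennreal (M * (2 * (V * V) powr (1 - recip p)) * (sqrt (fact k) * h powr ?e)) * slobodeckij \<theta> p k D \<eta>) =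
      ennreal (1 / V * (M * (2 * (V * V) powr (1 - recip p)) * (sqrt (fact k) * h powr ?e))) * slobodeckij \<theta> p k D \<eta>"
    using V(2) by (subst ennreal_mult') (simp_all add: mult.assoc)
  \<comment> \<open>The power of \<open>V * V\<close> stems from Hoelder's inequality on
    \<open>D \<times> D\<close>, the division by \<open>V\<close> from averaging over y; the
    exponents add up to 2 (1 - 1/p) - 1.\<close>
  also have "1 / V * (M * (2 * (V * V) powr (1 - recip p)) * (sqrt (fact k) * h powr ?e)) =
      2 * M * sqrt (fact k) * h powr ?e * V powr (1 - 2 * recip p)"
  proof -
    have "1 - 2 * recip p = (1 - recip p) + (1 - recip p) + - 1" by simp
    then have "V powr (1 - 2 * recip p) = V powr (1 - recip p) * V powr (1 - recip p) * V powr (- 1)"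
      by (simp only: powr_add)
    moreover have "V powr (- 1) = 1 / V" using V(2) by (simp add: powr_minus_divide)
    moreover have "(V * V) powr (1 - recip p) = V powr (1 - recip p) * V powr (1 - recip p)"
      using V(2) by (simp add: powr_mult)
    ultimately show ?thesis by simp
  qed
  finally show ?thesis .
qed

section \<open>The part of top degree of a polynomial\<close>

text \<open>Iterated derivatives are multilinear in their directions. The expansion is needed
  because weak derivatives are indexed by coordinate directions, while the test functions are
  differentiated along edges.\<close>

lemma foldr_dir_deriv_expansion:
  fixes \<psi> :: "'a::euclidean_space \<Rightarrow> real"
  assumes "smooth \<psi>" "length es = j"
  shows "foldr dir_deriv es \<psi> x = (\<Sum>bs | set bs \<subseteq> Basis \<and> length bs = j. (\<Prod>i<j. es ! i \<bullet> bs ! i) * foldr dir_deriv bs \<psi> x)"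
  using assms(2)
proof (induction j arbitrary: es x)
  case 0
  have "{bs. set bs \<subseteq> (Basis :: 'a set) \<and> length bs = 0} = {[]}" by auto
  then show ?case using 0 by simp
next
  case (Suc j)
  obtain e fs where es: "es = e # fs" "length fs = j" using Suc.prems by (cases es) auto
  let ?c = "\<lambda>bs. \<Prod>i<j. fs ! i \<bullet> bs ! i"
  have d: "foldr dir_deriv bs \<psi> differentiable (at x)" for bs x
    using smooth_differentiable[OF smooth_foldr_dir_deriv[OF assms(1)]] .
  have IH: "foldr dir_deriv fs \<psi> = (\<lambda>x. \<Sum>bs | set bs \<subseteq> Basis \<and> length bs = j. ?c bs * foldr dir_deriv bs \<psi> x)"
    using Suc.IH[OF es(2)] by blast
  have "foldr dir_deriv es \<psi> x = dir_deriv e (\<lambda>x. \<Sum>bs | set bs \<subseteq> Basis \<and> length bs = j. ?c bs * foldr dir_deriv bs \<psi> x) x"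
    by (simp add: es IH)
  also have "\<dots> = (\<Sum>bs | set bs \<subseteq> Basis \<and> length bs = j. ?c bs * dir_deriv e (foldr dir_deriv bs \<psi>) x)"
    by (rule dir_deriv_sum) (rule d)
  also have "\<dots> = (\<Sum>bs | set bs \<subseteq> Basis \<and> length bs = j. \<Sum>b\<in>Basis. (e \<bullet> b) * ?c bs * dir_deriv b (foldr dir_deriv bs \<psi>) x)"
    by (subst dir_deriv_Basis[OF d]) (simp add: sum_distrib_left mult_ac)
  also have "\<dots> = (\<Sum>b\<in>Basis. \<Sum>bs | set bs \<subseteq> Basis \<and> length bs = j. (e \<bullet> b) * ?c bs * dir_deriv b (foldr dir_deriv bs \<psi>) x)"
    by (rule sum.swap)
  also have "\<dots> = (\<Sum>bs | set bs \<subseteq> Basis \<and> length bs = Suc j. (\<Prod>i<Suc j. es ! i \<bullet> bs ! i) * foldr dir_deriv bs \<psi> x)"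
    unfolding sum_lists_Suc es(1) by (simp only: prod.lessThan_Suc_shift) simp
  finally show ?case .
qed

lemma integral_by_parts_foldr:
  assumes \<psi>: "test_fun U \<psi>" and q: "smooth q"
  shows "(\<integral>x. foldr dir_deriv es q x * \<psi> x \<partial>lborel) = (- 1) ^ length es * (\<integral>x. q x * foldr dir_deriv (rev es) \<psi> x \<partial>lborel)"
  using \<psi>
proof (induction es arbitrary: \<psi>)
  case (Cons e es)
  have s: "smooth \<psi>" "compact (closure {x. \<psi> x \<noteq> 0})" using Cons.prems by (auto simp: test_fun_def)
  have "(\<integral>x. foldr dir_deriv (e # es) q x * \<psi> x \<partial>lborel) = - (\<integral>x. foldr dir_deriv es q x * dir_deriv e \<psi> x \<partial>lborel)"
    using integral_by_parts_dir_deriv[OF smooth_foldr_dir_deriv[OF q] s] by simp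
  also have "\<dots> = - ((- 1) ^ length es * (\<integral>x. q x * foldr dir_deriv (rev es) (dir_deriv e \<psi>) x \<partial>lborel))"
    by (subst Cons.IH[OF test_fun_dir_deriv[OF Cons.prems]]) simp
  finally show ?case by simp
qed simp

text \<open>Up to the normalisation \<open>1 / r!\<close> this is the homogeneous part of degree \<open>r\<close> of \<open>q\<close> in the
  coordinates \<open>L (x - v)\<close>, where \<open>A\<close> is the inverse of \<open>L\<close>.\<close>

definition top_part :: "('a::euclidean_space \<Rightarrow> 'a) \<Rightarrow> ('a \<Rightarrow> 'a) \<Rightarrow> 'a \<Rightarrow> nat \<Rightarrow> ('a \<Rightarrow> real) \<Rightarrow> 'a \<Rightarrow> real" where
  "top_part A L v r q x = (\<Sum>bs | set bs \<subseteq> Basis \<and> length bs = r.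
     (\<Prod>b\<leftarrow>bs. L (x - v) \<bullet> b) * foldr dir_deriv (map A bs) q x)"

text \<open>Modulo polynomials of degree below s the operator multiplies q by the falling factorial
  s (s-1) ... (s-r+1). Each further order contributes a derivative in direction x - v of polynomials
  of degree s - r, and Euler's identity evaluates it as the factor s - r.\<close>

lemma top_part_Euler:
  fixes A L :: "'a::euclidean_space \<Rightarrow> 'a"
  assumes A: "linear A" and L: "linear L" and AL: "\<And>x. A (L x) = x"
    and q: "q \<in> polys (int s)" and r: "r \<le> s"
  shows "(\<lambda>x. top_part A L v r q x - (\<Prod>i<r. real (s - i)) * q x) \<in> polys (int s - 1)"
  using r
proof (induction r)
  case 0
  have "{bs. set bs \<subseteq> (Basis :: 'a set) \<and> length bs = 0} = {[]}" by auto
  then show ?case by (simp add: top_part_def polys_0)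
next
  case (Suc r)
  let ?B = "{bs. set bs \<subseteq> (Basis :: 'a set) \<and> length bs = r}"
  let ?l = "\<lambda>bs x. \<Prod>b\<leftarrow>bs. L (x - v) \<bullet> b"
  let ?F = "\<lambda>bs. foldr dir_deriv (map A bs) q"
  have F: "?F bs \<in> polys (int s - int r)" if "bs \<in> ?B" for bs
    using polys_foldr_dir_deriv[OF q, of "map A bs"] that by simp
  have l: "?l bs \<in> polys (int r)" if "bs \<in> ?B" for bs
    using polys_prod_list[of "map (\<lambda>b x. L (x - v) \<bullet> b) bs"] polys_affine[OF L] that
    by (auto simp: comp_def)
  \<comment> \<open>Since \<open>A\<close> inverts \<open>L\<close>, the vector x - v is the
    combination of the \<open>A b\<close> with coefficients L (x - v) \<bullet> b, so the sum is the
    derivative in direction x - v.\<close>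
  have dirF: "(\<Sum>b\<in>Basis. (L (x - v) \<bullet> b) * dir_deriv (A b) (?F bs) x) = dir_deriv x (?F bs) x - dir_deriv v (?F bs) x"
    if "bs \<in> ?B" for bs x
  proof -
    interpret D: linear "\<lambda>w. dir_deriv w (?F bs) x"
      by (rule dir_deriv_linear[OF polys_differentiable[OF F[OF that]]])
    have "x - v = A (\<Sum>b\<in>Basis. (L (x - v) \<bullet> b) *\<^sub>R b)" by (simp add: euclidean_representation AL)
    also have "\<dots> = (\<Sum>b\<in>Basis. (L (x - v) \<bullet> b) *\<^sub>R A b)" by (simp add: linear_sum[OF A] linear_scale[OF A])
    finally have "dir_deriv (x - v) (?F bs) x = dir_deriv (\<Sum>b\<in>Basis. (L (x - v) \<bullet> b) *\<^sub>R A b) (?F bs) x"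
      by (rule arg_cong)
    also have "\<dots> = (\<Sum>b\<in>Basis. (L (x - v) \<bullet> b) * dir_deriv (A b) (?F bs) x)"
      by (simp add: D.sum D.scale)
    finally show ?thesis by (simp add: D.diff)
  qed
  have top: "top_part A L v (Suc r) q x = (\<Sum>bs\<in>?B. ?l bs x * (dir_deriv x (?F bs) x - dir_deriv v (?F bs) x))" for x
  proof -
    have "top_part A L v (Suc r) q x = (\<Sum>bs\<in>?B. \<Sum>b\<in>Basis. ?l (b # bs) x * ?F (b # bs) x)"
      unfolding top_part_def sum_lists_Suc by (rule sum.swap)
    also have "\<dots> = (\<Sum>bs\<in>?B. ?l bs x * (\<Sum>b\<in>Basis. (L (x - v) \<bullet> b) * dir_deriv (A b) (?F bs) x))"
      by (simp add: sum_distrib_left mult_ac)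
    finally show ?thesis by (simp add: dirF)
  qed
  \<comment> \<open>The defect in Euler's identity for \<open>?F bs\<close> together with the
    derivative along the fixed vector v; both have degree below s - r.\<close>
  let ?e = "\<lambda>bs x. (real_of_int (int s - int r) * ?F bs x - dir_deriv x (?F bs) x) + dir_deriv v (?F bs) x"
  have "?e bs \<in> polys (int s - int r - 1)" if "bs \<in> ?B" for bs
    by (intro polys_add polys_Euler polys_dir_deriv F that)
  then have "(\<lambda>x. ?l bs x * ?e bs x) \<in> polys (int s - 1)" if "bs \<in> ?B" for bs
    using polys_mult[OF l[OF that], of "?e bs" "int s - int r - 1"] that by simp
  then have e: "(\<lambda>x. \<Sum>bs\<in>?B. ?l bs x * ?e bs x) \<in> polys (int s - 1)" by (rule polys_sum)
  have eq: "top_part A L v (Suc r) q x - (\<Prod>i<Suc r. real (s - i)) * q x =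
      real (s - r) * (top_part A L v r q x - (\<Prod>i<r. real (s - i)) * q x) - (\<Sum>bs\<in>?B. ?l bs x * ?e bs x)" for x
  proof -
    have "top_part A L v (Suc r) q x + (\<Sum>bs\<in>?B. ?l bs x * ?e bs x) = (\<Sum>bs\<in>?B. ?l bs x * (real (s - r) * ?F bs x))"
      unfolding top sum.distrib[symmetric] using Suc.prems by (intro sum.cong) (simp_all add: algebra_simps of_nat_diff)
    also have "\<dots> = real (s - r) * top_part A L v r q x"
      by (simp add: top_part_def sum_distrib_left mult_ac)
    finally show ?thesis by (simp add: algebra_simps)
  qed
  have IH: "(\<lambda>x. top_part A L v r q x - (\<Prod>i<r. real (s - i)) * q x) \<in> polys (int s - 1)"
    using Suc.prems by (intro Suc.IH) simp
  show ?case unfolding eq by (rule polys_diff[OF polys_cmult[OF IH] e])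
qed

text \<open>For s = r the falling factorial is r!, and dividing by it isolates the part of degree
  r.\<close>

lemma diff_top_part:
  fixes A L :: "'a::euclidean_space \<Rightarrow> 'a"
  assumes "linear A" "linear L" "\<And>x. A (L x) = x" "q \<in> polys (int r)"
  shows "(\<lambda>x. q x - top_part A L v r q x / fact r) \<in> polys (int r - 1)"
proof -
  have "(\<Prod>i<r. real (r - i)) = fact r"
    unfolding fact_prod_rev by (simp add: atLeast0LessThan)
  then have "(\<lambda>x. (- 1 / fact r) * (top_part A L v r q x - fact r * q x)) \<in> polys (int r - 1)"
    using polys_cmult[OF top_part_Euler[OF assms order_refl, of v], of "- 1 / fact r"] by simp
  moreover have "(- 1 / fact r) * (top_part A L v r q x - fact r * q x) = q x - top_part A L v r q x / fact r" for x
    by (simp add: field_simps)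
  ultimately show ?thesis by simp
qed

lemma dir_deriv_poly_forms:
  assumes "\<omega> \<in> poly_forms r k"
  shows "(\<lambda>x v. dir_deriv w (\<lambda>z. \<omega> z v) x) \<in> poly_forms r k"
  using dir_deriv_form_alt[OF assms] polys_mono[OF _ polys_dir_deriv[OF poly_forms_polys[OF assms]]]
  by (simp add: poly_forms_def)

lemma foldr_dir_deriv_poly_forms:
  assumes "\<omega> \<in> poly_forms r k"
  shows "(\<lambda>x v. foldr dir_deriv es (\<lambda>z. \<omega> z v) x) \<in> poly_forms r k"
proof (induction es)
  case (Cons e es)
  from dir_deriv_poly_forms[OF Cons, of e] show ?case by simp
qed (use assms in simp)

lemma diff_top_part_form:
  fixes A L :: "'a::euclidean_space \<Rightarrow> 'a"
  assumes "linear A" "linear L" "\<And>x. A (L x) = x" and \<omega>: "\<omega> \<in> poly_forms (int r) k"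
  shows "(\<lambda>x v. \<omega> x v - top_part A L v0 r (\<lambda>z. \<omega> z v) x / fact r) \<in> poly_forms (int r - 1) k"
proof -
  have "(\<lambda>v. (1 / fact r) * top_part A L v0 r (\<lambda>z. \<omega> z v) x) \<in> alt_forms k" for x
    unfolding top_part_def
    using poly_forms_alt[OF foldr_dir_deriv_poly_forms[OF \<omega>]]
    by (intro alt_forms_cmult alt_forms_sum) auto
  then have "(\<lambda>v. \<omega> x v - top_part A L v0 r (\<lambda>z. \<omega> z v) x / fact r) \<in> alt_forms k" for x
    using alt_forms_diff[OF poly_forms_alt[OF \<omega>, of x]] by simp
  moreover have "(\<lambda>x. \<omega> x v - top_part A L v0 r (\<lambda>z. \<omega> z v) x / fact r) \<in> polys (int r - 1)" for v
    by (rule diff_top_part[OF assms(1-3) poly_forms_polys[OF \<omega>]])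
  ultimately show ?thesis by (simp add: poly_forms_def)
qed

text \<open>\<open>A\<close> maps the coordinate vectors to the edge vectors issuing from a vertex
  \<open>v\<close>; affine independence makes it injective. The coordinates of
  \<open>L (x - v)\<close> are then the barycentric coordinates of x with respect to the other
  vertices.\<close>

lemma simplex_affine_coordinates:
  fixes C :: "'a::euclidean_space set"
  assumes C: "\<not> affine_dependent C" "card C = DIM('a) + 1"
  obtains A L :: "'a \<Rightarrow> 'a" and v where "linear A" "linear L" "\<And>x. L (A x) = x" "\<And>x. A (L x) = x"
    "v \<in> C" "\<And>b. b \<in> Basis \<Longrightarrow> v + A b \<in> C"
    "convex hull C = (\<lambda>y. v + A y) ` (convex hull (insert 0 Basis))"
proof -
  have fin: "finite C" using C(2) by (rule_tac card_ge_0_finite) simp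
  obtain v where v: "v \<in> C" using C(2) by fastforce
  have "card (C - {v}) = card (Basis :: 'a set)" using v fin C(2) by simp
  then obtain g where g: "bij_betw g (Basis :: 'a set) (C - {v})"
    using finite_same_card_bij[of "Basis :: 'a set" "C - {v}"] fin by auto
  define A where "A x = (\<Sum>b\<in>Basis. (x \<bullet> b) *\<^sub>R (g b - v))" for x :: 'a
  have A: "linear A" unfolding A_def
    by (rule linearI) (simp_all add: inner_add_left scaleR_add_left sum.distrib scaleR_sum_right)
  have Ab: "A b = g b - v" if "b \<in> Basis" for b
    using that by (simp add: A_def inner_Basis if_distrib[of "\<lambda>c. c *\<^sub>R _"] sum.delta cong: if_cong)
  have ind: "independent ((\<lambda>x. - v + x) ` (C - {v}))"
    using affine_dependent_iff_dependent2[OF v] C(1) by simp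
  have inj: "inj A"
  proof (rule linear_injective_on_subspace_0[OF A subspace_UNIV, THEN iffD2], intro ballI impI)
    fix x :: 'a assume "A x = 0"
    have i: "inj_on (\<lambda>b. g b - v) Basis" using g by (auto simp: bij_betw_def inj_on_def)
    have im: "(\<lambda>b. g b - v) ` Basis = (\<lambda>x. - v + x) ` (C - {v})"
    proof -
      have "g ` Basis = C - {v}" using g by (simp add: bij_betw_def)
      then have "(\<lambda>x. - v + x) ` (C - {v}) = (\<lambda>x. - v + x) ` g ` Basis" by simp
      then show ?thesis by (simp add: image_image)
    qed
    have "(\<Sum>w\<in>(\<lambda>b. g b - v) ` Basis. (x \<bullet> the_inv_into Basis (\<lambda>b. g b - v) w) *\<^sub>R w) = A x"
      unfolding A_def using i by (subst sum.reindex) (auto simp: the_inv_into_f_f[OF i] intro!: sum.cong)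
    then have "\<forall>w\<in>(\<lambda>b. g b - v) ` Basis. x \<bullet> the_inv_into Basis (\<lambda>b. g b - v) w = 0"
      using \<open>A x = 0\<close> ind unfolding im[symmetric]
      by (intro ballI independentD[of "(\<lambda>b. g b - v) ` Basis" "(\<lambda>b. g b - v) ` Basis"]) auto
    then have "x \<bullet> b = 0" if "b \<in> Basis" for b using that by (auto simp: the_inv_into_f_f[OF i])
    then show "x = 0" by (simp add: euclidean_eq_iff[of x 0])
  qed
  obtain L where L: "linear L" "\<And>x. L (A x) = x" "\<And>x. A (L x) = x"
    using linear_injective_isomorphism[OF A inj] by blast
  have "C = (\<lambda>y. v + A y) ` insert 0 Basis"
  proof -
    have "(\<lambda>y. v + A y) ` Basis = g ` Basis" using Ab by (intro image_cong) auto
    then show ?thesis using g v linear_0[OF A] by (auto simp: bij_betw_def)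
  qed
  then have "convex hull C = convex hull ((\<lambda>x. v + x) ` A ` insert 0 Basis)" by (simp add: image_image)
  also have "\<dots> = (\<lambda>x. v + x) ` A ` (convex hull (insert 0 Basis))"
    by (simp only: convex_hull_translation convex_hull_linear_image[OF A])
  finally have hull: "convex hull C = (\<lambda>y. v + A y) ` (convex hull (insert 0 Basis))" by (simp add: image_image)
  have "v + A b \<in> C" if "b \<in> Basis" for b using Ab[OF that] that g by (auto simp: bij_betw_def)
  then show ?thesis using that A L v hull by blast
qed

lemma smooth_compact_support_bounded:
  assumes "smooth \<psi>" "compact (closure {x. \<psi> x \<noteq> 0})"
  shows "\<exists>M. \<forall>x. \<bar>\<psi> x\<bar> \<le> M"
proof -
  have "bounded (\<psi> ` closure {x. \<psi> x \<noteq> 0})"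
    using assms(2) smooth_continuous[OF assms(1)] by (intro compact_imp_bounded compact_continuous_image) auto
  then obtain M where M: "0 < M" "\<And>x. x \<in> closure {x. \<psi> x \<noteq> 0} \<Longrightarrow> \<bar>\<psi> x\<bar> \<le> M" by (auto simp: bounded_pos)
  have "\<bar>\<psi> x\<bar> \<le> M" for x
    using M closure_subset[of "{x. \<psi> x \<noteq> 0}"] by (cases "\<psi> x = 0") auto
  then show ?thesis by blast
qed

text \<open>A fixed bump on the reference simplex is transplanted to \<open>T\<close>. Its derivatives along the edge
  vectors \<open>A b\<close> are bounded independently of the shape of \<open>T\<close>.\<close>

lemma simplex_test_function:
  "\<exists>M c. 0 < M \<and> 0 < c \<and> (\<forall>C :: 'a::euclidean_space set. \<not> affine_dependent C \<longrightarrow> card C = DIM('a) + 1 \<longrightarrow>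
     (\<exists>(A :: 'a \<Rightarrow> 'a) L v \<psi>. linear A \<and> linear L \<and> (\<forall>x. A (L x) = x) \<and>
        (\<forall>b\<in>Basis. norm (A b) \<le> diameter (convex hull C)) \<and>
        (\<forall>x\<in>convex hull C. \<forall>b\<in>Basis. \<bar>L (x - v) \<bullet> b\<bar> \<le> 1) \<and>
        test_fun (interior (convex hull C)) \<psi> \<and>
        c * measure lebesgue (convex hull C) \<le> (\<integral>x. \<psi> x \<partial>lborel) \<and>
        (\<forall>bs x. set bs \<subseteq> Basis \<and> length bs \<le> r \<longrightarrow> \<bar>foldr dir_deriv (map A bs) \<psi> x\<bar> \<le> M)))"
proof -
  let ?T = "convex hull (insert 0 (Basis :: 'a set))"
  \<comment> \<open>The point with all coordinates equal to \<open>d\<close> has coordinate sum 1/2.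
    In the box from \<open>d / 2\<close> to \<open>3 * d / 2\<close> around it the sums stay below
    1, so this box lies inside the reference simplex.\<close>
  define d where "d = 1 / (2 * real DIM('a))"
  define One' where "One' = (\<Sum>b\<in>(Basis :: 'a set). b)"
  have O: "One' \<bullet> b = 1" if "b \<in> Basis" for b using that by (simp add: One'_def inner_sum_left inner_Basis)
  have d: "0 < d" "real DIM('a) * d = 1 / 2" using DIM_positive[where 'a = 'a] by (auto simp: d_def)
  define l u where "l = (d / 2) *\<^sub>R One'" "u = (3 * d / 2) *\<^sub>R One'"
  define \<Psi> where "\<Psi> = box_bump 1 l u"
  have Tstd: "?T = {x. (\<forall>i\<in>Basis. 0 \<le> x \<bullet> i) \<and> (\<Sum>i\<in>Basis. x \<bullet> i) \<le> 1}" by (rule std_simplex)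
  have Tint: "interior ?T = {x. (\<forall>i\<in>Basis. 0 < x \<bullet> i) \<and> (\<Sum>i\<in>Basis. x \<bullet> i) < 1}" by (rule interior_std_simplex)
  have lu: "cbox l u \<subseteq> interior ?T"
  proof
    fix x assume x: "x \<in> cbox l u"
    have b: "d / 2 \<le> x \<bullet> i" "x \<bullet> i \<le> 3 * d / 2" if "i \<in> Basis" for i
      using x that by (auto simp: mem_box l_u_def O)
    have "(\<Sum>i\<in>Basis. x \<bullet> i) \<le> (\<Sum>i\<in>(Basis :: 'a set). 3 * d / 2)" using b by (intro sum_mono) auto
    also have "\<dots> = 3 / 2 * (real DIM('a) * d)" by simp
    also have "\<dots> < 1" unfolding d(2) by simp
    finally show "x \<in> interior ?T" unfolding Tint using b d(1) by fastforce
  qed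
  have \<Psi>: "test_fun (interior ?T) \<Psi>" unfolding \<Psi>_def using lu by (intro test_fun_box_bump) auto
  have smP: "smooth \<Psi>" using \<Psi> by (simp add: test_fun_def)
  obtain M where M: "0 < M" "\<And>bs x. set bs \<subseteq> Basis \<Longrightarrow> length bs \<le> r \<Longrightarrow> \<bar>foldr dir_deriv bs \<Psi> x\<bar> \<le> M"
  proof -
    let ?L = "{bs. set bs \<subseteq> (Basis :: 'a set) \<and> length bs \<le> r}"
    have fin: "finite ?L" by (rule finite_lists_length_le[OF finite_Basis])
    have "\<exists>M. \<forall>x. \<bar>foldr dir_deriv bs \<Psi> x\<bar> \<le> M" for bs
      using test_fun_foldr_dir_deriv[OF \<Psi>, of bs] by (intro smooth_compact_support_bounded) (auto simp: test_fun_def)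
    then obtain m where m: "\<And>bs x. \<bar>foldr dir_deriv bs \<Psi> x\<bar> \<le> m bs" by metis
    have "\<bar>foldr dir_deriv bs \<Psi> x\<bar> \<le> 1 + (\<Sum>bs\<in>?L. \<bar>m bs\<bar>)" if "set bs \<subseteq> Basis" "length bs \<le> r" for bs x
    proof -
      have "\<bar>m bs\<bar> \<le> (\<Sum>bs\<in>?L. \<bar>m bs\<bar>)" using fin that by (intro member_le_sum) auto
      then show ?thesis using m[of bs x] by linarith
    qed
    moreover have "0 < 1 + (\<Sum>bs\<in>?L. \<bar>m bs\<bar>)" by (intro add_pos_nonneg sum_nonneg) auto
    ultimately show ?thesis using that by blast
  qed
  \<comment> \<open>A smaller closed box inside the open one, on which the bump has a positive
    minimum \<open>c0\<close>.\<close>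
  define K where "K = cbox ((3 * d / 4) *\<^sub>R One') ((5 * d / 4) *\<^sub>R One')"
  have K: "compact K" "K \<noteq> {}" using d(1) by (auto simp: K_def box_ne_empty O)
  have Kbox: "K \<subseteq> box l u" using d(1) unfolding K_def l_u_def by (auto simp: mem_box O) (smt (verit))+
  obtain c0 where c0: "0 < c0" "\<And>x. x \<in> K \<Longrightarrow> c0 \<le> \<Psi> x"
  proof -
    obtain x0 where x0: "x0 \<in> K" "\<And>x. x \<in> K \<Longrightarrow> \<Psi> x0 \<le> \<Psi> x"
      using continuous_attains_inf[OF K smooth_continuous[OF smP]] by blast
    have "0 < \<Psi> x0" unfolding \<Psi>_def using x0(1) Kbox by (intro box_bump_pos) auto
    then show ?thesis using that x0(2) by blast
  qed
  \<comment> \<open>Coordinates of points in the reference simplex differ from \<open>d\<close> by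
    at most 1, so the homothety about \<open>p\<close> with ratio \<open>d / 4\<close> maps the
    simplex into \<open>K\<close>.\<close>
  define s where "s = d / 4"
  have s: "0 < s" using d(1) by (simp add: s_def)
  define p where "p = d *\<^sub>R One'"
  have shrink: "p + s *\<^sub>R (y - p) \<in> K" if y: "y \<in> ?T" for y
  proof -
    have "0 \<le> y \<bullet> i" "y \<bullet> i \<le> 1" if i: "i \<in> Basis" for i
    proof -
      show n: "0 \<le> y \<bullet> i" using y i unfolding Tstd by simp
      have "y \<bullet> i \<le> (\<Sum>i\<in>Basis. y \<bullet> i)" using y i unfolding Tstd by (intro member_le_sum) auto
      also have "\<dots> \<le> 1" using y unfolding Tstd by simp
      finally show "y \<bullet> i \<le> 1" .
    qed
    moreover have "d \<le> 1"
    proof -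
      have "1 \<le> real DIM('a)" using DIM_positive[where 'a = 'a] by (simp add: Suc_le_eq)
      then show ?thesis unfolding d_def by (subst divide_le_eq_1_pos) linarith+
    qed
    ultimately have "\<bar>y \<bullet> i - d\<bar> \<le> 1" if "i \<in> Basis" for i using that d(1) by (smt (verit))
    then have "\<bar>s * (y \<bullet> i - d)\<bar> \<le> s * 1" if "i \<in> Basis" for i
      unfolding abs_mult using that s by (intro mult_mono) auto
    then have dev: "\<bar>s * (y \<bullet> i - d)\<bar> \<le> d / 4" if "i \<in> Basis" for i using that by (simp add: s_def)
    have "3 * d / 4 \<le> d + s * (y \<bullet> i - d) \<and> d + s * (y \<bullet> i - d) \<le> 5 * d / 4" if "i \<in> Basis" for i
      using dev[OF that] unfolding abs_le_iff by linarith
    then show ?thesis unfolding K_def mem_box p_def by (simp add: O inner_add_left inner_diff_left)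
  qed
  define c where "c = c0 * s ^ DIM('a)"
  have c: "0 < c" using c0(1) s by (simp add: c_def)
  show ?thesis
  proof (rule exI[of _ M], rule exI[of _ c], intro conjI allI impI M(1) c)
    fix C :: "'a set" assume C: "\<not> affine_dependent C" "card C = DIM('a) + 1"
    obtain A L :: "'a \<Rightarrow> 'a" and v where A: "linear A" and L: "linear L" and LA: "\<And>x. L (A x) = x"
      and AL: "\<And>x. A (L x) = x" and v: "v \<in> C" "\<And>b. b \<in> Basis \<Longrightarrow> v + A b \<in> C"
      and hull: "convex hull C = (\<lambda>y. v + A y) ` ?T"
      using simplex_affine_coordinates[OF C] by blast
    define \<psi> where "\<psi> x = \<Psi> (L (x - v))" for x
    have fin: "finite C" using C(2) by (rule_tac card_ge_0_finite) simp
    have cH: "compact (convex hull C)" using fin by (rule finite_imp_compact_convex_hull)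
    have edge: "norm (A b) \<le> diameter (convex hull C)" if "b \<in> Basis" for b
    proof -
      have "v \<in> convex hull C" "v + A b \<in> convex hull C" using v that by (auto intro: hull_inc)
      then have "dist v (v + A b) \<le> diameter (convex hull C)"
        using compact_imp_bounded[OF cH] by (intro diameter_bounded_bound)
      then show ?thesis by (simp add: dist_norm)
    qed
    have mem: "x \<in> convex hull C \<longleftrightarrow> L (x - v) \<in> ?T" for x
      unfolding hull using LA AL by (auto simp: image_iff intro!: bexI[of _ "L (x - v)"])
    have coord: "\<bar>L (x - v) \<bullet> b\<bar> \<le> 1" if "x \<in> convex hull C" "b \<in> Basis" for x b
    proof -
      have y: "L (x - v) \<in> ?T" using that mem by simp
      then have "L (x - v) \<bullet> b \<le> (\<Sum>i\<in>Basis. L (x - v) \<bullet> i)" using that unfolding Tstd by (intro member_le_sum) auto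
      then show ?thesis using y that unfolding Tstd by auto
    qed
    have contL: "continuous_on UNIV (\<lambda>x. L (x - v))"
      using L by (intro continuous_on_compose2[OF linear_continuous_on[of L UNIV]] continuous_intros)
        (auto simp: linear_conv_bounded_linear)
    have contA: "continuous_on UNIV (\<lambda>y. v + A y)"
      using A by (intro continuous_intros linear_continuous_on) (auto simp: linear_conv_bounded_linear)
    have test: "test_fun (interior (convex hull C)) \<psi>"
    proof -
      have "smooth \<psi>" unfolding \<psi>_def by (rule smooth_affine_comp[OF L smP])
      moreover have "closure {x. \<psi> x \<noteq> 0} \<subseteq> (\<lambda>y. v + A y) ` cbox l u"
      proof (rule closure_minimal)
        show "{x. \<psi> x \<noteq> 0} \<subseteq> (\<lambda>y. v + A y) ` cbox l u"
        proof
          fix x assume "x \<in> {x. \<psi> x \<noteq> 0}"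
          then have "L (x - v) \<in> cbox l u"
            using box_bump_eq_0[of 1 "L (x - v)" l u] box_subset_cbox[of l u] by (auto simp: \<psi>_def \<Psi>_def)
          then show "x \<in> (\<lambda>y. v + A y) ` cbox l u" by (intro image_eqI[of _ _ "L (x - v)"]) (simp_all add: AL)
        qed
        show "closed ((\<lambda>y. v + A y) ` cbox l u)"
          using contA by (intro compact_imp_closed compact_continuous_image) (auto intro: continuous_on_subset)
      qed
      moreover have "compact ((\<lambda>y. v + A y) ` cbox l u)"
        using contA by (intro compact_continuous_image) (auto intro: continuous_on_subset)
      moreover have "(\<lambda>y. v + A y) ` cbox l u \<subseteq> interior (convex hull C)"
      proof -
        have "open {x. L (x - v) \<in> interior ?T}"
          using open_vimage[OF open_interior contL] by (simp add: vimage_def)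
        moreover have "{x. L (x - v) \<in> interior ?T} \<subseteq> convex hull C" using mem interior_subset by blast
        ultimately have "{x. L (x - v) \<in> interior ?T} \<subseteq> interior (convex hull C)" by (rule interior_maximal[rotated])
        moreover have "v + A y \<in> {x. L (x - v) \<in> interior ?T}" if "y \<in> cbox l u" for y
          using subsetD[OF lu that] by (simp add: LA)
        ultimately show ?thesis by blast
      qed
      moreover have "compact (closure {x. \<psi> x \<noteq> 0})"
      proof -
        have "closure {x. \<psi> x \<noteq> 0} = ((\<lambda>y. v + A y) ` cbox l u) \<inter> closure {x. \<psi> x \<noteq> 0}"
          using calculation(2) by blast
        then show ?thesis using compact_Int_closed[OF calculation(3) closed_closure] by metis
      qed
      ultimately show ?thesis unfolding test_fun_def by blast
    qed
    have vol: "c * measure lebesgue (convex hull C) \<le> (\<integral>x. \<psi> x \<partial>lborel)"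
    proof -
      \<comment> \<open>Homotheties commute with affine maps, so \<psi> is at least
        \<open>c0\<close> on the shrunken copy \<open>H\<close> of the simplex, which has a fixed
        fraction of its measure. In this way the determinant of \<open>A\<close> never
        enters.\<close>
      define w where "w = v + A p"
      define H where "H = (\<lambda>x. s *\<^sub>R x + (w - s *\<^sub>R w)) ` (convex hull C)"
      have Hc: "compact H" unfolding H_def using cH by (intro compact_continuous_image) (auto intro!: continuous_intros)
      have mH: "measure lebesgue H = s ^ DIM('a) * measure lebesgue (convex hull C)"
        using measure_lebesgue_affine[of s "w - s *\<^sub>R w" "convex hull C"] s by (simp add: H_def)
      have ge: "c0 * indicator H x \<le> \<psi> x" for x
      proof (cases "x \<in> H")
        case True
        then obtain y where y: "y \<in> convex hull C" "x = s *\<^sub>R y + (w - s *\<^sub>R w)" by (auto simp: H_def)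
        have "L (x - v) = p + s *\<^sub>R (L (y - v) - p)"
        proof -
          have "x - v = A p + s *\<^sub>R ((y - v) - A p)" unfolding y(2) w_def by (simp add: algebra_simps)
          then show ?thesis by (simp add: linear_add[OF L] linear_diff[OF L] linear_scale[OF L] LA)
        qed
        then have "L (x - v) \<in> K" using shrink y(1) mem by simp
        then show ?thesis using c0(2) True by (simp add: \<psi>_def)
      next
        case False
        then show ?thesis using box_bump_bounds(1) by (simp add: \<psi>_def \<Psi>_def)
      qed
      have int: "integrable lborel \<psi>"
        using test by (intro continuous_compact_support_integrable) (auto simp: test_fun_def intro: smooth_continuous)
      have "c * measure lebesgue (convex hull C) = c0 * measure lebesgue H" by (simp add: c_def mH)
      also have "\<dots> = (\<integral>x. c0 * indicator H x \<partial>lborel)"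
        using Hc by (simp add: compact_imp_closed measure_completion)
      also have "\<dots> \<le> (\<integral>x. \<psi> x \<partial>lborel)"
        using ge int emeasure_compact_finite[OF Hc] Hc
        by (intro integral_mono integrable_mult_right integrable_real_indicator) (auto simp: compact_imp_closed)
      finally show ?thesis .
    qed
    have bnd: "\<bar>foldr dir_deriv (map A bs) \<psi> x\<bar> \<le> M" if "set bs \<subseteq> Basis \<and> length bs \<le> r" for bs x
    proof -
      \<comment> \<open>The chain rule turns each direction \<open>A b\<close> into L (A b) = b, so
        the bound for the fixed bump carries over unchanged.\<close>
      have "foldr dir_deriv (map A bs) \<psi> x = foldr dir_deriv bs \<Psi> (L (x - v))"
        unfolding \<psi>_def foldr_dir_deriv_affine_comp[OF L smP] by (simp add: LA comp_def)
      then show ?thesis using M(2) that by simp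
    qed
    show "\<exists>(A :: 'a \<Rightarrow> 'a) L v \<psi>. linear A \<and> linear L \<and> (\<forall>x. A (L x) = x) \<and>
        (\<forall>b\<in>Basis. norm (A b) \<le> diameter (convex hull C)) \<and>
        (\<forall>x\<in>convex hull C. \<forall>b\<in>Basis. \<bar>L (x - v) \<bullet> b\<bar> \<le> 1) \<and>
        test_fun (interior (convex hull C)) \<psi> \<and>
        c * measure lebesgue (convex hull C) \<le> (\<integral>x. \<psi> x \<partial>lborel) \<and>
        (\<forall>bs x. set bs \<subseteq> Basis \<and> length bs \<le> r \<longrightarrow> \<bar>foldr dir_deriv (map A bs) \<psi> x\<bar> \<le> M)"
      by (rule exI[of _ A], rule exI[of _ L], rule exI[of _ v], rule exI[of _ \<psi>])
        (intro conjI allI ballI impI A L AL edge coord test vol bnd; blast)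
  qed
qed

section \<open>Approximation by polynomials of lower degree\<close>

definition seminorm_part :: "real \<Rightarrow> ennreal \<Rightarrow> nat \<Rightarrow> 'a::euclidean_space set \<Rightarrow> 'a form \<Rightarrow> ennreal" where
  "seminorm_part m p k U \<eta> = (if frac m = 0 then Lp_norm p k U \<eta> else slobodeckij (frac m) p k U \<eta>)"

lemma sobolev_seminorm_eq:
  "sobolev_seminorm m p k U \<omega> = (\<Sum>\<alpha>\<in>multi_indices (nat \<lfloor>m\<rfloor>). seminorm_part m p k U (pderiv_form k U \<alpha> \<omega>))"
  by (simp add: sobolev_seminorm_def seminorm_part_def)

lemma seminorm_part_mono:
  assumes "1 \<le> p" "open D" "open U" "D \<subseteq> U"
  shows "seminorm_part m p k D \<eta> \<le> seminorm_part m p k U \<eta>"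
proof -
  have "Lp_norm p k D \<eta> \<le> Lp_norm p k U \<eta>"
    unfolding Lp_norm_eq_lpnorm using assms by (intro lpnorm_le_AE_eq) auto
  moreover have "slobodeckij (frac m) p k D \<eta> \<le> slobodeckij (frac m) p k U \<eta>"
    unfolding slobodeckij_eq_lpnorm[OF assms(1)] using assms by (intro lpnorm_le_AE_eq) (auto simp: open_Times)
  ultimately show ?thesis by (simp add: seminorm_part_def)
qed

text \<open>For integer m this is Hoelder's inequality. In the fractional case the factor h^(n/p) of
  the Slobodeckij estimate is absorbed by V^(1/p) through the bound of h^n by \<open>K * V\<close>;
  this is the only entrance of the shape of the simplex.\<close>

lemma LINT_test_fun_le_seminorm_part:
  fixes \<eta> :: "'a::euclidean_space form"
  assumes p: "1 \<le> p" and D: "open D" "D \<subseteq> U" "open U"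
    and V: "emeasure lebesgue D = ennreal V" "0 < V"
    and \<eta>: "\<And>v. locally_integrable U (\<lambda>x. \<eta> x v)"
    and \<psi>: "test_fun D \<psi>" "\<And>x. \<bar>\<psi> x\<bar> \<le> M" and M: "0 \<le> M" and v: "set v \<subseteq> Basis" "length v = k"
    and mean: "frac m \<noteq> 0 \<Longrightarrow> (\<integral>x. \<psi> x \<partial>lborel) = 0"
    and h: "0 < h" "\<And>x y. x \<in> D \<Longrightarrow> y \<in> D \<Longrightarrow> norm (x - y) \<le> h"
    and K: "0 \<le> K" "h ^ DIM('a) \<le> K * V"
  shows "ennreal \<bar>LINT x:U|lebesgue. \<eta> x v * \<psi> x\<bar> \<le>
    ennreal (2 * M * sqrt (fact k) * max 1 K * V powr (1 - recip p) * h powr frac m) * seminorm_part m p k U \<eta>"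
proof (cases "frac m = 0")
  case True
  have meas: "(\<lambda>x. \<eta> x v) \<in> borel_measurable (lebesgue_on D)" for v
    using locally_integrable_measurable[OF D(1) locally_integrable_mono[OF \<eta> D(2)]] .
  have "ennreal \<bar>LINT x:U|lebesgue. \<eta> x v * \<psi> x\<bar> \<le>
      ennreal (2 * M * sqrt (fact k) * V powr (1 - recip p)) * Lp_norm p k D \<eta>"
    using D(3) by (intro LINT_test_fun_le_Lp_norm[OF p D(1,2) _ V meas \<psi> M v]) simp
  also have "\<dots> = ennreal (2 * M * sqrt (fact k) * V powr (1 - recip p)) * seminorm_part m p k D \<eta>"
    using True by (simp add: seminorm_part_def)
  also have "\<dots> \<le> ennreal (2 * M * sqrt (fact k) * max 1 K * V powr (1 - recip p) * h powr frac m) * seminorm_part m p k U \<eta>"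
  proof (rule mult_mono[OF ennreal_leI seminorm_part_mono[OF p D(1,3,2)]])
    have "2 * M * sqrt (fact k) * V powr (1 - recip p) * 1 \<le> 2 * M * sqrt (fact k) * V powr (1 - recip p) * max 1 K"
      using M by (intro mult_left_mono) auto
    moreover have "h powr frac m = 1" using h(1) by (simp only: True) simp
    ultimately show "2 * M * sqrt (fact k) * V powr (1 - recip p) \<le> 2 * M * sqrt (fact k) * max 1 K * V powr (1 - recip p) * h powr frac m"
      by (simp add: mult_ac)
  qed auto
  finally show ?thesis .
next
  case False
  let ?r = "recip p"
  have r: "0 \<le> ?r" "?r \<le> 1" using recip_bounds[OF p] by auto
  have "ennreal \<bar>LINT x:U|lebesgue. \<eta> x v * \<psi> x\<bar> \<le>
      ennreal (2 * M * sqrt (fact k) * h powr (real DIM('a) * ?r + frac m) * V powr (1 - 2 * ?r)) * slobodeckij (frac m) p k D \<eta>"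
    using D(3) by (intro LINT_test_fun_le_slobodeckij[OF p D(1,2) _ V \<eta> \<psi> M v mean[OF False] h]) auto
  also have "\<dots> = ennreal (2 * M * sqrt (fact k) * h powr (real DIM('a) * ?r + frac m) * V powr (1 - 2 * ?r)) * seminorm_part m p k D \<eta>"
    using False by (simp add: seminorm_part_def)
  also have "\<dots> \<le> ennreal (2 * M * sqrt (fact k) * max 1 K * V powr (1 - recip p) * h powr frac m) * seminorm_part m p k U \<eta>"
  proof (rule mult_mono[OF ennreal_leI seminorm_part_mono[OF p D(1,3,2)]])
    have "h powr (real DIM('a) * ?r) = (h ^ DIM('a)) powr ?r"
      using h(1) by (simp add: powr_powr[symmetric] powr_realpow)
    \<comment> \<open>With \<open>max 1 K\<close> in place of \<open>K\<close>, the power with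
      exponent 1/p \<le> 1 is at most the base itself, so the constant does not involve p.\<close>
    also have "\<dots> \<le> (max 1 K * V) powr ?r"
    proof (rule powr_mono2[OF r(1)])
      have "K * V \<le> max 1 K * V" using V(2) by (intro mult_right_mono) auto
      then show "h ^ DIM('a) \<le> max 1 K * V" using K(2) by simp
    qed (use h(1) in simp)
    also have "\<dots> = max 1 K powr ?r * V powr ?r" using V(2) by (simp add: powr_mult)
    also have "\<dots> \<le> max 1 K * V powr ?r"
      using powr_mono[OF r(2), of "max 1 K"] by (intro mult_right_mono) auto
    finally have "h powr (real DIM('a) * ?r) * V powr (1 - 2 * ?r) \<le> max 1 K * V powr ?r * V powr (1 - 2 * ?r)"
      by (intro mult_right_mono) auto
    also have "\<dots> = max 1 K * V powr (1 - ?r)" by (simp add: mult.assoc powr_add[symmetric])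
    finally have le: "h powr (real DIM('a) * ?r) * V powr (1 - 2 * ?r) \<le> max 1 K * V powr (1 - ?r)" .
    have "2 * M * sqrt (fact k) * h powr (real DIM('a) * ?r + frac m) * V powr (1 - 2 * ?r) =
        (2 * M * sqrt (fact k) * h powr frac m) * (h powr (real DIM('a) * ?r) * V powr (1 - 2 * ?r))"
      by (simp add: powr_add mult_ac)
    also have "\<dots> \<le> (2 * M * sqrt (fact k) * h powr frac m) * (max 1 K * V powr (1 - ?r))"
      using M by (intro mult_left_mono le) auto
    finally show "2 * M * sqrt (fact k) * h powr (real DIM('a) * ?r + frac m) * V powr (1 - 2 * ?r) \<le>
        2 * M * sqrt (fact k) * max 1 K * V powr (1 - ?r) * h powr frac m" by (simp add: mult_ac)
  qed auto
  finally show ?thesis .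
qed

lemma card_Basis_lists: "card {v. set v \<subseteq> (Basis :: 'a::euclidean_space set) \<and> length v = k} = DIM('a) ^ k"
  by (rule card_lists_length_eq) simp

lemma finite_multi_indices: "finite (multi_indices j :: 'a::euclidean_space multiset set)"
proof -
  have "multi_indices j \<subseteq> mset ` {bs. set bs \<subseteq> (Basis :: 'a set) \<and> length bs = j}"
  proof
    fix \<alpha> :: "'a multiset" assume "\<alpha> \<in> multi_indices j"
    moreover obtain bs where "mset bs = \<alpha>" using ex_mset by blast
    ultimately show "\<alpha> \<in> mset ` {bs. set bs \<subseteq> Basis \<and> length bs = j}" by (auto simp: multi_indices_def)
  qed
  then show ?thesis using finite_Basis_lists finite_surj by blast
qed

lemma mset_multi_indices: "set bs \<subseteq> Basis \<Longrightarrow> length bs = j \<Longrightarrow> mset bs \<in> multi_indices j"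
  by (simp add: multi_indices_def)

text \<open>Integration against a derivative of order \<open>r \<ge> m\<close> of a test function: \<open>\<lfloor>m\<rfloor>\<close> of the derivatives
  are moved to \<open>\<omega>\<close>.\<close>

lemma LINT_foldr_dir_deriv_le:
  fixes \<omega> :: "'a::euclidean_space form"
  assumes p: "1 \<le> p" and D: "open D" "D \<subseteq> U" "open U"
    and V: "emeasure lebesgue D = ennreal V" "0 < V"
    and m: "0 \<le> m" "m \<le> real (length es)"
    and ex: "\<And>\<alpha>. \<alpha> \<in> multi_indices (nat \<lfloor>m\<rfloor>) \<Longrightarrow> \<exists>\<eta>. weak_deriv_form k U \<alpha> \<omega> \<eta>"
    and \<omega>: "\<And>v. locally_integrable U (\<lambda>x. \<omega> x v)"
    and \<psi>: "test_fun D \<psi>" and bd: "\<And>i x. \<bar>foldr dir_deriv (drop i es) \<psi> x\<bar> \<le> M" and M: "0 \<le> M"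
    and v: "set v \<subseteq> Basis" "length v = k"
    and es: "\<And>e. e \<in> set es \<Longrightarrow> norm e \<le> h"
    and h: "0 < h" "\<And>x y. x \<in> D \<Longrightarrow> y \<in> D \<Longrightarrow> norm (x - y) \<le> h"
    and K: "0 \<le> K" "h ^ DIM('a) \<le> K * V"
  shows "ennreal \<bar>LINT x:U|lebesgue. \<omega> x v * foldr dir_deriv es \<psi> x\<bar> \<le>
    ennreal (2 * M * sqrt (fact k) * max 1 K * V powr (1 - recip p) * real DIM('a) ^ length es) *
      (ennreal (h powr m) * sobolev_seminorm m p k U \<omega>)"
proof -
  define j where "j = nat \<lfloor>m\<rfloor>"
  define W where "W = 2 * M * sqrt (fact k) * max 1 K * V powr (1 - recip p)"
  have W: "0 \<le> W" using M by (simp add: W_def)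
  have mj: "m = real j + frac m" using m(1) by (simp add: j_def frac_def)
  have j: "j \<le> length es" using m by (simp add: j_def nat_le_iff) linarith
  \<comment> \<open>The first \<open>j\<close> directions will be moved to \<omega>; the derivatives
    along \<open>gs\<close> stay on the test function.\<close>
  define gs where "gs = drop j es"
  define \<psi>2 where "\<psi>2 = foldr dir_deriv gs \<psi>"
  have t2: "test_fun D \<psi>2" unfolding \<psi>2_def by (rule test_fun_foldr_dir_deriv[OF \<psi>])
  have t2U: "test_fun U \<psi>2" using t2 D(2) by (rule test_fun_mono)
  have s2: "smooth \<psi>2" using t2 by (simp add: test_fun_def)
  have b2: "\<bar>\<psi>2 x\<bar> \<le> M" for x unfolding \<psi>2_def gs_def by (rule bd)
  \<comment> \<open>For fractional m at least one derivative stays on the test function, so its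
    integral vanishes, as the Slobodeckij estimate demands.\<close>
  have mean: "(\<integral>x. \<psi>2 x \<partial>lborel) = 0" if "frac m \<noteq> 0"
  proof -
    have "0 < frac m" using that frac_ge_0[of m] by linarith
    then have "j < length es" using mj m by linarith
    then obtain e gs' where gs: "gs = e # gs'" unfolding gs_def by (cases "drop j es") auto
    have "test_fun D (foldr dir_deriv gs' \<psi>)" by (rule test_fun_foldr_dir_deriv[OF \<psi>])
    then show ?thesis unfolding \<psi>2_def gs
      by (auto simp: test_fun_def intro!: integral_dir_deriv_eq_0 smooth_differentiable smooth_continuous smooth_dir_deriv)
  qed
  let ?B = "{cs. set cs \<subseteq> (Basis :: 'a set) \<and> length cs = j}"
  let ?c = "\<lambda>cs. \<Prod>i<j. take j es ! i \<bullet> cs ! i"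
  let ?\<eta> = "\<lambda>cs. pderiv_form k U (mset cs) \<omega>"
  let ?N = "\<lambda>\<alpha>. seminorm_part m p k U (pderiv_form k U \<alpha> \<omega>)"
  \<comment> \<open>The expansion into coordinate directions has coefficients that are products of
    \<open>j\<close> inner products, each at most h. They produce \<open>h ^ j\<close>, and
    \<open>seminorm_part\<close> supplies the remaining \<open>h powr frac m\<close>.\<close>
  have exp: "foldr dir_deriv es \<psi> x = (\<Sum>cs\<in>?B. ?c cs * foldr dir_deriv cs \<psi>2 x)" for x
  proof -
    have "foldr dir_deriv es \<psi> = foldr dir_deriv (take j es) \<psi>2"
      unfolding \<psi>2_def gs_def by (metis append_take_drop_id foldr_append comp_apply)
    then show ?thesis using foldr_dir_deriv_expansion[OF s2, of "take j es" j x] j by simp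
  qed
  have weak: "weak_deriv_form k U (mset cs) \<omega> (?\<eta> cs)" if "cs \<in> ?B" for cs
    using ex[of "mset cs"] mset_multi_indices[of cs j] that weak_deriv_form_pderiv_form by (auto simp: j_def)
  have each: "(LINT x:U|lebesgue. \<omega> x v * foldr dir_deriv cs \<psi>2 x) = (- 1) ^ j * (LINT x:U|lebesgue. ?\<eta> cs x v * \<psi>2 x)"
    if "cs \<in> ?B" for cs
    using weak[OF that] t2U that unfolding weak_deriv_form_def weak_deriv_def by auto
  have cbound: "\<bar>?c cs\<bar> \<le> h ^ j" if "cs \<in> ?B" for cs
  proof -
    have "\<bar>?c cs\<bar> = (\<Prod>i<j. \<bar>take j es ! i \<bullet> cs ! i\<bar>)" by (rule abs_prod)
    also have "\<dots> \<le> (\<Prod>i<j. h)"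
    proof (rule prod_mono)
      fix i assume i: "i \<in> {..<j}"
      have "\<bar>take j es ! i \<bullet> cs ! i\<bar> \<le> norm (es ! i) * norm (cs ! i)"
        using i Cauchy_Schwarz_ineq2 by simp
      also have "norm (cs ! i) = 1" using that i by (auto intro!: norm_Basis subsetD[OF _ nth_mem])
      also have "norm (es ! i) \<le> h" using es i j by simp
      finally show "0 \<le> \<bar>take j es ! i \<bullet> cs ! i\<bar> \<and> \<bar>take j es ! i \<bullet> cs ! i\<bar> \<le> h" by simp
    qed
    finally show ?thesis by simp
  qed
  have int: "integrable lebesgue (\<lambda>x. indicat_real U x *\<^sub>R (\<omega> x v * foldr dir_deriv cs \<psi>2 x))" for cs
    using locally_integrable_test_fun[OF \<omega> test_fun_foldr_dir_deriv[OF t2U]] by (simp add: set_integrable_def)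
  have "(LINT x:U|lebesgue. \<omega> x v * foldr dir_deriv es \<psi> x) =
      (\<integral>x. (\<Sum>cs\<in>?B. ?c cs * (indicat_real U x *\<^sub>R (\<omega> x v * foldr dir_deriv cs \<psi>2 x))) \<partial>lebesgue)"
    unfolding set_lebesgue_integral_def exp
    by (intro Bochner_Integration.integral_cong) (simp_all add: sum_distrib_left mult_ac)
  also have "\<dots> = (\<Sum>cs\<in>?B. ?c cs * (LINT x:U|lebesgue. \<omega> x v * foldr dir_deriv cs \<psi>2 x))"
  proof -
    have "(\<integral>x. (\<Sum>cs\<in>?B. ?c cs * (indicat_real U x *\<^sub>R (\<omega> x v * foldr dir_deriv cs \<psi>2 x))) \<partial>lebesgue) =
        (\<Sum>cs\<in>?B. \<integral>x. ?c cs * (indicat_real U x *\<^sub>R (\<omega> x v * foldr dir_deriv cs \<psi>2 x)) \<partial>lebesgue)"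
      by (rule Bochner_Integration.integral_sum) (rule integrable_mult_right[OF int])
    then show ?thesis unfolding set_lebesgue_integral_def by (simp only: integral_mult_right_zero)
  qed
  finally have eq: "(LINT x:U|lebesgue. \<omega> x v * foldr dir_deriv es \<psi> x) =
      (\<Sum>cs\<in>?B. ?c cs * (LINT x:U|lebesgue. \<omega> x v * foldr dir_deriv cs \<psi>2 x))" .
  have "\<bar>LINT x:U|lebesgue. \<omega> x v * foldr dir_deriv es \<psi> x\<bar> \<le>
      (\<Sum>cs\<in>?B. h ^ j * \<bar>LINT x:U|lebesgue. ?\<eta> cs x v * \<psi>2 x\<bar>)"
    unfolding eq
  proof (rule order_trans[OF sum_abs], rule sum_mono)
    fix cs assume cs: "cs \<in> ?B"
    show "\<bar>?c cs * (LINT x:U|lebesgue. \<omega> x v * foldr dir_deriv cs \<psi>2 x)\<bar> \<le> h ^ j * \<bar>LINT x:U|lebesgue. ?\<eta> cs x v * \<psi>2 x\<bar>"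
      using cbound[OF cs] unfolding each[OF cs] by (simp add: abs_mult mult_right_mono)
  qed
  then have "ennreal \<bar>LINT x:U|lebesgue. \<omega> x v * foldr dir_deriv es \<psi> x\<bar> \<le>
      ennreal (\<Sum>cs\<in>?B. h ^ j * \<bar>LINT x:U|lebesgue. ?\<eta> cs x v * \<psi>2 x\<bar>)" by (rule ennreal_leI)
  also have "\<dots> = (\<Sum>cs\<in>?B. ennreal (h ^ j) * ennreal \<bar>LINT x:U|lebesgue. ?\<eta> cs x v * \<psi>2 x\<bar>)"
    using h(1) by (subst sum_ennreal[symmetric]) (auto simp: ennreal_mult')
  also have "\<dots> \<le> (\<Sum>cs\<in>?B. ennreal (h ^ j) * (ennreal (W * h powr frac m) * (\<Sum>\<alpha>\<in>multi_indices j. ?N \<alpha>)))"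
  proof (intro sum_mono mult_left_mono)
    fix cs assume cs: "cs \<in> ?B"
    have "ennreal \<bar>LINT x:U|lebesgue. ?\<eta> cs x v * \<psi>2 x\<bar> \<le> ennreal (W * h powr frac m) * ?N (mset cs)"
      unfolding W_def using weak[OF cs]
      by (intro LINT_test_fun_le_seminorm_part[OF p D V _ t2 b2 M v mean h K])
        (auto simp: weak_deriv_form_def weak_deriv_def)
    also have "?N (mset cs) \<le> (\<Sum>\<alpha>\<in>multi_indices j. ?N \<alpha>)"
      using cs by (intro member_le_sum finite_multi_indices mset_multi_indices) auto
    finally show "ennreal \<bar>LINT x:U|lebesgue. ?\<eta> cs x v * \<psi>2 x\<bar> \<le> ennreal (W * h powr frac m) * (\<Sum>\<alpha>\<in>multi_indices j. ?N \<alpha>)"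
      by (simp add: mult_left_mono)
  qed simp
  also have "\<dots> = of_nat (DIM('a) ^ j) * (ennreal (h ^ j) * (ennreal (W * h powr frac m) * sobolev_seminorm m p k U \<omega>))"
    by (simp only: sum_constant card_Basis_lists sobolev_seminorm_eq j_def)
  also have "\<dots> = ennreal (real (DIM('a) ^ j) * h ^ j * (W * h powr frac m)) * sobolev_seminorm m p k U \<omega>"
    using h(1) by (simp add: ennreal_of_nat_eq_real_of_nat ennreal_mult' mult.assoc)
  also have "real (DIM('a) ^ j) * h ^ j * (W * h powr frac m) = W * real DIM('a) ^ j * h powr m"
    using h(1) by (subst (2) mj) (simp add: powr_add powr_realpow mult_ac)
  \<comment> \<open>Raising the exponent from \<open>j\<close> to \<open>length es\<close> makes the
    constant independent of m.\<close>
  also have "ennreal (W * real DIM('a) ^ j * h powr m) * sobolev_seminorm m p k U \<omega> \<le>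
      ennreal (W * real DIM('a) ^ length es * h powr m) * sobolev_seminorm m p k U \<omega>"
  proof (intro mult_right_mono ennreal_leI)
    have "1 \<le> real DIM('a)" using DIM_positive[where 'a = 'a] by (simp add: Suc_le_eq)
    then show "W * real DIM('a) ^ j \<le> W * real DIM('a) ^ length es"
      using W j by (intro mult_left_mono power_increasing)
  qed auto
  also have "\<dots> = ennreal (W * real DIM('a) ^ length es) * (ennreal (h powr m) * sobolev_seminorm m p k U \<omega>)"
    using W by (simp add: ennreal_mult' mult.assoc)
  finally show ?thesis by (simp add: W_def)
qed

lemma prod_list_abs_le_1: "(\<And>x. x \<in> set xs \<Longrightarrow> \<bar>x\<bar> \<le> 1) \<Longrightarrow> \<bar>prod_list xs\<bar> \<le> (1 :: real)"
  by (induction xs) (auto simp: abs_mult intro!: mult_le_one)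

text \<open>The constant is a function of the bound \<open>K\<close> for the ratio of diameter^n to
  measure alone, ready to be evaluated at a multiple of the shape measure. The set \<open>U\<close>
  may exceed the simplex, since the seminorm is finally taken over the star patch.\<close>

lemma lower_degree_approximation:
  fixes p :: ennreal and r k :: nat
  assumes p: "1 \<le> p"
  shows "\<exists>F :: real \<Rightarrow> real. (\<forall>K. 0 \<le> F K) \<and> (\<forall>(C :: 'a::euclidean_space set) U \<omega> q m K.
    \<not> affine_dependent C \<longrightarrow> card C = DIM('a) + 1 \<longrightarrow> open U \<longrightarrow> interior (convex hull C) \<subseteq> U \<longrightarrow>
    0 < measure lebesgue (convex hull C) \<longrightarrow> 0 < diameter (convex hull C) \<longrightarrow> 0 \<le> K \<longrightarrow>
    diameter (convex hull C) ^ DIM('a) \<le> K * measure lebesgue (convex hull C) \<longrightarrow>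
    0 \<le> m \<longrightarrow> m \<le> real r \<longrightarrow> (\<forall>\<alpha>\<in>multi_indices (nat \<lfloor>m\<rfloor>). \<exists>\<eta>. weak_deriv_form k U \<alpha> \<omega> \<eta>) \<longrightarrow>
    (\<forall>v. locally_integrable U (\<lambda>x. \<omega> x v)) \<longrightarrow> q \<in> poly_forms (int r) (int k) \<longrightarrow>
    (\<exists>Q\<in>poly_forms (int r - 1) (int k). Lp_norm p k (convex hull C) (q - Q) \<le>
      ennreal (F K) * (Lp_norm p k (interior (convex hull C)) (q - \<omega>) +
        ennreal (diameter (convex hull C) powr m) * sobolev_seminorm m p k U \<omega>)))"
proof -
  obtain M c where M: "0 < M" and c: "0 < c" and ref: "\<And>C :: 'a set. \<not> affine_dependent C \<Longrightarrow> card C = DIM('a) + 1 \<Longrightarrow>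
     (\<exists>(A :: 'a \<Rightarrow> 'a) L v \<psi>. linear A \<and> linear L \<and> (\<forall>x. A (L x) = x) \<and>
        (\<forall>b\<in>Basis. norm (A b) \<le> diameter (convex hull C)) \<and>
        (\<forall>x\<in>convex hull C. \<forall>b\<in>Basis. \<bar>L (x - v) \<bullet> b\<bar> \<le> 1) \<and>
        test_fun (interior (convex hull C)) \<psi> \<and>
        c * measure lebesgue (convex hull C) \<le> (\<integral>x. \<psi> x \<partial>lborel) \<and>
        (\<forall>bs x. set bs \<subseteq> Basis \<and> length bs \<le> r \<longrightarrow> \<bar>foldr dir_deriv (map A bs) \<psi> x\<bar> \<le> M))"
    using simplex_test_function[where 'a = 'a and r = r] by blast
  define n where "n = real DIM('a)"
  have n: "1 \<le> n" using DIM_positive[where 'a = 'a] by (simp add: n_def Suc_le_eq)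
  \<comment> \<open>\<open>c\<close> bounds the mean of the bump from below, \<open>M\<close> bounds
    its derivatives, and \<open>n ^ r\<close> counts the terms in the coordinate expansion of
    \<open>r\<close> directions. The other factors come from the estimates against test
    functions.\<close>
  define C5 where "C5 K = 2 * M * sqrt (fact k) * max 1 K * n ^ r / c" for K
  have C5: "0 \<le> C5 K" for K using M c n by (simp add: C5_def)
  have main: "\<exists>Q\<in>poly_forms (int r - 1) (int k). Lp_norm p k (convex hull C) (q - Q) \<le>
      ennreal (n ^ k * n ^ r * C5 K) * (Lp_norm p k (interior (convex hull C)) (q - \<omega>) +
        ennreal (diameter (convex hull C) powr m) * sobolev_seminorm m p k U \<omega>)"
    if C: "\<not> affine_dependent C" "card C = DIM('a) + 1" and U: "open U" "interior (convex hull C) \<subseteq> U"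
      and Vpos: "0 < measure lebesgue (convex hull C)" and hpos: "0 < diameter (convex hull C)"
      and K: "0 \<le> K" "diameter (convex hull C) ^ DIM('a) \<le> K * measure lebesgue (convex hull C)"
      and m: "0 \<le> m" "m \<le> real r" and ex: "\<forall>\<alpha>\<in>multi_indices (nat \<lfloor>m\<rfloor>). \<exists>\<eta>. weak_deriv_form k U \<alpha> \<omega> \<eta>"
      and \<omega>: "\<forall>v. locally_integrable U (\<lambda>x. \<omega> x v)" and q: "q \<in> poly_forms (int r) (int k)"
    for C :: "'a set" and U \<omega> q m K
  proof -
    define T where "T = convex hull C"
    define D where "D = interior T"
    define V where "V = measure lebesgue T"
    define h where "h = diameter T"
    obtain A L v0 \<psi> where A: "linear A" and L: "linear L" and AL: "\<And>x. A (L x) = x"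
      and edge: "\<And>b. b \<in> Basis \<Longrightarrow> norm (A b) \<le> h"
      and coord: "\<And>x b. x \<in> T \<Longrightarrow> b \<in> Basis \<Longrightarrow> \<bar>L (x - v0) \<bullet> b\<bar> \<le> 1"
      and \<psi>: "test_fun D \<psi>" and vol: "c * V \<le> (\<integral>x. \<psi> x \<partial>lborel)"
      and bnd: "\<And>bs x. set bs \<subseteq> (Basis :: 'a set) \<Longrightarrow> length bs \<le> r \<Longrightarrow> \<bar>foldr dir_deriv (map A bs) \<psi> x\<bar> \<le> M"
      using ref[OF C] unfolding T_def[symmetric] D_def[symmetric] V_def[symmetric] h_def[symmetric] by blast
    have fin: "finite C" using C(2) by (rule_tac card_ge_0_finite) simp
    have cT: "compact T" unfolding T_def using fin by (rule finite_imp_compact_convex_hull)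
    have D: "open D" "D \<subseteq> U" using U by (simp_all add: D_def T_def)
    have emT: "emeasure lebesgue T = ennreal V"
      unfolding V_def using lmeasurable_compact[OF cT] by (intro emeasure_eq_measure2) auto
    have emD: "emeasure lebesgue D = ennreal V"
    proof -
      have "negligible (frontier T)" unfolding T_def by (intro negligible_convex_frontier convex_convex_hull)
      moreover have "T - D \<subseteq> frontier T" using closure_subset[of T] by (auto simp: D_def frontier_def)
      ultimately have "negligible (T - D)" by (rule negligible_subset)
      moreover have "T = D \<union> (T - D)" using interior_subset[of T] by (auto simp: D_def)
      moreover have "D \<in> sets lebesgue" using D(1) by simp
      ultimately have "emeasure lebesgue T = emeasure lebesgue D"
        using emeasure_Un_null_set[of D lebesgue "T - D"] by (simp add: negligible_iff_null_sets)
      then show ?thesis using emT by simp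
    qed
    have V: "0 < V" and h: "0 < h" using Vpos hpos by (simp_all add: V_def T_def h_def)
    have diam: "norm (x - y) \<le> h" if "x \<in> D" "y \<in> D" for x y
      using diameter_bounded_bound[OF compact_imp_bounded[OF cT], of x y] that interior_subset[of T]
      by (auto simp: D_def h_def dist_norm)
    have K': "h ^ DIM('a) \<le> K * V" using K(2) by (simp add: h_def T_def V_def)
    define E where "E = Lp_norm p k D (q - \<omega>)"
    define S where "S = ennreal (h powr m) * sobolev_seminorm m p k U \<omega>"
    define W where "W = 2 * M * sqrt (fact k) * max 1 K * V powr (1 - recip p) * n ^ r"
    have W: "0 \<le> W" using M n by (simp add: W_def)
    let ?B = "\<lambda>j. {bs. set bs \<subseteq> (Basis :: 'a set) \<and> length bs = j}"
    \<comment> \<open>Derivatives of order \<open>r\<close> of a polynomial of degree at most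
      \<open>r\<close> are constant, so they can be recovered from their integral against the
      bump.\<close>
    define \<kappa> where "\<kappa> bs v = foldr dir_deriv (map A bs) (\<lambda>z. q z v) v0" for bs v
    have const: "foldr dir_deriv (map A bs) (\<lambda>z. q z v) x = \<kappa> bs v" if "bs \<in> ?B r" for bs v x
      unfolding \<kappa>_def using polys_foldr_dir_deriv[OF poly_forms_polys[OF q], of "map A bs" v] that
      by (intro polys_zero_const) simp
    have coeff: "ennreal \<bar>\<kappa> bs v\<bar> \<le> ennreal (C5 K * V powr (- recip p)) * (E + S)"
      if bs: "bs \<in> ?B r" and v: "v \<in> ?B k" for bs v
    proof -
      \<comment> \<open>The reversal reflects that repeated integration by parts moves the
        derivatives to \<psi> in opposite order.\<close>
      let ?es = "map A (rev bs)"
      let ?\<psi> = "foldr dir_deriv ?es \<psi>"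
      have sq: "smooth (\<lambda>z. q z v)" using poly_forms_polys[OF q] by (rule polys_smooth)
      have tU: "test_fun U ?\<psi>" by (rule test_fun_foldr_dir_deriv[OF test_fun_mono[OF \<psi> D(2)]])
      have li: "locally_integrable U (\<lambda>x. (q - \<omega>) x v)" for v
      proof -
        have "locally_integrable U (\<lambda>x. q x v)"
          using poly_forms_polys[OF q] by (intro continuous_locally_integrable polys_continuous)
        then show ?thesis using \<omega> by (simp add: locally_integrable_def set_integral_diff)
      qed
      have "\<kappa> bs v * (\<integral>x. \<psi> x \<partial>lborel) = (\<integral>x. foldr dir_deriv (map A bs) (\<lambda>z. q z v) x * \<psi> x \<partial>lborel)"
        by (simp add: const[OF bs])
      also have "\<dots> = (- 1) ^ r * (\<integral>x. q x v * ?\<psi> x \<partial>lborel)"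
        using integral_by_parts_foldr[OF \<psi> sq, of "map A bs"] bs by (simp add: rev_map)
      also have "(\<integral>x. q x v * ?\<psi> x \<partial>lborel) = (LINT x:U|lebesgue. q x v * ?\<psi> x)"
        using LINT_test_fun_lborel[OF smooth_continuous[OF sq] tU] by simp
      \<comment> \<open>The first summand is controlled by the distance of q from \<omega>; in the
        second, derivatives can be moved from the test function to \<omega>.\<close>
      also have "\<dots> = (LINT x:U|lebesgue. (q - \<omega>) x v * ?\<psi> x + \<omega> x v * ?\<psi> x)"
        by (simp add: algebra_simps)
      also have "\<dots> = (LINT x:U|lebesgue. (q - \<omega>) x v * ?\<psi> x) + (LINT x:U|lebesgue. \<omega> x v * ?\<psi> x)"
        using \<omega> by (intro set_integral_add locally_integrable_test_fun li tU) auto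
      finally have "\<bar>\<kappa> bs v\<bar> * \<bar>\<integral>x. \<psi> x \<partial>lborel\<bar> \<le>
          \<bar>LINT x:U|lebesgue. (q - \<omega>) x v * ?\<psi> x\<bar> + \<bar>LINT x:U|lebesgue. \<omega> x v * ?\<psi> x\<bar>"
        by (simp add: abs_mult[symmetric]) (simp add: abs_mult)
      moreover have "\<bar>\<kappa> bs v\<bar> * (c * V) \<le> \<bar>\<kappa> bs v\<bar> * \<bar>\<integral>x. \<psi> x \<partial>lborel\<bar>"
        using vol by (intro mult_left_mono) auto
      ultimately have "ennreal (\<bar>\<kappa> bs v\<bar> * (c * V)) \<le>
          ennreal (\<bar>LINT x:U|lebesgue. (q - \<omega>) x v * ?\<psi> x\<bar> + \<bar>LINT x:U|lebesgue. \<omega> x v * ?\<psi> x\<bar>)"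
        by (intro ennreal_leI) linarith
      also have "\<dots> = ennreal \<bar>LINT x:U|lebesgue. (q - \<omega>) x v * ?\<psi> x\<bar> + ennreal \<bar>LINT x:U|lebesgue. \<omega> x v * ?\<psi> x\<bar>"
        by (intro ennreal_plus) auto
      also have "\<dots> \<le> ennreal W * E + ennreal W * S"
      proof (rule add_mono)
        have "ennreal \<bar>LINT x:U|lebesgue. (q - \<omega>) x v * ?\<psi> x\<bar> \<le>
            ennreal (2 * M * sqrt (fact k) * V powr (1 - recip p)) * Lp_norm p k D (q - \<omega>)"
        proof (rule LINT_test_fun_le_Lp_norm[OF p D _ emD V])
          show "(\<lambda>x. (q - \<omega>) x v) \<in> borel_measurable (lebesgue_on D)" for v
            using locally_integrable_measurable[OF D(1) locally_integrable_mono[OF li D(2)]] .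
          show "\<bar>?\<psi> x\<bar> \<le> M" for x using bnd[of "rev bs"] bs by simp
        qed (use U(1) M v test_fun_foldr_dir_deriv[OF \<psi>] in auto)
        also have "\<dots> \<le> ennreal W * E"
          unfolding E_def
        proof (intro mult_right_mono ennreal_leI)
          have "1 * 1 \<le> max 1 K * n ^ r" using n by (intro mult_mono one_le_power) auto
          then have "2 * M * sqrt (fact k) * V powr (1 - recip p) * 1 \<le> 2 * M * sqrt (fact k) * V powr (1 - recip p) * (max 1 K * n ^ r)"
            using M by (intro mult_left_mono) auto
          then show "2 * M * sqrt (fact k) * V powr (1 - recip p) \<le> W" by (simp add: W_def mult_ac)
        qed simp
        finally show "ennreal \<bar>LINT x:U|lebesgue. (q - \<omega>) x v * ?\<psi> x\<bar> \<le> ennreal W * E" .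
        have "ennreal \<bar>LINT x:U|lebesgue. \<omega> x v * ?\<psi> x\<bar> \<le>
          ennreal (2 * M * sqrt (fact k) * max 1 K * V powr (1 - recip p) * real DIM('a) ^ length ?es) * S"
          unfolding S_def
        proof (rule LINT_foldr_dir_deriv_le[OF p D U(1) emD V m(1)])
          show "m \<le> real (length ?es)" using m bs by simp
          show "\<bar>foldr dir_deriv (drop i ?es) \<psi> x\<bar> \<le> M" for i x
            using bnd[of "drop i (rev bs)" x] bs set_drop_subset[of i "rev bs"] by (auto simp: drop_map)
          show "norm e \<le> h" if "e \<in> set ?es" for e using that bs edge by auto
        qed (use ex \<omega> \<psi> M v h diam K(1) K' in auto)
        then show "ennreal \<bar>LINT x:U|lebesgue. \<omega> x v * ?\<psi> x\<bar> \<le> ennreal W * S"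
          using bs by (simp add: W_def n_def)
      qed
      also have "\<dots> = ennreal W * (E + S)" by (simp add: distrib_left)
      finally have "ennreal (1 / (c * V)) * ennreal (\<bar>\<kappa> bs v\<bar> * (c * V)) \<le> ennreal (1 / (c * V)) * (ennreal W * (E + S))"
        by (rule mult_left_mono) simp
      also have "ennreal (1 / (c * V)) * ennreal (\<bar>\<kappa> bs v\<bar> * (c * V)) = ennreal \<bar>\<kappa> bs v\<bar>"
        using c V by (simp add: ennreal_mult'[symmetric])
      also have "ennreal (1 / (c * V)) * (ennreal W * (E + S)) = ennreal (1 / (c * V) * W) * (E + S)"
        using c V by (subst ennreal_mult') (simp_all add: mult.assoc)
      also have "1 / (c * V) * W = C5 K * V powr (- recip p)"
      proof -
        have "V powr (1 - recip p) / V = V powr (- recip p)"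
          using V by (simp add: powr_diff powr_minus divide_inverse)
        then have "2 * M * sqrt (fact k) * max 1 K * n ^ r / c * (V powr (1 - recip p) / V) = C5 K * V powr (- recip p)"
          by (simp add: C5_def)
        then show ?thesis by (simp add: W_def mult_ac)
      qed
      finally show ?thesis .
    qed
    define Q where "Q = (\<lambda>x v. q x v - top_part A L v0 r (\<lambda>z. q z v) x / fact r)"
    have Q: "Q \<in> poly_forms (int r - 1) (int k)" unfolding Q_def by (rule diff_top_part_form[OF A L AL q])
    \<comment> \<open>The coordinates of \<open>L (x - v0)\<close> are at most 1 in modulus on
      \<open>T\<close>, so the sum of the constants \<kappa> dominates q - Q pointwise, whatever the
      shape of \<open>T\<close>.\<close>
    define B where "B = (\<Sum>v\<in>?B k. \<Sum>bs\<in>?B r. \<bar>\<kappa> bs v\<bar>)"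
    have B0: "0 \<le> B" by (simp add: B_def sum_nonneg)
    have QB: "alt_norm k ((q - Q) x) \<le> B" if "x \<in> T" for x
    proof -
      have "alt_norm k ((q - Q) x) \<le> (\<Sum>v\<in>?B k. \<bar>(q - Q) x v\<bar>)" by (rule alt_norm_le_sum)
      also have "\<dots> \<le> B"
        unfolding B_def
      proof (rule sum_mono)
        fix v assume "v \<in> ?B k"
        have "\<bar>(q - Q) x v\<bar> = \<bar>top_part A L v0 r (\<lambda>z. q z v) x\<bar> / fact r" by (simp add: Q_def)
        also have "\<dots> \<le> \<bar>top_part A L v0 r (\<lambda>z. q z v) x\<bar> / 1"
          by (intro divide_left_mono) (auto simp: fact_ge_1)
        also have "\<dots> \<le> (\<Sum>bs\<in>?B r. \<bar>(\<Prod>b\<leftarrow>bs. L (x - v0) \<bullet> b) * foldr dir_deriv (map A bs) (\<lambda>z. q z v) x\<bar>)"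
          unfolding top_part_def by simp
        also have "\<dots> \<le> (\<Sum>bs\<in>?B r. \<bar>\<kappa> bs v\<bar>)"
        proof (rule sum_mono)
          fix bs assume bs: "bs \<in> ?B r"
          have "\<bar>\<Prod>b\<leftarrow>bs. L (x - v0) \<bullet> b\<bar> \<le> 1"
            using bs coord[OF that] by (intro prod_list_abs_le_1) auto
          then show "\<bar>(\<Prod>b\<leftarrow>bs. L (x - v0) \<bullet> b) * foldr dir_deriv (map A bs) (\<lambda>z. q z v) x\<bar> \<le> \<bar>\<kappa> bs v\<bar>"
            unfolding const[OF bs] abs_mult by (intro mult_left_le_one_le) auto
        qed
        finally show "\<bar>(q - Q) x v\<bar> \<le> (\<Sum>bs\<in>?B r. \<bar>\<kappa> bs v\<bar>)" .
      qed
      finally show ?thesis .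
    qed
    have qQ: "q - Q \<in> poly_forms (int r) (int k)"
      using poly_forms_diff[OF q poly_forms_mono[OF _ Q, of "int r"]] by simp
    have "ennreal B = (\<Sum>v\<in>?B k. \<Sum>bs\<in>?B r. ennreal \<bar>\<kappa> bs v\<bar>)"
      unfolding B_def by (simp add: sum_ennreal sum_nonneg)
    also have "\<dots> \<le> (\<Sum>v\<in>?B k. \<Sum>bs\<in>?B r. ennreal (C5 K * V powr (- recip p)) * (E + S))"
      by (intro sum_mono coeff)
    also have "\<dots> = of_nat (DIM('a) ^ k) * (of_nat (DIM('a) ^ r) * (ennreal (C5 K * V powr (- recip p)) * (E + S)))"
      by (simp only: sum_constant card_Basis_lists)
    finally have eB: "ennreal B \<le> of_nat (DIM('a) ^ k) * (of_nat (DIM('a) ^ r) * (ennreal (C5 K * V powr (- recip p)) * (E + S)))" .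
    have "Lp_norm p k T (q - Q) \<le> ennreal 1 * lpnorm p (lebesgue_on T) (\<lambda>_. B)"
      unfolding Lp_norm_eq_lpnorm
    proof (rule lpnorm_mono_AE[OF p])
      show "(\<lambda>x. alt_norm k ((q - Q) x)) \<in> borel_measurable (lebesgue_on T)"
        by (intro continuous_borel_measurable_lebesgue_on continuous_on_alt_norm polys_continuous[OF poly_forms_polys[OF qQ]])
      show "AE x in lebesgue_on T. alt_norm k ((q - Q) x) \<le> 1 * B" using QB by (intro AE_I2) simp
    qed (auto simp: alt_norm_nonneg B0)
    also have "\<dots> \<le> ennreal (B * V powr recip p)"
      using lpnorm_const_le[OF p B0, of "lebesgue_on T" V] emT V cT
      by (simp add: emeasure_restrict_space compact_imp_closed)
    also have "\<dots> = ennreal (V powr recip p) * ennreal B" using B0 by (simp add: ennreal_mult' mult.commute)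
    also have "\<dots> \<le> ennreal (V powr recip p) * (of_nat (DIM('a) ^ k) * (of_nat (DIM('a) ^ r) * (ennreal (C5 K * V powr (- recip p)) * (E + S))))"
      by (rule mult_left_mono[OF eB]) simp
    also have "\<dots> =
        ennreal (V powr recip p * (n ^ k * (n ^ r * (C5 K * V powr (- recip p))))) * (E + S)"
      using n C5[of K] by (simp add: ennreal_of_nat_eq_real_of_nat ennreal_mult' mult.assoc n_def)
    \<comment> \<open>The factor V^(-1/p) in the bound of the coefficients cancels the norm V^(1/p)
      of the constant 1 on \<open>T\<close>.\<close>
    also have "V powr recip p * (n ^ k * (n ^ r * (C5 K * V powr (- recip p)))) = n ^ k * n ^ r * C5 K"
      using V by (simp add: powr_minus)
    finally have "Lp_norm p k T (q - Q) \<le> ennreal (n ^ k * n ^ r * C5 K) * (E + S)" .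
    then show ?thesis using Q by (auto simp: E_def S_def D_def T_def h_def)
  qed
  show ?thesis
    by (rule exI[of _ "\<lambda>K. n ^ k * n ^ r * C5 K"]) (use main C5 n in \<open>auto intro!: mult_nonneg_nonneg\<close>)
qed

section \<open>The Clement interpolant\<close>

lemma alt_norm_eq_L2_set: "alt_norm k A = L2_set A {v. set v \<subseteq> Basis \<and> length v = k} / sqrt (fact k)"
  by (simp add: alt_norm_def L2_set_def real_sqrt_divide)

lemma alt_norm_add_le: "alt_norm k (A + B) \<le> alt_norm k A + alt_norm k B"
  unfolding alt_norm_eq_L2_set add_divide_distrib[symmetric] plus_fun_def
  by (intro divide_right_mono L2_set_triangle_ineq) simp

lemma alt_norm_minus_commute: "alt_norm k (A - B) = alt_norm k (B - A)"
  by (simp add: alt_norm_def power2_commute[of "A _" "B _"])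

lemma alt_norm_0 [simp]: "alt_norm k 0 = 0"
  by (simp add: alt_norm_def)

lemma alt_norm_sum_le: "alt_norm k (\<Sum>i\<in>I. A i) \<le> (\<Sum>i\<in>I. alt_norm k (A i))"
proof (induction I rule: infinite_finite_induct)
  case (insert i I)
  have "alt_norm k (A i + (\<Sum>i\<in>I. A i)) \<le> alt_norm k (A i) + (\<Sum>i\<in>I. alt_norm k (A i))"
    using alt_norm_add_le[of k "A i" "\<Sum>i\<in>I. A i"] insert.IH by linarith
  then show ?case by (simp only: sum.insert[OF insert.hyps(1,2)])
qed (simp_all del: zero_fun_apply)

lemma Lp_norm_restrict:
  fixes \<omega> :: "'a::euclidean_space form"
  assumes "1 \<le> p" "S \<subseteq> T" "S \<in> sets lebesgue" "T \<in> sets lebesgue" "\<And>x. x \<in> S \<Longrightarrow> \<omega> x = \<eta> x"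
  shows "Lp_norm p k S \<omega> \<le> Lp_norm p k T \<eta>"
  unfolding Lp_norm_eq_lpnorm using assms by (intro lpnorm_le_AE_eq AE_I2) auto

lemma Lp_norm_minus_commute: "Lp_norm p k T (\<omega> - \<eta>) = Lp_norm p k T (\<eta> - \<omega>)"
  unfolding Lp_norm_eq_lpnorm by (simp add: alt_norm_minus_commute[of k "\<omega> _"])

text \<open>\<open>lpnorm_sum_le\<close> with two summands, indexed by \<open>bool\<close>, yields
  the factor 4.\<close>

lemma Lp_norm_triangle:
  fixes \<omega> \<eta> \<zeta> :: "'a::euclidean_space form"
  assumes p: "1 \<le> p" and m: "\<And>v. (\<lambda>x. \<omega> x v) \<in> borel_measurable (lebesgue_on T)"
    "\<And>v. (\<lambda>x. \<eta> x v) \<in> borel_measurable (lebesgue_on T)" "\<And>v. (\<lambda>x. \<zeta> x v) \<in> borel_measurable (lebesgue_on T)"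
  shows "Lp_norm p k T (\<omega> - \<zeta>) \<le> 4 * (Lp_norm p k T (\<omega> - \<eta>) + Lp_norm p k T (\<eta> - \<zeta>))"
proof -
  let ?f = "\<lambda>i::bool. if i then (\<lambda>x. alt_norm k ((\<omega> - \<eta>) x)) else (\<lambda>x. alt_norm k ((\<eta> - \<zeta>) x))"
  have meas: "(\<lambda>x. alt_norm k (\<alpha> x - \<beta> x)) \<in> borel_measurable (lebesgue_on T)"
    if "\<And>v. (\<lambda>x. \<alpha> x v) \<in> borel_measurable (lebesgue_on T)" "\<And>v. (\<lambda>x. \<beta> x v) \<in> borel_measurable (lebesgue_on T)" for \<alpha> \<beta> :: "'a form"
    using alt_norm_measurable[of "\<alpha> - \<beta>"] that by simp
  have "lpnorm p (lebesgue_on T) (\<lambda>x. alt_norm k ((\<omega> - \<zeta>) x)) \<le>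
      ennreal ((real (card (UNIV :: bool set)))\<^sup>2) * (\<Sum>i\<in>UNIV. lpnorm p (lebesgue_on T) (?f i))"
  proof (rule lpnorm_sum_le[OF p])
    have "alt_norm k ((\<omega> - \<zeta>) x) \<le> (\<Sum>i\<in>UNIV. ?f i x)" for x
      using alt_norm_add_le[of k "(\<omega> - \<eta>) x" "(\<eta> - \<zeta>) x"] by (simp add: UNIV_bool)
    then show "AE x in lebesgue_on T. alt_norm k ((\<omega> - \<zeta>) x) \<le> (\<Sum>i\<in>UNIV. ?f i x)" by simp
  qed (auto simp: alt_norm_nonneg intro!: meas m)
  then show ?thesis unfolding Lp_norm_eq_lpnorm by (simp add: UNIV_bool add.commute)
qed

lemma clement_apply:
  "clement fam r k \<T> \<phi>' \<phi> P \<omega> x = (\<Sum>S\<in>\<T>. \<Sum>i\<in>indices fam r k S. \<phi>' S i (P S \<omega>) *\<^sub>R \<phi> S i x)"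
  by (simp add: clement_def sum_fun_apply scaleR_fun_def)

lemma Lp_forms_measurable: "\<omega> \<in> Lp_forms p k U \<Longrightarrow> (\<lambda>x. \<omega> x v) \<in> borel_measurable (lebesgue_on U)"
  and Lp_forms_alt: "\<omega> \<in> Lp_forms p k U \<Longrightarrow> x \<in> U \<Longrightarrow> \<omega> x \<in> alt_forms (int k)"
  by (simp_all add: Lp_forms_def)

lemma shape_function_Lp:
  assumes "biorthogonal_system p fam r k \<T> \<Omega> \<phi>' \<phi> C" "S \<in> \<T>" "i \<in> indices fam r k S"
  shows "\<phi> S i \<in> Lp_forms \<infinity> k \<Omega>"
  using biorthogonal_systemD(2)[OF assms] by (simp add: fe_space_def W_forms_def)

lemma clement_measurable:
  fixes T :: "'a::euclidean_space set"
  assumes tri: "triangulates \<T> \<Omega>" and bio: "biorthogonal_system p fam r k \<T> \<Omega> \<phi>' \<phi> C"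
    and T: "T \<in> top_simplices \<T>"
  shows "(\<lambda>x. clement fam r k \<T> \<phi>' \<phi> P \<omega> x v) \<in> borel_measurable (lebesgue_on T)"
proof -
  have "(\<lambda>x. \<phi> S i x v) \<in> borel_measurable (lebesgue_on T)" if "S \<in> \<T>" "i \<in> indices fam r k S" for S i
    by (rule top_simplex_measurable[OF tri T Lp_forms_measurable[OF shape_function_Lp[OF bio that]]])
  then show ?thesis
    unfolding clement_apply sum_fun_apply scaleR_fun_def
    by (intro borel_measurable_sum) simp
qed

text \<open>A list of more than n basis vectors has a repetition, so \<omega> and all shape
  functions have no nonzero components on \<Omega>. This leaves finitely many form degrees for the
  final constant.\<close>

lemma clement_high_degree:
  fixes T :: "'a::euclidean_space set"
  assumes p: "1 \<le> p" and k: "DIM('a) < k" and tri: "triangulates \<T> \<Omega>"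
    and bio: "biorthogonal_system p fam r k \<T> \<Omega> \<phi>' \<phi> C" and T: "T \<in> top_simplices \<T>"
    and \<omega>: "\<omega> \<in> Lp_forms p k \<Omega>"
  shows "Lp_norm p k T (\<omega> - clement fam r k \<T> \<phi>' \<phi> P \<omega>) = 0"
proof -
  let ?I = "clement fam r k \<T> \<phi>' \<phi> P \<omega>"
  have zero: "A v = 0" if "A \<in> alt_forms (int k)" "set v \<subseteq> Basis" "length v = k" for A and v :: "'a list"
  proof -
    have "\<not> distinct v"
    proof
      assume "distinct v"
      then have "length v = card (set v)" by (simp add: distinct_card)
      also have "\<dots> \<le> DIM('a)" using that(2) by (intro card_mono) auto
      finally show False using k that(3) by simp
    qed
    then obtain i j where "i < j" "j < length v" "v ! i = v ! j"
      unfolding distinct_conv_nth by (metis nat_neq_iff)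
    then show ?thesis by (rule alt_forms_eq_0[OF that(1)])
  qed
  have "alt_norm k ((\<omega> - ?I) x) \<le> 0" if "x \<in> \<Omega>" for x
  proof -
    have "(\<omega> - ?I) x v = 0" if v: "set v \<subseteq> Basis" "length v = k" for v
    proof -
      have "\<phi> S i x v = 0" if "S \<in> \<T>" "i \<in> indices fam r k S" for S i
        using zero[OF Lp_forms_alt[OF shape_function_Lp[OF bio that] \<open>x \<in> \<Omega>\<close>] v] .
      then have "?I x v = 0" by (simp add: clement_apply sum_fun_apply scaleR_fun_def)
      then show ?thesis using zero[OF Lp_forms_alt[OF \<omega> \<open>x \<in> \<Omega>\<close>] v] by simp
    qed
    then have "alt_norm k ((\<omega> - ?I) x) = alt_norm k (0 :: 'a list \<Rightarrow> real)"
      by (intro alt_norm_cong) simp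
    then show ?thesis by simp
  qed
  then have "AE x in lebesgue_on \<Omega>. alt_norm k ((\<omega> - ?I) x) \<le> 1 * 0" by (intro AE_I2) simp
  from AE_top_simplex[OF tri T this]
  have ae: "AE x in lebesgue_on T. alt_norm k ((\<omega> - ?I) x) \<le> 1 * 0" .
  have "(\<lambda>x. (\<omega> - ?I) x v) \<in> borel_measurable (lebesgue_on T)" for v
    using top_simplex_measurable[OF tri T Lp_forms_measurable[OF \<omega>]] clement_measurable[OF tri bio T] by simp
  from lpnorm_mono_AE[OF p alt_norm_measurable[OF this] ae] show ?thesis
    by (simp add: Lp_norm_eq_lpnorm lpnorm_0 alt_norm_nonneg)
qed

lemma clement_estimate_fixed_degree:
  fixes p :: ennreal and r k :: nat and CA CBH :: "real \<Rightarrow> real"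
  assumes p: "1 \<le> p"
  shows "\<exists>G :: real \<Rightarrow> real. (\<forall>\<mu>. 0 \<le> G \<mu>) \<and>
    (\<forall>(\<T> :: 'a::euclidean_space set set) \<Omega> fam \<phi>' \<phi> P m T \<omega>.
       triangulates \<T> \<Omega> \<longrightarrow>
       biorthogonal_system p fam r k \<T> \<Omega> \<phi>' \<phi> (CA (shape_measure \<T>)) \<longrightarrow>
       (\<forall>S\<in>\<T>. local_projection p r k \<T> \<Omega> (CBH (shape_measure \<T>)) S (P S)) \<longrightarrow>
       0 \<le> m \<longrightarrow> m \<le> (if fam = Full then real r + 1 else real r) \<longrightarrow>
       T \<in> top_simplices \<T> \<longrightarrow> \<omega> \<in> sobolev_forms m p k \<Omega> \<longrightarrow>
       Lp_norm p k T (\<omega> - clement fam r k \<T> \<phi>' \<phi> P \<omega>) \<le>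
         ennreal (G (shape_measure \<T>) * mesh_size \<T> T powr m) *
         sobolev_seminorm m p k (interior (star_patch \<T> T)) \<omega>)"
proof -
  obtain F :: "real \<Rightarrow> real" where F0: "\<And>K. 0 \<le> F K" and F: "\<And>(C :: 'a set) U \<omega> q m K.
    \<not> affine_dependent C \<Longrightarrow> card C = DIM('a) + 1 \<Longrightarrow> open U \<Longrightarrow> interior (convex hull C) \<subseteq> U \<Longrightarrow>
    0 < measure lebesgue (convex hull C) \<Longrightarrow> 0 < diameter (convex hull C) \<Longrightarrow> 0 \<le> K \<Longrightarrow>
    diameter (convex hull C) ^ DIM('a) \<le> K * measure lebesgue (convex hull C) \<Longrightarrow>
    0 \<le> m \<Longrightarrow> m \<le> real r \<Longrightarrow> (\<forall>\<alpha>\<in>multi_indices (nat \<lfloor>m\<rfloor>). \<exists>\<eta>. weak_deriv_form k U \<alpha> \<omega> \<eta>) \<Longrightarrow>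
    (\<forall>v. locally_integrable U (\<lambda>x. \<omega> x v)) \<Longrightarrow> q \<in> poly_forms (int r) (int k) \<Longrightarrow>
    (\<exists>Q\<in>poly_forms (int r - 1) (int k). Lp_norm p k (convex hull C) (q - Q) \<le>
      ennreal (F K) * (Lp_norm p k (interior (convex hull C)) (q - \<omega>) +
        ennreal (diameter (convex hull C) powr m) * sobolev_seminorm m p k U \<omega>))"
    using lower_degree_approximation[OF p, where 'a = 'a and r = r and k = k] by blast
  obtain K0 where K0: "0 < K0" "\<And>(\<T> :: 'a set set) \<Omega> T. triangulates \<T> \<Omega> \<Longrightarrow> T \<in> top_simplices \<T> \<Longrightarrow>
     diameter T ^ DIM('a) \<le> K0 * shape_measure \<T> * measure lebesgue T"
    using shape_measure_volume[where 'a = 'a] by blast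
  obtain N where N: "\<And>fam (S :: 'a set). card (indices fam r k S) \<le> N"
    using card_indices_bounded[where 'a = 'a] by blast
  \<comment> \<open>A bound for the number of summands of the error: \<omega> - Q, and at most
    \<open>N\<close> shape functions for each of at most 2^(n+1) faces of \<open>T\<close>.\<close>
  define n1 where "n1 = 1 + 2 ^ (DIM('a) + 1) * real N"
  \<comment> \<open>\<open>CA\<close> and \<open>CBH\<close> are arbitrary real functions, hence the
    truncation at 0. \<open>D\<close> bounds \<omega> - Q for both families at once: its first
    summand is the projection error of the full case, the second the triangle inequality through
    \<open>P T \<omega>\<close> in the trimmed case.\<close>
  define A B D where "A \<mu> = max 0 (CA \<mu>)" and "B \<mu> = max 0 (CBH \<mu>)"
    and "D \<mu> = B \<mu> + 4 * (B \<mu> + F (K0 * \<mu>) * (B \<mu> + 1))" for \<mu>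
  note A_B_D_def = A_def B_def D_def
  \<comment> \<open>The square is the constant of \<open>lpnorm_sum_le\<close>. The innermost
    product bounds one correction term, by stability of the biorthogonal system and the triangle
    inequality between Q, \<omega> and the projection.\<close>
  define G where "G \<mu> = n1\<^sup>2 * (D \<mu> + n1 * (A \<mu> * (4 * (D \<mu> + B \<mu>))))" for \<mu>
  have nn: "0 \<le> A \<mu>" "0 \<le> B \<mu>" "0 \<le> D \<mu>" "1 \<le> n1" for \<mu>
    using F0[of "K0 * \<mu>"] by (auto simp: A_B_D_def n1_def)
  have BD: "B \<mu> \<le> D \<mu>" for \<mu>
    using F0[of "K0 * \<mu>"] nn(2)[of \<mu>] by (simp add: D_def)
  have G0: "0 \<le> G \<mu>" for \<mu> using nn(1-3)[of \<mu>] nn(4) by (simp add: G_def)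
  have main: "Lp_norm p k T (\<omega> - clement fam r k \<T> \<phi>' \<phi> P \<omega>) \<le>
      ennreal (G (shape_measure \<T>) * mesh_size \<T> T powr m) * sobolev_seminorm m p k (interior (star_patch \<T> T)) \<omega>"
    if tri: "triangulates \<T> \<Omega>" and bio: "biorthogonal_system p fam r k \<T> \<Omega> \<phi>' \<phi> (CA (shape_measure \<T>))"
      and proj: "\<forall>S\<in>\<T>. local_projection p r k \<T> \<Omega> (CBH (shape_measure \<T>)) S (P S)"
      and m: "0 \<le> m" "m \<le> (if fam = Full then real r + 1 else real r)"
      and T: "T \<in> top_simplices \<T>" and \<omega>: "\<omega> \<in> sobolev_forms m p k \<Omega>"
    for \<T> :: "'a set set" and \<Omega> fam \<phi>' \<phi> P m T \<omega>
  proof -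
    define \<mu> where "\<mu> = shape_measure \<T>"
    define U where "U = interior (star_patch \<T> T)"
    define h where "h = diameter T"
    define Y where "Y = ennreal (h powr m) * sobolev_seminorm m p k U \<omega>"
    let ?I = "indices fam r k" and ?Lp = "Lp_norm p k T"
    note T' = top_simplicesD[OF T]
    have h: "mesh_size \<T> T = h" "0 < h" using mesh_size_top[OF tri T] by (simp_all add: h_def)
    have Tl: "T \<in> sets lebesgue" by (rule top_simplex_lebesgue[OF tri T])
    have \<omega>L: "\<omega> \<in> Lp_forms p k \<Omega>" using \<omega> by (simp add: sobolev_forms_def)
    have exO: "\<exists>\<eta>. weak_deriv_form k \<Omega> \<alpha> \<omega> \<eta>" if "\<alpha> \<in> multi_indices (nat \<lfloor>m\<rfloor>)" for \<alpha>
      using \<omega> that unfolding sobolev_forms_def by blast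
    have U: "open U" "U \<subseteq> \<Omega>" "interior T \<subseteq> U"
      using star_patch_interior[OF tri T T'(1) order_refl] interior_subset_star_patch[OF tri T T'(1) order_refl]
      by (auto simp: U_def)
    have exU: "\<exists>\<eta>. weak_deriv_form k U \<alpha> \<omega> \<eta>" if "\<alpha> \<in> multi_indices (nat \<lfloor>m\<rfloor>)" for \<alpha>
      using exO[OF that] weak_deriv_form_mono U(2) by blast
    have m\<omega>: "(\<lambda>x. \<omega> x v) \<in> borel_measurable (lebesgue_on T)" for v
      by (rule top_simplex_measurable[OF tri T Lp_forms_measurable[OF \<omega>L]])
    have mpoly: "(\<lambda>x. q x v) \<in> borel_measurable (lebesgue_on T)" if "q \<in> poly_forms d (int k)" for q d v
      using poly_forms_polys[OF that] by (intro continuous_borel_measurable_lebesgue_on polys_continuous)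
    \<comment> \<open>The projection on the patch is represented by a polynomial form on the whole
      space, to which functionals and norms on \<open>T\<close> apply directly.\<close>
    have local: "\<exists>q. q \<in> poly_forms (int r) (int k) \<and> P S \<omega> = zero_extension (patch \<T> S) q \<and>
        ?Lp (\<omega> - q) \<le> ennreal (B \<mu>) * Y" if S: "S \<in> \<T>" "S \<subseteq> T" for S
    proof -
      have lp: "local_projection p r k \<T> \<Omega> (CBH \<mu>) S (P S)" using proj S by (simp add: \<mu>_def)
      then obtain q where q: "q \<in> poly_forms (int r) (int k)" "P S \<omega> = zero_extension (patch \<T> S) q"
        using \<omega>L unfolding local_projection_def by blast
      \<comment> \<open>For the projection both families admit m up to r + 1; the stricter bound of
        the trimmed family is consumed by the truncation.\<close>
      have "m \<le> real (r + 1)" using m(2) by (auto split: if_splits)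
      then have est: "Lp_norm p k (patch \<T> S) (\<omega> - P S \<omega>) \<le>
          ennreal (CBH \<mu> * mesh_size \<T> S powr m) * sobolev_seminorm m p k (interior (patch \<T> S)) \<omega>"
        using lp m(1) \<omega> unfolding local_projection_def by blast
      have "?Lp (\<omega> - q) \<le> Lp_norm p k (patch \<T> S) (\<omega> - P S \<omega>)"
        using patch_superset[OF tri T S] patch_lebesgue[OF tri T S]
        by (intro Lp_norm_restrict p Tl) (auto simp: q(2) zero_extension_def)
      also note est
      also have "ennreal (CBH \<mu> * mesh_size \<T> S powr m) * sobolev_seminorm m p k (interior (patch \<T> S)) \<omega> \<le>
          ennreal (B \<mu> * h powr m) * sobolev_seminorm m p k U \<omega>"
      proof (rule mult_mono[OF ennreal_leI])
        have "CBH \<mu> * mesh_size \<T> S powr m \<le> B \<mu> * mesh_size \<T> S powr m"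
          by (intro mult_right_mono) (auto simp: A_B_D_def)
        also have "\<dots> \<le> B \<mu> * h powr m"
          using mesh_size_mono[OF tri T S] m(1) nn(2) h(1) by (intro mult_left_mono powr_mono2) auto
        finally show "CBH \<mu> * mesh_size \<T> S powr m \<le> B \<mu> * h powr m" .
        show "sobolev_seminorm m p k (interior (patch \<T> S)) \<omega> \<le> sobolev_seminorm m p k U \<omega>"
          using patch_subset_star_patch[OF tri T S] exU
          by (intro sobolev_seminorm_mono p) (auto simp: U_def intro!: interior_mono)
      qed auto
      also have "\<dots> = ennreal (B \<mu>) * Y" using nn(2) by (simp add: Y_def ennreal_mult' mult.assoc)
      finally show ?thesis using q by blast
    qed
    obtain q where q: "\<And>S. S \<in> \<T> \<Longrightarrow> S \<subseteq> T \<Longrightarrow> q S \<in> poly_forms (int r) (int k)"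
      and Pq: "\<And>S. S \<in> \<T> \<Longrightarrow> S \<subseteq> T \<Longrightarrow> P S \<omega> = zero_extension (patch \<T> S) (q S)"
      and qest: "\<And>S. S \<in> \<T> \<Longrightarrow> S \<subseteq> T \<Longrightarrow> ?Lp (\<omega> - q S) \<le> ennreal (B \<mu>) * Y"
    proof -
      define q where "q S = (SOME q. q \<in> poly_forms (int r) (int k) \<and> P S \<omega> = zero_extension (patch \<T> S) q \<and>
        ?Lp (\<omega> - q) \<le> ennreal (B \<mu>) * Y)" for S
      have "q S \<in> poly_forms (int r) (int k) \<and> P S \<omega> = zero_extension (patch \<T> S) (q S) \<and>
        ?Lp (\<omega> - q S) \<le> ennreal (B \<mu>) * Y" if "S \<in> \<T>" "S \<subseteq> T" for S
        unfolding q_def by (rule someI_ex[OF local[OF that]])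
      then show ?thesis by (intro that[of q]) auto
    qed
    obtain Q where Q: "Q \<in> family_forms fam (int r) (int k)" "?Lp (\<omega> - Q) \<le> ennreal (D \<mu>) * Y"
    proof (cases fam)
      case Full
      have "?Lp (\<omega> - q T) \<le> ennreal (B \<mu>) * Y" by (rule qest[OF T'(1) order_refl])
      also have "\<dots> \<le> ennreal (D \<mu>) * Y"
        by (intro mult_right_mono ennreal_leI BD) simp
      finally show ?thesis using that[of "q T"] q[OF T'(1) order_refl] Full by simp
    next
      case Trimmed
      obtain C where C: "finite C" "\<not> affine_dependent C" "T = convex hull C" "int (card C) = aff_dim T + 1"
        using triangulates_simplex[OF tri T'(1)] by metis
      have V: "0 < measure lebesgue T" by (rule top_simplex_measure_pos[OF tri T])
      have K: "h ^ DIM('a) \<le> K0 * \<mu> * measure lebesgue T" using K0(2)[OF tri T] by (simp add: h_def \<mu>_def)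
      have Kpos: "0 \<le> K0 * \<mu>"
      proof (rule ccontr)
        assume "\<not> 0 \<le> K0 * \<mu>"
        then have "K0 * \<mu> * measure lebesgue T < 0" using V by (simp add: mult_neg_pos)
        then show False using K h(2) zero_less_power[of h "DIM('a)"] by linarith
      qed
      \<comment> \<open>Any multi-index of the right order will do: possession of a weak derivative
        includes local integrability of the form itself.\<close>
      have "locally_integrable U (\<lambda>x. \<omega> x v)" for v
      proof -
        obtain b :: 'a where b: "b \<in> Basis" using nonempty_Basis by blast
        have "replicate_mset (nat \<lfloor>m\<rfloor>) b \<in> multi_indices (nat \<lfloor>m\<rfloor>)"
          using b by (auto simp: multi_indices_def)
        then show ?thesis using exU by (auto simp: weak_deriv_form_def weak_deriv_def)
      qed
      then have "\<exists>Q\<in>poly_forms (int r - 1) (int k). Lp_norm p k (convex hull C) (q T - Q) \<le>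
        ennreal (F (K0 * \<mu>)) * (Lp_norm p k (interior (convex hull C)) (q T - \<omega>) +
        ennreal (diameter (convex hull C) powr m) * sobolev_seminorm m p k U \<omega>)"
        unfolding C(3)[symmetric]
        by (intro F[where C = C and U = U and K = "K0 * \<mu>" and m = m and \<omega> = \<omega> and q = "q T", unfolded C(3)[symmetric]])
          (use C(2,4) U V h(2) Kpos K m Trimmed exU q[OF T'(1) order_refl] T'(2) in \<open>simp_all add: h_def\<close>)
      then obtain Q where Q: "Q \<in> poly_forms (int r - 1) (int k)"
        "?Lp (q T - Q) \<le> ennreal (F (K0 * \<mu>)) * (Lp_norm p k (interior T) (q T - \<omega>) + Y)"
        unfolding C(3)[symmetric] h_def[symmetric] Y_def by blast
      have "Lp_norm p k (interior T) (q T - \<omega>) \<le> ?Lp (q T - \<omega>)"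
        using interior_subset[of T] by (intro Lp_norm_restrict p Tl) auto
      also have "\<dots> \<le> ennreal (B \<mu>) * Y"
        unfolding Lp_norm_minus_commute[of p k T "q T"] by (rule qest[OF T'(1) order_refl])
      finally have "?Lp (q T - Q) \<le> ennreal (F (K0 * \<mu>)) * (ennreal (B \<mu>) * Y + Y)"
        using Q(2) by (meson add_right_mono mult_left_mono order_trans zero_le)
      also have "\<dots> = ennreal (F (K0 * \<mu>) * (B \<mu> + 1)) * Y"
        using F0 nn(2)[of \<mu>] by (simp add: ennreal_mult' ennreal_plus distrib_right mult.assoc)
      finally have qQ: "?Lp (q T - Q) \<le> ennreal (F (K0 * \<mu>) * (B \<mu> + 1)) * Y" .
      have "?Lp (\<omega> - Q) \<le> 4 * (?Lp (\<omega> - q T) + ?Lp (q T - Q))"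
        by (rule Lp_norm_triangle[OF p m\<omega> mpoly[OF q[OF T'(1) order_refl]] mpoly[OF Q(1)]])
      also have "\<dots> \<le> 4 * (ennreal (B \<mu>) * Y + ennreal (F (K0 * \<mu>) * (B \<mu> + 1)) * Y)"
        by (intro mult_left_mono add_mono qest[OF T'(1) order_refl] qQ) simp
      also have "\<dots> = ennreal (4 * (B \<mu> + F (K0 * \<mu>) * (B \<mu> + 1))) * Y"
        using F0[of "K0 * \<mu>"] nn(2)[of \<mu>] by (simp add: ennreal_mult' ennreal_plus distrib_right mult.assoc)
      also have "\<dots> \<le> ennreal (D \<mu>) * Y"
        using nn(2)[of \<mu>] by (intro mult_right_mono ennreal_leI) (simp_all add: D_def)
      finally show ?thesis
        using that[of Q] subsetD[OF poly_forms_subset_trimmed Q(1)] Trimmed by simp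
    qed
    have Qp: "Q \<in> poly_forms (int r) (int k)" using Q(1) family_forms_subset by blast
    define J where "J = (SIGMA S:{S\<in>\<T>. S \<subseteq> T}. ?I S)"
    define f where "f j = \<phi>' (fst j) (snd j) (Q - q (fst j)) *\<^sub>R \<phi> (fst j) (snd j)" for j
    have finS: "finite {S \<in> \<T>. S \<subseteq> T}" using triangulates_finite[OF tri] by simp
    have finJ: "finite J" unfolding J_def using finS by (intro finite_SigmaI) (simp_all add: indices_def)
    have cardJ: "real (card J) \<le> n1 - 1"
    proof -
      have "card J = (\<Sum>S\<in>{S\<in>\<T>. S \<subseteq> T}. card (?I S))"
        unfolding J_def using finS by (intro card_SigmaI) (auto simp: indices_def)
      also have "\<dots> \<le> card {S\<in>\<T>. S \<subseteq> T} * N" using sum_bounded_above[of "{S\<in>\<T>. S \<subseteq> T}" "\<lambda>S. card (?I S)" N] N by simp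
      also have "\<dots> \<le> 2 ^ (DIM('a) + 1) * N" using card_faces_le[OF tri T] by (rule mult_right_mono) simp
      finally have "real (card J) \<le> real (2 ^ (DIM('a) + 1) * N)" by (rule of_nat_mono)
      then show ?thesis by (simp add: n1_def)
    qed
    have mf: "(\<lambda>x. alt_norm k (f j x)) \<in> borel_measurable (lebesgue_on T)" if "j \<in> J" for j
    proof (rule alt_norm_measurable)
      fix v
      have "fst j \<in> \<T>" "snd j \<in> ?I (fst j)" using that by (auto simp: J_def)
      then have "(\<lambda>x. \<phi> (fst j) (snd j) x v) \<in> borel_measurable (lebesgue_on T)"
        by (intro top_simplex_measurable[OF tri T] Lp_forms_measurable[OF shape_function_Lp[OF bio]])
      then show "(\<lambda>x. f j x v) \<in> borel_measurable (lebesgue_on T)" by (simp add: f_def scaleR_fun_def)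
    qed
    have fest: "?Lp (f j) \<le> ennreal (A \<mu> * (4 * (D \<mu> + B \<mu>))) * Y" if j: "j \<in> J" for j
    proof -
      obtain S i where ji: "j = (S, i)" "S \<in> \<T>" "S \<subseteq> T" "i \<in> ?I S" using j by (auto simp: J_def)
      have "?Lp (f j) \<le> ennreal (CA \<mu>) * ?Lp (Q - q S)"
        unfolding f_def ji(1) \<mu>_def fst_conv snd_conv
        by (rule biorthogonal_systemD(6)[OF bio ji(2,4) T ji(3) poly_forms_diff[OF Qp q[OF ji(2,3)]]])
      also have "\<dots> \<le> ennreal (A \<mu>) * (4 * (?Lp (Q - \<omega>) + ?Lp (\<omega> - q S)))"
        by (intro mult_mono ennreal_leI Lp_norm_triangle p mpoly[OF Qp] m\<omega> mpoly[OF q[OF ji(2,3)]]) (auto simp: A_B_D_def)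
      also have "\<dots> \<le> ennreal (A \<mu>) * (4 * (ennreal (D \<mu>) * Y + ennreal (B \<mu>) * Y))"
        unfolding Lp_norm_minus_commute[of p k T Q]
        by (intro mult_left_mono add_mono Q(2) qest[OF ji(2,3)]) auto
      also have "\<dots> = ennreal (A \<mu> * (4 * (D \<mu> + B \<mu>))) * Y"
        using nn(1-3)[of \<mu>] nn(4) by (simp add: ennreal_mult' ennreal_plus distrib_right mult.assoc)
      finally show ?thesis .
    qed
    have rep: "AE x in lebesgue_on T. (\<omega> - clement fam r k \<T> \<phi>' \<phi> P \<omega>) x = (\<omega> - Q) x + (\<Sum>j\<in>J. f j x)"
    proof -
      have "AE x in lebesgue_on T. \<forall>j\<in>(SIGMA S:\<T>. ?I S). \<not> fst j \<subseteq> T \<longrightarrow> \<phi> (fst j) (snd j) x = 0"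
      proof (rule AE_finite_allI)
        show "finite (SIGMA S:\<T>. ?I S)" using triangulates_finite[OF tri] by (auto simp: indices_def)
        fix j assume j: "j \<in> (SIGMA S:\<T>. ?I S)"
        show "AE x in lebesgue_on T. \<not> fst j \<subseteq> T \<longrightarrow> \<phi> (fst j) (snd j) x = 0"
        proof (cases "fst j \<subseteq> T")
          case False
          have "AE x in lebesgue_on T. \<phi> (fst j) (snd j) x = 0"
            using j False by (intro shape_function_zero[OF tri bio T]) auto
          then show ?thesis by (rule eventually_mono) simp
        qed simp
      qed
      then show ?thesis
        using unisolvence[OF tri bio T Q(1)]
      proof eventually_elim
        case (elim x)
        have "clement fam r k \<T> \<phi>' \<phi> P \<omega> x = (\<Sum>j\<in>(SIGMA S:\<T>. ?I S). \<phi>' (fst j) (snd j) (P (fst j) \<omega>) *\<^sub>R \<phi> (fst j) (snd j) x)"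
          unfolding clement_apply using triangulates_finite[OF tri]
          by (subst sum.Sigma) (auto simp: indices_def case_prod_unfold)
        also have "\<dots> = (\<Sum>j\<in>J. \<phi>' (fst j) (snd j) (P (fst j) \<omega>) *\<^sub>R \<phi> (fst j) (snd j) x)"
        proof (rule sum.mono_neutral_right)
          show "finite (SIGMA S:\<T>. ?I S)" using triangulates_finite[OF tri] by (auto simp: indices_def)
          show "J \<subseteq> (SIGMA S:\<T>. ?I S)" by (auto simp: J_def)
          show "\<forall>j\<in>(SIGMA S:\<T>. ?I S) - J. \<phi>' (fst j) (snd j) (P (fst j) \<omega>) *\<^sub>R \<phi> (fst j) (snd j) x = 0"
          proof
            fix j assume "j \<in> (SIGMA S:\<T>. ?I S) - J"
            then have "j \<in> (SIGMA S:\<T>. ?I S)" "\<not> fst j \<subseteq> T" by (auto simp: J_def)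
            then have "\<phi> (fst j) (snd j) x = 0" using elim(1) by blast
            then show "\<phi>' (fst j) (snd j) (P (fst j) \<omega>) *\<^sub>R \<phi> (fst j) (snd j) x = 0" by simp
          qed
        qed
        finally have cl: "clement fam r k \<T> \<phi>' \<phi> P \<omega> x = (\<Sum>j\<in>J. \<phi>' (fst j) (snd j) (P (fst j) \<omega>) *\<^sub>R \<phi> (fst j) (snd j) x)" .
        have Qx: "Q x = (\<Sum>j\<in>J. \<phi>' (fst j) (snd j) Q *\<^sub>R \<phi> (fst j) (snd j) x)"
          using elim(2) by (simp add: J_def case_prod_unfold)
        have "f j x = \<phi>' (fst j) (snd j) Q *\<^sub>R \<phi> (fst j) (snd j) x - \<phi>' (fst j) (snd j) (P (fst j) \<omega>) *\<^sub>R \<phi> (fst j) (snd j) x"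
          if j: "j \<in> J" for j
        proof -
          obtain S i where ji: "j = (S, i)" "S \<in> \<T>" "S \<subseteq> T" "i \<in> ?I S" using j by (auto simp: J_def)
          note func = biorthogonal_functionals[OF bio ji(2,4)]
          \<comment> \<open>\<open>P S \<omega>\<close> is \<open>q S\<close> cut off outside the
            patch of \<open>S\<close>, and the simplex on which the functional is evaluated belongs
            to that patch.\<close>
          have "AE x in lebesgue_on (carrier_simplex \<T> S). P S \<omega> x = q S x"
            using carrier_simplex[OF tri ji(2)]
            by (intro AE_I2) (auto simp: Pq[OF ji(2,3)] zero_extension_def patch_def)
          then have P: "\<phi>' S i (P S \<omega>) = \<phi>' S i (q S)" by (rule functionals_cong[OF func])
          have "\<phi>' S i ((Q - q S) + q S) = \<phi>' S i (Q - q S) + \<phi>' S i (q S)"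
            by (rule functionals_linear(1)[OF tri ji(2) func poly_forms_diff[OF Qp q[OF ji(2,3)]] q[OF ji(2,3)]])
          then have "\<phi>' S i (Q - q S) = \<phi>' S i Q - \<phi>' S i (P S \<omega>)" by (simp only: P diff_add_cancel)
          then show ?thesis by (simp add: f_def ji(1) scaleR_fun_def fun_eq_iff left_diff_distrib)
        qed
        then have "(\<Sum>j\<in>J. f j x) = Q x - clement fam r k \<T> \<phi>' \<phi> P \<omega> x"
          unfolding cl Qx sum_subtractf[symmetric] by (intro sum.cong) auto
        then show ?case by simp
      qed
    qed
    \<comment> \<open>\<open>None\<close> stands for the summand \<omega> - Q, \<open>Some j\<close>
      for the correction along the shape function with index \<open>j\<close>.\<close>
    let ?X = "insert None (Some ` J)"
    let ?F = "\<lambda>z. case z of None \<Rightarrow> (\<lambda>x. alt_norm k ((\<omega> - Q) x)) | Some j \<Rightarrow> (\<lambda>x. alt_norm k (f j x))"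
    have cardX: "real (card ?X) \<le> n1"
    proof -
      have "card ?X = Suc (card J)" using finJ by (simp add: card_image image_iff)
      then show ?thesis using cardJ by simp
    qed
    have "?Lp (\<omega> - clement fam r k \<T> \<phi>' \<phi> P \<omega>) \<le>
        ennreal ((real (card ?X))\<^sup>2) * (\<Sum>z\<in>?X. lpnorm p (lebesgue_on T) (?F z))"
      unfolding Lp_norm_eq_lpnorm
    proof (rule lpnorm_sum_le[OF p])
      show "(\<lambda>x. alt_norm k ((\<omega> - clement fam r k \<T> \<phi>' \<phi> P \<omega>) x)) \<in> borel_measurable (lebesgue_on T)"
        using m\<omega> clement_measurable[OF tri bio T] by (intro alt_norm_measurable) simp
      have "(\<lambda>x. alt_norm k ((\<omega> - Q) x)) \<in> borel_measurable (lebesgue_on T)"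
        using m\<omega> mpoly[OF Qp] by (intro alt_norm_measurable) simp
      then show "?F z \<in> borel_measurable (lebesgue_on T)" if "z \<in> ?X" for z
        using that mf by auto
      show "AE x in lebesgue_on T. alt_norm k ((\<omega> - clement fam r k \<T> \<phi>' \<phi> P \<omega>) x) \<le> (\<Sum>z\<in>?X. ?F z x)"
        using rep
      proof eventually_elim
        case (elim x)
        have "(\<Sum>z\<in>?X. ?F z x) = alt_norm k ((\<omega> - Q) x) + (\<Sum>j\<in>J. alt_norm k (f j x))"
          using finJ by (simp add: image_iff sum.reindex)
        moreover have "alt_norm k ((\<omega> - Q) x + (\<Sum>j\<in>J. f j x)) \<le> alt_norm k ((\<omega> - Q) x) + (\<Sum>j\<in>J. alt_norm k (f j x))"
          using alt_norm_add_le[of k "(\<omega> - Q) x" "\<Sum>j\<in>J. f j x"] alt_norm_sum_le[of k "\<lambda>j. f j x" J] by linarith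
        ultimately show ?case by (simp only: elim)
      qed
    qed (use finJ in \<open>auto simp: alt_norm_nonneg split: option.split\<close>)
    also have "(\<Sum>z\<in>?X. lpnorm p (lebesgue_on T) (?F z)) = ?Lp (\<omega> - Q) + (\<Sum>j\<in>J. ?Lp (f j))"
      using finJ by (simp add: image_iff sum.reindex Lp_norm_eq_lpnorm)
    also have "ennreal ((real (card ?X))\<^sup>2) * (?Lp (\<omega> - Q) + (\<Sum>j\<in>J. ?Lp (f j))) \<le>
        ennreal (n1\<^sup>2) * (ennreal (D \<mu>) * Y + ennreal (n1 * (A \<mu> * (4 * (D \<mu> + B \<mu>)))) * Y)"
    proof (rule mult_mono[OF ennreal_leI add_mono[OF Q(2)]])
      show "(real (card ?X))\<^sup>2 \<le> n1\<^sup>2" using cardX by (intro power_mono) auto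
      have "(\<Sum>j\<in>J. ?Lp (f j)) \<le> of_nat (card J) * (ennreal (A \<mu> * (4 * (D \<mu> + B \<mu>))) * Y)"
        using fest by (rule sum_bounded_above)
      also have "\<dots> \<le> ennreal n1 * (ennreal (A \<mu> * (4 * (D \<mu> + B \<mu>))) * Y)"
        using cardJ by (intro mult_right_mono) (auto simp: ennreal_of_nat_eq_real_of_nat intro!: ennreal_leI)
      also have "\<dots> = ennreal (n1 * (A \<mu> * (4 * (D \<mu> + B \<mu>)))) * Y"
        using nn(1-3)[of \<mu>] nn(4) by (subst ennreal_mult'[of n1]) (simp_all add: mult.assoc)
      finally show "(\<Sum>j\<in>J. ?Lp (f j)) \<le> ennreal (n1 * (A \<mu> * (4 * (D \<mu> + B \<mu>)))) * Y" .
    qed auto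
    also have "\<dots> = ennreal (G \<mu>) * Y"
      using nn(1-3)[of \<mu>] nn(4) by (simp add: G_def ennreal_mult' ennreal_plus distrib_right mult.assoc)
    also have "\<dots> = ennreal (G \<mu> * h powr m) * sobolev_seminorm m p k U \<omega>"
      using G0[of \<mu>] by (simp add: Y_def ennreal_mult' mult.assoc)
    finally show ?thesis by (simp only: h(1) \<mu>_def U_def)
  qed
  show ?thesis by (rule exI[of _ G]) (use G0 main in blast)
qed

theorem corollary6p2:
  fixes p :: ennreal and r :: nat and C\<^sub>A C\<^sub>B\<^sub>H :: "real \<Rightarrow> real"
  assumes "1 \<le> p" and "1 \<le> r"
  shows "\<exists>C\<^sub>I :: real \<Rightarrow> real. (\<forall>\<mu>. 0 < C\<^sub>I \<mu>) \<and>
    (\<forall>(\<T> :: 'a::euclidean_space set set) \<Omega> fam k \<phi>' \<phi> P m T \<omega>.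
       triangulates \<T> \<Omega> \<longrightarrow> face_connected \<T> \<longrightarrow>
       (k = 0 \<longrightarrow> fam = Full) \<longrightarrow> (k = DIM('a) \<longrightarrow> fam = Trimmed) \<longrightarrow>
       biorthogonal_system p fam r k \<T> \<Omega> \<phi>' \<phi> (C\<^sub>A (shape_measure \<T>)) \<longrightarrow>
       (\<forall>S\<in>\<T>. local_projection p r k \<T> \<Omega> (C\<^sub>B\<^sub>H (shape_measure \<T>)) S (P S)) \<longrightarrow>
       0 \<le> m \<longrightarrow> m \<le> (if fam = Full then real r + 1 else real r) \<longrightarrow>
       T \<in> top_simplices \<T> \<longrightarrow> \<omega> \<in> sobolev_forms m p k \<Omega> \<longrightarrow>
       Lp_norm p k T (\<omega> - clement fam r k \<T> \<phi>' \<phi> P \<omega>) \<le>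
         ennreal (C\<^sub>I (shape_measure \<T>) * mesh_size \<T> T powr m) *
         sobolev_seminorm m p k (interior (star_patch \<T> T)) \<omega>)"
proof -
  let ?est = "\<lambda>c k (\<T> :: 'a set set) fam \<phi>' \<phi> P m T \<omega>.
    Lp_norm p k T (\<omega> - clement fam r k \<T> \<phi>' \<phi> P \<omega>) \<le>
      ennreal (c * mesh_size \<T> T powr m) * sobolev_seminorm m p k (interior (star_patch \<T> T)) \<omega>"
  have "\<forall>k. \<exists>G :: real \<Rightarrow> real. (\<forall>\<mu>. 0 \<le> G \<mu>) \<and>
    (\<forall>(\<T> :: 'a set set) \<Omega> fam \<phi>' \<phi> P m T \<omega>.
       triangulates \<T> \<Omega> \<longrightarrow>
       biorthogonal_system p fam r k \<T> \<Omega> \<phi>' \<phi> (C\<^sub>A (shape_measure \<T>)) \<longrightarrow>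
       (\<forall>S\<in>\<T>. local_projection p r k \<T> \<Omega> (C\<^sub>B\<^sub>H (shape_measure \<T>)) S (P S)) \<longrightarrow>
       0 \<le> m \<longrightarrow> m \<le> (if fam = Full then real r + 1 else real r) \<longrightarrow>
       T \<in> top_simplices \<T> \<longrightarrow> \<omega> \<in> sobolev_forms m p k \<Omega> \<longrightarrow>
       ?est (G (shape_measure \<T>)) k \<T> fam \<phi>' \<phi> P m T \<omega>)"
    by (intro allI clement_estimate_fixed_degree assms(1))
  from choice[OF this] obtain G :: "nat \<Rightarrow> real \<Rightarrow> real" where G': "\<forall>k. (\<forall>\<mu>. 0 \<le> G k \<mu>) \<and>
    (\<forall>(\<T> :: 'a set set) \<Omega> fam \<phi>' \<phi> P m T \<omega>.
       triangulates \<T> \<Omega> \<longrightarrow>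
       biorthogonal_system p fam r k \<T> \<Omega> \<phi>' \<phi> (C\<^sub>A (shape_measure \<T>)) \<longrightarrow>
       (\<forall>S\<in>\<T>. local_projection p r k \<T> \<Omega> (C\<^sub>B\<^sub>H (shape_measure \<T>)) S (P S)) \<longrightarrow>
       0 \<le> m \<longrightarrow> m \<le> (if fam = Full then real r + 1 else real r) \<longrightarrow>
       T \<in> top_simplices \<T> \<longrightarrow> \<omega> \<in> sobolev_forms m p k \<Omega> \<longrightarrow>
       ?est (G k (shape_measure \<T>)) k \<T> fam \<phi>' \<phi> P m T \<omega>)" ..
  then have G0: "0 \<le> G k \<mu>" for k \<mu> by blast
  note G = G'[THEN spec, THEN conjunct2, rule_format]
  \<comment> \<open>The sum dominates the constants of all form degrees up to n, and the summand 1
    makes it positive. In higher degrees the error is 0.\<close>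
  define C where "C \<mu> = 1 + (\<Sum>k\<le>DIM('a). G k \<mu>)" for \<mu>
  have C: "0 < C \<mu>" for \<mu> unfolding C_def using G0 by (intro add_pos_nonneg sum_nonneg) auto
  have "?est (C (shape_measure \<T>)) k \<T> fam \<phi>' \<phi> P m T \<omega>"
    if tri: "triangulates \<T> \<Omega>" and bio: "biorthogonal_system p fam r k \<T> \<Omega> \<phi>' \<phi> (C\<^sub>A (shape_measure \<T>))"
      and proj: "\<forall>S\<in>\<T>. local_projection p r k \<T> \<Omega> (C\<^sub>B\<^sub>H (shape_measure \<T>)) S (P S)"
      and m: "0 \<le> m" "m \<le> (if fam = Full then real r + 1 else real r)"
      and T: "T \<in> top_simplices \<T>" and \<omega>: "\<omega> \<in> sobolev_forms m p k \<Omega>"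
    for \<T> :: "'a set set" and \<Omega> fam k \<phi>' \<phi> P m T \<omega>
  proof (cases "k \<le> DIM('a)")
    case True
    have "G k (shape_measure \<T>) \<le> (\<Sum>k\<le>DIM('a). G k (shape_measure \<T>))"
      using True G0 by (intro member_le_sum) auto
    then have "G k (shape_measure \<T>) * mesh_size \<T> T powr m \<le> C (shape_measure \<T>) * mesh_size \<T> T powr m"
      by (intro mult_right_mono) (auto simp: C_def)
    then show ?thesis
      using G[OF tri bio proj[rule_format] m T \<omega>] by (meson ennreal_leI mult_right_mono order_trans zero_le)
  next
    case False
    have "\<omega> \<in> Lp_forms p k \<Omega>" using \<omega> by (simp add: sobolev_forms_def)
    then show ?thesis using False by (subst clement_high_degree[OF assms(1) _ tri bio T]) auto
  qed
  then show ?thesis using C by (intro exI[of _ C]) blast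
qed

end
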